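(* Let $X^n\in\{E^n,H^n,S^n\}$, let $\mathcal{L}$ be a collection of non-empty geometric subspaces of $X^n$ with $X^n\in\mathcal{L}$, and let $G_{\mathcal L}$ be a subgroup of the isometry group $I(X^n)$ (or, if $X^n=E^n$, of the affine group $A(E^n)$) that preserves $\mathcal{L}$ set-wise. If $\mathcal{L}$ is generated by points, then $\mathrm{ST}^{\mathcal L}(X^n)$ is homotopy equivalent to a wedge of $n$-spheres and there is an isomorphism of $\mathbb{Z}[G_{\mathcal L}]$-modules $$\mathrm{Ls}^{\mathcal L}(X^n)\xrightarrow{\ \cong\ }\widetilde H_n(\mathrm{ST}^{\mathcal L}(X^n)).$$
   Context: Geometries: $E^n=\{x\in\mathbb{R}^{n+1}: x_0=1\}$; $H^n=\{x\in\mathbb{R}^{n+1}: -x_0^2+\sum_{i=1}^n x_i^2=-1,\ x_0>0\}$; $S^n=\{x\in\mathbb{R}^{n+1}:\sum_{i=0}^n x_i^2=1\}$. A geometric subspace of $X^n$ is the intersection of $X^n$ with a linear subspace of $\mathbb{R}^{n+1}$ (so a $0$-dimensional geometric subspace of $S^n$ is a pair of antipodal points; these are the "points" in the spherical case). Groups (all inside $\mathrm{GL}_{n+1}(\mathbb{R})$): $I(E^n)\cong\mathbb{R}^n\rtimes O(n)$, $I(H^n)=O(1,n)^+$, $I(S^n)=O(n+1)$, and $A(E^n)\cong\mathbb{R}^n\rtimes\mathrm{GL}_n(\mathbb{R})$. $\mathcal{L}^0\subseteq\mathcal{L}$ is the set of $0$-dimensional elements. The span of a subset of $X^n$ is the smallest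 geometric subspace containing it. $\mathcal{L}$ is generated by points if it equals the set of all non-empty spans of finite collections of elements of $\mathcal{L}^0$. $\mathcal L$ is a poset under inclusion. Let $\mathrm{CT}^{\mathcal L}(X^n)$ be the geometric realisation (order complex) of $\mathcal{L}$ and $\mathrm{T}^{\mathcal L}(X^n)$ the subcomplex realising $\mathcal{L}\setminus\{X^n\}$. Then $\mathrm{ST}^{\mathcal L}(X^n)=\mathrm{CT}^{\mathcal L}(X^n)/\mathrm{T}^{\mathcal L}(X^n)$ (if the subcomplex is empty, the quotient means adding a disjoint basepoint). A wedge of spheres may be indexed by any set, including the empty set (a point). The restricted Lee--Szczarba group $\mathrm{Ls}^{\mathcal L}(X^n)$ is the free abelian group on all $(n+1)$-tuples $(x_0,\dots,x_n)$ of elements of $\mathcal{L}^0$ (repetitions allowed), modulo all tuples that lie in a geometric subspace $U\subsetneq X^n$ of dimension at most $n-1$, and modulo $\sum_{i=0}^{n+1}(-1)^i(y_0,\dots,\widehat{y_i},\dots,y_{n+1})$ for every $(n+2)$-tuple $(y_0,\dots,y_{n+1})$ of elements of $\mathcal{L}^0$. The group $G_{\mathcal L}$ acts by $g\cdot(x_0,\dots,x_n)=(gx_0,\dots,gx_n)$, and acts on $\mathrm{ST}^{\mathcal L}(X^n)$ through its action on the poset $\mathcal{L}$. *)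

theory Defs
  imports "HOL-Homology.Homology" "HOL-Algebra.Ring"
begin

section \<open>The geometries\<close>

text \<open>The ambient space of dimension \<open>n + 1\<close> is \<open>real ^ 'm\<close> with \<open>CARD('m) = n + 1\<close>. The class
  \<open>zero\<close> only serves to single out one index of \<open>'m\<close>, so that \<open>x $ 0\<close> is the coordinate
  \<open>x\<^sub>0\<close>; no algebraic property of the index type is used.\<close>

type_synonym 'm vect = "(real, 'm) vec"
type_synonym 'm matrix = "((real, 'm) vec, 'm) vec"

datatype geometry = Euclidean | Hyperbolic | Spherical

fun model_space :: "geometry \<Rightarrow> 'm::{finite,zero} vect set" where
  "model_space Euclidean = {x. x $ 0 = 1}"
| "model_space Hyperbolic = {x. - (x $ 0)\<^sup>2 + (\<Sum>i\<in>UNIV - {0}. (x $ i)\<^sup>2) = - 1 \<and> x $ 0 > 0}"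
| "model_space Spherical = {x. (\<Sum>i\<in>UNIV. (x $ i)\<^sup>2) = 1}"

definition geometric_subspaces :: "geometry \<Rightarrow> 'm::{finite,zero} vect set set" where
  "geometric_subspaces X = {model_space X \<inter> V |V. subspace V}"

text \<open>A non-empty geometric subspace \<open>U\<close> is the intersection of the model space with the linear
  span of \<open>U\<close>, and that linear span has dimension one more than \<open>U\<close>. The library constant
  \<open>dim\<close> is the dimension of the linear span.\<close>

definition geo_dim :: "'m::{finite,zero} vect set \<Rightarrow> int" where
  "geo_dim U = int (dim U) - 1"

definition geo_span :: "geometry \<Rightarrow> 'm::{finite,zero} vect set \<Rightarrow> 'm vect set" where
  "geo_span X A = \<Inter>{U \<in> geometric_subspaces X. A \<subseteq> U}"

definition points_of :: "'m::{finite,zero} vect set set \<Rightarrow> 'm vect set set" where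
  "points_of L = {U \<in> L. geo_dim U = 0}"

definition generated_by_points :: "geometry \<Rightarrow> 'm::{finite,zero} vect set set \<Rightarrow> bool" where
  "generated_by_points X L \<longleftrightarrow>
     L = {geo_span X (\<Union>F) |F. finite F \<and> F \<subseteq> points_of L} - {{}}"

lemma geo_span_geometric:
  assumes "A \<subseteq> model_space X"
  shows "geo_span X A \<in> geometric_subspaces X"
proof -
  let ?\<V> = "{V. subspace V \<and> A \<subseteq> V}"
  have "geo_span X A = model_space X \<inter> \<Inter>?\<V>"
    using assms subspace_UNIV unfolding geo_span_def geometric_subspaces_def by blast
  moreover have "subspace (\<Inter>?\<V>)"
    by (rule subspace_Inter) auto
  ultimately show ?thesis
    unfolding geometric_subspaces_def by blast
qed


section \<open>The groups\<close>

definition general_linear :: "'m::finite matrix monoid" where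
  "general_linear = \<lparr>carrier = {A. invertible A}, monoid.mult = (**), one = mat 1\<rparr>"

definition lorentz_form :: "'m::{finite,zero} vect \<Rightarrow> 'm vect \<Rightarrow> real" where
  "lorentz_form x y = - (x $ 0 * y $ 0) + (\<Sum>i\<in>UNIV - {0}. x $ i * y $ i)"

text \<open>Matrices whose row \<open>0\<close> is \<open>(1, 0, \<dots>, 0)\<close> are the block matrices with a translation
  vector in column \<open>0\<close> and an arbitrary linear part.\<close>

definition affine_group :: "'m::{finite,zero} matrix monoid" where
  "affine_group = general_linear\<lparr>carrier := {A. invertible A \<and> A $ 0 = axis 0 1}\<rparr>"

fun isometries :: "geometry \<Rightarrow> 'm::{finite,zero} matrix set" where
  "isometries Euclidean =
     {A. invertible A \<and> A $ 0 = axis 0 1 \<and>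
         (\<forall>j\<in>UNIV - {0}. \<forall>k\<in>UNIV - {0}.
            (\<Sum>i\<in>UNIV - {0}. A $ i $ j * A $ i $ k) = (if j = k then 1 else 0))}"
| "isometries Hyperbolic =
     {A. invertible A \<and> (\<forall>x y. lorentz_form (A *v x) (A *v y) = lorentz_form x y) \<and>
         (*v) A ` model_space Hyperbolic = model_space Hyperbolic}"
| "isometries Spherical = {A. orthogonal_matrix A}"

definition isometry_group :: "geometry \<Rightarrow> 'm::{finite,zero} matrix monoid" where
  "isometry_group X = general_linear\<lparr>carrier := isometries X\<rparr>"

lemma group_general_linear: "group (general_linear :: 'm::finite matrix monoid)"
proof (rule groupI)
  fix A :: "'m matrix" assume "A \<in> carrier general_linear"
  then obtain B where "A ** B = mat 1" "B ** A = mat 1"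
    by (auto simp: general_linear_def invertible_def)
  then show "\<exists>B\<in>carrier general_linear. B \<otimes>\<^bsub>general_linear\<^esub> A = \<one>\<^bsub>general_linear\<^esub>"
    by (intro bexI[of _ B]) (auto simp: general_linear_def invertible_def)
next
  have "invertible (mat 1 :: 'm matrix)"
    unfolding invertible_def by (rule exI[of _ "mat 1"]) simp
  then show "\<one>\<^bsub>general_linear\<^esub> \<in> carrier (general_linear :: 'm matrix monoid)"
    by (simp add: general_linear_def)
qed (simp_all add: general_linear_def invertible_mult matrix_mul_assoc)


section \<open>Geometric realisations and quotients\<close>

definition order_complex :: "'a set set \<Rightarrow> 'a set set set" where
  "order_complex P = {\<sigma> \<in> chains P. finite \<sigma> \<and> \<sigma> \<noteq> {}}"

definition face :: "'v set \<Rightarrow> ('v \<Rightarrow> real) set" where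
  "face \<sigma> = {t. (\<forall>v. 0 \<le> t v) \<and> (\<forall>v. v \<notin> \<sigma> \<longrightarrow> t v = 0) \<and> (\<Sum>v\<in>\<sigma>. t v) = 1}"

text \<open>The weak topology of an abstract simplicial complex, in barycentric coordinates.\<close>

definition realisation :: "'v set set \<Rightarrow> ('v \<Rightarrow> real) topology" where
  "realisation K = topology (\<lambda>U. U \<subseteq> (\<Union>\<sigma>\<in>K. face \<sigma>) \<and>
     (\<forall>\<sigma>\<in>K. openin (subtopology (powertop_real UNIV) (face \<sigma>)) (U \<inter> face \<sigma>)))"

definition realisation_map :: "('v \<Rightarrow> 'w) \<Rightarrow> ('v \<Rightarrow> real) \<Rightarrow> 'w \<Rightarrow> real" where
  "realisation_map f t = (\<lambda>w. \<Sum>v | t v \<noteq> 0 \<and> f v = w. t v)"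

text \<open>The quotient of a space by a subset: \<open>None\<close> is the basepoint, which is disjoint from the
  rest if the subset is empty.\<close>

definition collapse_map :: "'a set \<Rightarrow> 'a \<Rightarrow> 'a option" where
  "collapse_map A x = (if x \<in> A then None else Some x)"

definition collapse :: "'a topology \<Rightarrow> 'a set \<Rightarrow> 'a option topology" where
  "collapse X A = topology (\<lambda>U. U \<subseteq> insert None (Some ` (topspace X - A)) \<and>
     openin X {x \<in> topspace X. collapse_map A x \<in> U})"

definition wedge_of_spheres :: "nat \<Rightarrow> 'i set \<Rightarrow> ('i \<times> (nat \<Rightarrow> real)) option topology" where
  "wedge_of_spheres n I =
     collapse (sum_topology (\<lambda>_. nsphere n) I) (I \<times> {\<lambda>k. if k = 0 then 1 else 0})"

lemma openin_realisation:
  "openin (realisation K) U \<longleftrightarrow> U \<subseteq> (\<Union>\<sigma>\<in>K. face \<sigma>) \<and>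
     (\<forall>\<sigma>\<in>K. openin (subtopology (powertop_real UNIV) (face \<sigma>)) (U \<inter> face \<sigma>))"
proof -
  have int: "openin Y (S \<inter> T \<inter> F)" if "openin Y (S \<inter> F)" "openin Y (T \<inter> F)"
    for Y and S T F :: "('a \<Rightarrow> real) set"
    using openin_Int[OF that] by (simp add: Int_ac)
  have un: "openin Y (\<Union>\<U> \<inter> F)" if "\<And>S. S \<in> \<U> \<Longrightarrow> openin Y (S \<inter> F)"
    for Y \<U> and F :: "('a \<Rightarrow> real) set"
  proof -
    have "openin Y (\<Union>S\<in>\<U>. S \<inter> F)"
      by (rule openin_Union) (use that in auto)
    then show ?thesis
      by (simp only: Int_Union2)
  qed
  have "istopology (\<lambda>U. U \<subseteq> (\<Union>\<sigma>\<in>K. face \<sigma>) \<and>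
     (\<forall>\<sigma>\<in>K. openin (subtopology (powertop_real UNIV) (face \<sigma>)) (U \<inter> face \<sigma>)))"
    unfolding istopology_def
    by (safe; (rule int | rule un)?; blast)
  then show ?thesis
    unfolding realisation_def by (subst topology_inverse') (assumption, rule refl)
qed

lemma openin_collapse:
  "openin (collapse X A) U \<longleftrightarrow> U \<subseteq> insert None (Some ` (topspace X - A)) \<and>
     openin X {x \<in> topspace X. collapse_map A x \<in> U}"
proof -
  have "istopology (\<lambda>U. U \<subseteq> insert None (Some ` (topspace X - A)) \<and>
     openin X {x \<in> topspace X. collapse_map A x \<in> U})"
    unfolding istopology_def
  proof (intro conjI allI impI)
    fix S T
    assume ST: "S \<subseteq> insert None (Some ` (topspace X - A)) \<and>
        openin X {x \<in> topspace X. collapse_map A x \<in> S}"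
      "T \<subseteq> insert None (Some ` (topspace X - A)) \<and>
        openin X {x \<in> topspace X. collapse_map A x \<in> T}"
    show "S \<inter> T \<subseteq> insert None (Some ` (topspace X - A))"
      using ST by blast
    have "{x \<in> topspace X. collapse_map A x \<in> S} \<inter> {x \<in> topspace X. collapse_map A x \<in> T} =
        {x \<in> topspace X. collapse_map A x \<in> S \<inter> T}"
      by blast
    then show "openin X {x \<in> topspace X. collapse_map A x \<in> S \<inter> T}"
      using ST by (metis (no_types, lifting) openin_Int)
  next
    fix \<U>
    assume \<U>: "\<forall>S\<in>\<U>. S \<subseteq> insert None (Some ` (topspace X - A)) \<and>
        openin X {x \<in> topspace X. collapse_map A x \<in> S}"
    show "\<Union>\<U> \<subseteq> insert None (Some ` (topspace X - A))"
      using \<U> by blast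
    have "openin X (\<Union>S\<in>\<U>. {x \<in> topspace X. collapse_map A x \<in> S})"
      using \<U> by (intro openin_clauses(3)) blast
    moreover have "(\<Union>S\<in>\<U>. {x \<in> topspace X. collapse_map A x \<in> S}) =
        {x \<in> topspace X. collapse_map A x \<in> \<Union>\<U>}"
      by blast
    ultimately show "openin X {x \<in> topspace X. collapse_map A x \<in> \<Union>\<U>}"
      by simp
  qed
  then show ?thesis
    unfolding collapse_def by (subst topology_inverse') (assumption, rule refl)
qed

lemma topspace_collapse: "topspace (collapse X A) = insert None (Some ` (topspace X - A))"
proof (rule antisym)
  show "topspace (collapse X A) \<subseteq> insert None (Some ` (topspace X - A))"
    using openin_collapse[of X A "topspace (collapse X A)"] by simp
  have "{x \<in> topspace X. collapse_map A x \<in> insert None (Some ` (topspace X - A))} = topspace X"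
    by (auto simp: collapse_map_def)
  then show "insert None (Some ` (topspace X - A)) \<subseteq> topspace (collapse X A)"
    by (intro openin_subset) (simp add: openin_collapse)
qed

lemma quotient_map_collapse:
  assumes "A \<subseteq> topspace X" "A \<noteq> {}"
  shows "quotient_map X (collapse X A) (collapse_map A)"
proof -
  have "collapse_map A ` topspace X = topspace (collapse X A)"
    using assms unfolding topspace_collapse by (auto simp: collapse_map_def image_iff)
  then show ?thesis
    unfolding quotient_map_def by (simp add: openin_collapse topspace_collapse)
qed

lemma face_mono:
  assumes "\<sigma> \<subseteq> \<tau>" "finite \<tau>"
  shows "face \<sigma> \<subseteq> face \<tau>"
proof
  fix t :: "'a \<Rightarrow> real" assume t: "t \<in> face \<sigma>"
  then have "(\<Sum>v\<in>\<tau>. t v) = (\<Sum>v\<in>\<sigma>. t v)"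
    using assms by (intro sum.mono_neutral_right) (auto simp: face_def)
  then show "t \<in> face \<tau>"
    using t assms by (auto simp: face_def)
qed

lemma topspace_realisation:
  "topspace (realisation K) = (\<Union>\<sigma>\<in>K. face \<sigma>)"
proof (rule antisym)
  show "topspace (realisation K) \<subseteq> (\<Union>\<sigma>\<in>K. face \<sigma>)"
    using openin_realisation[of K "topspace (realisation K)"] by simp
  have "openin (subtopology (powertop_real UNIV) (face \<sigma>)) ((\<Union>\<sigma>\<in>K. face \<sigma>) \<inter> face \<sigma>)"
    if "\<sigma> \<in> K" for \<sigma>
  proof -
    have "(\<Union>\<sigma>\<in>K. face \<sigma>) \<inter> face \<sigma> = topspace (subtopology (powertop_real UNIV) (face \<sigma>))"
      using that by auto
    then show ?thesis
      by (metis openin_topspace)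
  qed
  then show "(\<Union>\<sigma>\<in>K. face \<sigma>) \<subseteq> topspace (realisation K)"
    by (intro openin_subset) (simp add: openin_realisation)
qed


section \<open>The spaces attached to a collection of subspaces\<close>

definition CT_space :: "'m::{finite,zero} vect set set \<Rightarrow> ('m vect set \<Rightarrow> real) topology" where
  "CT_space L = realisation (order_complex L)"

definition T_space :: "geometry \<Rightarrow> 'm::{finite,zero} vect set set
    \<Rightarrow> ('m vect set \<Rightarrow> real) topology" where
  "T_space X L = realisation (order_complex (L - {model_space X}))"

definition ST_space :: "geometry \<Rightarrow> 'm::{finite,zero} vect set set
    \<Rightarrow> ('m vect set \<Rightarrow> real) option topology" where
  "ST_space X L = collapse (CT_space L) (topspace (T_space X L))"

definition ST_action :: "'m::{finite,zero} matrix
    \<Rightarrow> ('m vect set \<Rightarrow> real) option \<Rightarrow> ('m vect set \<Rightarrow> real) option" where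
  "ST_action g = map_option (realisation_map ((`) ((*v) g)))"

definition ST_homology_action :: "geometry \<Rightarrow> nat \<Rightarrow> 'm::{finite,zero} vect set set
    \<Rightarrow> 'm matrix \<Rightarrow> ('m vect set \<Rightarrow> real) option chain set
    \<Rightarrow> ('m vect set \<Rightarrow> real) option chain set" where
  "ST_homology_action X n L g =
     hom_induced (int n) (ST_space X L) {} (ST_space X L) {} (ST_action g)"


section \<open>The restricted Lee--Szczarba group\<close>

definition point_tuples :: "nat \<Rightarrow> 'm::{finite,zero} vect set set \<Rightarrow> 'm vect set list set" where
  "point_tuples k L = {xs. length xs = k \<and> set xs \<subseteq> points_of L}"

definition omit :: "nat \<Rightarrow> 'a list \<Rightarrow> 'a list" where
  "omit i xs = take i xs @ drop (Suc i) xs"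

definition Ls_degenerate :: "geometry \<Rightarrow> nat \<Rightarrow> 'm::{finite,zero} vect set set
    \<Rightarrow> ('m vect set list \<Rightarrow>\<^sub>0 int) set" where
  "Ls_degenerate X n L = {frag_of xs |xs. xs \<in> point_tuples (n + 1) L \<and>
     (\<exists>U\<in>geometric_subspaces X. U \<subset> model_space X \<and> geo_dim U \<le> int n - 1 \<and>
        (\<forall>x\<in>set xs. x \<subseteq> U))}"

definition Ls_boundaries :: "nat \<Rightarrow> 'm::{finite,zero} vect set set
    \<Rightarrow> ('m vect set list \<Rightarrow>\<^sub>0 int) set" where
  "Ls_boundaries n L = {\<Sum>i\<le>n + 1. frag_cmul ((- 1) ^ i) (frag_of (omit i ys)) |ys.
     ys \<in> point_tuples (n + 2) L}"

definition Ls_group :: "geometry \<Rightarrow> nat \<Rightarrow> 'm::{finite,zero} vect set set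
    \<Rightarrow> ('m vect set list \<Rightarrow>\<^sub>0 int) set monoid" where
  "Ls_group X n L =
     (let F = free_Abelian_group (point_tuples (n + 1) L)
      in F Mod generate F (Ls_degenerate X n L \<union> Ls_boundaries n L))"

text \<open>Elements of the quotient are cosets, and \<open>g\<close> sends a coset to its image.\<close>

definition Ls_action :: "'m::{finite,zero} matrix \<Rightarrow> ('m vect set list \<Rightarrow>\<^sub>0 int) set
    \<Rightarrow> ('m vect set list \<Rightarrow>\<^sub>0 int) set" where
  "Ls_action g C = frag_extend (\<lambda>xs. frag_of (map ((`) ((*v) g)) xs)) ` C"


section \<open>Modules over integral group rings\<close>

text \<open>The library's locale \<open>module\<close> requires a commutative ring of scalars, so left modules over
  a possibly non-commutative ring are introduced here, with a multiplicatively written underlying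
  group as provided by the homology library.\<close>

definition group_ring :: "('g, 'b) monoid_scheme \<Rightarrow> ('g \<Rightarrow>\<^sub>0 int) ring" where
  "group_ring G =
     \<lparr>carrier = carrier (free_Abelian_group (carrier G)),
      monoid.mult = (\<lambda>a b. frag_extend (\<lambda>g. frag_extend (\<lambda>h. frag_of (g \<otimes>\<^bsub>G\<^esub> h)) b) a),
      one = frag_of \<one>\<^bsub>G\<^esub>, zero = 0, add = (+)\<rparr>"

definition group_ring_smult ::
    "('c, 'b) monoid_scheme \<Rightarrow> ('g \<Rightarrow> 'c \<Rightarrow> 'c) \<Rightarrow> ('g \<Rightarrow>\<^sub>0 int) \<Rightarrow> 'c \<Rightarrow> 'c" where
  "group_ring_smult M act a x =
     finprod M (\<lambda>g. act g x [^]\<^bsub>M\<^esub> Poly_Mapping.lookup a g) (Poly_Mapping.keys a)"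

definition left_module ::
    "('r, 'a) ring_scheme \<Rightarrow> ('c, 'b) monoid_scheme \<Rightarrow> ('r \<Rightarrow> 'c \<Rightarrow> 'c) \<Rightarrow> bool" where
  "left_module R M s \<longleftrightarrow> ring R \<and> comm_group M \<and>
     (\<forall>a\<in>carrier R. \<forall>x\<in>carrier M. s a x \<in> carrier M) \<and>
     (\<forall>a\<in>carrier R. \<forall>x\<in>carrier M. \<forall>y\<in>carrier M. s a (x \<otimes>\<^bsub>M\<^esub> y) = s a x \<otimes>\<^bsub>M\<^esub> s a y) \<and>
     (\<forall>a\<in>carrier R. \<forall>b\<in>carrier R. \<forall>x\<in>carrier M. s (a \<oplus>\<^bsub>R\<^esub> b) x = s a x \<otimes>\<^bsub>M\<^esub> s b x) \<and>
     (\<forall>a\<in>carrier R. \<forall>b\<in>carrier R. \<forall>x\<in>carrier M. s (a \<otimes>\<^bsub>R\<^esub> b) x = s a (s b x)) \<and>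
     (\<forall>x\<in>carrier M. s \<one>\<^bsub>R\<^esub> x = x)"

definition left_module_iso ::
    "('r, 'a) ring_scheme \<Rightarrow> ('c, 'b) monoid_scheme \<Rightarrow> ('r \<Rightarrow> 'c \<Rightarrow> 'c)
      \<Rightarrow> ('d, 'e) monoid_scheme \<Rightarrow> ('r \<Rightarrow> 'd \<Rightarrow> 'd) \<Rightarrow> ('c \<Rightarrow> 'd) \<Rightarrow> bool" where
  "left_module_iso R M s N t \<phi> \<longleftrightarrow>
     left_module R M s \<and> left_module R N t \<and> \<phi> \<in> iso M N \<and>
     (\<forall>a\<in>carrier R. \<forall>x\<in>carrier M. \<phi> (s a x) = t a (\<phi> x))"

lemma ring_group_ring:
  assumes "group G"
  shows "ring (group_ring G)"
proof -
  interpret group G by fact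
  let ?m = "\<lambda>a b :: 'a \<Rightarrow>\<^sub>0 int. frag_extend (\<lambda>g. frag_extend (\<lambda>h. frag_of (g \<otimes>\<^bsub>G\<^esub> h)) b) a"
  have diffL: "?m (a - b) c = ?m a c - ?m b c" for a b c
    by (simp add: frag_extend_diff)
  have diffR: "?m a (b - c) = ?m a b - ?m a c" for a b c
    using subset_UNIV[of "Poly_Mapping.keys a"]
    by (induction a rule: frag_induction) (simp_all add: frag_extend_diff)
  have zeroR: "?m a 0 = 0" for a
    by (simp add: frag_extend_eq_0)
  have closed: "Poly_Mapping.keys (?m a b) \<subseteq> carrier G"
    if a: "Poly_Mapping.keys a \<subseteq> carrier G" and b: "Poly_Mapping.keys b \<subseteq> carrier G" for a b
  proof -
    have "Poly_Mapping.keys (frag_extend (\<lambda>h. frag_of (g \<otimes>\<^bsub>G\<^esub> h)) b) \<subseteq> carrier G"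
      if "g \<in> Poly_Mapping.keys a" for g
      using keys_frag_extend[of "\<lambda>h. frag_of (g \<otimes>\<^bsub>G\<^esub> h)" b] that a b by fastforce
    then show ?thesis
      using keys_frag_extend[of "\<lambda>g. frag_extend (\<lambda>h. frag_of (g \<otimes>\<^bsub>G\<^esub> h)) b" a] by blast
  qed
  have addL: "?m (a + b) c = ?m a c + ?m b c" for a b c
    by (simp add: frag_extend_add)
  have addR: "?m a (b + c) = ?m a b + ?m a c" for a b c
    using diffR[where a = a and b = "b + c" and c = c] by simp
  have assoc: "?m (?m a b) c = ?m a (?m b c)"
    if a: "Poly_Mapping.keys a \<subseteq> carrier G" and b: "Poly_Mapping.keys b \<subseteq> carrier G"
      and c: "Poly_Mapping.keys c \<subseteq> carrier G" for a b c
    using a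
  proof (induction a rule: frag_induction)
    case (one x)
    from b show ?case
    proof (induction b rule: frag_induction)
      case (one y)
      from c show ?case
        using \<open>x \<in> carrier G\<close> \<open>y \<in> carrier G\<close>
        by (induction c rule: frag_induction) (simp_all add: frag_extend_diff m_assoc)
    qed (simp_all add: frag_extend_diff)
  qed (simp_all only: diffL frag_extend_0)
  have oneL: "?m (frag_of \<one>\<^bsub>G\<^esub>) a = a" if "Poly_Mapping.keys a \<subseteq> carrier G" for a
    using that by (induction a rule: frag_induction) (simp_all add: frag_extend_diff)
  have oneR: "?m a (frag_of \<one>\<^bsub>G\<^esub>) = a" if "Poly_Mapping.keys a \<subseteq> carrier G" for a
    using that by (induction a rule: frag_induction) (simp_all add: frag_extend_diff)
  show ?thesis
  proof (rule ringI)
    show "abelian_group (group_ring G)"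
    proof (rule abelian_groupI)
      fix x assume "x \<in> carrier (group_ring G)"
      then show "\<exists>y\<in>carrier (group_ring G). y \<oplus>\<^bsub>group_ring G\<^esub> x = \<zero>\<^bsub>group_ring G\<^esub>"
        by (intro bexI[of _ "- x"]) (auto simp: group_ring_def)
    next
      fix x y assume "x \<in> carrier (group_ring G)" "y \<in> carrier (group_ring G)"
      then show "x \<oplus>\<^bsub>group_ring G\<^esub> y \<in> carrier (group_ring G)"
        using keys_add[of x y] by (auto simp: group_ring_def)
    qed (simp_all add: group_ring_def algebra_simps)
    show "Group.monoid (group_ring G)"
      by (rule monoidI) (simp_all add: group_ring_def closed assoc oneL[unfolded frag_extend_of] oneR[unfolded frag_extend_of])
  next
    fix x y z
    show "(x \<oplus>\<^bsub>group_ring G\<^esub> y) \<otimes>\<^bsub>group_ring G\<^esub> z =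
        x \<otimes>\<^bsub>group_ring G\<^esub> z \<oplus>\<^bsub>group_ring G\<^esub> y \<otimes>\<^bsub>group_ring G\<^esub> z"
      by (simp add: group_ring_def frag_extend_add)
    show "z \<otimes>\<^bsub>group_ring G\<^esub> (x \<oplus>\<^bsub>group_ring G\<^esub> y) =
        z \<otimes>\<^bsub>group_ring G\<^esub> x \<oplus>\<^bsub>group_ring G\<^esub> z \<otimes>\<^bsub>group_ring G\<^esub> y"
      using addR[where a = z and b = x and c = y] by (simp add: group_ring_def)
  qed
qed

end

theory Submission
  imports Defs "HOL-Analysis.Abstract_Topological_Spaces"
begin

text \<open>The topology of \<open>ST\<close> only depends on the ranked lattice \<open>L\<close>, in which adding a point to \<open>U\<close>
  raises the rank by at most one. Choose a point \<open>pt U\<close> below every \<open>U\<close>, and call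
  \<open>V \<subset> U\<close> a good step if \<open>U\<close> is the join of \<open>V\<close> and \<open>pt U\<close>. Filter the chains by the number
  of consecutive good steps below the top element. A chain that ends its run of good steps at \<open>U\<close> can be
  contracted below \<open>U\<close> by the maps \<open>V \<le> join V (pt U) \<ge> pt U\<close>, which never create another good step, so the
  quotient by \<open>T\<close> is equivalent to the quotient by all chains that are not good throughout. What
  remains are the \<open>n\<close>-simplices of the full good chains modulo their boundaries, a wedge of \<open>n\<close>-spheres.

  For the homology, barycentric subdivision with spans as barycentres sends a tuple of points to a chain in the
  cone \<open>CT\<close>, and the degenerate tuples to chains in \<open>T\<close>. Conversely, \<open>CT\<close> and \<open>T\<close> are covered by the
  neighbourhoods of the cones below the elements \<open>U\<close>, so a subdivided singular chain is turned into
  tuples by replacing every vertex by a chosen point below it. Both composites are carried by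
  acyclic carriers (simplices of points in \<open>U\<close>, and contractible cones), hence homotopic to the identity.
  Naturality of the subdivision gives equivariance.\<close>

section \<open>Realisations of simplicial complexes\<close>

text \<open>The wedge decomposition and the module isomorphism are proved independently. Good chains
  depend on the choice \<open>pt\<close>, which the group need not respect, so they do not yield an
  equivariant map, whereas the subdivision by spans involves no choice. Choices return only in the
  opposite direction, where bare existence of chains is enough.

  The rank condition makes good steps rigid: each lowers the rank by exactly one, so a chain
  contains at most one run of good steps of a given length. A simplex therefore determines the
  element \<open>U\<close> along which it is contracted, and the contractions on different simplices
  fit together.

  The topological obstacle is that \<open>L\<close> may be infinite, so that the realisation need be
  neither metrizable nor locally compact. Homotopies are tested face by face instead, and the bound
  \<open>n + 1\<close> on the length of chains gives one neighbourhood width for all simplices.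

  Algebra and topology meet in one rank estimate: the span of \<open>n\<close> points has rank less
  than \<open>n\<close>. Hence the boundary of every subdivided tuple of \<open>n + 1\<close> points
  lies in \<open>T\<close>, and the tuple gives a relative cycle.\<close>

abbreviation unit_interval :: "real topology" where
  "unit_interval \<equiv> top_of_set {0..1}"

abbreviation face_topology :: "'v set \<Rightarrow> ('v \<Rightarrow> real) topology" where
  "face_topology \<sigma> \<equiv> subtopology (powertop_real UNIV) (face \<sigma>)"

abbreviation supp :: "('v \<Rightarrow> real) \<Rightarrow> 'v set" where
  "supp t \<equiv> {v. t v \<noteq> 0}"

definition polyhedron :: "'v set set \<Rightarrow> ('v \<Rightarrow> real) set" where
  "polyhedron K = (\<Union>\<sigma>\<in>K. face \<sigma>)"

definition simplicial_complex :: "'v set set \<Rightarrow> bool" where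
  "simplicial_complex K \<longleftrightarrow> (\<forall>\<sigma>\<in>K. finite \<sigma> \<and> \<sigma> \<noteq> {} \<and> (\<forall>\<tau>. \<tau> \<subseteq> \<sigma> \<and> \<tau> \<noteq> {} \<longrightarrow> \<tau> \<in> K))"

lemma topspace_realisation' [simp]: "topspace (realisation K) = polyhedron K"
  by (simp add: topspace_realisation polyhedron_def)

lemma face_ne: "t \<in> face \<sigma> \<Longrightarrow> supp t \<noteq> {}"
  by (auto simp: face_def) (metis (no_types, lifting) sum.neutral zero_neq_one)

lemma supp_subset: "t \<in> face \<sigma> \<Longrightarrow> supp t \<subseteq> \<sigma>"
  by (auto simp: face_def)

lemma in_face_supp:
  assumes "t \<in> face \<sigma>" "finite \<sigma>"
  shows "t \<in> face (supp t)"
proof -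
  have "sum t (supp t) = sum t \<sigma>"
    using assms by (intro sum.mono_neutral_left) (auto simp: face_def)
  then show ?thesis
    using assms by (simp add: face_def)
qed

text \<open>The support spans the only face whose interior contains the point. Later membership
  questions about subcomplexes are settled by looking at supports.\<close>

lemma polyhedron_iff:
  assumes "simplicial_complex K"
  shows "t \<in> polyhedron K \<longleftrightarrow> t \<in> face (supp t) \<and> supp t \<in> K"
proof
  assume "t \<in> polyhedron K"
  then obtain \<sigma> where \<sigma>: "\<sigma> \<in> K" "t \<in> face \<sigma>" by (auto simp: polyhedron_def)
  then show "t \<in> face (supp t) \<and> supp t \<in> K"
    using assms in_face_supp[OF \<sigma>(2)] supp_subset[OF \<sigma>(2)] face_ne[OF \<sigma>(2)]
    unfolding simplicial_complex_def by metis
qed (auto simp: polyhedron_def)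

lemma polyhedron_mono: "B \<subseteq> K \<Longrightarrow> polyhedron B \<subseteq> polyhedron K"
  by (auto simp: polyhedron_def)

lemma simplicial_complexD:
  assumes "simplicial_complex K" "\<sigma> \<in> K"
  shows "finite \<sigma>" "\<sigma> \<noteq> {}" "\<And>\<tau>. \<tau> \<subseteq> \<sigma> \<Longrightarrow> \<tau> \<noteq> {} \<Longrightarrow> \<tau> \<in> K"
  using assms unfolding simplicial_complex_def by blast+

lemma polyhedronD:
  assumes "t \<in> polyhedron K" "simplicial_complex K"
  shows "supp t \<in> K" "finite (supp t)" "supp t \<noteq> {}" "\<And>v. 0 \<le> t v" "sum t (supp t) = 1"
proof -
  have t: "t \<in> face (supp t)" "supp t \<in> K"
    using assms polyhedron_iff by blast+
  then show "supp t \<in> K" by blast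
  show "\<And>v. 0 \<le> t v" "sum t (supp t) = 1"
    using t by (auto simp: face_def)
  show "finite (supp t)" "supp t \<noteq> {}"
    using t assms simplicial_complexD by blast+
qed

lemma polyhedronI:
  assumes "simplicial_complex K" "\<And>v. 0 \<le> t v" "sum t (supp t) = 1" "supp t \<in> K"
  shows "t \<in> polyhedron K"
  unfolding polyhedron_iff[OF assms(1)] using assms by (auto simp: face_def)

text \<open>The weak topology is the final topology for the inclusions of the faces.\<close>

lemma continuous_map_realisation_iff:
  "continuous_map (realisation K) Y f \<longleftrightarrow> (\<forall>\<sigma>\<in>K. continuous_map (face_topology \<sigma>) Y f)"
proof (intro iffI ballI)
  fix \<sigma> assume f: "continuous_map (realisation K) Y f" and \<sigma>: "\<sigma> \<in> K"
  show "continuous_map (face_topology \<sigma>) Y f"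
    unfolding continuous_map_def
  proof (intro conjI allI impI)
    show "f \<in> topspace (face_topology \<sigma>) \<rightarrow> topspace Y"
      using continuous_map_funspace[OF f] \<sigma> by (auto simp: polyhedron_def)
    fix U assume "openin Y U"
    then have "openin (realisation K) {x \<in> topspace (realisation K). f x \<in> U}"
      using f openin_continuous_map_preimage by blast
    then have "openin (face_topology \<sigma>) ({x \<in> topspace (realisation K). f x \<in> U} \<inter> face \<sigma>)"
      using \<sigma> openin_realisation by blast
    moreover have "{x \<in> topspace (realisation K). f x \<in> U} \<inter> face \<sigma> = {x \<in> topspace (face_topology \<sigma>). f x \<in> U}"
      using \<sigma> by (auto simp: polyhedron_def)
    ultimately show "openin (face_topology \<sigma>) {x \<in> topspace (face_topology \<sigma>). f x \<in> U}" by simp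
  qed
next
  assume f: "\<forall>\<sigma>\<in>K. continuous_map (face_topology \<sigma>) Y f"
  show "continuous_map (realisation K) Y f"
    unfolding continuous_map_def
  proof (intro conjI allI impI)
    show "f \<in> topspace (realisation K) \<rightarrow> topspace Y"
      using f by (fastforce simp: polyhedron_def continuous_map_def)
    fix U assume U: "openin Y U"
    have "openin (face_topology \<sigma>) ({x \<in> topspace (realisation K). f x \<in> U} \<inter> face \<sigma>)" if "\<sigma> \<in> K" for \<sigma>
    proof -
      have "{x \<in> topspace (realisation K). f x \<in> U} \<inter> face \<sigma> = {x \<in> topspace (face_topology \<sigma>). f x \<in> U}"
        using that by (auto simp: polyhedron_def)
      then show ?thesis
        using openin_continuous_map_preimage[OF bspec[OF f that] U] by simp
    qed
    then show "openin (realisation K) {x \<in> topspace (realisation K). f x \<in> U}"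
      unfolding openin_realisation by (auto simp: polyhedron_def)
  qed
qed

lemma continuous_map_face_realisation:
  "\<sigma> \<in> K \<Longrightarrow> continuous_map (face_topology \<sigma>) (realisation K) id"
  using continuous_map_realisation_iff[of K "realisation K" id] by simp

text \<open>The final topology once more, as a quotient of a disjoint union. In this form it
  survives the product with the interval, which is locally compact and Hausdorff.\<close>

lemma quotient_map_faces:
  "quotient_map (sum_topology face_topology K) (realisation K) snd"
  unfolding quotient_map_def
proof (intro conjI allI impI)
  show "snd ` topspace (sum_topology face_topology K) = topspace (realisation K)"
    by (force simp: polyhedron_def)
  fix U assume "U \<subseteq> topspace (realisation K)"
  then have U: "U \<subseteq> polyhedron K" by simp
  have "{x. (i, x) \<in> topspace (sum_topology face_topology K) \<and> x \<in> U} = U \<inter> face i" if "i \<in> K" for i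
    using that by auto
  then show "openin (sum_topology face_topology K)
      {x \<in> topspace (sum_topology face_topology K). snd x \<in> U} = openin (realisation K) U"
    unfolding openin_sum_topology openin_realisation using U
    by (auto simp: polyhedron_def)
qed

section \<open>Homotopies on a realisation\<close>

lemma locally_compact_unit_interval: "locally_compact_space unit_interval"
  by (simp add: compact_imp_locally_compact_space compact_space_subtopology)

lemma Hausdorff_unit_interval: "Hausdorff_space unit_interval"
  by (simp add: Hausdorff_space_subtopology)

text \<open>A product with a quotient space can have fewer open sets than the corresponding quotient
  of products. Local compactness of the interval excludes this, and a homotopy may then be checked
  one face at a time.\<close>

lemma openin_prod_realisation:
  "openin (prod_topology unit_interval (realisation K)) Q \<longleftrightarrow>
    Q \<subseteq> {0..1} \<times> polyhedron K \<and>
    (\<forall>\<sigma>\<in>K. openin (prod_topology unit_interval (face_topology \<sigma>)) (Q \<inter> ({0..1} \<times> face \<sigma>)))"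
    (is "?L \<longleftrightarrow> ?R")
proof
  assume L: ?L
  have "openin (prod_topology unit_interval (face_topology \<sigma>)) (Q \<inter> ({0..1} \<times> face \<sigma>))" if "\<sigma> \<in> K" for \<sigma>
  proof -
    have "continuous_map (prod_topology unit_interval (face_topology \<sigma>))
       (prod_topology unit_interval (realisation K)) id"
      using continuous_map_compose[OF continuous_map_snd continuous_map_face_realisation[OF that]]
      by (simp add: continuous_map_pairwise o_def id_def continuous_map_fst)
    from openin_continuous_map_preimage[OF this L]
    show ?thesis
      by (rule back_subst[of "openin _"]) auto
  qed
  then show ?R using openin_subset[OF L] by auto
next
  assume R: ?R
  let ?S = "sum_topology face_topology K"
  have q: "quotient_map (prod_topology unit_interval ?S) (prod_topology unit_interval (realisation K)) (\<lambda>(x,y). (x, snd y))"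
    by (intro quotient_map_prod_right locally_compact_unit_interval disjI1 Hausdorff_unit_interval quotient_map_faces)
  have "openin (prod_topology unit_interval ?S) {x \<in> topspace (prod_topology unit_interval ?S). (case x of (x,y) \<Rightarrow> (x, snd y)) \<in> Q}"
    unfolding openin_prod_topology_alt
  proof (intro allI impI)
    fix s p assume sp: "(s, p) \<in> {x \<in> topspace (prod_topology unit_interval ?S). (case x of (x,y) \<Rightarrow> (x, snd y)) \<in> Q}"
    then obtain \<sigma> t where p: "p = (\<sigma>,t)" "\<sigma> \<in> K" "t \<in> face \<sigma>" "s \<in> {0..1}" "(s,t) \<in> Q" by auto
    then have "openin (prod_topology unit_interval (face_topology \<sigma>)) (Q \<inter> ({0..1} \<times> face \<sigma>))"
      using R by blast
    moreover have "(s,t) \<in> Q \<inter> ({0..1} \<times> face \<sigma>)" using p by simp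
    ultimately obtain U V where UV: "openin unit_interval U" "openin (face_topology \<sigma>) V" "s \<in> U" "t \<in> V" "U \<times> V \<subseteq> Q \<inter> ({0..1} \<times> face \<sigma>)"
      unfolding openin_prod_topology_alt by meson
    have "openin ?S ({\<sigma>} \<times> V)"
      using openin_disjoint_union[of face_topology K "\<lambda>i. if i = \<sigma> then V else {}"] UV(2) p(2)
      by (auto simp: Sigma_def if_distrib[of "\<lambda>A. _ \<in> A"] elim!: back_subst[of "openin _"] split: if_splits)
    then show "\<exists>U V. openin unit_interval U \<and> openin ?S V \<and> s \<in> U \<and> p \<in> V \<and>
        U \<times> V \<subseteq> {x \<in> topspace (prod_topology unit_interval ?S). (case x of (x,y) \<Rightarrow> (x, snd y)) \<in> Q}"
      using UV p by (intro exI[of _ U] exI[of _ "{\<sigma>} \<times> V"]) fastforce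
  qed
  moreover have "Q \<subseteq> topspace (prod_topology unit_interval (realisation K))"
    using R by auto
  ultimately show ?L
    using q unfolding quotient_map_def by blast
qed

text \<open>The open subset \<open>S\<close> is there for the neighbourhoods
  \<open>near P U\<close>, which are contracted later and need not be subcomplexes.\<close>

lemma continuous_map_prod_realisation_open:
  assumes S: "openin (realisation K) S"
    and f: "\<And>\<sigma>. \<sigma> \<in> K \<Longrightarrow> continuous_map (prod_topology unit_interval (subtopology (face_topology \<sigma>) S)) Y f"
  shows "continuous_map (prod_topology unit_interval (subtopology (realisation K) S)) Y f"
  unfolding continuous_map_def
proof (intro conjI allI impI)
  have SK: "S \<subseteq> polyhedron K" using openin_subset[OF S] by simp
  show "f \<in> topspace (prod_topology unit_interval (subtopology (realisation K) S)) \<rightarrow> topspace Y"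
  proof
    fix x assume "x \<in> topspace (prod_topology unit_interval (subtopology (realisation K) S))"
    then obtain \<sigma> where "\<sigma> \<in> K" "x \<in> topspace (prod_topology unit_interval (subtopology (face_topology \<sigma>) S))"
      by (auto simp: polyhedron_def)
    then show "f x \<in> topspace Y" using continuous_map_funspace[OF f] by blast
  qed
  fix U assume U: "openin Y U"
  let ?Q = "{x \<in> topspace (prod_topology unit_interval (subtopology (realisation K) S)). f x \<in> U}"
  have "openin (prod_topology unit_interval (face_topology \<sigma>)) (?Q \<inter> ({0..1} \<times> face \<sigma>))" if \<sigma>: "\<sigma> \<in> K" for \<sigma>
  proof -
    have 1: "openin (prod_topology unit_interval (subtopology (face_topology \<sigma>) S))
        {x \<in> topspace (prod_topology unit_interval (subtopology (face_topology \<sigma>) S)). f x \<in> U}"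
      using f[OF \<sigma>] U openin_continuous_map_preimage by blast
    have 2: "{x \<in> topspace (prod_topology unit_interval (subtopology (face_topology \<sigma>) S)). f x \<in> U} = ?Q \<inter> ({0..1} \<times> face \<sigma>)"
      using \<sigma> by (auto simp: polyhedron_def)
    have 3: "prod_topology unit_interval (subtopology (face_topology \<sigma>) S) = subtopology (prod_topology unit_interval (face_topology \<sigma>)) ({0..1} \<times> S)"
      using prod_topology_subtopology(2)[of unit_interval "face_topology \<sigma>" S] by simp
    have "openin (face_topology \<sigma>) (S \<inter> face \<sigma>)"
      using S \<sigma> openin_realisation by blast
    then have o: "openin (prod_topology unit_interval (face_topology \<sigma>)) ({0..1} \<times> (S \<inter> face \<sigma>))"
      by (simp add: openin_prod_Times_iff)
    have "\<exists>B. openin (prod_topology unit_interval (face_topology \<sigma>)) B \<and>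
        ?Q \<inter> ({0..1} \<times> face \<sigma>) = B \<inter> ({0..1} \<times> S)"
      using 1[unfolded 2] unfolding 3 openin_subtopology .
    then obtain B where B: "openin (prod_topology unit_interval (face_topology \<sigma>)) B"
        "?Q \<inter> ({0..1} \<times> face \<sigma>) = B \<inter> ({0..1} \<times> S)"
      by (elim exE conjE) (rule that)
    have "?Q \<inter> ({0..1} \<times> face \<sigma>) = B \<inter> ({0..1} \<times> (S \<inter> face \<sigma>))"
      using B openin_subset[OF B(1)] by auto
    then show ?thesis
      using openin_Int[OF B(1) o] by metis
  qed
  then have "openin (prod_topology unit_interval (realisation K)) ?Q"
    unfolding openin_prod_realisation using SK by auto
  moreover have "?Q = ?Q \<inter> (topspace unit_interval \<times> S)" by auto
  ultimately show "openin (prod_topology unit_interval (subtopology (realisation K) S)) ?Q"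
    unfolding prod_topology_subtopology(2)[of unit_interval "realisation K" S] openin_subtopology by blast
qed

lemma continuous_map_prod_realisation:
  assumes "\<And>\<sigma>. \<sigma> \<in> K \<Longrightarrow> continuous_map (prod_topology unit_interval (face_topology \<sigma>)) Y f"
  shows "continuous_map (prod_topology unit_interval (realisation K)) Y f"
proof -
  have "subtopology (face_topology \<sigma>) (polyhedron K) = face_topology \<sigma>" if "\<sigma> \<in> K" for \<sigma>
    using that by (auto simp: subtopology_subtopology polyhedron_def intro!: arg_cong[of _ _ "subtopology _"])
  moreover have "openin (realisation K) (polyhedron K)"
    using openin_topspace[of "realisation K"] by simp
  moreover have "subtopology (realisation K) (polyhedron K) = realisation K"
    using subtopology_topspace[of "realisation K"] by simp
  ultimately show ?thesis
    using continuous_map_prod_realisation_open[of K "polyhedron K" Y f] assms by simp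
qed

section \<open>Closed subcomplexes\<close>

lemma closedin_face:
  assumes "finite \<sigma>" shows "closedin (powertop_real UNIV) (face \<sigma>)"
proof -
  have "face \<sigma> = (\<Inter>v. {t \<in> topspace (powertop_real UNIV). t v \<in> (if v \<in> \<sigma> then {0..} else {0})}) \<inter>
      {t \<in> topspace (powertop_real UNIV). (\<Sum>v\<in>\<sigma>. t v) \<in> {1}}"
    by (auto simp: face_def split: if_splits) (metis order_refl)
  also have "closedin (powertop_real UNIV) \<dots>"
    by (intro closedin_Int closedin_INT closedin_continuous_map_preimage[where Y=euclideanreal]
        continuous_map_product_projection continuous_map_sum assms) (auto simp flip: closed_closedin)
  finally show ?thesis .
qed

lemma closedin_realisation:
  "closedin (realisation K) U \<longleftrightarrow> U \<subseteq> polyhedron K \<and> (\<forall>\<sigma>\<in>K. closedin (face_topology \<sigma>) (U \<inter> face \<sigma>))"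
proof -
  have "openin (face_topology \<sigma>) ((polyhedron K - U) \<inter> face \<sigma>) = closedin (face_topology \<sigma>) (U \<inter> face \<sigma>)"
    if "\<sigma> \<in> K" for \<sigma>
  proof -
    have "(polyhedron K - U) \<inter> face \<sigma> = topspace (face_topology \<sigma>) - U \<inter> face \<sigma>"
      using that by (auto simp: polyhedron_def)
    then show ?thesis by (simp add: closedin_def)
  qed
  then show ?thesis
    unfolding closedin_def openin_realisation topspace_realisation' polyhedron_def by auto
qed

text \<open>A map with uniformly finite support may be continuous into the realisation although its values lie in
  many different faces.\<close>

lemma continuous_map_into_realisation:
  assumes K: "simplicial_complex K" and F: "\<And>v. continuous_map Y euclideanreal (\<lambda>y. F y v)"
    and S: "finite S" and im: "\<And>y. y \<in> topspace Y \<Longrightarrow> F y \<in> polyhedron K \<and> supp (F y) \<subseteq> S"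
  shows "continuous_map Y (realisation K) F"
  unfolding continuous_map_closedin
proof (intro conjI allI impI)
  show "F \<in> topspace Y \<rightarrow> topspace (realisation K)" using im by simp
next
  fix U assume U: "closedin (realisation K) U"
  have cF: "continuous_map Y (powertop_real UNIV) F"
    using F by (simp add: continuous_map_componentwise_UNIV)
  have "closedin Y {y \<in> topspace Y. F y \<in> U \<inter> face \<tau>}" if "\<tau> \<in> K" for \<tau>
  proof -
    have "closedin (face_topology \<tau>) (U \<inter> face \<tau>)"
      using U that closedin_realisation by blast
    then have "closedin (powertop_real UNIV) (U \<inter> face \<tau>)"
      using closedin_face K simplicial_complexD(1) that closedin_trans_full by blast
    then show ?thesis using cF closedin_continuous_map_preimage by fastforce
  qed
  then have "closedin Y (\<Union>\<tau>\<in>K \<inter> Pow S. {y \<in> topspace Y. F y \<in> U \<inter> face \<tau>})"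
    using S by (intro closedin_Union) auto
  moreover have "(\<Union>\<tau>\<in>K \<inter> Pow S. {y \<in> topspace Y. F y \<in> U \<inter> face \<tau>}) = {y \<in> topspace Y. F y \<in> U}"
    using im polyhedron_iff[OF K] by blast
  ultimately show "closedin Y {y \<in> topspace Y. F y \<in> U}" by simp
qed

text \<open>Reduces closedness questions about a subcomplex to finite unions of closed faces, even
  when the complex is infinite.\<close>

lemma polyhedron_Int_face:
  assumes "simplicial_complex B" "finite \<sigma>"
  shows "polyhedron B \<inter> face \<sigma> = (\<Union>\<tau>\<in>B \<inter> Pow \<sigma>. face \<tau>)"
proof (intro equalityI subsetI)
  fix t assume "t \<in> polyhedron B \<inter> face \<sigma>"
  then have "supp t \<in> B \<inter> Pow \<sigma>" "t \<in> face (supp t)"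
    using polyhedron_iff[OF assms(1)] supp_subset by blast+
  then show "t \<in> (\<Union>\<tau>\<in>B \<inter> Pow \<sigma>. face \<tau>)" by blast
next
  fix t assume "t \<in> (\<Union>\<tau>\<in>B \<inter> Pow \<sigma>. face \<tau>)"
  then obtain \<tau> where "\<tau> \<in> B" "\<tau> \<subseteq> \<sigma>" "t \<in> face \<tau>" by blast
  then show "t \<in> polyhedron B \<inter> face \<sigma>"
    using face_mono[OF _ assms(2)] unfolding polyhedron_def by blast
qed

lemma closedin_polyhedron:
  assumes K: "simplicial_complex K" "simplicial_complex B" "B \<subseteq> K"
  shows "closedin (realisation K) (polyhedron B)"
  unfolding closedin_realisation
proof (intro conjI ballI)
  fix \<sigma> assume \<sigma>: "\<sigma> \<in> K"
  have fin: "finite \<sigma>" using K \<sigma> simplicial_complexD by blast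
  have "closedin (face_topology \<sigma>) (\<Union>\<tau>\<in>B \<inter> Pow \<sigma>. face \<tau>)"
  proof (intro closedin_Union)
    fix T assume "T \<in> face ` (B \<inter> Pow \<sigma>)"
    then obtain \<tau> where \<tau>: "\<tau> \<in> B" "\<tau> \<subseteq> \<sigma>" "T = face \<tau>" by blast
    then have "face \<tau> \<subseteq> face \<sigma>" using face_mono fin by blast
    then show "closedin (face_topology \<sigma>) T"
      unfolding \<tau>(3) using closedin_face[of \<tau>] \<tau>(2) fin finite_subset
      by (metis closedin_closed_subtopology closedin_subset_topspace)
  qed (use fin in auto)
  then show "closedin (face_topology \<sigma>) (polyhedron B \<inter> face \<sigma>)"
    by (simp add: polyhedron_Int_face K fin)
qed (use polyhedron_mono K in auto)

text \<open>Closed sets are compared rather than open ones: the subcomplex is closed, so what is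
  closed in it stays closed in the whole realisation.\<close>

lemma subtopology_realisation:
  assumes K: "simplicial_complex K" "simplicial_complex B" "B \<subseteq> K"
  shows "subtopology (realisation K) (polyhedron B) = realisation B"
proof (rule topology_eq[THEN iffD2], rule allI)
  have "closedin (subtopology (realisation K) (polyhedron B)) U \<longleftrightarrow> closedin (realisation B) U" for U
  proof
    assume "closedin (subtopology (realisation K) (polyhedron B)) U"
    then have U: "closedin (realisation K) U" "U \<subseteq> polyhedron B"
      using closedin_closed_subtopology[OF closedin_polyhedron[OF K]] by blast+
    then show "closedin (realisation B) U"
      using K(3) unfolding closedin_realisation by blast
  next
    assume U: "closedin (realisation B) U"
    have "continuous_map (face_topology \<tau>) (realisation B) id" if "\<tau> \<in> B" for \<tau>
      using that continuous_map_face_realisation by blast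
    have "closedin (face_topology \<sigma>) (U \<inter> face \<sigma>)" if \<sigma>: "\<sigma> \<in> K" for \<sigma>
    proof -
      have fin: "finite \<sigma>" using K \<sigma> simplicial_complexD by blast
      have "closedin (face_topology \<sigma>) (\<Union>\<tau>\<in>B \<inter> Pow \<sigma>. U \<inter> face \<tau>)"
      proof (intro closedin_Union)
        fix T assume "T \<in> (\<lambda>\<tau>. U \<inter> face \<tau>) ` (B \<inter> Pow \<sigma>)"
        then obtain \<tau> where \<tau>: "\<tau> \<in> B" "\<tau> \<subseteq> \<sigma>" "T = U \<inter> face \<tau>" by blast
        then have sub: "face \<tau> \<subseteq> face \<sigma>" using face_mono fin by blast
        have "closedin (face_topology \<tau>) (U \<inter> face \<tau>)"
          using U \<tau> closedin_realisation by blast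
        then have "closedin (powertop_real UNIV) (U \<inter> face \<tau>)"
          using closedin_face[of \<tau>] \<tau>(2) fin finite_subset closedin_trans_full by blast
        then show "closedin (face_topology \<sigma>) T"
          unfolding \<tau>(3) using sub by (metis closedin_subset_topspace le_infI2)
      qed (use fin in auto)
      moreover have "(\<Union>\<tau>\<in>B \<inter> Pow \<sigma>. U \<inter> face \<tau>) = U \<inter> (polyhedron B \<inter> face \<sigma>)"
        by (simp add: polyhedron_Int_face K fin)
      moreover have "U \<subseteq> polyhedron B" using closedin_subset[OF U] by simp
      ultimately show ?thesis by (metis Int_assoc inf.orderE)
    qed
    then have "closedin (realisation K) U"
      unfolding closedin_realisation using closedin_subset[OF U] polyhedron_mono[OF K(3)] by auto
    then show "closedin (subtopology (realisation K) (polyhedron B)) U"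
      using closedin_closed_subtopology[OF closedin_polyhedron[OF K]] closedin_subset[OF U] by simp
  qed
  then have eq: "closedin (subtopology (realisation K) (polyhedron B)) = closedin (realisation B)"
    by blast
  fix U
  have "topspace (subtopology (realisation K) (polyhedron B)) = topspace (realisation B)"
    using polyhedron_mono[OF K(3)] by auto
  then show "openin (subtopology (realisation K) (polyhedron B)) U = openin (realisation B) U"
    unfolding openin_closedin_eq eq by simp
qed

section \<open>Collapsing a subspace\<close>

text \<open>The value at the basepoint is a separate hypothesis because \<open>None\<close> is
  outside the image of \<open>collapse_map A\<close> when \<open>A\<close> is empty.\<close>

lemma continuous_map_from_collapse:
  assumes f: "continuous_map W Y (f \<circ> collapse_map A)" and N: "f None \<in> topspace Y"
  shows "continuous_map (collapse W A) Y f"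
  unfolding continuous_map_def
proof (intro conjI allI impI)
  show "f \<in> topspace (collapse W A) \<rightarrow> topspace Y"
    using continuous_map_funspace[OF f] N by (auto simp: topspace_collapse collapse_map_def Pi_iff)
  fix U assume "openin Y U"
  then have "openin W {x \<in> topspace W. (f \<circ> collapse_map A) x \<in> U}"
    using f openin_continuous_map_preimage by blast
  moreover have "{x \<in> topspace W. (f \<circ> collapse_map A) x \<in> U} = {x \<in> topspace W. collapse_map A x \<in> {x \<in> topspace (collapse W A). f x \<in> U}}"
    by (auto simp: topspace_collapse collapse_map_def)
  ultimately show "openin (collapse W A) {x \<in> topspace (collapse W A). f x \<in> U}"
    by (auto simp: openin_collapse topspace_collapse)
qed

lemma continuous_map_collapse: "continuous_map W (collapse W A) (collapse_map A)"
  unfolding continuous_map_def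
  by (auto simp: openin_collapse topspace_collapse collapse_map_def)

text \<open>If \<open>A\<close> is empty then the basepoint is isolated.\<close>

lemma continuous_map_prod_collapse:
  assumes f: "continuous_map (prod_topology unit_interval W) Y (\<lambda>(s,x). f (s, collapse_map A x))"
    and N: "continuous_map unit_interval Y (\<lambda>s. f (s, None))" and A: "A \<subseteq> topspace W"
  shows "continuous_map (prod_topology unit_interval (collapse W A)) Y f"
proof (cases "A = {}")
  case False
  have "quotient_map (prod_topology unit_interval W) (prod_topology unit_interval (collapse W A)) (\<lambda>(x,y). (x, collapse_map A y))"
    by (intro quotient_map_prod_right locally_compact_unit_interval disjI1 Hausdorff_unit_interval quotient_map_collapse A False)
  then show ?thesis
    using f by (elim continuous_compose_quotient_map) (simp add: o_def case_prod_unfold)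
next
  case True
  have emb: "continuous_map W (subtopology (collapse W A) (Some ` topspace W)) Some"
    using continuous_map_collapse[of W A] True
    by (auto simp: continuous_map_in_subtopology collapse_map_def[abs_def])
  have the: "continuous_map (subtopology (collapse W A) (Some ` topspace W)) W the"
    unfolding continuous_map_def
  proof (intro conjI allI impI)
    fix U assume U: "openin W U"
    then have "{x \<in> topspace W. collapse_map A x \<in> Some ` U} = U"
      using openin_subset[OF U] True by (auto simp: collapse_map_def)
    then have "openin (collapse W A) (Some ` U)"
      using U openin_subset[OF U] True by (auto simp: openin_collapse)
    moreover have "{x \<in> topspace (subtopology (collapse W A) (Some ` topspace W)). the x \<in> U} = Some ` U \<inter> Some ` topspace W"
      using openin_subset[OF U] True by (auto simp: topspace_collapse)
    ultimately show "openin (subtopology (collapse W A) (Some ` topspace W)) {x \<in> topspace (subtopology (collapse W A) (Some ` topspace W)). the x \<in> U}"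
      unfolding openin_subtopology by blast
  qed (auto simp: topspace_collapse)
  show ?thesis
  proof (rule pasting_lemma[where I = UNIV and T = "\<lambda>b. {0..1} \<times> (if b then {None} else Some ` topspace W)" and f = "\<lambda>b. f"])
    have "openin (collapse W A) {None}" "openin (collapse W A) (Some ` topspace W)"
      using True by (auto simp: openin_collapse collapse_map_def image_iff)
    then show "openin (prod_topology unit_interval (collapse W A)) ({0..1} \<times> (if b then {None} else Some ` topspace W))" for b
      by (auto simp: openin_prod_Times_iff)
    show "continuous_map (subtopology (prod_topology unit_interval (collapse W A)) ({0..1} \<times> (if b then {None} else Some ` topspace W))) Y f" for b
    proof (cases b)
      case True
      have "continuous_map (subtopology (prod_topology unit_interval (collapse W A)) ({0..1} \<times> {None})) Y ((\<lambda>s. f (s, None)) \<circ> fst)"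
        by (intro continuous_map_compose[OF _ N] continuous_map_from_subtopology continuous_map_fst)
      then show ?thesis
        using True by (auto elim!: continuous_map_eq)
    next
      case False
      have "continuous_map (prod_topology unit_interval (subtopology (collapse W A) (Some ` topspace W))) (prod_topology unit_interval W) (\<lambda>(s,x). (s, the x))"
        unfolding continuous_map_pairwise
        by (auto simp: o_def case_prod_unfold intro!: continuous_map_fst continuous_map_compose[OF continuous_map_snd the, unfolded o_def])
      from continuous_map_compose[OF this f]
      have "continuous_map (prod_topology unit_interval (subtopology (collapse W A) (Some ` topspace W))) Y f"
        by (rule continuous_map_eq) (auto simp: collapse_map_def \<open>A = {}\<close>)
      then have "continuous_map (subtopology (prod_topology unit_interval (collapse W A)) ({0..1} \<times> Some ` topspace W)) Y f"
        unfolding prod_topology_subtopology(2)[of unit_interval "collapse W A"] by simp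
      then show ?thesis
        by (rule continuous_map_from_subtopology_mono) (use False in auto)
    qed
  qed (use True in \<open>auto simp: topspace_collapse\<close>)
qed

section \<open>Collapsing a contractible subcomplex\<close>

text \<open>Pushing a point away from the faces opposite to its small coordinates retracts a neighbourhood of every
  subcomplex onto it, simultaneously for all subcomplexes. This replaces the homotopy extension property.\<close>

definition shrink :: "real \<Rightarrow> ('v \<Rightarrow> real) \<Rightarrow> 'v \<Rightarrow> real" where
  "shrink c t = (\<lambda>v. max 0 (t v - c) / (\<Sum>w\<in>supp t. max 0 (t w - c)))"

text \<open>A uniform bound on the number of vertices provides one threshold for shrinking that
  works on all simplices at once.\<close>

locale bounded_complex =
  fixes K :: "'v set set" and N :: nat
  assumes complex: "simplicial_complex K" and card_le: "\<And>\<sigma>. \<sigma> \<in> K \<Longrightarrow> card \<sigma> \<le> N"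
begin

text \<open>Cutting this much off each of at most \<open>N\<close> coordinates costs at most half of
  the total mass, so what is left can be renormalised.\<close>

definition width :: real where "width = 1 / (2 * real N)"

lemma N_pos: "\<sigma> \<in> K \<Longrightarrow> N > 0"
  using card_le[of \<sigma>] simplicial_complexD(1,2)[OF complex, of \<sigma>] by (metis card_gt_0_iff leD not_gr_zero)

lemma width_nonneg: "width \<ge> 0"
  by (simp add: width_def)

lemma shrink_denominator:
  assumes t: "t \<in> polyhedron K" and c: "0 \<le> c" "c \<le> width"
  shows "(\<Sum>w\<in>supp t. max 0 (t w - c)) \<ge> 1/2"
proof -
  note tD = polyhedronD[OF t complex]
  have "1/2 \<le> 1 - real (card (supp t)) * c"
  proof -
    have "real (card (supp t)) * c \<le> real N * width"
      using card_le[OF tD(1)] c width_nonneg by (intro mult_mono) auto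
    also have "\<dots> = 1/2" using N_pos[OF tD(1)] by (simp add: width_def)
    finally show ?thesis by simp
  qed
  also have "\<dots> = (\<Sum>w\<in>supp t. t w - c)" using tD(5) by (simp add: sum_subtractf)
  also have "\<dots> \<le> (\<Sum>w\<in>supp t. max 0 (t w - c))" by (intro sum_mono) auto
  finally show ?thesis .
qed

lemma supp_shrink:
  assumes t: "t \<in> polyhedron K" and c: "0 \<le> c" "c \<le> width"
  shows "supp (shrink c t) = {v. t v > c}"
  using shrink_denominator[OF assms] by (auto simp: shrink_def max_def)

lemma shrink_0: "t \<in> polyhedron K \<Longrightarrow> shrink 0 t = t"
proof -
  assume "t \<in> polyhedron K"
  note tD = polyhedronD[OF this complex]
  have "(\<Sum>w\<in>supp t. max 0 (t w - 0)) = 1" using tD(4,5) by (simp add: max_absorb2)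
  then show ?thesis unfolding shrink_def using tD(4) by (auto simp: max_absorb2)
qed

text \<open>Supports only lose vertices, so every subcomplex is mapped into itself.\<close>

lemma shrink_in:
  assumes t: "t \<in> polyhedron K" and c: "0 \<le> c" "c \<le> width"
    and B: "simplicial_complex B" and tB: "t \<in> polyhedron B"
  shows "shrink c t \<in> polyhedron B"
proof (rule polyhedronI[OF B])
  note tD = polyhedronD[OF t complex]
  show "0 \<le> shrink c t v" for v unfolding shrink_def by (auto intro!: divide_nonneg_nonneg sum_nonneg)
  have sub: "supp (shrink c t) \<subseteq> supp t" unfolding supp_shrink[OF t c] using c by auto
  have "sum (shrink c t) (supp (shrink c t)) = sum (shrink c t) (supp t)"
    using tD(2) sub by (intro sum.mono_neutral_left) auto
  also have "\<dots> = 1"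
    using shrink_denominator[OF t c] by (simp add: shrink_def flip: sum_divide_distrib)
  finally show 1: "sum (shrink c t) (supp (shrink c t)) = 1" .
  then have "supp (shrink c t) \<noteq> {}" by (metis sum.empty zero_neq_one)
  then show "supp (shrink c t) \<in> B"
    using sub simplicial_complexD(3)[OF B] polyhedronD(1)[OF tB B] by blast
qed

lemma continuous_map_face_coordinate:
  "continuous_map (face_topology \<sigma>) euclideanreal (\<lambda>t. t v)"
  by (intro continuous_map_from_subtopology continuous_map_product_projection) simp

lemma continuous_map_shrink:
  "continuous_map (prod_topology unit_interval (realisation K)) (realisation K) (\<lambda>(s,t). shrink (s * width) t)"
proof (rule continuous_map_prod_realisation)
  fix \<sigma> assume \<sigma>: "\<sigma> \<in> K"
  let ?Y = "prod_topology unit_interval (face_topology \<sigma>)"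
  have fin: "finite \<sigma>" using simplicial_complexD[OF complex \<sigma>] by blast
  have tK: "t \<in> polyhedron K" if "t \<in> face \<sigma>" for t using that \<sigma> by (auto simp: polyhedron_def)
  have sc: "0 \<le> s * width \<and> s * width \<le> width" if "s \<in> {0..1}" for s
    using that width_nonneg by (auto intro: mult_left_le_one_le)
  show "continuous_map ?Y (realisation K) (\<lambda>(s,t). shrink (s * width) t)"
  proof (rule continuous_map_into_realisation[OF complex _ fin])
    fix y assume "y \<in> topspace ?Y"
    then obtain s t where y: "y = (s,t)" "s \<in> {0..1}" "t \<in> face \<sigma>" by auto
    have "supp (shrink (s * width) t) \<subseteq> supp t"
      using supp_shrink[OF tK[OF y(3)]] sc[OF y(2)] by auto
    then show "(case y of (s,t) \<Rightarrow> shrink (s * width) t) \<in> polyhedron K \<and> supp (case y of (s,t) \<Rightarrow> shrink (s * width) t) \<subseteq> \<sigma>"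
      using y shrink_in[OF tK _ _ complex tK] sc supp_subset[OF y(3)] by auto
  next
    fix v
    have t: "continuous_map ?Y euclideanreal (\<lambda>y. snd y v)" for v
      using continuous_map_compose[OF continuous_map_snd continuous_map_face_coordinate] by (simp add: o_def)
    have s: "continuous_map ?Y euclideanreal fst"
      using continuous_map_fst continuous_map_into_fulltopology by blast
    \<comment> \<open>The index set \<open>supp t\<close> varies with \<open>t\<close>. On a fixed
      face it is replaced by all of \<sigma>; the added terms are zero.\<close>
    have "continuous_map ?Y euclideanreal (\<lambda>y. max 0 (snd y v - fst y * width) / (\<Sum>w\<in>\<sigma>. max 0 (snd y w - fst y * width)))"
    proof (intro continuous_intros s t fin)
      fix y assume "y \<in> topspace ?Y"
      then obtain s t where y: "y = (s,t)" "s \<in> {0..1}" "t \<in> face \<sigma>" by auto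
      have "(\<Sum>w\<in>supp t. max 0 (t w - s * width)) \<le> (\<Sum>w\<in>\<sigma>. max 0 (t w - s * width))"
        using supp_subset[OF y(3)] fin by (intro sum_mono2) auto
      then show "(\<Sum>w\<in>\<sigma>. max 0 (snd y w - fst y * width)) \<noteq> 0"
        using shrink_denominator[OF tK[OF y(3)]] sc[OF y(2)] y(1) by fastforce
    qed auto
    then show "continuous_map ?Y euclideanreal (\<lambda>y. (case y of (s,t) \<Rightarrow> shrink (s * width) t) v)"
    proof (rule continuous_map_eq)
      fix y assume "y \<in> topspace ?Y"
      then obtain s t where y: "y = (s,t)" "s \<in> {0..1}" "t \<in> face \<sigma>" by auto
      have "(\<Sum>w\<in>supp t. max 0 (t w - s * width)) = (\<Sum>w\<in>\<sigma>. max 0 (t w - s * width))"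
        using supp_subset[OF y(3)] fin sc[OF y(2)] by (intro sum.mono_neutral_left) (auto simp: max_def)
      then show "max 0 (snd y v - fst y * width) / (\<Sum>w\<in>\<sigma>. max 0 (snd y w - fst y * width)) =
          (case y of (s,t) \<Rightarrow> shrink (s * width) t) v"
        using y by (simp add: shrink_def)
    qed
  qed
qed

text \<open>A Urysohn function: it vanishes on \<open>B\<close> and is \<open>1\<close> as long as \<^term>\<open>shrink width t\<close> lies outside \<open>B\<close>.\<close>

definition excess :: "'v set set \<Rightarrow> ('v \<Rightarrow> real) \<Rightarrow> real" where
  "excess B t = min 1 (\<Sum>\<tau> | \<tau> \<subseteq> supp t \<and> \<tau> \<noteq> {} \<and> \<tau> \<notin> B. \<Prod>v\<in>\<tau>. min 1 (t v / width))"

lemma excess_nonneg: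
  assumes t: "t \<in> polyhedron K" shows "0 \<le> excess B t"
  unfolding excess_def using polyhedronD[OF t complex] width_nonneg
  by (auto intro!: sum_nonneg prod_nonneg)

lemma excess_eq_0:
  assumes B: "simplicial_complex B" and t: "t \<in> polyhedron B" shows "excess B t = 0"
proof -
  have "{\<tau>. \<tau> \<subseteq> supp t \<and> \<tau> \<noteq> {} \<and> \<tau> \<notin> B} = {}"
    using polyhedronD(1)[OF t B] simplicial_complexD(3)[OF B] by blast
  then show ?thesis unfolding excess_def by (metis sum.empty min.absorb2 zero_le_one)
qed

text \<open>The support of \<open>shrink width t\<close> is itself one of the nonfaces in the sum.
  All its coordinates exceed \<open>width\<close>, so its product alone is already 1.\<close>

lemma excess_eq_1:
  assumes t: "t \<in> polyhedron K" and B: "simplicial_complex B" and n: "shrink width t \<notin> polyhedron B"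
  shows "excess B t = 1"
proof -
  note tD = polyhedronD[OF t complex]
  have w: "width > 0" using N_pos[OF tD(1)] by (simp add: width_def)
  let ?\<tau> = "supp (shrink width t)" and ?I = "{\<tau>. \<tau> \<subseteq> supp t \<and> \<tau> \<noteq> {} \<and> \<tau> \<notin> B}"
  have "shrink width t \<in> polyhedron K" using shrink_in[OF t _ _ complex t] w by simp
  note sD = polyhedronD[OF this complex]
  have s: "?\<tau> = {v. t v > width}" using supp_shrink[OF t] w by simp
  have "?\<tau> \<notin> B" using n polyhedronI[OF B sD(4,5)] by blast
  then have I: "?\<tau> \<in> ?I" using sD(3) s w by auto
  have fin: "finite ?I" using tD(2) by (auto intro: finite_subset[of _ "Pow (supp t)"])
  have "(\<Prod>v\<in>?\<tau>. min 1 (t v / width)) = 1"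
    using s w by (intro prod.neutral) (auto simp: min_def field_simps)
  then have "1 \<le> (\<Sum>\<tau>\<in>?I. \<Prod>v\<in>\<tau>. min 1 (t v / width))"
    using member_le_sum[OF I _ fin, of "\<lambda>\<tau>. \<Prod>v\<in>\<tau>. min 1 (t v / width)"] tD(4) w
    by (simp add: prod_nonneg)
  then show ?thesis unfolding excess_def by simp
qed

lemma continuous_map_excess: "continuous_map (realisation K) euclideanreal (excess B)"
  unfolding continuous_map_realisation_iff
proof
  fix \<sigma> assume \<sigma>: "\<sigma> \<in> K"
  have fin: "finite \<sigma>" using simplicial_complexD[OF complex \<sigma>] by blast
  let ?J = "{\<tau>. \<tau> \<subseteq> \<sigma> \<and> \<tau> \<noteq> {} \<and> \<tau> \<notin> B}"
  have finJ: "finite ?J" using fin by (auto intro: finite_subset[of _ "Pow \<sigma>"])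
  have w: "width \<noteq> 0" using N_pos[OF \<sigma>] by (simp add: width_def)
  have "continuous_map (face_topology \<sigma>) euclideanreal (\<lambda>t. min 1 (\<Sum>\<tau>\<in>?J. \<Prod>v\<in>\<tau>. min 1 (t v / width)))"
    using finJ fin w by (intro continuous_intros continuous_map_face_coordinate) (auto intro: finite_subset)
  then show "continuous_map (face_topology \<sigma>) euclideanreal (excess B)"
  proof (rule continuous_map_eq)
    fix t assume "t \<in> topspace (face_topology \<sigma>)"
    then have t: "t \<in> face \<sigma>" by simp
    have "(\<Sum>\<tau> | \<tau> \<subseteq> supp t \<and> \<tau> \<noteq> {} \<and> \<tau> \<notin> B. \<Prod>v\<in>\<tau>. min 1 (t v / width)) = (\<Sum>\<tau>\<in>?J. \<Prod>v\<in>\<tau>. min 1 (t v / width))"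
    proof (intro sum.mono_neutral_left finJ ballI)
      \<comment> \<open>A set that is not inside the support has a vertex of coordinate 0, which
        kills its product; the jump of the index set is therefore invisible.\<close>
      fix \<tau> assume \<tau>: "\<tau> \<in> ?J - {\<tau>. \<tau> \<subseteq> supp t \<and> \<tau> \<noteq> {} \<and> \<tau> \<notin> B}"
      then obtain v where "v \<in> \<tau>" "t v = 0" by auto
      then show "(\<Prod>v\<in>\<tau>. min 1 (t v / width)) = 0"
        using \<tau> fin finite_subset by (intro prod_zero) (auto intro!: bexI[of _ v])
    qed (use supp_subset[OF t] in auto)
    then show "min 1 (\<Sum>\<tau>\<in>?J. \<Prod>v\<in>\<tau>. min 1 (t v / width)) = excess B t" by (simp add: excess_def)
  qed
qed

text \<open>The hypotheses say that \<open>B\<close> contracts to the basepoint within the quotient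
  by \<open>A\<close>. During the first half of the time everything is shrunk. During the second
  half the points that have landed in \<open>B\<close> follow \<open>g\<close>, slowed down by the
  factor \<open>1 - excess B\<close>, so that the motion dies out where shrunk points cease to lie
  in \<open>B\<close>. The condition \<open>gB\<close> lets the homotopy descend to the quotient by
  \<open>B\<close> as well.\<close>

theorem collapse_homotopy_equivalent:
  fixes A B :: "'v set set" and g :: "real \<times> ('v \<Rightarrow> real) \<Rightarrow> ('v \<Rightarrow> real) option"
  assumes A: "simplicial_complex A" and B: "simplicial_complex B" and AB: "A \<subseteq> B" and BK: "B \<subseteq> K"
    and g: "continuous_map (prod_topology unit_interval (realisation B)) (collapse (realisation K) (polyhedron A)) g"
    and g0: "\<And>t. t \<in> polyhedron B \<Longrightarrow> g (0, t) = collapse_map (polyhedron A) t"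
    and g1: "\<And>t. t \<in> polyhedron B \<Longrightarrow> g (1, t) = None"
    and gA: "\<And>s t. s \<in> {0..1} \<Longrightarrow> t \<in> polyhedron A \<Longrightarrow> g (s, t) = None"
    and gB: "\<And>s t. s \<in> {0..1} \<Longrightarrow> t \<in> polyhedron B \<Longrightarrow> g (s, t) \<in> insert None (Some ` polyhedron B)"
  shows "collapse (realisation K) (polyhedron A) homotopy_equivalent_space
         collapse (realisation K) (polyhedron B)"
proof -
  let ?W = "realisation K" and ?A = "polyhedron A" and ?B = "polyhedron B"
  let ?YA = "collapse ?W ?A" and ?YB = "collapse ?W ?B"
  let ?IW = "prod_topology unit_interval ?W"
  have AsB: "?A \<subseteq> ?B" and BsK: "?B \<subseteq> polyhedron K" using polyhedron_mono[OF AB] polyhedron_mono[OF BK] by auto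
  define D :: "real \<times> ('v \<Rightarrow> real) \<Rightarrow> 'v \<Rightarrow> real" where "D = (\<lambda>(s,t). shrink (min 1 (2 * s) * width) t)"
  define lam where "lam = (\<lambda>s::real. max 0 (2 * s - 1))"
  define h where "h = (\<lambda>(s,t). if D (s,t) \<in> ?B then g (lam s * (1 - excess B t), D (s,t)) else collapse_map ?A (D (s,t)))"
  have sc: "0 \<le> min 1 (2 * s) * width \<and> min 1 (2 * s) * width \<le> width" if "s \<in> {0..1}" for s
    using that width_nonneg by (auto intro: mult_left_le_one_le)
  have contD: "continuous_map ?IW ?W D"
  proof -
    have "continuous_map ?IW ?IW (\<lambda>p. (min 1 (2 * fst p), snd p))"
    proof -
      have "continuous_map ?IW euclideanreal (\<lambda>p. min 1 (2 * fst p))"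
        by (intro continuous_intros continuous_map_into_fulltopology[OF continuous_map_fst])
      then show ?thesis
        by (auto simp: continuous_map_pairwise o_def continuous_map_in_subtopology continuous_map_snd)
    qed
    from continuous_map_compose[OF this continuous_map_shrink] show ?thesis
      by (simp add: o_def D_def case_prod_unfold)
  qed
  have DK: "D (s,t) \<in> polyhedron C" if "s \<in> {0..1}" "t \<in> polyhedron C" "simplicial_complex C" "C \<subseteq> K" for s t C
    using shrink_in[OF _ _ _ that(3,2)] sc[OF that(1)] polyhedron_mono[OF that(4)] that(2) by (auto simp: D_def)
  have u01: "excess B t \<in> {0..1}" if "t \<in> polyhedron K" for t
    using excess_nonneg[OF that] by (auto simp: excess_def)
  have conth: "continuous_map ?IW ?YA h"
  proof -
    \<comment> \<open>The two formulas for \<open>h\<close> are pasted along closed sets: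
      \<open>C\<close>, where the shrunk point lies in \<open>B\<close>, and \<open>E\<close>, where
      the time argument handed to \<open>g\<close> is 0. They agree on the overlap by
      \<open>g0\<close>.\<close>
    define C where "C = {p \<in> topspace ?IW. D p \<in> ?B}"
    define E where "E = {p \<in> topspace ?IW. lam (fst p) * (1 - excess B (snd p)) \<in> {..0}}"
    let ?f = "\<lambda>b p. if b then g (lam (fst p) * (1 - excess B (snd p)), D p) else collapse_map ?A (D p)"
    have clC: "closedin ?IW C"
      unfolding C_def by (rule closedin_continuous_map_preimage[OF contD closedin_polyhedron[OF complex B BK]])
    have cl: "continuous_map ?IW euclideanreal (\<lambda>p. lam (fst p) * (1 - excess B (snd p)))"
      unfolding lam_def
      by (intro continuous_intros continuous_map_into_fulltopology[OF continuous_map_fst]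
          continuous_map_compose[OF continuous_map_snd continuous_map_excess, unfolded o_def])
    have clE: "closedin ?IW E"
      unfolding E_def by (rule closedin_continuous_map_preimage[OF cl]) (simp flip: closed_closedin)
    have l01: "lam (fst p) * (1 - excess B (snd p)) \<in> {0..1}" if "p \<in> topspace ?IW" for p
      using that u01[of "snd p"] by (auto simp: lam_def intro!: mult_le_one)
    show ?thesis
    proof (rule pasting_lemma_closed[where I = UNIV and T = "\<lambda>b. if b then C else E" and f = ?f])
      show "closedin ?IW (if b then C else E)" for b using clC clE by simp
      show "continuous_map (subtopology ?IW (if b then C else E)) ?YA (?f b)" for b
      proof (cases b)
        case True
        have "continuous_map (subtopology ?IW C) (realisation B) D"
          using continuous_map_from_subtopology[OF contD]
          by (auto simp: continuous_map_in_subtopology C_def simp flip: subtopology_realisation[OF complex B BK])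
        moreover have "continuous_map (subtopology ?IW C) unit_interval (\<lambda>p. lam (fst p) * (1 - excess B (snd p)))"
          unfolding continuous_map_in_subtopology using l01
          by (auto simp: continuous_map_from_subtopology[OF cl])
        ultimately have "continuous_map (subtopology ?IW C) (prod_topology unit_interval (realisation B)) (\<lambda>p. (lam (fst p) * (1 - excess B (snd p)), D p))"
          by (simp add: continuous_map_pairwise o_def)
        from continuous_map_compose[OF this g] show ?thesis using True by (simp add: o_def)
      next
        case False
        then show ?thesis
          using continuous_map_from_subtopology[OF continuous_map_compose[OF contD continuous_map_collapse]]
          by (simp add: o_def)
      qed
      show "?f i p = ?f j p" if "p \<in> topspace ?IW \<inter> (if i then C else E) \<inter> (if j then C else E)" for i j p
      proof -
        have "g (lam (fst p) * (1 - excess B (snd p)), D p) = collapse_map ?A (D p)" if "p \<in> C" "p \<in> E"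
        proof -
          have "lam (fst p) * (1 - excess B (snd p)) = 0"
            using that l01[of p] by (auto simp: E_def)
          then have "g (lam (fst p) * (1 - excess B (snd p)), D p) = g (0, D p)" by (simp only:)
          then show ?thesis using g0 that(1) by (simp add: C_def)
        qed
        then show ?thesis using that by (cases i; cases j) auto
      qed
      show "\<exists>b. b \<in> UNIV \<and> p \<in> (if b then C else E) \<and> h p = ?f b p" if p: "p \<in> topspace ?IW" for p
      proof (cases "p \<in> C")
        case True
        then show ?thesis by (intro exI[of _ True]) (auto simp: h_def C_def case_prod_unfold)
      next
        case False
        \<comment> \<open>Either the second phase has not begun, or shrinking is complete and has
          left the point outside \<open>B\<close>, where \<open>excess\<close> equals 1.\<close>
        have "lam (fst p) * (1 - excess B (snd p)) = 0"
        proof (cases "fst p \<le> 1/2")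
          case F: False
          then have "D p = shrink width (snd p)" by (simp add: D_def case_prod_unfold)
          then show ?thesis using excess_eq_1[OF _ B, of "snd p"] False p by (auto simp: C_def)
        qed (auto simp: lam_def)
        then show ?thesis using False p by (intro exI[of _ False]) (auto simp: h_def C_def E_def case_prod_unfold)
      qed
    qed simp
  qed
  have hA: "h (s,t) = None" if "s \<in> {0..1}" "t \<in> ?A" for s t
  proof -
    have "D (s,t) \<in> ?A" using DK that A AB BK by blast
    moreover have "lam s * (1 - excess B t) \<in> {0..1}"
      using that AsB BsK u01[of t] by (auto simp: lam_def intro!: mult_le_one)
    ultimately show ?thesis using AsB gA by (auto simp: h_def)
  qed
  have hB: "h (s,t) \<in> insert None (Some ` ?B)" if "s \<in> {0..1}" "t \<in> ?B" for s t
  proof -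
    have "D (s,t) \<in> ?B" using DK that B BK by blast
    moreover have "lam s * (1 - excess B t) \<in> {0..1}"
      using that BsK u01[of t] by (auto simp: lam_def intro!: mult_le_one)
    ultimately show ?thesis using gB by (auto simp: h_def)
  qed
  have h0: "h (0,t) = collapse_map ?A t" if "t \<in> polyhedron K" for t
    using that g0 by (simp add: h_def D_def lam_def shrink_0)
  have h1: "h (1,t) = None" if "t \<in> ?B" for t
    using DK[of 1 t B] that B BK excess_eq_0[OF B that] g1 by (simp add: h_def lam_def)
  define q where "q = (\<lambda>x. case x of None \<Rightarrow> None | Some t \<Rightarrow> collapse_map ?B t)"
  have q_collapse: "q (collapse_map ?A t) = collapse_map ?B t" for t
    using AsB by (auto simp: q_def collapse_map_def)
  have contq: "continuous_map ?YA ?YB q"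
    by (rule continuous_map_from_collapse)
       (simp_all add: q_collapse o_def continuous_map_collapse, simp add: q_def topspace_collapse)
  \<comment> \<open>The homotopy inverse of the projection \<open>q\<close> is the end of
    \<open>h\<close>, which sends \<open>B\<close> to the basepoint.\<close>
  define f where "f = (\<lambda>x. case x of None \<Rightarrow> None | Some t \<Rightarrow> h (1,t))"
  have f_collapse: "f (collapse_map ?B t) = h (1,t)" for t
    using h1 by (auto simp: f_def collapse_map_def)
  have conth1: "continuous_map ?W ?YA (\<lambda>t. h (1,t))"
    using continuous_map_compose[OF _ conth, of ?W "\<lambda>t. (1,t)"] by (simp add: o_def continuous_map_pairwise)
  have contf: "continuous_map ?YB ?YA f"
    by (rule continuous_map_from_collapse)
       (simp_all add: f_collapse o_def conth1, simp add: f_def topspace_collapse)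
  define H where "H = (\<lambda>(s,x). case x of None \<Rightarrow> None | Some t \<Rightarrow> h (s,t))"
  have contH: "continuous_map (prod_topology unit_interval ?YA) ?YA H"
  proof (rule continuous_map_prod_collapse)
    show "continuous_map ?IW ?YA (\<lambda>(s,t). H (s, collapse_map ?A t))"
      by (rule continuous_map_eq[OF conth]) (use hA in \<open>auto simp: H_def collapse_map_def\<close>)
  qed (use AsB BsK in \<open>auto simp: H_def topspace_collapse\<close>)
  define H' where "H' = (\<lambda>(s,x). case x of None \<Rightarrow> None | Some t \<Rightarrow> q (h (s,t)))"
  have contH': "continuous_map (prod_topology unit_interval ?YB) ?YB H'"
  proof (rule continuous_map_prod_collapse)
    have "q (h (s,t)) = None" if "s \<in> {0..1}" "t \<in> ?B" for s t
      using hB[OF that] by (auto simp: q_def collapse_map_def)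
    then show "continuous_map ?IW ?YB (\<lambda>(s,t). H' (s, collapse_map ?B t))"
      by (intro continuous_map_eq[OF continuous_map_compose[OF conth contq]])
         (auto simp: H'_def collapse_map_def)
  qed (use BsK in \<open>auto simp: H'_def topspace_collapse\<close>)
  have "homotopic_with (\<lambda>x. True) ?YA ?YA id (f \<circ> q)"
  proof (subst homotopic_with, simp, intro exI[of _ H] conjI ballI)
    fix x assume "x \<in> topspace ?YA"
    then show "H (0,x) = id x" "H (1,x) = (f \<circ> q) x"
      using h0 by (auto simp: topspace_collapse H_def f_def q_def collapse_map_def h1 split: option.split)
  qed (use contH in auto)
  moreover have "homotopic_with (\<lambda>x. True) ?YB ?YB id (q \<circ> f)"
  proof (subst homotopic_with, simp, intro exI[of _ H'] conjI ballI)
    fix x assume "x \<in> topspace ?YB"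
    then show "H' (0,x) = id x" "H' (1,x) = (q \<circ> f) x"
      using h0 AsB by (auto simp: topspace_collapse H'_def f_def q_def collapse_map_def h1 subset_iff
          split: option.split if_splits)
  qed (use contH' in auto)
  ultimately show ?thesis
    unfolding homotopy_equivalent_space_def using contq contf homotopic_with_symD by blast
qed

end

section \<open>Ranked posets generated by points\<close>

lemma order_complex_iff:
  "\<sigma> \<in> order_complex P \<longleftrightarrow> \<sigma> \<subseteq> P \<and> finite \<sigma> \<and> \<sigma> \<noteq> {} \<and> (\<forall>U\<in>\<sigma>. \<forall>V\<in>\<sigma>. U \<subseteq> V \<or> V \<subseteq> U)"
  by (auto simp: order_complex_def chains_def chain_subset_def)

lemma simplicial_complex_order_complex: "simplicial_complex (order_complex P)"
  unfolding simplicial_complex_def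
proof (intro ballI conjI allI impI)
  fix \<sigma> \<tau> assume \<sigma>: "\<sigma> \<in> order_complex P" and \<tau>: "\<tau> \<subseteq> \<sigma> \<and> \<tau> \<noteq> {}"
  then show "\<tau> \<in> order_complex P"
    unfolding order_complex_iff using finite_subset[of \<tau> \<sigma>] by (simp add: subset_iff)
qed (simp_all add: order_complex_iff)

text \<open>This is all that the topology needs to know about \<open>L\<close>. Upper bounds are
  required for infinite families as well, because the span of a singular simplex
  (\<open>span_of\<close>) joins infinitely many elements. Joining a point raises the rank by at
  most one; the condition is phrased for any least upper bound since \<open>lub\<close> is only
  defined afterwards.\<close>

locale point_lattice =
  fixes L :: "'a set set" and X :: "'a set" and rk :: "'a set \<Rightarrow> nat" and n :: nat
  assumes top_in: "X \<in> L" and le_top: "U \<in> L \<Longrightarrow> U \<subseteq> X"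
    and lub_exists: "\<A> \<subseteq> L \<Longrightarrow> \<A> \<noteq> {} \<Longrightarrow> \<exists>J\<in>L. (\<forall>U\<in>\<A>. U \<subseteq> J) \<and> (\<forall>W\<in>L. (\<forall>U\<in>\<A>. U \<subseteq> W) \<longrightarrow> J \<subseteq> W)"
    and rank_strict: "U \<in> L \<Longrightarrow> V \<in> L \<Longrightarrow> U \<subset> V \<Longrightarrow> rk U < rk V"
    and rank_top: "rk X = n"
    and point_exists: "U \<in> L \<Longrightarrow> \<exists>p\<in>L. rk p = 0 \<and> p \<subseteq> U"
    and rank_lub: "U \<in> L \<Longrightarrow> p \<in> L \<Longrightarrow> rk p = 0 \<Longrightarrow> J \<in> L \<Longrightarrow> U \<subseteq> J \<Longrightarrow> p \<subseteq> J \<Longrightarrow>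
      (\<And>W. W \<in> L \<Longrightarrow> U \<subseteq> W \<Longrightarrow> p \<subseteq> W \<Longrightarrow> J \<subseteq> W) \<Longrightarrow> rk J \<le> Suc (rk U)"
begin

definition lub :: "'a set set \<Rightarrow> 'a set" where
  "lub \<A> = (THE J. J \<in> L \<and> (\<forall>U\<in>\<A>. U \<subseteq> J) \<and> (\<forall>W\<in>L. (\<forall>U\<in>\<A>. U \<subseteq> W) \<longrightarrow> J \<subseteq> W))"

lemma lub_props:
  assumes "\<A> \<subseteq> L" "\<A> \<noteq> {}"
  shows "lub \<A> \<in> L" "\<And>U. U \<in> \<A> \<Longrightarrow> U \<subseteq> lub \<A>" "\<And>W. W \<in> L \<Longrightarrow> (\<And>U. U \<in> \<A> \<Longrightarrow> U \<subseteq> W) \<Longrightarrow> lub \<A> \<subseteq> W"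
proof -
  have "\<exists>!J. J \<in> L \<and> (\<forall>U\<in>\<A>. U \<subseteq> J) \<and> (\<forall>W\<in>L. (\<forall>U\<in>\<A>. U \<subseteq> W) \<longrightarrow> J \<subseteq> W)"
  proof -
    obtain J where J: "J \<in> L" "\<And>U. U \<in> \<A> \<Longrightarrow> U \<subseteq> J" "\<And>W. W \<in> L \<Longrightarrow> (\<And>U. U \<in> \<A> \<Longrightarrow> U \<subseteq> W) \<Longrightarrow> J \<subseteq> W"
      using lub_exists[OF assms] by metis
    show ?thesis
    proof (rule ex1I[of _ J])
      fix J' assume "J' \<in> L \<and> (\<forall>U\<in>\<A>. U \<subseteq> J') \<and> (\<forall>W\<in>L. (\<forall>U\<in>\<A>. U \<subseteq> W) \<longrightarrow> J' \<subseteq> W)"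
      then show "J' = J" using J by (intro equalityI) simp_all
    qed (use J in simp)
  qed
  from theI'[OF this] show "lub \<A> \<in> L" "\<And>U. U \<in> \<A> \<Longrightarrow> U \<subseteq> lub \<A>"
    "\<And>W. W \<in> L \<Longrightarrow> (\<And>U. U \<in> \<A> \<Longrightarrow> U \<subseteq> W) \<Longrightarrow> lub \<A> \<subseteq> W"
    unfolding lub_def by blast+
qed

lemma lub_mono: "\<A> \<subseteq> \<B> \<Longrightarrow> \<B> \<subseteq> L \<Longrightarrow> \<A> \<noteq> {} \<Longrightarrow> lub \<A> \<subseteq> lub \<B>"
  using lub_props[of \<A>] lub_props[of \<B>] by (metis bot.extremum_uniqueI subset_eq)

abbreviation join :: "'a set \<Rightarrow> 'a set \<Rightarrow> 'a set" where
  "join U V \<equiv> lub {U, V}"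

lemma join_props:
  assumes "U \<in> L" "V \<in> L"
  shows "join U V \<in> L" "U \<subseteq> join U V" "V \<subseteq> join U V" "\<And>W. W \<in> L \<Longrightarrow> U \<subseteq> W \<Longrightarrow> V \<subseteq> W \<Longrightarrow> join U V \<subseteq> W"
proof -
  have *: "{U,V} \<subseteq> L" "{U,V} \<noteq> {}" using assms by auto
  show "join U V \<in> L" "U \<subseteq> join U V" "V \<subseteq> join U V" using lub_props(1,2)[OF *] by simp_all
  show "\<And>W. W \<in> L \<Longrightarrow> U \<subseteq> W \<Longrightarrow> V \<subseteq> W \<Longrightarrow> join U V \<subseteq> W"
    by (rule lub_props(3)[OF *]) auto
qed

definition pt :: "'a set \<Rightarrow> 'a set" where
  "pt U = (SOME p. p \<in> L \<and> rk p = 0 \<and> p \<subseteq> U)"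

lemma pt: assumes "U \<in> L" shows "pt U \<in> L" "rk (pt U) = 0" "pt U \<subseteq> U"
  using someI_ex[of "\<lambda>p. p \<in> L \<and> rk p = 0 \<and> p \<subseteq> U"] point_exists[OF assms] unfolding pt_def by blast+

lemma rank_join_point: "U \<in> L \<Longrightarrow> p \<in> L \<Longrightarrow> rk p = 0 \<Longrightarrow> rk (join U p) \<le> Suc (rk U)"
  using join_props[of U p] by (intro rank_lub[of U p]) auto

lemma rank_mono: "U \<in> L \<Longrightarrow> V \<in> L \<Longrightarrow> U \<subseteq> V \<Longrightarrow> rk U \<le> rk V"
  using rank_strict[of U V] by (metis less_imp_le order_refl psubsetI)

text \<open>The rank embeds a chain into \<open>{0..n}\<close>.\<close>

lemma chain_card_le:
  assumes "\<sigma> \<in> order_complex L" shows "card \<sigma> \<le> Suc n"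
proof -
  have "inj_on rk \<sigma>"
  proof (rule inj_onI)
    fix U V assume UV: "U \<in> \<sigma>" "V \<in> \<sigma>" "rk U = rk V"
    then have "U \<in> L" "V \<in> L" "U \<subseteq> V \<or> V \<subseteq> U" using assms by (auto simp: order_complex_iff)
    then show "U = V" using rank_strict[of U V] rank_strict[of V U] UV(3) by auto
  qed
  moreover have "rk ` \<sigma> \<subseteq> {0..n}"
    using assms rank_mono[OF _ top_in] le_top rank_top by (fastforce simp: order_complex_iff)
  ultimately show ?thesis using card_inj_on_le[of rk \<sigma> "{0..n}"] by simp
qed

sublocale bounded_complex "order_complex L" "Suc n"
  by standard (auto simp: simplicial_complex_order_complex chain_card_le)

subsection \<open>Good chains\<close>

definition good_step :: "'a set \<Rightarrow> 'a set \<Rightarrow> bool" where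
  "good_step U V \<longleftrightarrow> V \<in> L \<and> V \<subset> U \<and> join V (pt U) = U"

text \<open>Lists are written upwards: the last entry is \<open>X\<close> and the head is the lowest
  element, so a run of good steps is prolonged downwards by a Cons.\<close>

fun good_list :: "'a set list \<Rightarrow> bool" where
  "good_list [] = False"
| "good_list [U] = (U = X)"
| "good_list (V # U # ws) = (good_step U V \<and> good_list (U # ws))"

text \<open>Strict inclusion raises the rank by at least one, joining a point by at most
  one.\<close>

lemma good_step_rank: "U \<in> L \<Longrightarrow> good_step U V \<Longrightarrow> rk U = Suc (rk V)"
  using rank_join_point[of V "pt U"] pt[of U] rank_strict[of V U] by (auto simp: good_step_def)

lemma good_list_props: "good_list ws \<Longrightarrow> set ws \<subseteq> L \<and> rk (hd ws) + length ws = Suc n \<and> ws \<noteq> []"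
proof (induction ws rule: good_list.induct)
  case (3 V U ws)
  then have "U \<in> L" "good_step U V" by auto
  with 3 good_step_rank[of U V] show ?case by (auto simp: good_step_def)
qed (auto simp: top_in rank_top)

lemma good_list_hd_le: "good_list ws \<Longrightarrow> W \<in> set ws \<Longrightarrow> hd ws \<subseteq> W"
  by (induction ws rule: good_list.induct) (fastforce simp: good_step_def)+

lemma good_list_distinct: "good_list ws \<Longrightarrow> distinct ws"
proof (induction ws rule: good_list.induct)
  case (3 V U ws)
  then show ?case using good_list_hd_le[of "U # ws"] by (auto simp: good_step_def)
qed auto

definition is_chain :: "'a set set \<Rightarrow> bool" where
  "is_chain \<sigma> \<longleftrightarrow> \<sigma> \<subseteq> L \<and> (\<forall>U\<in>\<sigma>. \<forall>V\<in>\<sigma>. U \<subseteq> V \<or> V \<subseteq> U)"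

lemma is_chain_subset: "is_chain \<sigma> \<Longrightarrow> \<tau> \<subseteq> \<sigma> \<Longrightarrow> is_chain \<tau>"
  by (auto simp: is_chain_def subset_iff)

lemma is_chainD: "is_chain \<sigma> \<Longrightarrow> U \<in> \<sigma> \<Longrightarrow> V \<in> \<sigma> \<Longrightarrow> U \<subseteq> V \<or> V \<subseteq> U"
  by (auto simp: is_chain_def)

lemma is_chainI: "\<sigma> \<subseteq> L \<Longrightarrow> (\<And>U V. U \<in> \<sigma> \<Longrightarrow> V \<in> \<sigma> \<Longrightarrow> U \<subseteq> V \<or> V \<subseteq> U) \<Longrightarrow> is_chain \<sigma>"
  by (auto simp: is_chain_def)

text \<open>The position in a good list determines the rank, and within a chain the rank determines
  the element. This uniqueness makes the contraction of a stratum well defined.\<close>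

lemma good_list_unique:
  assumes "is_chain \<sigma>"
  shows "good_list ws \<Longrightarrow> good_list ws' \<Longrightarrow> set ws \<subseteq> \<sigma> \<Longrightarrow> set ws' \<subseteq> \<sigma> \<Longrightarrow> length ws = length ws' \<Longrightarrow> ws = ws'"
proof (induction ws arbitrary: ws' rule: good_list.induct)
  case (2 U)
  then show ?case by (cases ws' rule: good_list.cases) auto
next
  case (3 V U ws)
  then obtain V' U' us where ws': "ws' = V' # U' # us" by (cases ws' rule: good_list.cases) auto
  then have "U # ws = U' # us" using 3(1)[of "U' # us"] 3(2-) by simp
  then have "good_step U V" "good_step U V'" "U \<in> L" using 3 ws' good_list_props[of "U # ws"] by auto
  then have "rk V = rk V'" using good_step_rank by (metis Suc_inject)
  moreover have "V \<subseteq> V' \<or> V' \<subseteq> V" "V \<in> L" "V' \<in> L" using 3 ws' assms by (auto simp: is_chain_def)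
  ultimately have "V = V'" using rank_strict[of V V'] rank_strict[of V' V] by auto
  then show ?case using ws' \<open>U # ws = U' # us\<close> by simp
qed auto

text \<open>The condition is negative so that it passes to subchains and each stratum is a
  subcomplex.\<close>

definition partly_good :: "nat \<Rightarrow> 'a set set set" where
  "partly_good k = {\<sigma> \<in> order_complex L. \<not> (\<exists>ws. good_list ws \<and> length ws = Suc k \<and> set ws \<subseteq> \<sigma>)}"

lemma complex_partly_good: "simplicial_complex (partly_good k)"
  using simplicial_complex_order_complex[of L] unfolding simplicial_complex_def partly_good_def
  by (blast dest: subset_trans)

lemma partly_good_subset: "partly_good k \<subseteq> order_complex L"
  by (auto simp: partly_good_def)

lemma partly_good_mono: "partly_good k \<subseteq> partly_good (Suc k)"
proof
  fix \<sigma> assume "\<sigma> \<in> partly_good k"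
  then have \<sigma>: "\<sigma> \<in> order_complex L" "\<And>ws. good_list ws \<Longrightarrow> length ws = Suc k \<Longrightarrow> set ws \<subseteq> \<sigma> \<Longrightarrow> False"
    by (auto simp: partly_good_def)
  have False if "good_list ws" "length ws = Suc (Suc k)" "set ws \<subseteq> \<sigma>" for ws
    using that \<sigma>(2)[of "tl ws"] by (cases ws rule: good_list.cases) auto
  then show "\<sigma> \<in> partly_good (Suc k)" using \<sigma>(1) by (auto simp: partly_good_def)
qed

lemma partly_good_0: "partly_good 0 = order_complex (L - {X})"
proof -
  have "(\<exists>ws. good_list ws \<and> length ws = Suc 0 \<and> set ws \<subseteq> \<sigma>) \<longleftrightarrow> X \<in> \<sigma>" for \<sigma>
    by (force simp: length_Suc_conv)
  then have "\<sigma> \<in> partly_good 0 \<longleftrightarrow> \<sigma> \<in> order_complex L \<and> X \<notin> \<sigma>" for \<sigma>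
    unfolding partly_good_def mem_Collect_eq by metis
  moreover have "\<sigma> \<subseteq> L \<and> X \<notin> \<sigma> \<longleftrightarrow> \<sigma> \<subseteq> L - {X}" for \<sigma> by blast
  ultimately show ?thesis unfolding order_complex_iff set_eq_iff by metis
qed

subsection \<open>The contraction of a stratum\<close>

text \<open>Time \<open>a\<close> moves the top \<open>a\<close> units of the mass carried by elements below \<open>U\<close> from \<open>V\<close> to
  \<open>join V (pt U)\<close>. Moving the top part first keeps the support a chain.\<close>

definition moved :: "'a set set \<Rightarrow> 'a set \<Rightarrow> real \<Rightarrow> ('a set \<Rightarrow> real) \<Rightarrow> 'a set \<Rightarrow> real" where
  "moved \<sigma> U a t V = min (t V) (max 0 (a - (\<Sum>W | W \<in> \<sigma> \<and> V \<subset> W \<and> W \<subset> U. t W)))"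

definition push :: "'a set set \<Rightarrow> 'a set \<Rightarrow> real \<Rightarrow> ('a set \<Rightarrow> real) \<Rightarrow> 'a set \<Rightarrow> real" where
  "push \<sigma> U a t W = t W - (if W \<subset> U then moved \<sigma> U a t W else 0) +
     (\<Sum>V | V \<in> \<sigma> \<and> V \<subset> U \<and> join V (pt U) = W. moved \<sigma> U a t V)"

text \<open>The simplicial map that sends everything contained in \<open>U\<close> to
  \<open>pt U\<close>. Unlike \<open>push\<close> it also moves the mass at \<open>U\<close> itself,
  which is what destroys the good run at the end.\<close>

definition gather :: "'a set set \<Rightarrow> 'a set \<Rightarrow> ('a set \<Rightarrow> real) \<Rightarrow> 'a set \<Rightarrow> real" where
  "gather \<sigma> U t W = (if W = pt U then (\<Sum>V | V \<in> \<sigma> \<and> V \<subseteq> U. t V) else if W \<subseteq> U then 0 else t W)"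

text \<open>First the transfer to the joins, then a straight line towards \<open>gather\<close>. The
  straight line stays in the complex because \<open>pt U\<close> lies below all the joins.\<close>

definition contraction :: "'a set set \<Rightarrow> 'a set \<Rightarrow> real \<Rightarrow> ('a set \<Rightarrow> real) \<Rightarrow> 'a set \<Rightarrow> real" where
  "contraction \<sigma> U s t W =
     (1 - max 0 (2 * s - 1)) * push \<sigma> U (min 1 (2 * s)) t W + max 0 (2 * s - 1) * gather \<sigma> U t W"

lemma moved_restrict:
  assumes "finite \<sigma>" "supp t \<subseteq> \<sigma>" shows "moved (supp t) U a t V = moved \<sigma> U a t V"
proof -
  have "(\<Sum>W | W \<in> supp t \<and> V \<subset> W \<and> W \<subset> U. t W) = (\<Sum>W | W \<in> \<sigma> \<and> V \<subset> W \<and> W \<subset> U. t W)"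
    using assms by (intro sum.mono_neutral_left) auto
  then show ?thesis unfolding moved_def by metis
qed

lemma moved_zero: "t V = 0 \<Longrightarrow> moved \<sigma> U a t V = 0"
  by (simp add: moved_def)

text \<open>The formulas depend on the face only through the support, so the contractions written
  down on different faces agree where the faces meet.\<close>

lemma contraction_restrict:
  assumes "finite \<sigma>" "supp t \<subseteq> \<sigma>" shows "contraction (supp t) U s t = contraction \<sigma> U s t"
proof -
  have "push (supp t) U a t W = push \<sigma> U a t W" for a W
  proof -
    have "(\<Sum>V | V \<in> supp t \<and> V \<subset> U \<and> join V (pt U) = W. moved \<sigma> U a t V) =
        (\<Sum>V | V \<in> \<sigma> \<and> V \<subset> U \<and> join V (pt U) = W. moved \<sigma> U a t V)"
      using assms by (intro sum.mono_neutral_left) (auto simp: moved_zero)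
    then show ?thesis unfolding push_def moved_restrict[OF assms] by simp
  qed
  moreover have "(\<Sum>V | V \<in> supp t \<and> V \<subseteq> U. t V) = (\<Sum>V | V \<in> \<sigma> \<and> V \<subseteq> U. t V)"
    using assms by (intro sum.mono_neutral_left) auto
  ultimately show ?thesis unfolding contraction_def gather_def by (auto simp: fun_eq_iff)
qed

end

text \<open>One simplex of a stratum that is about to be collapsed: it contains the run
  \<open>ws\<close>, and none of its vertices prolongs the run. Positive rank makes
  \<open>pt U\<close> a proper part of \<open>U\<close>.\<close>

locale good_prefix = point_lattice +
  fixes ws :: "'a set list" and \<sigma> :: "'a set set" and U :: "'a set"
  assumes chain: "\<sigma> \<in> order_complex L" and good: "good_list ws" and sub: "set ws \<subseteq> \<sigma>" and U: "U = hd ws"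
    and no_step: "\<And>V. V \<in> \<sigma> \<Longrightarrow> \<not> good_step U V" and rank_pos: "rk U > 0"
begin

lemma sigma: "\<sigma> \<subseteq> L" "finite \<sigma>" "is_chain \<sigma>"
  using chain by (auto simp: order_complex_iff is_chain_def)

lemma U_in: "U \<in> L" "U \<in> set ws" "U \<in> \<sigma>"
  using good_list_props[OF good] U sub by auto

abbreviation J :: "'a set \<Rightarrow> 'a set" where "J V \<equiv> join V (pt U)"

lemma pt_U: "pt U \<in> L" "pt U \<subset> U"
  using pt[OF U_in(1)] rank_pos by auto

text \<open>The strictness of \<open>J V \<subset> U\<close> is where \<open>no_step\<close> enters:
  equality would make \<open>V\<close> a good step below \<open>U\<close>.\<close>

lemma J_props:
  assumes "V \<in> \<sigma>" "V \<subset> U" shows "J V \<in> L" "V \<subseteq> J V" "pt U \<subseteq> J V" "J V \<subset> U"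
proof -
  have V: "V \<in> L" using assms sigma by auto
  show "J V \<in> L" "V \<subseteq> J V" "pt U \<subseteq> J V" using join_props[OF V pt_U(1)] by auto
  have "J V \<subseteq> U" using join_props(4)[OF V pt_U(1) U_in(1)] assms pt_U(2) by auto
  moreover have "J V \<noteq> U" using no_step[OF assms(1)] assms V by (auto simp: good_step_def)
  ultimately show "J V \<subset> U" by blast
qed

lemma J_mono: "V \<in> \<sigma> \<Longrightarrow> W \<in> \<sigma> \<Longrightarrow> W \<subset> U \<Longrightarrow> V \<subseteq> W \<Longrightarrow> J V \<subseteq> J W"
  using J_props[of W] join_props(4)[of V "pt U" "J W"] sigma(1) pt_U by blast

definition vertices :: "'a set set" where "vertices = \<sigma> \<union> J ` {V \<in> \<sigma>. V \<subset> U} \<union> {pt U}"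

lemma vertices: "finite vertices" "vertices \<subseteq> L"
  using sigma J_props pt_U by (auto simp: vertices_def)

lemma vertices_new: "W \<in> vertices - \<sigma> \<Longrightarrow> W \<subset> U"
proof -
  assume "W \<in> vertices - \<sigma>"
  then consider V where "V \<in> \<sigma>" "V \<subset> U" "W = J V" | "W = pt U" by (auto simp: vertices_def)
  then show "W \<subset> U" using J_props(4) pt_U(2) by cases blast+
qed

lemma vertices_good_list: "W \<in> vertices \<Longrightarrow> V \<in> set ws \<Longrightarrow> W \<subseteq> V \<or> V \<subseteq> W"
proof (cases "W \<in> \<sigma>")
  assume "W \<in> vertices" "V \<in> set ws" "W \<notin> \<sigma>"
  then show ?thesis using vertices_new[of W] good_list_hd_le[OF good, of V] U by blast
qed (use is_chainD[OF sigma(3)] sub in blast)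

text \<open>The new vertices already contain \<open>pt U\<close>, so joining \<open>pt U\<close> to
  them does not bring them up to \<open>U\<close>.\<close>

lemma vertices_no_step: "W \<in> vertices \<Longrightarrow> \<not> good_step U W"
proof
  assume W: "W \<in> vertices" and g: "good_step U W"
  have "join W (pt U) = W" if "pt U \<subseteq> W" "W \<in> L"
    using join_props[of W "pt U"] that pt_U by (intro equalityI) auto
  then have WU: "W = U" if "pt U \<subseteq> W" "W \<in> L" using that g by (auto simp: good_step_def)
  have "W \<notin> \<sigma>" using g no_step by blast
  then consider V where "V \<in> \<sigma>" "V \<subset> U" "W = J V" | "W = pt U" using W by (auto simp: vertices_def)
  then have "pt U \<subseteq> W \<and> W \<in> L \<and> W \<subset> U"
  proof cases
    case 1 then show ?thesis using J_props[of V] by simp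
  qed (use pt_U in auto)
  then show False using WU by blast
qed

text \<open>Every vertex, old or new, is comparable with all of \<open>ws\<close>. So
  \<open>\<tau> \<union> set ws\<close> is again a chain and the uniqueness of good lists applies in
  it.\<close>

lemma good_in_vertices:
  assumes \<tau>: "\<tau> \<subseteq> vertices" "is_chain \<tau>" and v: "good_list vs" "set vs \<subseteq> \<tau>" "length vs = length ws"
  shows "vs = ws"
proof (rule good_list_unique[OF _ v(1) good])
  have A: "\<And>W V. W \<in> \<tau> \<Longrightarrow> V \<in> set ws \<Longrightarrow> W \<subseteq> V \<or> V \<subseteq> W"
    using vertices_good_list \<tau>(1) by blast
  have B: "is_chain (set ws)"
    using sigma(3) sub by (rule is_chain_subset)
  show "is_chain (\<tau> \<union> set ws)"
  proof (rule is_chainI)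
    show "\<tau> \<union> set ws \<subseteq> L" using \<tau>(2) B by (simp add: is_chain_def)
    fix V W assume "V \<in> \<tau> \<union> set ws" "W \<in> \<tau> \<union> set ws"
    then show "V \<subseteq> W \<or> W \<subseteq> V"
      using A[of V W] A[of W V] is_chainD[OF \<tau>(2), of V W] is_chainD[OF B, of V W] by blast
  qed
qed (use v in auto)

lemma no_longer_good_list:
  assumes \<tau>: "\<tau> \<subseteq> vertices" "is_chain \<tau>" and v: "good_list vs" "set vs \<subseteq> \<tau>"
  shows "length vs \<noteq> Suc (length ws)"
proof
  assume l: "length vs = Suc (length ws)"
  have "ws \<noteq> []" using good_list_props[OF good] by blast
  then obtain V W us where vs: "vs = V # W # us" using l v(1) by (cases vs rule: good_list.cases) auto
  then have "W # us = ws" using good_in_vertices[OF \<tau>, of "W # us"] v l by auto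
  then have "good_step U V" "V \<in> vertices" using vs v U \<tau> by auto
  then show False using vertices_no_step by blast
qed

context
  fixes t :: "'a set \<Rightarrow> real"
  assumes t: "t \<in> face \<sigma>"
begin

lemma t_props: "0 \<le> t V" "supp t \<subseteq> \<sigma>" "V \<notin> \<sigma> \<Longrightarrow> t V = 0" "sum t \<sigma> = 1"
  using t by (auto simp: face_def)

lemma moved_bounds: "0 \<le> moved \<sigma> U a t V" "moved \<sigma> U a t V \<le> t V"
  using t_props by (auto simp: moved_def)

lemma moved_0: "moved \<sigma> U 0 t V = 0"
proof -
  have "0 \<le> (\<Sum>W | W \<in> \<sigma> \<and> V \<subset> W \<and> W \<subset> U. t W)" by (intro sum_nonneg) (rule t_props)
  then show ?thesis using t_props(1)[of V] by (simp add: moved_def)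
qed

lemma moved_1: "moved \<sigma> U 1 t V = t V"
proof (cases "V \<in> \<sigma>")
  case True
  have "t V + (\<Sum>W | W \<in> \<sigma> \<and> V \<subset> W \<and> W \<subset> U. t W) = sum t (insert V {W. W \<in> \<sigma> \<and> V \<subset> W \<and> W \<subset> U})"
    using sigma(2) by (subst sum.insert) auto
  also have "\<dots> \<le> sum t \<sigma>" using True sigma(2) by (intro sum_mono2) (auto simp: t_props)
  finally show ?thesis using t_props by (simp add: moved_def)
qed (simp add: moved_def t_props)

text \<open>The quota \<open>a\<close> is used up from the top: as soon as \<open>V\<close> gives
  away any mass, everything strictly between \<open>V\<close> and \<open>U\<close> has been
  emptied.\<close>

lemma moved_order:
  assumes V: "V \<in> \<sigma>" "V \<subset> U" "moved \<sigma> U a t V > 0" and W: "W \<in> \<sigma>" "W \<subset> U" "moved \<sigma> U a t W < t W"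
  shows "W \<subseteq> V"
proof (rule ccontr)
  assume "\<not> W \<subseteq> V"
  then have VW: "V \<subset> W" using is_chainD[OF sigma(3) V(1) W(1)] by blast
  have "t W + (\<Sum>W' | W' \<in> \<sigma> \<and> W \<subset> W' \<and> W' \<subset> U. t W') = sum t (insert W {W'. W' \<in> \<sigma> \<and> W \<subset> W' \<and> W' \<subset> U})"
    using sigma(2) by (subst sum.insert) auto
  also have "\<dots> \<le> (\<Sum>W' | W' \<in> \<sigma> \<and> V \<subset> W' \<and> W' \<subset> U. t W')"
    using W VW sigma(2) by (intro sum_mono2) (auto simp: t_props)
  also have "\<dots> < a" using V(3) by (auto simp: moved_def split: if_splits)
  finally show False using W(3) t_props(1)[of W] by (auto simp: moved_def)
qed

lemma push_nonneg: "0 \<le> push \<sigma> U a t W"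
proof -
  have "0 \<le> (\<Sum>V | V \<in> \<sigma> \<and> V \<subset> U \<and> J V = W. moved \<sigma> U a t V)" by (intro sum_nonneg) (rule moved_bounds)
  then show ?thesis using moved_bounds[of a W] t_props(1)[of W] by (auto simp: push_def)
qed

lemma push_supp:
  assumes "push \<sigma> U a t W \<noteq> 0"
  shows "(W \<in> \<sigma> \<and> t W \<noteq> 0 \<and> (W \<subset> U \<longrightarrow> moved \<sigma> U a t W < t W)) \<or> (\<exists>V\<in>\<sigma>. V \<subset> U \<and> W = J V \<and> moved \<sigma> U a t V > 0)"
proof (cases "t W = 0 \<or> W \<subset> U \<and> moved \<sigma> U a t W = t W")
  case True
  then have "(\<Sum>V | V \<in> \<sigma> \<and> V \<subset> U \<and> J V = W. moved \<sigma> U a t V) \<noteq> 0"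
  proof -
    have "t W - (if W \<subset> U then moved \<sigma> U a t W else 0) = 0 \<or> \<not> W \<subset> U \<and> t W = 0"
      using True moved_zero[of t W \<sigma> U a] by (cases "W \<subset> U"; cases "t W = 0") simp_all
    then have "t W - (if W \<subset> U then moved \<sigma> U a t W else 0) = 0" by (metis diff_zero)
    then show ?thesis using assms unfolding push_def by (metis add_0)
  qed
  then have "\<not> (\<forall>V\<in>{V. V \<in> \<sigma> \<and> V \<subset> U \<and> J V = W}. moved \<sigma> U a t V = 0)"
    using sum.neutral by blast
  then obtain V where "V \<in> \<sigma>" "V \<subset> U" "J V = W" "moved \<sigma> U a t V \<noteq> 0" by blast
  then show ?thesis using moved_bounds[of a V] by force
next
  case False
  then show ?thesis using t_props(3) moved_bounds[of a W] by force
qed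

lemma gather_nonneg: "0 \<le> gather \<sigma> U t W"
  by (auto simp: gather_def t_props intro!: sum_nonneg)

lemma gather_supp: "gather \<sigma> U t W \<noteq> 0 \<Longrightarrow> W = pt U \<or> (W \<in> \<sigma> \<and> \<not> W \<subseteq> U)"
  using t_props(3)[of W] by (auto simp: gather_def split: if_splits)

lemma push_in_vertices: "push \<sigma> U a t W \<noteq> 0 \<Longrightarrow> W \<in> vertices"
  using push_supp[of a W] by (auto simp: vertices_def)

lemma gather_in_vertices: "gather \<sigma> U t W \<noteq> 0 \<Longrightarrow> W \<in> vertices"
  using gather_supp[of W] by (auto simp: vertices_def)

lemma sum_push: "sum (push \<sigma> U a t) vertices = 1"
proof -
  let ?D = "{V \<in> \<sigma>. V \<subset> U}"
  have "(\<Sum>W\<in>vertices. \<Sum>V | V \<in> \<sigma> \<and> V \<subset> U \<and> J V = W. moved \<sigma> U a t V) = sum (moved \<sigma> U a t) ?D"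
    using sum.group[of ?D vertices J "moved \<sigma> U a t"] sigma(2) vertices(1)
    by (simp add: vertices_def image_subset_iff conj_assoc)
  moreover have "(\<Sum>W\<in>vertices. if W \<subset> U then moved \<sigma> U a t W else 0) = sum (moved \<sigma> U a t) ?D"
  proof -
    have "(\<Sum>W\<in>vertices. if W \<subset> U then moved \<sigma> U a t W else 0) = (\<Sum>W\<in>?D. if W \<subset> U then moved \<sigma> U a t W else 0)"
    proof (intro sum.mono_neutral_right ballI vertices(1))
      show "?D \<subseteq> vertices" unfolding vertices_def by blast
      show "(if W \<subset> U then moved \<sigma> U a t W else 0) = 0" if "W \<in> vertices - ?D" for W
      proof (cases "W \<subset> U")
        case True
        then have "W \<notin> \<sigma>" using that by simp
        then show ?thesis using t_props(3)[of W] moved_zero[of t W] by simp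
      qed simp
    qed
    then show ?thesis by simp
  qed
  moreover have "sum t vertices = 1"
    using sum.mono_neutral_left[of vertices \<sigma> t] vertices(1) t_props by (auto simp: vertices_def)
  ultimately show ?thesis by (simp add: push_def sum.distrib sum_subtractf)
qed

lemma sum_gather: "sum (gather \<sigma> U t) vertices = 1"
proof -
  have "vertices = insert (pt U) (vertices - {pt U})" by (auto simp: vertices_def)
  then have "sum (gather \<sigma> U t) vertices = gather \<sigma> U t (pt U) + sum (gather \<sigma> U t) (vertices - {pt U})"
    using vertices(1) by (metis Diff_iff finite_Diff insertI1 sum.insert)
  also have "sum (gather \<sigma> U t) (vertices - {pt U}) = sum t {W \<in> \<sigma>. \<not> W \<subseteq> U}"
  proof -
    have "sum (gather \<sigma> U t) (vertices - {pt U}) = sum (gather \<sigma> U t) {W \<in> \<sigma>. \<not> W \<subseteq> U}"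
      using vertices(1) pt_U gather_supp by (intro sum.mono_neutral_right) (auto simp: vertices_def)
    also have "\<dots> = sum t {W \<in> \<sigma>. \<not> W \<subseteq> U}" using pt_U by (intro sum.cong) (auto simp: gather_def)
    finally show ?thesis .
  qed
  also have "gather \<sigma> U t (pt U) = sum t {W \<in> \<sigma>. W \<subseteq> U}" by (simp add: gather_def)
  also have "sum t {W \<in> \<sigma>. W \<subseteq> U} + sum t {W \<in> \<sigma>. \<not> W \<subseteq> U} = sum t \<sigma>"
    using sigma(2) by (subst sum.union_disjoint[symmetric]) (auto intro: sum.cong)
  finally show ?thesis using t_props by simp
qed

lemma contraction_nonneg: "s \<in> {0..1} \<Longrightarrow> 0 \<le> contraction \<sigma> U s t W"
  using push_nonneg gather_nonneg by (auto simp: contraction_def intro!: add_nonneg_nonneg mult_nonneg_nonneg)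

lemma sum_contraction: "sum (contraction \<sigma> U s t) vertices = 1"
  unfolding contraction_def by (simp add: sum.distrib sum_push sum_gather flip: sum_distrib_left)

lemma supp_contraction: "supp (contraction \<sigma> U s t) \<subseteq> vertices"
proof
  fix W assume "W \<in> supp (contraction \<sigma> U s t)"
  then have "push \<sigma> U (min 1 (2 * s)) t W \<noteq> 0 \<or> gather \<sigma> U t W \<noteq> 0"
    by (auto simp: contraction_def)
  then show "W \<in> vertices" using push_in_vertices gather_in_vertices by blast
qed

lemma supp_contraction_chain:
  "is_chain (supp (contraction \<sigma> U s t))"
proof -
  define a where "a = min 1 (2 * s)"
  have "W \<subseteq> W' \<or> W' \<subseteq> W"
    if W: "contraction \<sigma> U s t W \<noteq> 0" and W': "contraction \<sigma> U s t W' \<noteq> 0" for W W'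
  proof (cases "s \<le> 1/2")
    case True
    then have p: "push \<sigma> U a t W \<noteq> 0" "push \<sigma> U a t W' \<noteq> 0" using W W' by (auto simp: contraction_def a_def)
    \<comment> \<open>By \<open>moved_order\<close>, an element below \<open>U\<close> that still
      keeps mass lies below every element that has begun to move, hence below its join. An element
      not strictly below \<open>U\<close> contains \<open>U\<close> and thus all joins.\<close>
    have mixed: "V \<subseteq> J V' \<or> J V' \<subseteq> V"
      if "V \<in> \<sigma>" "V \<subset> U \<longrightarrow> moved \<sigma> U a t V < t V" "V' \<in> \<sigma>" "V' \<subset> U" "moved \<sigma> U a t V' > 0" for V V'
    proof (cases "V \<subset> U")
      case True
      then show ?thesis using moved_order[of V' a V] that J_props[of V'] by blast
    next
      case False
      then have "U \<subseteq> V" using that(1) U_in sigma(3) by (auto simp: is_chain_def)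
      then show ?thesis using J_props[of V'] that by blast
    qed
    show ?thesis
      using push_supp[OF p(1)] push_supp[OF p(2)]
    proof (elim disjE bexE conjE)
      fix V V' assume a: "V \<in> \<sigma>" "V \<subset> U" "W = J V" "V' \<in> \<sigma>" "V' \<subset> U" "W' = J V'"
      show ?thesis using is_chainD[OF sigma(3) a(1,4)] J_mono[OF a(1,4,5)] J_mono[OF a(4,1,2)] a(3,6) by blast
    qed (use mixed sigma(3) in \<open>auto simp: is_chain_def\<close>)
  next
    case False
    \<comment> \<open>In the second half no element below \<open>U\<close> keeps its place: only
      joins, \<open>pt U\<close> and the elements containing \<open>U\<close> can occur.\<close>
    then have a1: "a = 1" by (simp add: a_def)
    have *: "(V \<in> \<sigma> \<and> U \<subseteq> V) \<or> (\<exists>V'\<in>\<sigma>. V' \<subset> U \<and> V = J V') \<or> V = pt U" if "contraction \<sigma> U s t V \<noteq> 0" for V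
    proof -
      have "push \<sigma> U 1 t V \<noteq> 0 \<or> gather \<sigma> U t V \<noteq> 0"
        using that False a1 by (auto simp: contraction_def a_def)
      then show ?thesis
      proof
        assume "push \<sigma> U 1 t V \<noteq> 0"
        then show ?thesis using push_supp[of 1 V] U_in sigma(3) by (auto simp: moved_1 is_chain_def)
      next
        assume "gather \<sigma> U t V \<noteq> 0"
        then show ?thesis using gather_supp[of V] U_in sigma(3) by (auto simp: is_chain_def)
      qed
    qed
    show ?thesis
      using *[OF W] *[OF W']
    proof (elim disjE bexE conjE)
      fix V V' assume a: "V \<in> \<sigma>" "V \<subset> U" "W = J V" "V' \<in> \<sigma>" "V' \<subset> U" "W' = J V'"
      show ?thesis using is_chainD[OF sigma(3) a(1,4)] J_mono[OF a(1,4,5)] J_mono[OF a(4,1,2)] a(3,6) by blast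
    next
      assume "W \<in> \<sigma>" "W' \<in> \<sigma>"
      then show ?thesis using is_chainD[OF sigma(3)] by blast
    next
      fix V' assume "U \<subseteq> W" "V' \<in> \<sigma>" "V' \<subset> U" "W' = J V'"
      then show ?thesis using J_props(4)[of V'] by blast
    next
      fix V' assume "U \<subseteq> W'" "V' \<in> \<sigma>" "V' \<subset> U" "W = J V'"
      then show ?thesis using J_props(4)[of V'] by blast
    next
      fix V' assume "V' \<in> \<sigma>" "V' \<subset> U" "W = J V'" "W' = pt U"
      then show ?thesis using J_props(3)[of V'] by blast
    next
      fix V' assume "V' \<in> \<sigma>" "V' \<subset> U" "W' = J V'" "W = pt U"
      then show ?thesis using J_props(3)[of V'] by blast
    qed (use pt_U(2) in blast)+
  qed
  then show ?thesis using supp_contraction vertices(2) unfolding is_chain_def by blast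
qed

lemma contraction_in_complex:
  assumes "s \<in> {0..1}" shows "contraction \<sigma> U s t \<in> polyhedron (order_complex L)"
proof (rule polyhedronI[OF complex contraction_nonneg[OF assms]])
  have "sum (contraction \<sigma> U s t) (supp (contraction \<sigma> U s t)) = sum (contraction \<sigma> U s t) vertices"
    using supp_contraction vertices(1) by (intro sum.mono_neutral_left) auto
  then show 1: "sum (contraction \<sigma> U s t) (supp (contraction \<sigma> U s t)) = 1"
    by (simp add: sum_contraction)
  then have "supp (contraction \<sigma> U s t) \<noteq> {}" by (metis sum.empty zero_neq_one)
  then show "supp (contraction \<sigma> U s t) \<in> order_complex L"
    using supp_contraction_chain[of s] finite_subset[OF supp_contraction vertices(1)]
    unfolding order_complex_iff is_chain_def by simp
qed

lemma contraction_0: "contraction \<sigma> U 0 t = t"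
  by (auto simp: contraction_def push_def moved_0 fun_eq_iff)

text \<open>No join reaches up to \<open>U\<close>, so the coordinates along the run are untouched,
  except that the one at \<open>U\<close> fades out in the second half.\<close>

lemma contraction_good_list:
  assumes "W \<in> set ws" shows "contraction \<sigma> U s t W = (if W = U then (1 - max 0 (2 * s - 1)) * t W else t W)"
proof -
  have UW: "U \<subseteq> W" using good_list_hd_le[OF good assms] U by simp
  have none: "{V. V \<in> \<sigma> \<and> V \<subset> U \<and> J V = W} = {}" using J_props(4) UW by auto
  have "push \<sigma> U a t W = t W" for a
    unfolding push_def none using UW by auto
  moreover have "gather \<sigma> U t W = (if W = U then 0 else t W)"
  proof -
    have "W \<noteq> pt U" using UW pt_U(2) by (metis psubset_subset_trans psubset_eq)
    moreover have "W \<subseteq> U \<longleftrightarrow> W = U" using UW by (metis subset_antisym order_refl)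
    ultimately show ?thesis by (simp add: gather_def)
  qed
  ultimately show ?thesis by (simp add: contraction_def) (simp add: algebra_simps)
qed

lemma contraction_in_stratum:
  assumes "s \<in> {0..1}" "length ws = Suc k" shows "contraction \<sigma> U s t \<in> polyhedron (partly_good (Suc k))"
proof -
  have "contraction \<sigma> U s t \<in> polyhedron (order_complex L)" using contraction_in_complex assms by blast
  note D = polyhedronD[OF this complex]
  have "supp (contraction \<sigma> U s t) \<in> partly_good (Suc k)"
    using D(1) no_longer_good_list[OF supp_contraction supp_contraction_chain] assms(2)
    by (auto simp: partly_good_def)
  then show ?thesis using polyhedronI[OF complex_partly_good D(4,5)] by blast
qed

text \<open>Only \<open>ws\<close> itself can be a good run of its length in such a support, so
  losing one of its vertices suffices. At time 1 the lost vertex is \<open>U\<close>; otherwise it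
  is one that was already missing.\<close>

lemma contraction_in_lower_stratum:
  assumes s: "s \<in> {0..1}" and l: "length ws = Suc k" and "s = 1 \<or> (\<exists>W\<in>set ws. t W = 0)"
  shows "contraction \<sigma> U s t \<in> polyhedron (partly_good k)"
proof -
  have "contraction \<sigma> U s t \<in> polyhedron (order_complex L)" using contraction_in_complex assms by blast
  note D = polyhedronD[OF this complex]
  obtain W where W: "W \<in> set ws" "contraction \<sigma> U s t W = 0"
  proof (cases "s = 1")
    case True
    then show ?thesis using that[of U] contraction_good_list[OF U_in(2), of s] U_in(2) by simp
  next
    case False
    then obtain W where "W \<in> set ws" "t W = 0" using assms(3) by blast
    then show ?thesis using that[of W] contraction_good_list[of W s] by (metis mult_zero_right)
  qed
  have False if "good_list vs" "length vs = Suc k" "set vs \<subseteq> supp (contraction \<sigma> U s t)" for vs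
    using good_in_vertices[OF supp_contraction supp_contraction_chain that(1,3)] that W l by auto
  then have "supp (contraction \<sigma> U s t) \<in> partly_good k"
    using D(1) by (auto simp: partly_good_def)
  then show ?thesis using polyhedronI[OF complex_partly_good D(4,5)] by blast
qed

end

lemma continuous_map_contraction:
  "continuous_map (prod_topology unit_interval (face_topology \<sigma>)) (realisation (order_complex L))
     (\<lambda>(s,t). contraction \<sigma> U s t)"
proof (rule continuous_map_into_realisation[OF complex _ vertices(1)])
  let ?Y = "prod_topology unit_interval (face_topology \<sigma>)"
  fix y assume "y \<in> topspace ?Y"
  then show "(case y of (s,t) \<Rightarrow> contraction \<sigma> U s t) \<in> polyhedron (order_complex L) \<and>
      supp (case y of (s,t) \<Rightarrow> contraction \<sigma> U s t) \<subseteq> vertices"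
    using contraction_in_complex[of "snd y" "fst y"] supp_contraction[of "snd y" "fst y"]
    by (auto simp: case_prod_unfold)
next
  let ?Y = "prod_topology unit_interval (face_topology \<sigma>)"
  fix W
  have t: "continuous_map ?Y euclideanreal (\<lambda>y. snd y V)" for V
    using continuous_map_compose[OF continuous_map_snd continuous_map_face_coordinate] by (simp add: o_def)
  have s: "continuous_map ?Y euclideanreal fst"
    using continuous_map_fst continuous_map_into_fulltopology by blast
  have f: "finite {W. W \<in> \<sigma> \<and> Q W}" for Q using sigma(2) by auto
  have m: "continuous_map ?Y euclideanreal (\<lambda>y. moved \<sigma> U (min 1 (2 * fst y)) (snd y) V)" for V
    unfolding moved_def by (intro continuous_intros t s f)
  have if_cont: "continuous_map ?Y euclideanreal (\<lambda>y. if P then p y else q y)"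
    if "continuous_map ?Y euclideanreal p" "continuous_map ?Y euclideanreal q" for P p q
    using that by (cases P) auto
  have "continuous_map ?Y euclideanreal (\<lambda>y. contraction \<sigma> U (fst y) (snd y) W)"
    unfolding contraction_def push_def gather_def by (intro continuous_intros if_cont m t s f)
  then show "continuous_map ?Y euclideanreal (\<lambda>y. (case y of (s,t) \<Rightarrow> contraction \<sigma> U s t) W)"
    by (simp add: case_prod_unfold)
qed

end

context point_lattice
begin

lemma good_prefixI:
  assumes "\<sigma> \<in> partly_good (Suc k)" "good_list ws" "length ws = Suc k" "set ws \<subseteq> \<sigma>" "k < n"
  shows "good_prefix L X rk n ws \<sigma> (hd ws)"
proof unfold_locales
  show "\<sigma> \<in> order_complex L" using assms(1) by (simp add: partly_good_def)
  show "rk (hd ws) > 0" using good_list_props[OF assms(2)] assms(3,5) by simp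
  show "\<not> good_step (hd ws) V" if V: "V \<in> \<sigma>" for V
  proof
    assume "good_step (hd ws) V"
    then have "good_list (V # ws)" using assms(2) by (cases ws) auto
    moreover have "set (V # ws) \<subseteq> \<sigma>" "length (V # ws) = Suc (Suc k)" using V assms(3,4) by auto
    ultimately show False using assms(1) unfolding partly_good_def by blast
  qed
qed (use assms in auto)

text \<open>Every simplex of the larger stratum that is not in the smaller one is contracted along
  its own good run, while the smaller stratum is the basepoint of the quotient.\<close>

lemma stratum_step:
  assumes k: "k < n"
  shows "collapse (realisation (order_complex L)) (polyhedron (partly_good k)) homotopy_equivalent_space
         collapse (realisation (order_complex L)) (polyhedron (partly_good (Suc k)))"
proof -
  let ?A = "partly_good k" and ?B = "partly_good (Suc k)" and ?C = "order_complex L"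
  note A = complex_partly_good[of k] and B = complex_partly_good[of "Suc k"]
  have AsB: "polyhedron ?A \<subseteq> polyhedron ?B" by (rule polyhedron_mono[OF partly_good_mono])
  define P where "P = (\<lambda>\<sigma> ws. good_list ws \<and> length ws = Suc k \<and> set ws \<subseteq> \<sigma>)"
  \<comment> \<open>The run is selected from the support of the point. It is unique, so on a face
    that contains a full run every point outside the smaller stratum selects the same one;
    \<open>g_eq\<close> extends the formula to the whole face.\<close>
  define g where "g = (\<lambda>(s::real,t). if t \<in> polyhedron ?A then None else
     collapse_map (polyhedron ?A) (contraction (supp t) (hd (SOME ws. P (supp t) ws)) s t))"
  have exP: "\<exists>ws. P \<sigma> ws" if "\<sigma> \<in> ?B" "\<sigma> \<notin> ?A" for \<sigma>
    using that partly_good_subset[of "Suc k"] by (auto simp: partly_good_def P_def)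
  have g_eq: "g (s,t) = collapse_map (polyhedron ?A) (contraction \<sigma> (hd ws) s t)"
    if \<sigma>: "\<sigma> \<in> ?B" "P \<sigma> ws" and s: "s \<in> {0..1}" and t: "t \<in> face \<sigma>" for \<sigma> ws s t
  proof -
    interpret good_prefix L X rk n ws \<sigma> "hd ws"
      using good_prefixI[OF \<sigma>(1) _ _ _ k] \<sigma>(2) by (simp add: P_def)
    have tB: "t \<in> polyhedron ?B" using t \<sigma> by (auto simp: polyhedron_def)
    show ?thesis
    proof (cases "t \<in> polyhedron ?A")
      case True
      \<comment> \<open>A point of the smaller stratum lacks a vertex of \<open>ws\<close>. The
        contraction keeps this coordinate at 0, so the point never leaves the basepoint of the
        quotient.\<close>
      have "\<not> set ws \<subseteq> supp t"
        using polyhedronD(1)[OF True A] \<sigma>(2) by (auto simp: partly_good_def P_def)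
      then have "contraction \<sigma> (hd ws) s t \<in> polyhedron ?A"
        using \<sigma>(2) by (intro contraction_in_lower_stratum[OF t s]) (auto simp: P_def)
      then show ?thesis using True by (simp add: g_def collapse_map_def)
    next
      case False
      have "supp t \<notin> ?A" using False polyhedronI[OF A] polyhedronD[OF tB B] by blast
      then have "P (supp t) (SOME ws. P (supp t) ws)"
        using exP[OF polyhedronD(1)[OF tB B]] by (metis someI_ex)
      then have "(SOME ws. P (supp t) ws) = ws"
        using good_list_unique[OF sigma(3)] \<sigma>(2) supp_subset[OF t] by (metis P_def subset_trans)
      then show ?thesis
        using False contraction_restrict[OF sigma(2) supp_subset[OF t]] by (simp add: g_def)
    qed
  qed
  have g_in_A: "g (s,t) = None" if "t \<in> polyhedron ?A" for s t using that by (simp add: g_def)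
  have cases: "(t \<in> polyhedron ?A) \<or> (\<exists>\<sigma> ws. \<sigma> \<in> ?B \<and> P \<sigma> ws \<and> t \<in> face \<sigma> \<and> good_prefix L X rk n ws \<sigma> (hd ws))"
    if "t \<in> polyhedron ?B" for t
  proof -
    have st: "supp t \<in> ?B" "t \<in> face (supp t)" using that polyhedron_iff[OF B] by auto
    show ?thesis
    proof (cases "supp t \<in> ?A")
      case True
      then show ?thesis using st polyhedron_iff[OF A] by blast
    next
      case False
      then obtain ws where "P (supp t) ws" using exP st by blast
      then show ?thesis using st good_prefixI[OF st(1) _ _ _ k] unfolding P_def by blast
    qed
  qed
  show ?thesis
  proof (rule collapse_homotopy_equivalent[OF A B partly_good_mono partly_good_subset, of g])
    show "continuous_map (prod_topology unit_interval (realisation ?B)) (collapse (realisation ?C) (polyhedron ?A)) g"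
    proof (rule continuous_map_prod_realisation)
      fix \<sigma> assume \<sigma>: "\<sigma> \<in> ?B"
      let ?Y = "prod_topology unit_interval (face_topology \<sigma>)"
      show "continuous_map ?Y (collapse (realisation ?C) (polyhedron ?A)) g"
      proof (cases "\<sigma> \<in> ?A")
        case True
        have "continuous_map ?Y (collapse (realisation ?C) (polyhedron ?A)) (\<lambda>_. None)"
          by (simp add: topspace_collapse)
        then show ?thesis
          by (rule continuous_map_eq) (use True in \<open>auto simp: polyhedron_def intro!: g_in_A[symmetric]\<close>)
      next
        case False
        then obtain ws where ws: "P \<sigma> ws" using exP \<sigma> by blast
        interpret good_prefix L X rk n ws \<sigma> "hd ws"
          using good_prefixI[OF \<sigma>(1) _ _ _ k] ws by (simp add: P_def)
        show ?thesis
          by (rule continuous_map_eq[OF continuous_map_compose[OF continuous_map_contraction continuous_map_collapse]])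
             (use g_eq[OF \<sigma> ws] in auto)
      qed
    qed
  next
    fix t assume t: "t \<in> polyhedron ?B"
    show "g (0, t) = collapse_map (polyhedron ?A) t"
      using cases[OF t]
    proof (elim disjE exE conjE)
      fix \<sigma> ws assume *: "\<sigma> \<in> ?B" "P \<sigma> ws" "t \<in> face \<sigma>" "good_prefix L X rk n ws \<sigma> (hd ws)"
      then show ?thesis using g_eq[OF *(1,2) _ *(3)] good_prefix.contraction_0[OF *(4,3)] by simp
    qed (simp add: g_in_A collapse_map_def)
    show "g (1, t) = None"
      using cases[OF t]
    proof (elim disjE exE conjE)
      fix \<sigma> ws assume *: "\<sigma> \<in> ?B" "P \<sigma> ws" "t \<in> face \<sigma>" "good_prefix L X rk n ws \<sigma> (hd ws)"
      then show ?thesis using g_eq[OF *(1,2) _ *(3)] good_prefix.contraction_in_lower_stratum[OF *(4,3), of 1 k]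
        by (simp add: collapse_map_def P_def)
    qed (simp add: g_in_A)
    fix s :: real assume s: "s \<in> {0..1}"
    show "g (s, t) \<in> insert None (Some ` polyhedron ?B)"
      using cases[OF t]
    proof (elim disjE exE conjE)
      fix \<sigma> ws assume *: "\<sigma> \<in> ?B" "P \<sigma> ws" "t \<in> face \<sigma>" "good_prefix L X rk n ws \<sigma> (hd ws)"
      then show ?thesis using g_eq[OF *(1,2) s *(3)] good_prefix.contraction_in_stratum[OF *(4,3) s, of k]
        by (simp add: collapse_map_def P_def)
    qed (simp add: g_in_A)
  qed (use g_in_A in auto)
qed

lemma strata_equivalent:
  "k \<le> n \<Longrightarrow> collapse (realisation (order_complex L)) (polyhedron (order_complex (L - {X}))) homotopy_equivalent_space
         collapse (realisation (order_complex L)) (polyhedron (partly_good k))"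
proof (induction k)
  case 0
  then show ?case by (simp add: partly_good_0 homotopy_equivalent_space_refl)
next
  case (Suc k)
  then show ?case using stratum_step[of k] homotopy_eqv_trans by simp
qed

end

section \<open>Simplices modulo their boundary are spheres\<close>

text \<open>The interior of the simplex is identified with \<open>n\<close>-dimensional Euclidean space by
  \<open>b \<mapsto> (b k - b 0) / Min b\<close>, and Euclidean space with the punctured sphere by inverse stereographic projection.\<close>

definition simplex_min :: "nat \<Rightarrow> (nat \<Rightarrow> real) \<Rightarrow> real" where
  "simplex_min n b = Min (b ` {..n})"

definition simplex_sq :: "nat \<Rightarrow> (nat \<Rightarrow> real) \<Rightarrow> real" where
  "simplex_sq n b = (\<Sum>k=1..n. (b k - b 0)\<^sup>2)"

text \<open>Inverse stereographic projection of the vector with entries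
  \<open>(b k - b 0) / m\<close>, with the fractions cleared by \<open>m\<^sup>2\<close>. The
  cleared formula makes sense on the boundary too, where \<open>m = 0\<close> and the value is the
  pole \<open>sphere_base\<close>.\<close>

definition sphere_map :: "nat \<Rightarrow> (nat \<Rightarrow> real) \<Rightarrow> nat \<Rightarrow> real" where
  "sphere_map n b = (\<lambda>k. let m = simplex_min n b; q = simplex_sq n b in
     if k = 0 then (q - m\<^sup>2) / (q + m\<^sup>2) else if k \<le> n then 2 * m * (b k - b 0) / (q + m\<^sup>2) else 0)"

text \<open>Stereographic projection recovers \<open>w i = (b i - b 0) / m\<close>. As the least
  coordinate of \<open>b\<close> is \<open>m\<close>, this gives
  \<open>b i / m = 1 + w i - \<mu>\<close>, and dividing by the sum \<open>S = 1 / m\<close> returns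
  \<open>b i\<close>.\<close>

definition sphere_inv :: "nat \<Rightarrow> (nat \<Rightarrow> real) \<Rightarrow> nat \<Rightarrow> real" where
  "sphere_inv n y = (let w = (\<lambda>i. if i = 0 then 0 else y i / (1 - y 0)); \<mu> = Min (w ` {..n});
     S = (\<Sum>i\<le>n. 1 + w i - \<mu>) in (\<lambda>i. if i \<le> n then (1 + w i - \<mu>) / S else 0))"

abbreviation sphere_base :: "nat \<Rightarrow> real" where
  "sphere_base \<equiv> (\<lambda>k. if k = 0 then 1 else 0)"

lemma standard_simplexD:
  assumes "b \<in> standard_simplex n"
  shows "0 \<le> b i" "i > n \<Longrightarrow> b i = 0" "sum b {..n} = 1"
  using assms by (auto simp: standard_simplex_def)

lemma standard_simplexI:
  assumes "\<And>i. 0 \<le> b i" "\<And>i. i > n \<Longrightarrow> b i = 0" "sum b {..n} = 1"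
  shows "b \<in> standard_simplex n"
proof -
  have "b i \<le> 1" for i
    using member_le_sum[of i "{..n}" b] assms by (cases "i \<le> n") auto
  then show ?thesis using assms by (auto simp: standard_simplex_def)
qed

lemma simplex_min_nonneg: "b \<in> standard_simplex n \<Longrightarrow> 0 \<le> simplex_min n b"
  by (auto simp: simplex_min_def standard_simplexD)

lemma simplex_min_eq_0:
  assumes "b \<in> standard_simplex n" shows "simplex_min n b = 0 \<longleftrightarrow> (\<exists>i\<le>n. b i = 0)"
proof
  assume "simplex_min n b = 0"
  moreover have "simplex_min n b \<in> b ` {..n}" unfolding simplex_min_def by (intro Min_in) auto
  ultimately show "\<exists>i\<le>n. b i = 0" by auto
next
  assume "\<exists>i\<le>n. b i = 0"
  then have "simplex_min n b \<le> 0" unfolding simplex_min_def by (auto intro!: Min_le)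
  then show "simplex_min n b = 0" using simplex_min_nonneg[OF assms] by simp
qed

text \<open>If both squares vanished, all coordinates would be equal and one of them 0,
  contradicting their sum 1.\<close>

lemma simplex_denominator_pos:
  assumes b: "b \<in> standard_simplex n" shows "simplex_sq n b + (simplex_min n b)\<^sup>2 > 0"
proof (rule ccontr)
  assume "\<not> ?thesis"
  moreover have q: "simplex_sq n b \<ge> 0" by (simp add: simplex_sq_def sum_nonneg)
  ultimately have q0: "simplex_sq n b = 0" and m0: "simplex_min n b = 0"
    by (smt (verit) zero_le_power2 power2_less_eq_zero_iff)+
  have "b k = b 0" if "k \<le> n" for k
    using q0 that by (cases "k = 0") (auto simp: simplex_sq_def sum_nonneg_eq_0_iff)
  then have "b i = 0" if "i \<le> n" for i
    using m0 that simplex_min_eq_0[OF b] by metis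
  then show False using standard_simplexD(3)[OF b] by simp
qed

lemma sphere_map_in: "b \<in> standard_simplex n \<Longrightarrow> sphere_map n b \<in> topspace (nsphere n)"
proof -
  assume b: "b \<in> standard_simplex n"
  define m q where "m = simplex_min n b" and "q = simplex_sq n b"
  have d: "q + m\<^sup>2 > 0" using simplex_denominator_pos[OF b] by (simp add: m_def q_def)
  have "(\<Sum>i\<le>n. (sphere_map n b i)\<^sup>2) = (sphere_map n b 0)\<^sup>2 + (\<Sum>i=1..n. (sphere_map n b i)\<^sup>2)"
    by (simp add: sum.atLeast_Suc_atMost atMost_atLeast0)
  also have "(\<Sum>i=1..n. (sphere_map n b i)\<^sup>2) = (\<Sum>i=1..n. (2 * m / (q + m\<^sup>2))\<^sup>2 * (b i - b 0)\<^sup>2)"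
    by (intro sum.cong) (auto simp: sphere_map_def Let_def m_def q_def power_divide power_mult_distrib)
  also have "\<dots> = (2 * m / (q + m\<^sup>2))\<^sup>2 * q"
    by (simp add: simplex_sq_def q_def flip: sum_distrib_left)
  also have "sphere_map n b 0 = (q - m\<^sup>2) / (q + m\<^sup>2)"
    by (simp add: sphere_map_def m_def q_def Let_def)
  also have "((q - m\<^sup>2) / (q + m\<^sup>2))\<^sup>2 + (2 * m / (q + m\<^sup>2))\<^sup>2 * q = ((q - m\<^sup>2)\<^sup>2 + (2 * m)\<^sup>2 * q) / (q + m\<^sup>2)\<^sup>2"
    by (simp add: power_divide add_divide_distrib)
  also have "(q - m\<^sup>2)\<^sup>2 + (2 * m)\<^sup>2 * q = (q + m\<^sup>2)\<^sup>2" by (simp add: power2_eq_square algebra_simps)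
  also have "(q + m\<^sup>2)\<^sup>2 / (q + m\<^sup>2)\<^sup>2 = 1" using d by simp
  finally show ?thesis by (simp add: nsphere) (simp add: sphere_map_def)
qed

lemma sphere_map_0: "b \<in> standard_simplex n \<Longrightarrow>
    1 - sphere_map n b 0 = 2 * (simplex_min n b)\<^sup>2 / (simplex_sq n b + (simplex_min n b)\<^sup>2)"
  using simplex_denominator_pos[of b n] by (simp add: sphere_map_def Let_def field_simps)

lemma sphere_map_boundary:
  assumes b: "b \<in> standard_simplex n" and z: "\<exists>i\<le>n. b i = 0" shows "sphere_map n b = sphere_base"
proof -
  have "simplex_min n b = 0" using simplex_min_eq_0[OF b] z by blast
  then show ?thesis using simplex_denominator_pos[OF b] by (auto simp: sphere_map_def)
qed

lemma sphere_map_interior: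
  assumes b: "b \<in> standard_simplex n" and z: "\<forall>i\<le>n. b i \<noteq> 0"
  shows "sphere_map n b \<noteq> sphere_base" "sphere_inv n (sphere_map n b) = b"
proof -
  define m q where "m = simplex_min n b" and "q = simplex_sq n b"
  have d: "q + m\<^sup>2 > 0" using simplex_denominator_pos[OF b] by (simp add: m_def q_def)
  have m: "m > 0" using simplex_min_eq_0[OF b] z simplex_min_nonneg[OF b] unfolding m_def by force
  then have n1: "1 - sphere_map n b 0 = 2 * m\<^sup>2 / (q + m\<^sup>2)" "2 * m\<^sup>2 / (q + m\<^sup>2) > 0"
    using sphere_map_0[OF b] d by (simp_all add: m_def q_def)
  then show "sphere_map n b \<noteq> sphere_base" by auto
  define w where "w = (\<lambda>i. if i = 0 then 0 else sphere_map n b i / (1 - sphere_map n b 0))"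
  have w: "w i = (b i - b 0) / m" if "i \<le> n" for i
  proof (cases "i = 0")
    case False
    have "sphere_map n b i = 2 * m * (b i - b 0) / (q + m\<^sup>2)"
      using False that by (simp add: sphere_map_def m_def q_def Let_def)
    then show ?thesis
      unfolding w_def n1(1) using False m d by (simp add: power2_eq_square)
  qed (simp add: w_def)
  have "Min (w ` {..n}) = (m - b 0) / m"
  proof -
    have "w ` {..n} = (\<lambda>x. (x - b 0) / m) ` (b ` {..n})" using w by (auto simp: image_iff)
    moreover have "mono (\<lambda>x. (x - b 0) / m)" using m by (auto simp: mono_def divide_right_mono)
    ultimately show ?thesis
      using mono_Min_commute[of "\<lambda>x. (x - b 0) / m" "b ` {..n}"] by (simp add: m_def simplex_min_def)
  qed
  then have *: "1 + w i - Min (w ` {..n}) = b i / m" if "i \<le> n" for i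
    using w[OF that] m by (simp add: field_simps)
  have "(\<Sum>i\<le>n. 1 + w i - Min (w ` {..n})) = (\<Sum>i\<le>n. b i / m)" by (intro sum.cong) (simp_all add: *)
  also have "\<dots> = 1 / m" using standard_simplexD[OF b] by (simp flip: sum_divide_distrib)
  finally have S: "(\<Sum>i\<le>n. 1 + w i - Min (w ` {..n})) = 1 / m" .
  show "sphere_inv n (sphere_map n b) = b"
  proof
    fix i show "sphere_inv n (sphere_map n b) i = b i"
      unfolding sphere_inv_def Let_def w_def[symmetric] S
      using *[of i] m standard_simplexD(2)[OF b, of i] by (cases "i \<le> n") auto
  qed
qed

lemma sphere_inv:
  assumes y: "y \<in> topspace (nsphere n)" "y \<noteq> sphere_base"
  shows "sphere_inv n y \<in> standard_simplex n" "\<forall>i\<le>n. sphere_inv n y i \<noteq> 0" "sphere_map n (sphere_inv n y) = y"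
proof -
  have y1: "(\<Sum>i\<le>n. (y i)\<^sup>2) = 1" "\<And>i. i > n \<Longrightarrow> y i = 0" using y(1) by (auto simp: nsphere)
  then have ysum: "(y 0)\<^sup>2 + (\<Sum>i=1..n. (y i)\<^sup>2) = 1"
    by (simp add: sum.atLeast_Suc_atMost atMost_atLeast0)
  have y0: "y 0 < 1"
  proof (rule ccontr)
    assume "\<not> y 0 < 1"
    then have "(y 0)\<^sup>2 \<ge> 1" by (simp add: one_le_power)
    moreover have "(\<Sum>i=1..n. (y i)\<^sup>2) \<ge> 0" by (simp add: sum_nonneg)
    ultimately have s: "(\<Sum>i=1..n. (y i)\<^sup>2) = 0" "(y 0)\<^sup>2 = 1" using ysum by linarith+
    then have "y 0 = 1" using \<open>\<not> y 0 < 1\<close> by (simp add: power2_eq_1_iff)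
    moreover have "y k = 0" if "k > 0" for k
      using s(1) y1(2)[of k] that by (cases "k \<le> n") (auto simp: sum_nonneg_eq_0_iff)
    ultimately show False using y(2) by auto
  qed
  define w where "w = (\<lambda>i. if i = 0 then 0 else y i / (1 - y 0))"
  define \<mu> where "\<mu> = Min (w ` {..n})"
  define S where "S = (\<Sum>i\<le>n. 1 + w i - \<mu>)"
  have w\<mu>: "\<mu> \<le> w i" if "i \<le> n" for i using that by (simp add: \<mu>_def)
  obtain j where j: "j \<le> n" "w j = \<mu>"
  proof -
    have "\<mu> \<in> w ` {..n}" unfolding \<mu>_def by (intro Min_in) auto
    then show ?thesis using that by auto
  qed
  have "0 < 1 + w i - \<mu>" if "i \<in> {..n}" for i using w\<mu>[of i] that by simp
  then have S: "S > 0" unfolding S_def by (intro sum_pos) auto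
  define b where "b = sphere_inv n y"
  have b_eq: "b i = (if i \<le> n then (1 + w i - \<mu>) / S else 0)" for i
    by (simp add: b_def sphere_inv_def Let_def w_def[symmetric] \<mu>_def[symmetric] S_def[symmetric])
  have bpos: "b i > 0" if "i \<le> n" for i using that w\<mu>[OF that] S by (simp add: b_eq)
  have "sum b {..n} = (\<Sum>i\<le>n. (1 + w i - \<mu>) / S)" by (intro sum.cong) (simp_all add: b_eq)
  also have "\<dots> = 1" using S by (simp add: S_def[symmetric] flip: sum_divide_distrib)
  finally have bS: "b \<in> standard_simplex n"
    using bpos by (intro standard_simplexI) (auto simp: b_eq less_imp_le not_le)
  then show "sphere_inv n y \<in> standard_simplex n" by (simp add: b_def)
  show "\<forall>i\<le>n. sphere_inv n y i \<noteq> 0" using bpos by (fastforce simp: b_def)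
  have m: "simplex_min n b = 1 / S"
    unfolding simplex_min_def
  proof (rule Min_eqI)
    show "1 / S \<in> b ` {..n}" using j by (intro image_eqI[of _ _ j]) (simp_all add: b_eq)
    show "1 / S \<le> x" if "x \<in> b ` {..n}" for x
      using that w\<mu> S by (auto simp: b_eq divide_right_mono)
  qed simp
  have diff: "b k - b 0 = w k / S" if "k \<le> n" for k
    using that by (simp add: b_eq w_def diff_divide_distrib[symmetric])
  \<comment> \<open>The length of the stereographic projection is determined by the height
    \<open>y 0\<close>; this recovers \<open>y 0\<close> from the projected point.\<close>
  have w2: "(\<Sum>k=1..n. (w k)\<^sup>2) = (1 + y 0) / (1 - y 0)"
  proof -
    have "(\<Sum>k=1..n. (w k)\<^sup>2) = (\<Sum>k=1..n. (y k)\<^sup>2 / (1 - y 0)\<^sup>2)"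
      by (intro sum.cong) (auto simp: w_def power_divide)
    also have "\<dots> = (\<Sum>k=1..n. (y k)\<^sup>2) / (1 - y 0)\<^sup>2" by (simp flip: sum_divide_distrib)
    also have "(\<Sum>k=1..n. (y k)\<^sup>2) = (1 - y 0) * (1 + y 0)" using ysum by (simp add: power2_eq_square algebra_simps)
    finally show ?thesis using y0 by (simp add: power2_eq_square)
  qed
  have q: "simplex_sq n b = (1 + y 0) / (1 - y 0) / S\<^sup>2"
  proof -
    have "simplex_sq n b = (\<Sum>k=1..n. (w k)\<^sup>2 / S\<^sup>2)"
      unfolding simplex_sq_def by (intro sum.cong) (auto simp: diff power_divide)
    then show ?thesis unfolding w2[symmetric] by (simp only: sum_divide_distrib)
  qed
  have q1: "simplex_sq n b + (simplex_min n b)\<^sup>2 = 2 / (1 - y 0) / S\<^sup>2"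
  proof -
    have "(1 + y 0) / (1 - y 0) + 1 = 2 / (1 - y 0)" using y0 by (simp add: field_simps)
    then show ?thesis unfolding m q power_divide power_one add_divide_distrib[symmetric] by (simp only:)
  qed
  have q2: "simplex_sq n b - (simplex_min n b)\<^sup>2 = 2 * y 0 / (1 - y 0) / S\<^sup>2"
  proof -
    have "(1 + y 0) / (1 - y 0) - 1 = 2 * y 0 / (1 - y 0)" using y0 by (simp add: field_simps)
    then show ?thesis unfolding m q power_divide power_one diff_divide_distrib[symmetric] by (simp only:)
  qed
  have "sphere_map n b k = y k" for k
  proof -
    consider "k = 0" | "k > 0" "k \<le> n" | "k > n" by linarith
    then show ?thesis
    proof cases
      case 1
      then show ?thesis using S y0 by (simp add: sphere_map_def Let_def q1 q2)
    next
      case 2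
      have "sphere_map n b k = 2 * (1 / S) * (w k / S) / (2 / (1 - y 0) / S\<^sup>2)"
        using 2 unfolding sphere_map_def Let_def q1 unfolding m diff[OF 2(2)] by simp
      also have "\<dots> = w k * (1 - y 0)" using S y0 by (simp add: power2_eq_square field_simps)
      finally show ?thesis using 2 y0 by (simp add: w_def)
    next
      case 3
      then show ?thesis using y1(2) by (simp add: sphere_map_def Let_def)
    qed
  qed
  then show "sphere_map n (sphere_inv n y) = y" by (auto simp: b_def)
qed

lemma continuous_map_Min:
  assumes "finite I" "I \<noteq> {}" "\<And>i. i \<in> I \<Longrightarrow> continuous_map Y euclideanreal (f i)"
  shows "continuous_map Y euclideanreal (\<lambda>x. Min ((\<lambda>i. f i x) ` I))"
  using assms
proof (induction I rule: finite_ne_induct)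
  case (insert i F)
  have "Min ((\<lambda>i. f i x) ` insert i F) = min (f i x) (Min ((\<lambda>i. f i x) ` F))" for x
    using insert by simp
  then show ?case using insert by (simp add: continuous_map_real_min)
qed simp

abbreviation simplex_topology :: "nat \<Rightarrow> (nat \<Rightarrow> real) topology" where
  "simplex_topology n \<equiv> subtopology (powertop_real UNIV) (standard_simplex n)"

lemma continuous_map_simplex_coordinate: "continuous_map (simplex_topology n) euclideanreal (\<lambda>b. b i)"
  by (intro continuous_map_from_subtopology continuous_map_product_projection) simp

lemma continuous_map_sphere_map: "continuous_map (simplex_topology n) (nsphere n) (sphere_map n)"
proof -
  have if_cont: "continuous_map Y euclideanreal (\<lambda>y. if P then p y else q y)"
    if "continuous_map Y euclideanreal p" "continuous_map Y euclideanreal q" for P p q and Y :: "(nat \<Rightarrow> real) topology"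
    using that by (cases P) auto
  have "continuous_map (simplex_topology n) euclideanreal (\<lambda>b. sphere_map n b k)" for k
    unfolding sphere_map_def Let_def simplex_min_def simplex_sq_def
    by (intro if_cont continuous_intros continuous_map_simplex_coordinate continuous_map_Min)
       (auto dest!: simplex_denominator_pos simp: simplex_min_def simplex_sq_def)
  then show ?thesis
    using sphere_map_in unfolding nsphere
    by (auto simp: continuous_map_in_subtopology continuous_map_componentwise_UNIV)
qed

text \<open>For \<open>n = 0\<close> the basepoint is not in the image of the simplex.\<close>

lemma continuous_map_from_nsphere:
  assumes f: "continuous_map (simplex_topology n) Y (f \<circ> sphere_map n)" and base: "f sphere_base \<in> topspace Y"
  shows "continuous_map (nsphere n) Y f"
proof (cases "n = 0")
  case False
  have "sphere_base \<in> sphere_map n ` standard_simplex n"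
  proof -
    have 1: "sphere_base \<in> standard_simplex n" by simp
    have "sphere_map n sphere_base = sphere_base"
      by (rule sphere_map_boundary[OF 1]) (use False in \<open>auto intro!: exI[of _ 1]\<close>)
    then show ?thesis using 1 by (metis imageI)
  qed
  note base_in = this
  have onto: "topspace (nsphere n) \<subseteq> sphere_map n ` standard_simplex n"
  proof
    fix y assume "y \<in> topspace (nsphere n)"
    then show "y \<in> sphere_map n ` standard_simplex n"
      using sphere_inv[of y n] base_in by (cases "y = sphere_base") (auto intro: image_eqI[of y _ "sphere_inv n y"])
  qed
  have "quotient_map (simplex_topology n) (nsphere n) (sphere_map n)"
  proof (rule continuous_imp_quotient_map[OF continuous_map_sphere_map])
    show "compact_space (simplex_topology n)"
      using compactin_standard_simplex[of n] by (simp add: compact_space_subtopology)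
    show "Hausdorff_space (nsphere n)"
      unfolding nsphere by (intro Hausdorff_space_subtopology) (simp add: Hausdorff_space_product_topology)
    show "sphere_map n ` topspace (simplex_topology n) = topspace (nsphere n)"
      using onto sphere_map_in by auto
  qed
  then show ?thesis using f continuous_compose_quotient_map by blast
next
  case True
  have b: "sphere_base \<in> standard_simplex 0" by simp
  have fin: "topspace (nsphere n) \<subseteq> {sphere_base, sphere_map n sphere_base}"
  proof
    fix y assume "y \<in> topspace (nsphere n)"
    then show "y \<in> {sphere_base, sphere_map n sphere_base}"
      using sphere_inv(1,3)[of y n] True by (auto simp: standard_simplex_0)
  qed
  have "t1_space (nsphere n)"
    unfolding nsphere by (intro Hausdorff_imp_t1_space Hausdorff_space_subtopology) (simp add: Hausdorff_space_product_topology)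
  then have cl: "closedin (nsphere n) A" if "A \<subseteq> topspace (nsphere n)" for A
    using that finite_subset[OF fin] finite_subset[OF that] unfolding t1_space_closedin_finite by blast
  have "f (sphere_map n sphere_base) \<in> topspace Y"
    using continuous_map_funspace[OF f] b True by auto
  then show ?thesis
    unfolding continuous_map_closedin using fin base by (auto intro!: cl)
qed

section \<open>Affine simplices of a realisation\<close>

text \<open>Lists may repeat a vertex, in which case the coordinates of the equal entries add up.
  Degenerate affine simplices are therefore included.\<close>

definition vertex_map :: "'v list \<Rightarrow> (nat \<Rightarrow> real) \<Rightarrow> 'v \<Rightarrow> real" where
  "vertex_map ws b = (\<lambda>v. \<Sum>i | i < length ws \<and> ws ! i = v. b i)"

lemma vertex_map_outside: "v \<notin> set ws \<Longrightarrow> vertex_map ws b v = 0"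
  by (auto simp: vertex_map_def intro!: sum.neutral)

lemma vertex_map_in_face:
  assumes ws: "length ws = Suc p" and b: "b \<in> standard_simplex p"
  shows "vertex_map ws b \<in> face (set ws)"
proof -
  have "(\<Sum>v\<in>set ws. vertex_map ws b v) = (\<Sum>v\<in>set ws. \<Sum>i | i \<in> {..p} \<and> ws ! i = v. b i)"
    unfolding vertex_map_def ws by (intro sum.cong) (auto simp: less_Suc_eq_le)
  also have "\<dots> = (\<Sum>i\<le>p. b i)"
    by (rule sum.group) (use ws in \<open>auto simp: less_Suc_eq_le[symmetric]\<close>)
  finally show ?thesis
    using standard_simplexD[OF b] vertex_map_outside by (auto simp: face_def vertex_map_def intro!: sum_nonneg)
qed

lemma continuous_map_vertex_map:
  assumes ws: "length ws = Suc p" and K: "simplicial_complex K" "set ws \<in> K"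
  shows "continuous_map (simplex_topology p) (realisation K) (vertex_map ws)"
proof (rule continuous_map_into_realisation[OF K(1)])
  show "continuous_map (simplex_topology p) euclideanreal (\<lambda>b. vertex_map ws b v)" for v
    unfolding vertex_map_def by (intro continuous_intros continuous_map_simplex_coordinate) auto
  fix b assume "b \<in> topspace (simplex_topology p)"
  then have "vertex_map ws b \<in> face (set ws)" using vertex_map_in_face[OF ws] by simp
  then show "vertex_map ws b \<in> polyhedron K \<and> supp (vertex_map ws b) \<subseteq> set ws"
    using K(2) supp_subset by (auto simp: polyhedron_def)
qed simp

definition coordinates :: "'v list \<Rightarrow> ('v \<Rightarrow> real) \<Rightarrow> nat \<Rightarrow> real" where
  "coordinates ws t = (\<lambda>i. if i < length ws then t (ws ! i) else 0)"

lemma vertex_map_distinct: "distinct ws \<Longrightarrow> i < length ws \<Longrightarrow> vertex_map ws b (ws ! i) = b i"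
proof -
  assume "distinct ws" "i < length ws"
  then have "{j. j < length ws \<and> ws ! j = ws ! i} = {i}" by (auto simp: nth_eq_iff_index_eq)
  then show ?thesis by (simp add: vertex_map_def)
qed

lemma coordinates_vertex_map:
  assumes "distinct ws" "length ws = Suc p" "b \<in> standard_simplex p"
  shows "coordinates ws (vertex_map ws b) = b"
  using assms by (auto simp: coordinates_def vertex_map_distinct standard_simplexD(2))

lemma vertex_map_coordinates:
  assumes "distinct ws" "t \<in> face (set ws)"
  shows "vertex_map ws (coordinates ws t) = t"
proof
  fix v show "vertex_map ws (coordinates ws t) v = t v"
  proof (cases "v \<in> set ws")
    case True
    then obtain i where "i < length ws" "v = ws ! i" by (metis in_set_conv_nth)
    then show ?thesis using vertex_map_distinct[OF assms(1)] by (simp add: coordinates_def)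
  next
    case False
    then show ?thesis using assms(2) vertex_map_outside by (auto simp: face_def)
  qed
qed

lemma coordinates_in_simplex:
  assumes "distinct ws" "length ws = Suc p" "t \<in> face (set ws)"
  shows "coordinates ws t \<in> standard_simplex p"
proof (rule standard_simplexI)
  have "sum (coordinates ws t) {..p} = (\<Sum>i<length ws. t (ws ! i))"
    unfolding assms(2) by (intro sum.cong) (auto simp: coordinates_def assms(2))
  also have "\<dots> = sum t (set ws)"
    using sum.reindex_bij_betw[OF bij_betw_nth[OF assms(1) refl refl], of t] by simp
  finally show "sum (coordinates ws t) {..p} = 1" using assms(3) by (simp add: face_def)
qed (use assms in \<open>auto simp: coordinates_def face_def\<close>)

section \<open>The quotient by the strata is a wedge of spheres\<close>

context point_lattice
begin

definition full_lists :: "'a set list set" where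
  "full_lists = {ws. good_list ws \<and> length ws = Suc n}"

lemma full_list_props:
  assumes "ws \<in> full_lists"
  shows "distinct ws" "length ws = Suc n" "good_list ws"
  using assms good_list_distinct by (auto simp: full_lists_def)

text \<open>A chain has at most \<open>n + 1\<close> elements, so a full good list exhausts every
  simplex that contains it. The simplices outside the last stratum are thus top-dimensional, and
  their boundaries lie in that stratum.\<close>

lemma full_list_maximal:
  assumes "ws \<in> full_lists" "set ws \<subseteq> \<sigma>" "\<sigma> \<in> order_complex L" shows "\<sigma> = set ws"
proof -
  have "finite \<sigma>" "card \<sigma> \<le> Suc n" using assms chain_card_le by (auto simp: order_complex_iff)
  moreover have "card (set ws) = Suc n" using full_list_props[OF assms(1)] by (simp add: distinct_card)
  ultimately show ?thesis using assms(2) card_seteq[of \<sigma> "set ws"] by simp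
qed

lemma full_list_unique:
  assumes "ws \<in> full_lists" "ws' \<in> full_lists" "set ws = set ws'" "set ws \<in> order_complex L" shows "ws = ws'"
proof -
  have "is_chain (set ws)" using assms(4) by (simp add: is_chain_def order_complex_iff)
  then show ?thesis using good_list_unique[of "set ws" ws ws'] assms by (simp add: full_lists_def)
qed

lemma good_list_chain: "good_list ws \<Longrightarrow> is_chain (set ws)"
proof (induction ws rule: good_list.induct)
  case (3 V U ws)
  have V: "V \<subseteq> W" if "W \<in> set (V # U # ws)" for W using good_list_hd_le[OF 3(2) that] by simp
  have c: "is_chain (set (U # ws))" using 3 by simp
  show ?case
  proof (rule is_chainI)
    show "set (V # U # ws) \<subseteq> L" using good_list_props[OF 3(2)] by blast
    fix W W' assume "W \<in> set (V # U # ws)" "W' \<in> set (V # U # ws)"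
    then consider "W = V" | "W' = V" | "W \<in> set (U # ws)" "W' \<in> set (U # ws)" by auto
    then show "W \<subseteq> W' \<or> W' \<subseteq> W"
      using V is_chainD[OF c] \<open>W \<in> _\<close> \<open>W' \<in> _\<close> by cases blast+
  qed
qed (auto simp: is_chain_def top_in)

lemma full_list_simplex: "ws \<in> full_lists \<Longrightarrow> set ws \<in> order_complex L"
  using good_list_chain[of ws] by (auto simp: full_lists_def order_complex_iff is_chain_def)

lemma partly_good_full:
  "\<sigma> \<in> order_complex L \<Longrightarrow> \<sigma> \<notin> partly_good n \<longleftrightarrow> (\<exists>ws\<in>full_lists. \<sigma> = set ws)"
  using full_list_maximal by (auto simp: partly_good_def full_lists_def)

lemma continuous_map_from_sum:
  assumes "\<And>i. i \<in> I \<Longrightarrow> continuous_map (Y i) Z (\<lambda>x. f (i, x))"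
  shows "continuous_map (sum_topology Y I) Z f"
  unfolding continuous_map_def
proof (intro conjI allI impI)
  show "f \<in> topspace (sum_topology Y I) \<rightarrow> topspace Z"
    using continuous_map_funspace[OF assms] by (auto simp: Pi_iff)
  fix U assume "openin Z U"
  then have "openin (Y i) {x \<in> topspace (Y i). f (i, x) \<in> U}" if "i \<in> I" for i
    using assms[OF that] openin_continuous_map_preimage by blast
  then show "openin (sum_topology Y I) {x \<in> topspace (sum_topology Y I). f x \<in> U}"
    by (auto simp: openin_sum_topology)
qed

text \<open>Outside the last stratum only disjoint open \<open>n\<close>-simplices remain, and each
  is a sphere without its base point. The two maps are inverse on these pieces; continuity comes
  from writing them over whole simplices, where the boundary goes to the basepoint.\<close>

lemma collapse_strata_wedge:
  "collapse (realisation (order_complex L)) (polyhedron (partly_good n)) homeomorphic_space wedge_of_spheres n full_lists"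
proof -
  let ?C = "order_complex L" and ?Z = "polyhedron (partly_good n)"
  let ?S = "sum_topology (\<lambda>_. nsphere n) full_lists" and ?b = "full_lists \<times> {sphere_base}"
  note Z = complex_partly_good[of n]
  \<comment> \<open>Outside the last stratum the support is a whole flag and determines the list.
    Elsewhere the value is masked by the collapse.\<close>
  define list_of where "list_of = (\<lambda>t::'a set \<Rightarrow> real. THE ws. ws \<in> full_lists \<and> set ws = supp t)"
  have list_of: "list_of t = ws" if "ws \<in> full_lists" "set ws = supp t" for t ws
    unfolding list_of_def using that full_list_unique full_list_simplex by (intro the_equality) auto
  define \<theta> where "\<theta> = (\<lambda>t. collapse_map ?b (list_of t, sphere_map n (coordinates (list_of t) t)))"
  define F where "F = (\<lambda>x. case x of None \<Rightarrow> None | Some t \<Rightarrow> \<theta> t)"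
  define \<psi> where "\<psi> = (\<lambda>(ws,y). collapse_map ?Z (vertex_map ws (sphere_inv n y)))"
  define G where "G = (\<lambda>x. case x of None \<Rightarrow> None | Some p \<Rightarrow> \<psi> p)"
  have topS: "topspace ?S = full_lists \<times> topspace (nsphere n)" by auto
  have interior: "(\<forall>i\<le>n. coordinates ws t i \<noteq> 0) \<longleftrightarrow> supp t = set ws"
    if "ws \<in> full_lists" "t \<in> face (set ws)" for ws t
  proof -
    have "(\<forall>i\<le>n. coordinates ws t i \<noteq> 0) \<longleftrightarrow> set ws \<subseteq> supp t"
      using full_list_props[OF that(1)] by (auto simp: coordinates_def less_Suc_eq_le[symmetric] set_conv_nth)
    then show ?thesis using supp_subset[OF that(2)] by blast
  qed
  have in_Z: "t \<in> ?Z \<longleftrightarrow> supp t \<noteq> set ws" if "ws \<in> full_lists" "t \<in> face (set ws)" for ws t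
  proof -
    have t: "t \<in> polyhedron ?C" using that full_list_simplex by (auto simp: polyhedron_def)
    have s: "supp t \<subseteq> set ws" using supp_subset[OF that(2)] .
    have "supp t \<notin> partly_good n \<longleftrightarrow> supp t = set ws"
    proof
      assume "supp t \<notin> partly_good n"
      then obtain ws' where ws': "ws' \<in> full_lists" "supp t = set ws'"
        using partly_good_full polyhedronD(1)[OF t complex] by blast
      then have "set ws = set ws'" using full_list_maximal[OF ws'(1) _ full_list_simplex[OF that(1)]] s by auto
      then show "supp t = set ws" using ws' by simp
    next
      assume "supp t = set ws"
      then show "supp t \<notin> partly_good n"
        using partly_good_full[OF full_list_simplex[OF that(1)]] that(1) by auto
    qed
    then show ?thesis using polyhedron_iff[OF Z] polyhedron_iff[OF complex] t by auto
  qed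
  have not_in_Z: "\<exists>ws\<in>full_lists. supp t = set ws \<and> t \<in> face (set ws)" if "t \<in> polyhedron ?C" "t \<notin> ?Z" for t
  proof -
    have "supp t \<in> ?C" "t \<in> face (supp t)" "supp t \<notin> partly_good n"
      using that polyhedron_iff[OF complex] polyhedron_iff[OF Z] by auto
    then show ?thesis using partly_good_full by metis
  qed
  have \<theta>_eq: "(if t \<in> ?Z then None else \<theta> t) = collapse_map ?b (ws, sphere_map n (coordinates ws t))"
    if "ws \<in> full_lists" "t \<in> face (set ws)" for ws t
  proof (cases "t \<in> ?Z")
    case True
    then have "\<exists>i\<le>n. coordinates ws t i = 0" using interior[OF that] in_Z[OF that] by blast
    then have "sphere_map n (coordinates ws t) = sphere_base"
      using sphere_map_boundary coordinates_in_simplex full_list_props[OF that(1)] that(2) by blast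
    then show ?thesis using True that by (simp add: collapse_map_def)
  next
    case False
    then have "list_of t = ws" using list_of[OF that(1)] in_Z[OF that] by auto
    then show ?thesis using False by (simp add: \<theta>_def)
  qed
  have \<psi>_eq: "collapse_map ?Z (vertex_map ws b) = (if sphere_map n b = sphere_base then None else \<psi> (ws, sphere_map n b))"
    if "ws \<in> full_lists" "b \<in> standard_simplex n" for ws b
  proof -
    note w = full_list_props[OF that(1)]
    have f: "vertex_map ws b \<in> face (set ws)" using vertex_map_in_face[OF w(2) that(2)] .
    have c: "coordinates ws (vertex_map ws b) = b" using coordinates_vertex_map[OF w(1,2) that(2)] .
    show ?thesis
    proof (cases "\<forall>i\<le>n. b i \<noteq> 0")
      case True
      then show ?thesis using sphere_map_interior[OF that(2)] by (simp add: \<psi>_def)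
    next
      case False
      then have "vertex_map ws b \<in> ?Z" using in_Z[OF that(1) f] interior[OF that(1) f] c by metis
      then show ?thesis using False sphere_map_boundary[OF that(2)] by (auto simp: collapse_map_def)
    qed
  qed
  have contF: "continuous_map (collapse (realisation ?C) ?Z) (wedge_of_spheres n full_lists) F"
    unfolding wedge_of_spheres_def
  proof (rule continuous_map_from_collapse)
    show "continuous_map (realisation ?C) (collapse ?S ?b) (F \<circ> collapse_map ?Z)"
      unfolding continuous_map_realisation_iff
    proof
      fix \<sigma> assume \<sigma>: "\<sigma> \<in> ?C"
      show "continuous_map (face_topology \<sigma>) (collapse ?S ?b) (F \<circ> collapse_map ?Z)"
      proof (cases "\<sigma> \<in> partly_good n")
        case True
        have "continuous_map (face_topology \<sigma>) (collapse ?S ?b) (\<lambda>_. None)"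
          by (simp add: topspace_collapse)
        then show ?thesis
          by (rule continuous_map_eq) (use True in \<open>auto simp: F_def collapse_map_def polyhedron_def\<close>)
      next
        case False
        then obtain ws where ws: "ws \<in> full_lists" "\<sigma> = set ws" using partly_good_full[OF \<sigma>] by blast
        note w = full_list_props[OF ws(1)]
        have "continuous_map (face_topology \<sigma>) euclideanreal (\<lambda>t. coordinates ws t i)" for i
          by (cases "i < length ws") (auto simp: coordinates_def continuous_map_face_coordinate)
        then have 1: "continuous_map (face_topology \<sigma>) (simplex_topology n) (coordinates ws)"
          using coordinates_in_simplex[OF w(1,2)] ws
          by (auto simp: continuous_map_in_subtopology continuous_map_componentwise_UNIV)
        have 2: "continuous_map (nsphere n) ?S (\<lambda>y. (ws, y))"
          using continuous_map_component_injection[of ws full_lists "\<lambda>_. nsphere n"] ws by simp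
        have "continuous_map (face_topology \<sigma>) (collapse ?S ?b) (collapse_map ?b \<circ> ((\<lambda>y. (ws, y)) \<circ> (sphere_map n \<circ> coordinates ws)))"
          by (intro continuous_map_compose[OF _ continuous_map_collapse] continuous_map_compose[OF _ 2]
              continuous_map_compose[OF 1 continuous_map_sphere_map])
        then show ?thesis
        proof (rule continuous_map_eq)
          fix t assume "t \<in> topspace (face_topology \<sigma>)"
          then have "t \<in> face (set ws)" using ws by simp
          moreover have "(F \<circ> collapse_map ?Z) t = (if t \<in> ?Z then None else \<theta> t)"
            by (simp add: F_def collapse_map_def)
          ultimately show "(collapse_map ?b \<circ> ((\<lambda>y. (ws, y)) \<circ> (sphere_map n \<circ> coordinates ws))) t = (F \<circ> collapse_map ?Z) t"
            using \<theta>_eq[OF ws(1)] by simp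
        qed
      qed
    qed
  qed (simp add: F_def topspace_collapse)
  have contG: "continuous_map (wedge_of_spheres n full_lists) (collapse (realisation ?C) ?Z) G"
    unfolding wedge_of_spheres_def
  proof (rule continuous_map_from_collapse)
    show "continuous_map ?S (collapse (realisation ?C) ?Z) (G \<circ> collapse_map ?b)"
    proof (rule continuous_map_from_sum)
      fix ws assume ws: "ws \<in> full_lists"
      show "continuous_map (nsphere n) (collapse (realisation ?C) ?Z) (\<lambda>y. (G \<circ> collapse_map ?b) (ws, y))"
      proof (rule continuous_map_from_nsphere)
        show "continuous_map (simplex_topology n) (collapse (realisation ?C) ?Z) ((\<lambda>y. (G \<circ> collapse_map ?b) (ws, y)) \<circ> sphere_map n)"
          by (rule continuous_map_eq[OF continuous_map_compose[OF continuous_map_vertex_map[OF full_list_props(2)[OF ws] complex full_list_simplex[OF ws]] continuous_map_collapse]])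
             (use \<psi>_eq[OF ws] ws in \<open>auto simp: G_def collapse_map_def\<close>)
      qed (use ws in \<open>simp add: G_def collapse_map_def topspace_collapse\<close>)
    qed
  qed (simp add: G_def topspace_collapse)
  have GF: "G (F x) = x" if x: "x \<in> topspace (collapse (realisation ?C) ?Z)" for x
  proof (cases x)
    case (Some t)
    then have t: "t \<in> polyhedron ?C" "t \<notin> ?Z" using x by (auto simp: topspace_collapse)
    then obtain ws where ws: "ws \<in> full_lists" "supp t = set ws" "t \<in> face (set ws)" using not_in_Z by blast
    note w = full_list_props[OF ws(1)]
    have b: "coordinates ws t \<in> standard_simplex n" using coordinates_in_simplex[OF w(1,2) ws(3)] .
    have i: "\<forall>i\<le>n. coordinates ws t i \<noteq> 0" using interior[OF ws(1,3)] ws(2) by blast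
    have "F x = Some (ws, sphere_map n (coordinates ws t))"
      using Some \<theta>_eq[OF ws(1,3)] t sphere_map_interior(1)[OF b i] by (simp add: F_def collapse_map_def)
    then have "G (F x) = collapse_map ?Z (vertex_map ws (coordinates ws t))"
      using sphere_map_interior(2)[OF b i] by (simp add: G_def \<psi>_def)
    then show ?thesis using vertex_map_coordinates[OF w(1) ws(3)] t Some by (simp add: collapse_map_def)
  qed (simp add: F_def G_def)
  have FG: "F (G x) = x" if x: "x \<in> topspace (wedge_of_spheres n full_lists)" for x
  proof (cases x)
    case (Some p)
    then obtain ws y where p: "p = (ws,y)" "ws \<in> full_lists" "y \<in> topspace (nsphere n)" "y \<noteq> sphere_base"
      using x by (auto simp: wedge_of_spheres_def topspace_collapse)
    note w = full_list_props[OF p(2)]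
    note y = sphere_inv[OF p(3,4)]
    have f: "vertex_map ws (sphere_inv n y) \<in> face (set ws)" using vertex_map_in_face[OF w(2) y(1)] .
    have c: "coordinates ws (vertex_map ws (sphere_inv n y)) = sphere_inv n y"
      using coordinates_vertex_map[OF w(1,2) y(1)] .
    have "vertex_map ws (sphere_inv n y) \<notin> ?Z" using in_Z[OF p(2) f] interior[OF p(2) f] c y(2) by metis
    then show ?thesis
      using Some p \<theta>_eq[OF p(2) f] c y(3) by (simp add: F_def G_def \<psi>_def collapse_map_def)
  qed (simp add: F_def G_def)
  show ?thesis
    unfolding homeomorphic_space_def homeomorphic_maps_def using contF contG GF FG by blast
qed

theorem wedge_of_spheres_equivalence:
  "collapse (realisation (order_complex L)) (polyhedron (order_complex (L - {X}))) homotopy_equivalent_space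
   wedge_of_spheres n full_lists"
  using strata_equivalent[of n] collapse_strata_wedge homeomorphic_imp_homotopy_equivalent_space homotopy_eqv_trans
  by blast

end

section \<open>Chain complexes of tuples\<close>

text \<open>Compatibility with differences suffices because \<open>frag_induction\<close> builds a
  chain from generators by subtraction alone.\<close>

lemma frag_linear_eq:
  assumes c: "Poly_Mapping.keys c \<subseteq> S"
    and f: "\<And>a b. f (a - b) = f a - f b" and g: "\<And>a b. g (a - b) = g a - g b"
    and eq: "\<And>x. x \<in> S \<Longrightarrow> f (frag_of x) = g (frag_of x)"
  shows "f c = (g c :: 'b::ab_group_add)"
  using c
proof (induction c rule: frag_induction)
  case zero
  then show ?case using f[of 0 0] g[of 0 0] by simp
qed (auto simp: f g eq)

lemma keys_frag_extend_subset:
  assumes "Poly_Mapping.keys c \<subseteq> S" "\<And>x. x \<in> S \<Longrightarrow> Poly_Mapping.keys (f x) \<subseteq> T"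
  shows "Poly_Mapping.keys (frag_extend f c) \<subseteq> T"
  using keys_frag_extend[of f c] assms by blast

lemma keys_sum_cmul_subset:
  assumes "\<And>i. i \<in> I \<Longrightarrow> Poly_Mapping.keys (f i) \<subseteq> T"
  shows "Poly_Mapping.keys (\<Sum>i\<in>I. frag_cmul (k i) (f i)) \<subseteq> T"
  using assms by (induction I rule: infinite_finite_induct) (auto dest!: subsetD[OF keys_add])

lemma keys_diff_subset:
  "Poly_Mapping.keys a \<subseteq> T \<Longrightarrow> Poly_Mapping.keys b \<subseteq> T \<Longrightarrow> Poly_Mapping.keys (a - b) \<subseteq> T"
  using keys_diff[of a b] by blast

text \<open>The complex is augmented: a list of one entry has the empty list as boundary. Degrees
  are lengths, one more than the dimension of the corresponding simplex.\<close>

definition tuple_boundary :: "'a list \<Rightarrow> 'a list \<Rightarrow>\<^sub>0 int" where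
  "tuple_boundary xs = (\<Sum>i<length xs. frag_cmul ((-1) ^ i) (frag_of (omit i xs)))"

abbreviation boundary :: "('a list \<Rightarrow>\<^sub>0 int) \<Rightarrow> 'a list \<Rightarrow>\<^sub>0 int" where
  "boundary \<equiv> frag_extend tuple_boundary"

definition tuple_cone :: "'a \<Rightarrow> ('a list \<Rightarrow>\<^sub>0 int) \<Rightarrow> 'a list \<Rightarrow>\<^sub>0 int" where
  "tuple_cone v = frag_extend (\<lambda>xs. frag_of (v # xs))"

lemma cone_of [simp]: "tuple_cone v (frag_of xs) = frag_of (v # xs)"
  by (simp add: tuple_cone_def)

lemma cone_0 [simp]: "tuple_cone v 0 = 0"
  by (simp add: tuple_cone_def)

lemma cone_diff: "tuple_cone v (a - b) = tuple_cone v a - tuple_cone v b"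
  by (simp add: tuple_cone_def frag_extend_diff)

lemma omit_Cons [simp]: "omit 0 (v # xs) = xs" "omit (Suc i) (v # xs) = v # omit i xs"
  by (auto simp: omit_def)

lemma length_omit: "i < length xs \<Longrightarrow> length (omit i xs) = length xs - 1"
  by (auto simp: omit_def)

lemma set_omit: "set (omit i xs) \<subseteq> set xs"
  using set_take_subset[of i xs] set_drop_subset[of "Suc i" xs] by (auto simp: omit_def)

lemma map_omit: "map f (omit i xs) = omit i (map f xs)"
  by (simp add: omit_def take_map drop_map)

lemma nth_omit: "i < length xs \<Longrightarrow> j < length xs - 1 \<Longrightarrow> omit i xs ! j = (if j < i then xs ! j else xs ! Suc j)"
  by (auto simp: omit_def nth_append)

lemma tuple_boundary_Nil [simp]: "tuple_boundary [] = 0"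
  by (simp add: tuple_boundary_def)

text \<open>With the boundary expressed through a cone, its square vanishes by induction on the
  list, without cancelling terms of a double sum.\<close>

lemma tuple_boundary_Cons: "tuple_boundary (v # xs) = frag_of xs - tuple_cone v (tuple_boundary xs)"
proof -
  have "tuple_boundary (v # xs) = frag_of xs + (\<Sum>i<length xs. frag_cmul ((-1) ^ Suc i) (frag_of (v # omit i xs)))"
    unfolding tuple_boundary_def by (simp add: sum.lessThan_Suc_shift del: sum.lessThan_Suc)
  also have "(\<Sum>i<length xs. frag_cmul ((-1) ^ Suc i) (frag_of (v # omit i xs))) = - tuple_cone v (tuple_boundary xs)"
    unfolding tuple_boundary_def tuple_cone_def
    by (simp add: frag_extend_sum o_def frag_extend_cmul sum_negf flip: minus_frag_cmul)
  finally show ?thesis by simp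
qed

lemma boundary_cone: "boundary (tuple_cone v c) = c - tuple_cone v (boundary c)"
  using subset_UNIV
  by (induction c rule: frag_induction) (auto simp: tuple_boundary_Cons cone_diff frag_extend_diff)

lemma boundary_tuple_boundary: "boundary (tuple_boundary xs) = 0"
  by (induction xs) (simp_all add: tuple_boundary_Cons frag_extend_diff boundary_cone)

lemma keys_tuple_boundary:
  "Poly_Mapping.keys (tuple_boundary xs) \<subseteq> {ys. Suc (length ys) = length xs \<and> set ys \<subseteq> set xs}"
  unfolding tuple_boundary_def
  by (rule keys_sum_cmul_subset) (auto simp: length_omit dest: subsetD[OF set_omit])

lemma keys_cone: "Poly_Mapping.keys c \<subseteq> S \<Longrightarrow> Poly_Mapping.keys (tuple_cone v c) \<subseteq> (#) v ` S"
  unfolding tuple_cone_def by (erule keys_frag_extend_subset) auto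

definition map_tuples :: "('a \<Rightarrow> 'b) \<Rightarrow> ('a list \<Rightarrow>\<^sub>0 int) \<Rightarrow> 'b list \<Rightarrow>\<^sub>0 int" where
  "map_tuples f = frag_extend (\<lambda>xs. frag_of (map f xs))"

lemma map_tuples_of [simp]: "map_tuples f (frag_of xs) = frag_of (map f xs)"
  by (simp add: map_tuples_def)

lemma map_tuples_diff: "map_tuples f (a - b) = map_tuples f a - map_tuples f b"
  by (simp add: map_tuples_def frag_extend_diff)

lemma map_tuples_add: "map_tuples f (a + b) = map_tuples f a + map_tuples f b"
  by (simp add: map_tuples_def frag_extend_add)

lemma map_tuples_0 [simp]: "map_tuples f 0 = 0"
  by (simp add: map_tuples_def)

lemma map_tuples_boundary: "map_tuples f (tuple_boundary xs) = tuple_boundary (map f xs)"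
  by (simp add: tuple_boundary_def map_tuples_def frag_extend_sum o_def frag_extend_cmul map_omit)

lemma map_tuples_cone: "map_tuples f (tuple_cone v c) = tuple_cone (f v) (map_tuples f c)"
  using subset_UNIV
  by (induction c rule: frag_induction) (auto simp: map_tuples_diff cone_diff)

lemma keys_map_tuples: "Poly_Mapping.keys c \<subseteq> S \<Longrightarrow> Poly_Mapping.keys (map_tuples f c) \<subseteq> map f ` S"
  unfolding map_tuples_def by (erule keys_frag_extend_subset) auto

section \<open>Subdivision of tuples by spans\<close>

context point_lattice
begin

text \<open>The index is the length of the tuples, not their dimension. The recursion starts with
  the identity on the empty tuple, and a one-entry tuple is replaced by the list of its
  \<open>lub\<close>.\<close>

fun subdivide :: "nat \<Rightarrow> ('a set list \<Rightarrow>\<^sub>0 int) \<Rightarrow> 'a set list \<Rightarrow>\<^sub>0 int" where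
  "subdivide 0 c = c"
| "subdivide (Suc k) c = frag_extend (\<lambda>xs. tuple_cone (lub (set xs)) (subdivide k (tuple_boundary xs))) c"

lemma subdivide_0 [simp]: "subdivide k 0 = 0"
  by (cases k) auto

lemma subdivide_diff: "subdivide k (a - b) = subdivide k a - subdivide k b"
  by (cases k) (auto simp: frag_extend_diff)

lemma subdivide_add: "subdivide k (a + b) = subdivide k a + subdivide k b"
  by (cases k) (auto simp: frag_extend_add)

text \<open>By the cone formula the boundary of a subdivided tuple is the subdivision of its
  boundary minus a cone over a further boundary. The induction hypothesis identifies the latter with
  a subdivision of \<open>boundary (tuple_boundary xs) = 0\<close>.\<close>

lemma boundary_subdivide:
  "Poly_Mapping.keys c \<subseteq> {xs. length xs = Suc k} \<Longrightarrow> boundary (subdivide (Suc k) c) = subdivide k (boundary c)"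
proof (induction k arbitrary: c)
  case 0
  show ?case
  proof (rule frag_linear_eq[OF 0])
    fix xs :: "'a set list" assume "xs \<in> {xs. length xs = Suc 0}"
    then obtain x where "xs = [x]" by (auto simp: length_Suc_conv)
    then show "boundary (subdivide (Suc 0) (frag_of xs)) = subdivide 0 (boundary (frag_of xs))"
      by (simp add: boundary_cone tuple_boundary_Cons)
  qed (simp_all add: frag_extend_diff)
next
  case (Suc k)
  show ?case
  proof (rule frag_linear_eq[OF Suc.prems])
    fix xs :: "'a set list" assume xs: "xs \<in> {xs. length xs = Suc (Suc k)}"
    have "Poly_Mapping.keys (tuple_boundary xs) \<subseteq> {xs. length xs = Suc k}"
      using keys_tuple_boundary[of xs] xs by auto
    from Suc.IH[OF this] show "boundary (subdivide (Suc (Suc k)) (frag_of xs)) = subdivide (Suc k) (boundary (frag_of xs))"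
      unfolding subdivide.simps(2)[of "Suc k"] frag_extend_of boundary_cone by (simp add: boundary_tuple_boundary del: subdivide.simps)
  qed (simp_all add: frag_extend_diff subdivide_diff del: subdivide.simps)
qed

definition flag_lists :: "nat \<Rightarrow> 'a set \<Rightarrow> 'a set list set" where
  "flag_lists k U = {xs. length xs = k \<and> is_chain (set xs) \<and> (\<forall>x\<in>set xs. x \<subseteq> U)}"

definition tuples :: "nat \<Rightarrow> 'a set \<Rightarrow> 'a set list set" where
  "tuples k U = {xs. length xs = k \<and> set xs \<subseteq> L \<and> (\<forall>x\<in>set xs. x \<subseteq> U)}"

text \<open>The span of a tuple contains the spans of all its faces, so putting it in front of a
  flag made from the faces gives a flag again.\<close>

lemma keys_subdivide:
  "Poly_Mapping.keys c \<subseteq> tuples k U \<Longrightarrow> U \<in> L \<Longrightarrow> Poly_Mapping.keys (subdivide k c) \<subseteq> flag_lists k U"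
proof (induction k arbitrary: c U)
  case 0
  then show ?case by (auto simp: tuples_def flag_lists_def is_chain_def)
next
  case (Suc k)
  have "Poly_Mapping.keys (tuple_cone (lub (set xs)) (subdivide k (tuple_boundary xs))) \<subseteq> flag_lists (Suc k) U"
    if "xs \<in> tuples (Suc k) U" for xs
  proof -
    have xs: "length xs = Suc k" "set xs \<subseteq> L" "\<And>x. x \<in> set xs \<Longrightarrow> x \<subseteq> U" "set xs \<noteq> {}"
      using that by (auto simp: tuples_def)
    let ?V = "lub (set xs)"
    note V = lub_props[OF xs(2,4)]
    have VU: "?V \<subseteq> U" using V(3)[OF Suc.prems(2) xs(3)] .
    have "Poly_Mapping.keys (tuple_boundary xs) \<subseteq> tuples k ?V"
    proof
      fix ys assume "ys \<in> Poly_Mapping.keys (tuple_boundary xs)"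
      then have "Suc (length ys) = length xs" "set ys \<subseteq> set xs" using keys_tuple_boundary by blast+
      moreover from this have "y \<subseteq> ?V" if "y \<in> set ys" for y using V(2) that by blast
      ultimately show "ys \<in> tuples k ?V" using xs(1,2) unfolding tuples_def by simp
    qed
    then have "Poly_Mapping.keys (subdivide k (tuple_boundary xs)) \<subseteq> flag_lists k ?V"
      using Suc.IH V(1) by blast
    then have "Poly_Mapping.keys (tuple_cone ?V (subdivide k (tuple_boundary xs))) \<subseteq> (#) ?V ` flag_lists k ?V"
      by (rule keys_cone)
    also have "\<dots> \<subseteq> flag_lists (Suc k) U"
    proof
      fix zs assume "zs \<in> (#) ?V ` flag_lists k ?V"
      then obtain ys where ys: "zs = ?V # ys" "length ys = k" "is_chain (set ys)" "\<And>y. y \<in> set ys \<Longrightarrow> y \<subseteq> ?V"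
        by (auto simp: flag_lists_def)
      have "is_chain (set zs)"
      proof (rule is_chainI)
        show "set zs \<subseteq> L" using ys V(1) by (simp add: is_chain_def)
        fix W W' assume "W \<in> set zs" "W' \<in> set zs"
        then consider "W = ?V" "W' = ?V" | "W = ?V" "W' \<in> set ys" | "W \<in> set ys" "W' = ?V" | "W \<in> set ys" "W' \<in> set ys"
          using ys by auto
        then show "W \<subseteq> W' \<or> W' \<subseteq> W"
          using ys(4)[of W] ys(4)[of W'] is_chainD[OF ys(3), of W W'] by cases simp_all
      qed
      moreover have "W \<subseteq> U" if "W \<in> set zs" for W
        using that ys(1) ys(4)[of W] VU by auto
      ultimately show "zs \<in> flag_lists (Suc k) U" using ys by (simp add: flag_lists_def)
    qed
    finally show ?thesis .
  qed
  then show ?case unfolding subdivide.simps by (rule keys_frag_extend_subset[OF Suc.prems(1)])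
qed

subsection \<open>The relations of the Lee--Szczarba group\<close>

definition points :: "'a set set" where "points = {p \<in> L. rk p = 0}"

definition point_lists :: "nat \<Rightarrow> 'a set \<Rightarrow> 'a set list set" where
  "point_lists k U = {xs. length xs = k \<and> set xs \<subseteq> points \<and> (\<forall>x\<in>set xs. x \<subseteq> U)}"

lemma point_lists_tuples: "point_lists k U \<subseteq> tuples k U"
  by (auto simp: point_lists_def tuples_def points_def)

lemma point_lists_top: "xs \<in> point_lists k X \<longleftrightarrow> length xs = k \<and> set xs \<subseteq> points"
  using le_top by (auto simp: point_lists_def points_def)

text \<open>The first point has rank 0 and each further point adds at most one. In particular
  \<open>n\<close> points never span \<open>X\<close>.\<close>

lemma rank_lub_points: "xs \<noteq> [] \<Longrightarrow> set xs \<subseteq> points \<Longrightarrow> rk (lub (set xs)) < length xs"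
proof (induction xs)
  case (Cons x xs)
  have x: "x \<in> L" "rk x = 0" "set (x # xs) \<subseteq> L" using Cons.prems by (auto simp: points_def)
  show ?case
  proof (cases "xs = []")
    case True
    have "lub {x} \<subseteq> x" using lub_props(3)[of "{x}" x] x by auto
    then have "rk (lub {x}) \<le> rk x" using lub_props(1)[of "{x}"] x by (intro rank_mono) auto
    then show ?thesis using True x by simp
  next
    case False
    let ?J = "lub (set (x # xs))" and ?U = "lub (set xs)"
    have ne: "set (x # xs) \<noteq> {}" "set xs \<noteq> {}" "set xs \<subseteq> L" using False x by auto
    note J = lub_props[OF x(3) ne(1)] and U = lub_props[OF ne(3,2)]
    have "rk ?J \<le> Suc (rk ?U)"
    proof (rule rank_lub[OF U(1) x(1,2) J(1)])
      show "?U \<subseteq> ?J" by (rule lub_mono) (use ne x in auto)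
      show "x \<subseteq> ?J" by (rule J(2)) simp
      fix W assume W: "W \<in> L" "?U \<subseteq> W" "x \<subseteq> W"
      show "?J \<subseteq> W"
      proof (rule J(3)[OF W(1)])
        fix V assume "V \<in> set (x # xs)"
        then show "V \<subseteq> W" using W U(2)[of V] by auto
      qed
    qed
    then show ?thesis using Cons.IH[OF False] Cons.prems by simp
  qed
qed simp

definition degenerate_lists :: "'a set list set" where
  "degenerate_lists = {xs \<in> point_lists (Suc n) X. lub (set xs) \<noteq> X}"

text \<open>A closed form of the subgroup divided out in the Lee--Szczarba group;
  \<open>generate_relations\<close> makes the identification.\<close>

definition relations :: "('a set list \<Rightarrow>\<^sub>0 int) set" where
  "relations = {boundary a + b |a b. Poly_Mapping.keys a \<subseteq> point_lists (Suc (Suc n)) X \<and> Poly_Mapping.keys b \<subseteq> degenerate_lists}"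

lemma relations_boundary: "Poly_Mapping.keys a \<subseteq> point_lists (Suc (Suc n)) X \<Longrightarrow> boundary a \<in> relations"
  unfolding relations_def by (rule CollectI, rule exI[of _ a], rule exI[of _ 0]) auto

lemma relations_degenerate: "Poly_Mapping.keys b \<subseteq> degenerate_lists \<Longrightarrow> b \<in> relations"
  unfolding relations_def by (rule CollectI, rule exI[of _ 0], rule exI[of _ b]) auto

lemma relations_diff: assumes "x \<in> relations" "y \<in> relations" shows "x - y \<in> relations"
proof -
  obtain a b a' b' where "x = boundary a + b" "y = boundary a' + b'" and k: "Poly_Mapping.keys a \<subseteq> point_lists (Suc (Suc n)) X"
    "Poly_Mapping.keys a' \<subseteq> point_lists (Suc (Suc n)) X" "Poly_Mapping.keys b \<subseteq> degenerate_lists" "Poly_Mapping.keys b' \<subseteq> degenerate_lists"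
    using assms unfolding relations_def by blast
  then have "x - y = boundary (a - a') + (b - b')" by (simp add: frag_extend_diff)
  then show ?thesis unfolding relations_def using keys_diff_subset[OF k(1,2)] keys_diff_subset[OF k(3,4)] by blast
qed

lemma keys_boundary:
  assumes "Poly_Mapping.keys c \<subseteq> point_lists (Suc k) U" shows "Poly_Mapping.keys (boundary c) \<subseteq> point_lists k U"
proof (rule keys_frag_extend_subset[OF assms])
  fix xs assume "xs \<in> point_lists (Suc k) U"
  then show "Poly_Mapping.keys (tuple_boundary xs) \<subseteq> point_lists k U"
    using keys_tuple_boundary[of xs] by (fastforce simp: point_lists_def)
qed

text \<open>Every augmentation preserving endomorphism carried by spans is chain homotopic to the identity, because the
  tuples of points in a given subspace form a cone.\<close>

fun cone_homotopy :: "(nat \<Rightarrow> ('a set list \<Rightarrow>\<^sub>0 int) \<Rightarrow> 'a set list \<Rightarrow>\<^sub>0 int) \<Rightarrow> nat \<Rightarrow> ('a set list \<Rightarrow>\<^sub>0 int) \<Rightarrow> 'a set list \<Rightarrow>\<^sub>0 int" where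
  "cone_homotopy \<theta> 0 c = 0"
| "cone_homotopy \<theta> (Suc k) c =
     frag_extend (\<lambda>xs. tuple_cone (hd xs) (\<theta> (Suc k) (frag_of xs) - frag_of xs - cone_homotopy \<theta> k (tuple_boundary xs))) c"

context
  fixes \<theta> :: "nat \<Rightarrow> ('a set list \<Rightarrow>\<^sub>0 int) \<Rightarrow> 'a set list \<Rightarrow>\<^sub>0 int"
  assumes \<theta>_diff: "\<And>k a b. \<theta> k (a - b) = \<theta> k a - \<theta> k b"
    and \<theta>_Nil: "\<theta> 0 (frag_of []) = frag_of []"
    and \<theta>_boundary: "\<And>k xs. xs \<in> point_lists (Suc k) X \<Longrightarrow> boundary (\<theta> (Suc k) (frag_of xs)) = \<theta> k (tuple_boundary xs)"
    and \<theta>_carrier: "\<And>k xs U. U \<in> L \<Longrightarrow> xs \<in> point_lists k U \<Longrightarrow> Poly_Mapping.keys (\<theta> k (frag_of xs)) \<subseteq> point_lists k U"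
begin

lemma cone_homotopy_diff: "cone_homotopy \<theta> k (a - b) = cone_homotopy \<theta> k a - cone_homotopy \<theta> k b"
  by (cases k) (auto simp: frag_extend_diff)

text \<open>The apex of the cone is the first entry of the tuple itself, hence a point of every
  \<open>U\<close> that carries the tuple.\<close>

lemma cone_homotopy_carrier:
  "Poly_Mapping.keys c \<subseteq> point_lists k U \<Longrightarrow> U \<in> L \<Longrightarrow> Poly_Mapping.keys (cone_homotopy \<theta> k c) \<subseteq> point_lists (Suc k) U"
proof (induction k arbitrary: c)
  case (Suc k)
  have "Poly_Mapping.keys (tuple_cone (hd xs) (\<theta> (Suc k) (frag_of xs) - frag_of xs - cone_homotopy \<theta> k (tuple_boundary xs)))
      \<subseteq> point_lists (Suc (Suc k)) U" if xs: "xs \<in> point_lists (Suc k) U" for xs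
  proof -
    have "Poly_Mapping.keys (tuple_boundary xs) \<subseteq> point_lists k U"
      using keys_boundary[of "frag_of xs" k U] xs by simp
    then have "Poly_Mapping.keys (\<theta> (Suc k) (frag_of xs) - frag_of xs - cone_homotopy \<theta> k (tuple_boundary xs)) \<subseteq> point_lists (Suc k) U"
      using xs Suc.IH Suc.prems(2) \<theta>_carrier[OF Suc.prems(2) xs] by (intro keys_diff_subset) auto
    from keys_cone[OF this, of "hd xs"] show ?thesis
    proof (rule subset_trans)
      have "hd xs \<in> points" "hd xs \<subseteq> U" using xs by (cases xs; simp add: point_lists_def)+
      then show "(#) (hd xs) ` point_lists (Suc k) U \<subseteq> point_lists (Suc (Suc k)) U"
        by (force simp: point_lists_def)
    qed
  qed
  then show ?case unfolding cone_homotopy.simps by (rule keys_frag_extend_subset[OF Suc.prems(1)])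
qed auto

lemma cone_homotopy:
  "Poly_Mapping.keys c \<subseteq> point_lists (Suc k) X \<Longrightarrow>
    boundary (cone_homotopy \<theta> (Suc k) c) + cone_homotopy \<theta> k (boundary c) = \<theta> (Suc k) c - c"
proof (induction k arbitrary: c)
  have step: "boundary (cone_homotopy \<theta> (Suc k) (frag_of xs)) + cone_homotopy \<theta> k (tuple_boundary xs) = \<theta> (Suc k) (frag_of xs) - frag_of xs"
    if xs: "xs \<in> point_lists (Suc k) X" and b: "boundary (cone_homotopy \<theta> k (tuple_boundary xs)) = \<theta> k (tuple_boundary xs) - tuple_boundary xs" for xs k
    using b \<theta>_boundary[OF xs] by (simp add: boundary_cone frag_extend_diff)
  {
    case 0
    show ?case
    proof (rule frag_linear_eq[OF 0])
      fix xs assume xs: "xs \<in> point_lists (Suc 0) X"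
      then obtain x where "xs = [x]" by (auto simp: point_lists_def length_Suc_conv)
      then have "tuple_boundary xs = frag_of []" by (simp add: tuple_boundary_Cons)
      then show "boundary (cone_homotopy \<theta> (Suc 0) (frag_of xs)) + cone_homotopy \<theta> 0 (boundary (frag_of xs)) =
        \<theta> (Suc 0) (frag_of xs) - frag_of xs"
        using step[OF xs] \<theta>_Nil by (simp del: cone_homotopy.simps(2))
    qed (simp_all add: \<theta>_diff cone_homotopy_diff frag_extend_diff del: cone_homotopy.simps(2))
  next
    case (Suc k)
    show ?case
    proof (rule frag_linear_eq[OF Suc.prems])
      fix xs assume xs: "xs \<in> point_lists (Suc (Suc k)) X"
      have "Poly_Mapping.keys (tuple_boundary xs) \<subseteq> point_lists (Suc k) X"
        using keys_boundary[of "frag_of xs" "Suc k" X] xs by simp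
      from Suc.IH[OF this] have "boundary (cone_homotopy \<theta> (Suc k) (tuple_boundary xs)) = \<theta> (Suc k) (tuple_boundary xs) - tuple_boundary xs"
        unfolding boundary_tuple_boundary using cone_homotopy_diff[of k 0 0] by simp
      from step[OF xs this] show "boundary (cone_homotopy \<theta> (Suc (Suc k)) (frag_of xs)) + cone_homotopy \<theta> (Suc k) (boundary (frag_of xs)) =
        \<theta> (Suc (Suc k)) (frag_of xs) - frag_of xs"
        by (simp del: cone_homotopy.simps(2))
    qed (simp_all add: \<theta>_diff cone_homotopy_diff frag_extend_diff del: cone_homotopy.simps(2))
  }
qed

lemma boundary_degenerate:
  assumes "Poly_Mapping.keys c \<subseteq> point_lists (Suc n) X" "xs \<in> Poly_Mapping.keys (boundary c)" "xs \<noteq> []"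
  shows "set xs \<subseteq> L" "lub (set xs) \<in> L" "lub (set xs) \<noteq> X" "xs \<in> point_lists n (lub (set xs))"
proof -
  have xs: "length xs = n" "set xs \<subseteq> points" using subsetD[OF keys_boundary[OF assms(1)] assms(2)] by (simp_all add: point_lists_top)
  then show L: "set xs \<subseteq> L" by (auto simp: points_def)
  show "lub (set xs) \<in> L" using lub_props(1)[OF L] assms(3) by simp
  show "lub (set xs) \<noteq> X" using rank_lub_points[OF assms(3) xs(2)] xs(1) rank_top by auto
  show "xs \<in> point_lists n (lub (set xs))" using xs lub_props(2)[OF L] assms(3) by (simp add: point_lists_def)
qed

text \<open>The homotopy formula writes \<open>\<theta> (Suc n) c - c\<close> as a boundary plus the
  homotopy applied to \<open>boundary c\<close>. The latter is degenerate: tuples of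
  \<open>n\<close> points have proper spans and the homotopy stays inside them. Hence \<theta> is
  the identity modulo relations. For \<open>n = 0\<close> the second term is 0 because the homotopy
  vanishes on the augmentation.\<close>

lemma carried_endomorphism_relations:
  assumes c: "Poly_Mapping.keys c \<subseteq> point_lists (Suc n) X" and "\<theta> (Suc n) c \<in> relations"
  shows "c \<in> relations"
proof -
  have "Poly_Mapping.keys (cone_homotopy \<theta> n (boundary c)) \<subseteq> degenerate_lists"
  proof (cases n)
    case (Suc k)
    have "Poly_Mapping.keys (tuple_cone (hd xs) (\<theta> (Suc k) (frag_of xs) - frag_of xs - cone_homotopy \<theta> k (tuple_boundary xs))) \<subseteq> degenerate_lists"
      if xs: "xs \<in> Poly_Mapping.keys (boundary c)" for xs
    proof -
      have "length xs = n" using keys_boundary[OF c] xs by (auto simp: point_lists_top)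
      then have ne: "xs \<noteq> []" using Suc by auto
      note d = boundary_degenerate[OF c xs ne]
      have "Poly_Mapping.keys (cone_homotopy \<theta> n (frag_of xs)) \<subseteq> point_lists (Suc n) (lub (set xs))"
        using cone_homotopy_carrier[of "frag_of xs"] d by simp
      also have "\<dots> \<subseteq> degenerate_lists"
      proof
        fix ys assume ys: "ys \<in> point_lists (Suc n) (lub (set xs))"
        then have "set ys \<subseteq> L" "set ys \<noteq> {}" by (auto simp: point_lists_def points_def)
        then have "lub (set ys) \<subseteq> lub (set xs)" using ys d(2) by (intro lub_props(3)) (auto simp: point_lists_def)
        then have "lub (set ys) \<noteq> X" using d le_top[of "lub (set xs)"] by auto
        moreover have "ys \<in> point_lists (Suc n) X" using ys by (simp add: point_lists_top) (simp add: point_lists_def)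
        ultimately show "ys \<in> degenerate_lists" by (simp add: degenerate_lists_def)
      qed
      finally show ?thesis by (simp add: Suc)
    qed
    then show ?thesis unfolding Suc cone_homotopy.simps by (rule keys_frag_extend_subset[OF order_refl])
  qed simp
  then have "boundary (cone_homotopy \<theta> (Suc n) c) + cone_homotopy \<theta> n (boundary c) \<in> relations"
    using cone_homotopy_carrier[OF c top_in] relations_def by blast
  then have "\<theta> (Suc n) c - c \<in> relations" unfolding cone_homotopy[OF c] .
  then have "\<theta> (Suc n) c - (\<theta> (Suc n) c - c) \<in> relations"
    by (rule relations_diff[OF assms(2)])
  then show ?thesis by simp
qed

end

end

section \<open>Affine chains\<close>

text \<open>Singular simplices are extensional functions, hence the restriction.\<close>

definition affine_simplex :: "nat \<Rightarrow> 'v list \<Rightarrow> (nat \<Rightarrow> real) \<Rightarrow> 'v \<Rightarrow> real" where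
  "affine_simplex p ys = restrict (vertex_map ys) (standard_simplex p)"

definition affine_chain :: "nat \<Rightarrow> ('v list \<Rightarrow>\<^sub>0 int) \<Rightarrow> ('v \<Rightarrow> real) chain" where
  "affine_chain p = frag_extend (\<lambda>ys. frag_of (affine_simplex p ys))"

lemma affine_chain_of [simp]: "affine_chain p (frag_of ys) = frag_of (affine_simplex p ys)"
  by (simp add: affine_chain_def)

lemma affine_chain_diff: "affine_chain p (a - b) = affine_chain p a - affine_chain p b"
  by (simp add: affine_chain_def frag_extend_diff)

lemma affine_chain_add: "affine_chain p (a + b) = affine_chain p a + affine_chain p b"
  by (simp add: affine_chain_def frag_extend_add)

lemma affine_chain_0 [simp]: "affine_chain p 0 = 0"
  by (simp add: affine_chain_def)

lemma singular_simplex_affine: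
  assumes "length ys = Suc p" "simplicial_complex K" "set ys \<in> K"
  shows "singular_simplex p (realisation K) (affine_simplex p ys)"
  unfolding singular_simplex_def affine_simplex_def
  using continuous_map_eq[OF continuous_map_vertex_map[OF assms], of "restrict (vertex_map ys) (standard_simplex p)"]
  by auto

text \<open>\<open>simplical_face i\<close> inserts a zero at position \<open>i\<close>, exactly
  where \<open>omit i\<close> deletes an entry. Every other position comes from one position of the
  shorter list.\<close>

lemma vertex_map_face:
  assumes "length ys = Suc (Suc p)" "i \<le> Suc p"
  shows "vertex_map ys (simplical_face i b) = vertex_map (omit i ys) b"
proof
  fix v
  let ?f = "\<lambda>j. if j < i then j else Suc j"
  let ?A = "{j. j < length (omit i ys) \<and> omit i ys ! j = v}" and ?B = "{j. j < length ys \<and> ys ! j = v}"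
  have l: "length (omit i ys) = Suc p" using assms by (simp add: length_omit)
  have nth: "omit i ys ! j = ys ! ?f j" if "j < Suc p" for j
    using nth_omit[of i ys j] assms that by simp
  have "(\<Sum>j\<in>?B. simplical_face i b j) = (\<Sum>j\<in>?f ` ?A. simplical_face i b j)"
  proof (rule sum.mono_neutral_right)
    show "?f ` ?A \<subseteq> ?B" using nth l assms by (auto split: if_splits)
    show "\<forall>j\<in>?B - ?f ` ?A. simplical_face i b j = 0"
    proof
      fix j assume j: "j \<in> ?B - ?f ` ?A"
      have "j = i"
      proof (rule ccontr)
        assume "j \<noteq> i"
        define k where "k = (if j < i then j else j - 1)"
        have "?f k = j" "k < Suc p" using \<open>j \<noteq> i\<close> j assms by (auto simp: k_def)
        then have "j \<in> ?f ` ?A" using j l nth[of k] by (intro image_eqI[of _ _ k]) auto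
        then show False using j by blast
      qed
      then show "simplical_face i b j = 0" by (simp add: simplical_face_def)
    qed
  qed simp
  also have "\<dots> = (\<Sum>j\<in>?A. simplical_face i b (?f j))"
    by (rule sum.reindex[unfolded o_def]) (auto simp: inj_on_def split: if_splits)
  also have "\<dots> = (\<Sum>j\<in>?A. b j)" by (intro sum.cong) (auto simp: simplical_face_def)
  finally show "vertex_map ys (simplical_face i b) v = vertex_map (omit i ys) b v"
    by (simp add: vertex_map_def)
qed

lemma singular_face_affine:
  assumes "length ys = Suc (Suc p)" "i \<le> Suc p"
  shows "singular_face (Suc p) i (affine_simplex (Suc p) ys) = affine_simplex p (omit i ys)"
  using assms unfolding affine_simplex_def
  by (subst singular_face_restrict) (simp_all add: singular_face_def o_def vertex_map_face)

lemma chain_boundary_affine: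
  assumes "Poly_Mapping.keys c \<subseteq> {ys. length ys = Suc (Suc p)}"
  shows "chain_boundary (Suc p) (affine_chain (Suc p) c) = affine_chain p (boundary c)"
proof (rule frag_linear_eq[OF assms])
  fix ys :: "'a list" assume ys: "ys \<in> {ys. length ys = Suc (Suc p)}"
  then show "chain_boundary (Suc p) (affine_chain (Suc p) (frag_of ys)) = affine_chain p (boundary (frag_of ys))"
    by (simp add: chain_boundary_of tuple_boundary_def affine_chain_def frag_extend_sum o_def frag_extend_cmul
        lessThan_Suc_atMost singular_face_affine del: sum.atMost_Suc)
qed (simp_all add: affine_chain_diff chain_boundary_diff frag_extend_diff)

lemma singular_chain_affine:
  assumes K: "simplicial_complex K" and c: "Poly_Mapping.keys c \<subseteq> S"
    and S: "\<And>ys. ys \<in> S \<Longrightarrow> length ys = Suc p \<and> set ys \<in> K \<and> face (set ys) \<subseteq> A"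
  shows "singular_chain p (subtopology (realisation K) A) (affine_chain p c)"
  unfolding affine_chain_def
proof (rule singular_chain_extend)
  fix ys assume "ys \<in> Poly_Mapping.keys c"
  then have ys: "length ys = Suc p" "set ys \<in> K" "face (set ys) \<subseteq> A" using c S by auto
  then show "singular_chain p (subtopology (realisation K) A) (frag_of (affine_simplex p ys))"
    using singular_simplex_affine[OF ys(1) K ys(2)] vertex_map_in_face[OF ys(1)]
    by (auto simp: singular_chain_of singular_simplex_subtopology affine_simplex_def)
qed

section \<open>Chains in contractible spaces\<close>

text \<open>This is the vanishing of reduced homology, brought to chain level. In degree 0 being
  reduced means that the coefficients sum to zero; the sum is encoded in the free group on one
  generator.\<close>

lemma contractible_cycle_bounds:
  assumes Y: "contractible_space Y" and c: "singular_chain p Y c" "chain_boundary p c = 0"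
    and aug: "p = 0 \<Longrightarrow> frag_extend (\<lambda>_. frag_of ()) c = 0"
  shows "\<exists>d. singular_chain (Suc p) Y d \<and> chain_boundary (Suc p) d = c"
proof -
  let ?H = "homologous_rel_set p Y {} c"
  let ?pt = "discrete_topology {()}"
  have cyc: "singular_relcycle p Y {} c" using c by (simp add: singular_cycle)
  then have H: "?H \<in> carrier (homology_group (int p) Y)" by (simp add: carrier_relative_homology_group)
  have "?H \<in> carrier (reduced_homology_group (int p) Y)"
  proof (cases "p = 0")
    case True
    have cont: "continuous_map Y ?pt (\<lambda>x. ())" by simp
    define k where "k = (\<lambda>_::nat \<Rightarrow> real. ())"
    \<comment> \<open>The one-point space has a single 0-simplex, so the map to it sees only the sum
      of the coefficients.\<close>
    have "chain_map 0 (\<lambda>x. ()) c = frag_extend (\<lambda>_. frag_of k) (frag_extend (\<lambda>_. frag_of ()) c)"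
      using subset_UNIV
      by (induction c rule: frag_induction)
         (auto simp: chain_map_diff frag_extend_diff simplex_map_def o_def k_def fun_eq_iff intro!: arg_cong[of _ _ frag_of])
    then have "chain_map p (\<lambda>x. ()) c = 0" using aug True by simp
    then have "hom_induced (int p) Y {} ?pt {} (\<lambda>x. ()) ?H = homologous_rel_set p ?pt {} 0"
      using hom_induced_chain_map[OF cont _ cyc, of "{}"] by simp
    also have "\<dots> = \<one>\<^bsub>homology_group (int p) ?pt\<^esub>"
      by (simp add: homologous_rel_set_eq_relboundary)
    finally show ?thesis using H by (simp add: carrier_reduced_homology_group kernel_def)
  next
    case False
    then show ?thesis using H by (simp add: un_reduced_homology_group)
  qed
  moreover have "trivial_group (reduced_homology_group (int p) Y)"
    by (rule trivial_reduced_homology_group_contractible_space[OF Y])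
  ultimately have "?H = \<one>\<^bsub>homology_group (int p) Y\<^esub>"
    by (simp add: trivial_group_def one_reduced_homology_group)
  then have "singular_relboundary p Y {} c" by (simp add: homologous_rel_set_eq_relboundary)
  then show ?thesis by (simp add: singular_boundary)
qed

section \<open>Iterated subdivision\<close>

abbreviation iterated_subdivision :: "nat \<Rightarrow> nat \<Rightarrow> 'a chain \<Rightarrow> 'a chain" where
  "iterated_subdivision m p \<equiv> singular_subdivision p ^^ m"

lemma singular_chain_iterated_subdivision:
  "singular_chain p Y c \<Longrightarrow> singular_chain p Y (iterated_subdivision m p c)"
  by (induction m) (auto intro: singular_chain_singular_subdivision)

lemma chain_boundary_iterated_subdivision:
  "singular_chain p Y c \<Longrightarrow> chain_boundary p (iterated_subdivision m p c) = iterated_subdivision m (p - 1) (chain_boundary p c)"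
  by (induction m) (simp_all add: chain_boundary_singular_subdivision[OF singular_chain_iterated_subdivision])

lemma iterated_subdivision_zero: "singular_chain 0 Y c \<Longrightarrow> iterated_subdivision m 0 c = c"
  by (induction m) (auto simp: singular_subdivision_zero)

lemma homologous_iterated_subdivision:
  assumes "singular_relcycle p Y S c"
  shows "homologous_rel p Y S (iterated_subdivision m p c) c"
proof (induction m)
  case (Suc m)
  then have "singular_relcycle p Y S (iterated_subdivision m p c)"
    using assms homologous_rel_singular_relcycle by blast
  from homologous_rel_trans[OF Suc homologous_rel_singular_subdivision[OF this]] show ?case by simp
qed simp

section \<open>Neighbourhoods of cones\<close>

context point_lattice
begin

text \<open>The open star of the subcomplex of chains below \<open>U\<close>. The parameter
  \<open>P\<close> is later \<open>L\<close> or \<open>L - {X}\<close>, so \<open>CT\<close> and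
  \<open>T\<close> share the same contraction.\<close>

definition near :: "'a set set \<Rightarrow> 'a set \<Rightarrow> ('a set \<Rightarrow> real) set" where
  "near P U = {t \<in> polyhedron (order_complex P). \<exists>V\<in>supp t. V \<subseteq> U}"

lemma openin_near: "openin (realisation (order_complex P)) (near P U)"
  unfolding openin_realisation
proof (intro conjI ballI)
  show "near P U \<subseteq> (\<Union>\<sigma>\<in>order_complex P. face \<sigma>)" by (auto simp: near_def polyhedron_def)
  fix \<sigma> assume \<sigma>: "\<sigma> \<in> order_complex P"
  have fin: "finite {V \<in> \<sigma>. V \<subseteq> U}" using \<sigma> by (auto simp: order_complex_iff)
  have "near P U \<inter> face \<sigma> = {t \<in> topspace (face_topology \<sigma>). (\<Sum>V | V \<in> \<sigma> \<and> V \<subseteq> U. t V) \<in> {0<..}}"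
  proof -
    have "(\<exists>V\<in>supp t. V \<subseteq> U) \<longleftrightarrow> 0 < (\<Sum>V | V \<in> \<sigma> \<and> V \<subseteq> U. t V)" if "t \<in> face \<sigma>" for t
    proof -
      have nn: "0 \<le> t V" for V using that by (simp add: face_def)
      have "0 < (\<Sum>V | V \<in> \<sigma> \<and> V \<subseteq> U. t V) \<longleftrightarrow> (\<Sum>V | V \<in> \<sigma> \<and> V \<subseteq> U. t V) \<noteq> 0"
        using sum_nonneg[of _ t] nn by (metis (no_types, lifting) order_less_le)
      also have "\<dots> \<longleftrightarrow> (\<exists>V. V \<in> \<sigma> \<and> V \<subseteq> U \<and> t V \<noteq> 0)"
        using fin nn by (subst sum_nonneg_eq_0_iff) auto
      also have "\<dots> \<longleftrightarrow> (\<exists>V\<in>supp t. V \<subseteq> U)" using supp_subset[OF that] by blast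
      finally show ?thesis by simp
    qed
    then show ?thesis using \<sigma> by (auto simp: near_def polyhedron_def)
  qed
  then show "openin (face_topology \<sigma>) (near P U \<inter> face \<sigma>)"
    using openin_continuous_map_preimage[OF continuous_map_sum[OF fin continuous_map_face_coordinate], of "{0<..}" \<sigma>]
    by (simp flip: open_openin)
qed

definition cone_weight :: "'a set \<Rightarrow> real \<Rightarrow> ('a set \<Rightarrow> real) \<Rightarrow> 'a set \<Rightarrow> real" where
  "cone_weight U a t V = (if V \<subseteq> U then t V else (1 - a) * t V)"

text \<open>In the first half the vertices not below \<open>U\<close> are faded out and the rest is
  renormalised; the denominator stays positive because a point near \<open>U\<close> has mass below
  \<open>U\<close>. In the second half a straight line leads to the vertex \<open>U\<close>, which
  is comparable with all that is left.\<close>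

definition cone_contraction :: "'a set set \<Rightarrow> 'a set \<Rightarrow> real \<Rightarrow> ('a set \<Rightarrow> real) \<Rightarrow> 'a set \<Rightarrow> real" where
  "cone_contraction \<sigma> U s t V =
     (1 - max 0 (2 * s - 1)) * (cone_weight U (min 1 (2 * s)) t V / (\<Sum>W\<in>\<sigma>. cone_weight U (min 1 (2 * s)) t W))
     + max 0 (2 * s - 1) * (if V = U then 1 else 0)"

lemma cone_contraction_props:
  assumes P: "P \<subseteq> L" "U \<in> P" and t: "t \<in> near P U" "t \<in> face \<sigma>" and \<sigma>: "\<sigma> \<in> order_complex P" and s: "s \<in> {0..1}"
  shows "cone_contraction \<sigma> U s t \<in> near P U" "supp (cone_contraction \<sigma> U s t) \<subseteq> insert U \<sigma>"
    "(\<Sum>W\<in>\<sigma>. cone_weight U (min 1 (2 * s)) t W) > 0"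
proof -
  define a lam where "a = min 1 (2 * s)" and "lam = max 0 (2 * s - 1)"
  have a: "0 \<le> a" "a \<le> 1" and lam: "0 \<le> lam" "lam \<le> 1" "lam > 0 \<Longrightarrow> a = 1" using s by (auto simp: a_def lam_def)
  have fin: "finite \<sigma>" using \<sigma> by (auto simp: order_complex_iff)
  have nn: "0 \<le> t V" for V using t(2) by (simp add: face_def)
  have out: "t V = 0" if "V \<notin> \<sigma>" for V using t(2) that by (simp add: face_def)
  have w: "0 \<le> cone_weight U a t V" for V using nn a by (auto simp: cone_weight_def)
  obtain V0 where V0: "t V0 \<noteq> 0" "V0 \<subseteq> U" using t(1) by (auto simp: near_def)
  have "V0 \<in> \<sigma>" using V0 out by blast
  have "0 < cone_weight U a t V0" using V0 nn[of V0] by (simp add: cone_weight_def)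
  also have "\<dots> \<le> (\<Sum>W\<in>\<sigma>. cone_weight U a t W)" using \<open>V0 \<in> \<sigma>\<close> fin w by (intro member_le_sum) auto
  finally have D: "(\<Sum>W\<in>\<sigma>. cone_weight U a t W) > 0" .
  then show "(\<Sum>W\<in>\<sigma>. cone_weight U (min 1 (2 * s)) t W) > 0" by (simp add: a_def)
  let ?D = "\<Sum>W\<in>\<sigma>. cone_weight U a t W"
  have H: "cone_contraction \<sigma> U s t V = (1 - lam) * (cone_weight U a t V / ?D) + lam * (if V = U then 1 else 0)" for V
    by (simp add: cone_contraction_def a_def lam_def)
  show sub: "supp (cone_contraction \<sigma> U s t) \<subseteq> insert U \<sigma>"
  proof
    fix V assume "V \<in> supp (cone_contraction \<sigma> U s t)"
    then have "cone_contraction \<sigma> U s t V \<noteq> 0" by simp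
    moreover have "cone_weight U a t V = 0" if "V \<notin> \<sigma>" using out[OF that] by (simp add: cone_weight_def)
    ultimately show "V \<in> insert U \<sigma>" unfolding H by (cases "V = U"; cases "V \<in> \<sigma>") simp_all
  qed
  have nonneg: "0 \<le> cone_contraction \<sigma> U s t V" for V
    unfolding H using lam w D by (auto intro!: add_nonneg_nonneg mult_nonneg_nonneg divide_nonneg_nonneg)
  have "sum (cone_contraction \<sigma> U s t) (supp (cone_contraction \<sigma> U s t)) = sum (cone_contraction \<sigma> U s t) (insert U \<sigma>)"
    using fin sub by (intro sum.mono_neutral_left) auto
  also have "\<dots> = (1 - lam) * ((\<Sum>V\<in>insert U \<sigma>. cone_weight U a t V) / ?D) + lam * (\<Sum>V\<in>insert U \<sigma>. if V = U then 1 else 0)"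
    unfolding H sum.distrib sum_distrib_left[symmetric] sum_divide_distrib[symmetric] ..
  also have "(\<Sum>V\<in>insert U \<sigma>. cone_weight U a t V) = ?D"
    using fin out by (intro sum.mono_neutral_right) (auto simp: cone_weight_def)
  finally have sum1: "sum (cone_contraction \<sigma> U s t) (supp (cone_contraction \<sigma> U s t)) = 1"
    using D fin by simp
  have comparable: "V \<subseteq> W \<or> W \<subseteq> V" if "V \<in> \<sigma>" "W \<in> \<sigma>" for V W using \<sigma> that by (auto simp: order_complex_iff)
  \<comment> \<open>Once \<open>lam\<close> is positive, the fading is complete: old vertices in the
    support are below \<open>U\<close>, so the new vertex \<open>U\<close> does not spoil the
    chain.\<close>
  have sp: "V \<in> \<sigma> \<and> lam < 1 \<and> (lam > 0 \<longrightarrow> V \<subseteq> U) \<or> (V = U \<and> lam > 0)"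
    if "cone_contraction \<sigma> U s t V \<noteq> 0" for V
  proof (cases "V = U \<and> lam > 0")
    case False
    then have "lam * (if V = U then 1 else 0) = 0" using lam(1) by (cases "V = U") simp_all
    then have "(1 - lam) * (cone_weight U a t V / ?D) \<noteq> 0" using that unfolding H by (metis add_0_right)
    then have c: "lam \<noteq> 1" "cone_weight U a t V \<noteq> 0" by auto
    then have "V \<in> \<sigma>" "lam > 0 \<longrightarrow> V \<subseteq> U" using out lam(3) by (auto simp: cone_weight_def split: if_splits)
    then show ?thesis using c lam(2) by auto
  qed simp
  have chain: "V \<subseteq> W \<or> W \<subseteq> V" if "cone_contraction \<sigma> U s t V \<noteq> 0" "cone_contraction \<sigma> U s t W \<noteq> 0" for V W
    using sp[OF that(1)] sp[OF that(2)]
  proof (elim disjE conjE)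
    assume "V \<in> \<sigma>" "W \<in> \<sigma>" then show ?thesis by (rule comparable)
  qed auto
  have "supp (cone_contraction \<sigma> U s t) \<noteq> {}" using sum1 by (metis sum.empty zero_neq_one)
  then have oc: "supp (cone_contraction \<sigma> U s t) \<in> order_complex P"
    using finite_subset[OF sub] fin sub P \<sigma> chain unfolding order_complex_iff by auto
  have "\<exists>V\<in>supp (cone_contraction \<sigma> U s t). V \<subseteq> U"
  proof (cases "lam > 0")
    case True
    have "cone_contraction \<sigma> U s t U > 0"
      unfolding H using True lam w[of U] D by (auto intro!: add_nonneg_pos mult_nonneg_nonneg divide_nonneg_nonneg)
    then show ?thesis by force
  next
    case False
    then have "lam = 0" using lam(1) by simp
    then have "cone_contraction \<sigma> U s t V0 = cone_weight U a t V0 / ?D" unfolding H by simp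
    then have "cone_contraction \<sigma> U s t V0 > 0"
      using divide_pos_pos[OF \<open>0 < cone_weight U a t V0\<close> D] by (simp only:)
    then show ?thesis using V0(2) by (intro bexI[of _ V0]) auto
  qed
  then show "cone_contraction \<sigma> U s t \<in> near P U"
    unfolding near_def using polyhedronI[OF simplicial_complex_order_complex nonneg sum1 oc] by blast
qed

lemma contractible_near:
  assumes P: "P \<subseteq> L" "U \<in> P"
  shows "contractible_space (subtopology (realisation (order_complex P)) (near P U))"
proof -
  let ?W = "realisation (order_complex P)" and ?N = "near P U"
  note oc = simplicial_complex_order_complex[of P]
  define H where "H = (\<lambda>(s,t). cone_contraction (supp t) U s t)"
  have H_eq: "H (s,t) = cone_contraction \<sigma> U s t" if \<sigma>: "\<sigma> \<in> order_complex P" and t: "t \<in> face \<sigma>" for \<sigma> s t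
  proof -
    have fin: "finite \<sigma>" using \<sigma> by (auto simp: order_complex_iff)
    have "(\<Sum>W\<in>supp t. cone_weight U a t W) = (\<Sum>W\<in>\<sigma>. cone_weight U a t W)" for a
      using fin supp_subset[OF t] by (intro sum.mono_neutral_left) (auto simp: cone_weight_def)
    then show ?thesis by (simp add: H_def cone_contraction_def fun_eq_iff)
  qed
  have "continuous_map (prod_topology unit_interval (subtopology ?W ?N)) ?W H"
  proof (rule continuous_map_prod_realisation_open[OF openin_near])
    fix \<sigma> assume \<sigma>: "\<sigma> \<in> order_complex P"
    let ?Y = "prod_topology unit_interval (subtopology (face_topology \<sigma>) ?N)"
    have fin: "finite (insert U \<sigma>)" "finite \<sigma>" using \<sigma> by (auto simp: order_complex_iff)
    have cont: "continuous_map ?Y ?W (\<lambda>y. cone_contraction \<sigma> U (fst y) (snd y))"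
    proof (rule continuous_map_into_realisation[OF oc _ fin(1)])
      fix y assume "y \<in> topspace ?Y"
      then have "snd y \<in> near P U" "snd y \<in> face \<sigma>" "fst y \<in> {0..1}" by auto
      note props = cone_contraction_props(1,2)[OF P this(1,2) \<sigma> this(3)]
      show "cone_contraction \<sigma> U (fst y) (snd y) \<in> polyhedron (order_complex P) \<and>
          supp (cone_contraction \<sigma> U (fst y) (snd y)) \<subseteq> insert U \<sigma>"
        using props(1) props(2) by (simp add: near_def)
    next
      fix V
      have t: "continuous_map ?Y euclideanreal (\<lambda>y. snd y W)" for W
        using continuous_map_compose[OF continuous_map_snd continuous_map_from_subtopology[OF continuous_map_face_coordinate]]
        by (simp add: o_def)
      have s: "continuous_map ?Y euclideanreal fst"
        using continuous_map_fst continuous_map_into_fulltopology by blast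
      have w: "continuous_map ?Y euclideanreal (\<lambda>y. cone_weight U (min 1 (2 * fst y)) (snd y) W)" for W
        unfolding cone_weight_def by (cases "W \<subseteq> U") (auto intro!: continuous_intros s t)
      show "continuous_map ?Y euclideanreal (\<lambda>y. cone_contraction \<sigma> U (fst y) (snd y) V)"
        unfolding cone_contraction_def
      proof (intro continuous_intros w s fin)
        fix y assume "y \<in> topspace ?Y"
        then show "(\<Sum>W\<in>\<sigma>. cone_weight U (min 1 (2 * fst y)) (snd y) W) \<noteq> 0"
          using cone_contraction_props(3)[OF P _ _ \<sigma>, of "snd y" "fst y"] by auto
      qed simp_all
    qed
    show "continuous_map ?Y ?W H"
      by (rule continuous_map_eq[OF cont]) (use H_eq[OF \<sigma>] in auto)
  qed
  moreover have "H (s,t) \<in> ?N" if "s \<in> {0..1}" "t \<in> ?N" for s t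
  proof -
    have "supp t \<in> order_complex P" "t \<in> face (supp t)" using that(2) polyhedron_iff[OF oc] by (auto simp: near_def)
    then show ?thesis using cone_contraction_props(1)[OF P that(2) _ _ that(1)] by (simp add: H_def)
  qed
  ultimately have contH: "continuous_map (prod_topology unit_interval (subtopology ?W ?N)) (subtopology ?W ?N) H"
    by (auto simp: continuous_map_in_subtopology)
  have "homotopic_with (\<lambda>x. True) (subtopology ?W ?N) (subtopology ?W ?N) id (\<lambda>x V. if V = U then 1 else 0)"
  proof (subst homotopic_with, simp, intro exI[of _ H] conjI ballI)
    fix t assume "t \<in> topspace (subtopology ?W ?N)"
    then have t: "t \<in> polyhedron (order_complex P)" by simp
    have w: "cone_weight U 0 t = t" by (auto simp: cone_weight_def fun_eq_iff)
    show "H (0, t) = id t" using polyhedronD(5)[OF t oc] by (simp add: H_def cone_contraction_def w fun_eq_iff)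
    show "H (1, t) = (\<lambda>V. if V = U then 1 else 0)" by (auto simp: H_def cone_contraction_def)
  qed (use contH in auto)
  then show ?thesis unfolding contractible_space_def by blast
qed

end

section \<open>Comparing tuples of points with singular chains\<close>

context point_lattice
begin

abbreviation CT :: "('a set \<Rightarrow> real) topology" where "CT \<equiv> realisation (order_complex L)"
abbreviation T :: "('a set \<Rightarrow> real) set" where "T \<equiv> polyhedron (order_complex (L - {X}))"

lemma subtopology_T: "subtopology CT T = realisation (order_complex (L - {X}))"
  by (rule subtopology_realisation) (auto simp: simplicial_complex_order_complex order_complex_iff)

lemma T_subset: "T \<subseteq> polyhedron (order_complex L)"
  by (rule polyhedron_mono) (auto simp: order_complex_iff)

text \<open>The lowest vertex of the support; it alone decides near which elements the point lies
  (\<open>near_apex\<close>).\<close>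

definition apex :: "('a set \<Rightarrow> real) \<Rightarrow> 'a set" where
  "apex t = (SOME V. V \<in> supp t \<and> (\<forall>W\<in>supp t. V \<subseteq> W))"

lemma apex:
  assumes "t \<in> polyhedron (order_complex L)"
  shows "apex t \<in> L" "apex t \<in> supp t" "\<And>W. W \<in> supp t \<Longrightarrow> apex t \<subseteq> W"
proof -
  have s: "supp t \<subseteq> L" "finite (supp t)" "supp t \<noteq> {}" "\<And>U V. U \<in> supp t \<Longrightarrow> V \<in> supp t \<Longrightarrow> U \<subseteq> V \<or> V \<subseteq> U"
    using polyhedronD(1)[OF assms complex] by (auto simp: order_complex_iff)
  obtain V where V: "V \<in> supp t" "\<And>W. W \<in> supp t \<Longrightarrow> rk V \<le> rk W"
  proof -
    have "Min (rk ` supp t) \<in> rk ` supp t" using s(2,3) by (intro Min_in) auto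
    then obtain V where "V \<in> supp t" "rk V = Min (rk ` supp t)" by auto
    then show ?thesis using that[of V] s(2) by simp
  qed
  have "V \<subseteq> W" if W: "W \<in> supp t" for W
  proof (rule ccontr)
    assume "\<not> V \<subseteq> W"
    then have "W \<subset> V" using s(4)[OF V(1) W] by blast
    then show False using rank_strict[of W V] V(2)[OF W] V(1) W s(1) by auto
  qed
  then have "\<exists>V. V \<in> supp t \<and> (\<forall>W\<in>supp t. V \<subseteq> W)" using V(1) by blast
  from someI_ex[OF this] show *: "apex t \<in> supp t" "\<And>W. W \<in> supp t \<Longrightarrow> apex t \<subseteq> W"
    unfolding apex_def by blast+
  then show "apex t \<in> L" using s(1) by blast
qed

lemma near_apex: "t \<in> polyhedron (order_complex L) \<Longrightarrow> t \<in> near L U \<longleftrightarrow> apex t \<subseteq> U"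
  using apex[of t] unfolding near_def by (blast dest: subset_trans)

lemma near_T: "near (L - {X}) U = T \<inter> near L U"
  using T_subset by (auto simp: near_def)

abbreviation corner :: "nat \<Rightarrow> nat \<Rightarrow> real" where
  "corner i \<equiv> (\<lambda>j. if j = i then 1 else 0)"

text \<open>Only the corners of a singular simplex enter, so passing to faces deletes entries and a
  chain map results. If the whole simplex lies near \<open>U\<close>, all the chosen points are
  below \<open>U\<close>.\<close>

definition corner_points :: "nat \<Rightarrow> ((nat \<Rightarrow> real) \<Rightarrow> 'a set \<Rightarrow> real) \<Rightarrow> 'a set list" where
  "corner_points p s = map (\<lambda>i. pt (apex (s (corner i)))) [0..<Suc p]"

definition corner_chain :: "nat \<Rightarrow> ('a set \<Rightarrow> real) chain \<Rightarrow> 'a set list \<Rightarrow>\<^sub>0 int" where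
  "corner_chain p = frag_extend (\<lambda>s. frag_of (corner_points p s))"

lemma corner_chain_of [simp]: "corner_chain p (frag_of s) = frag_of (corner_points p s)"
  by (simp add: corner_chain_def)

lemma corner_chain_diff: "corner_chain p (a - b) = corner_chain p a - corner_chain p b"
  by (simp add: corner_chain_def frag_extend_diff)

lemma corner_points_face:
  assumes "k \<le> Suc p" shows "corner_points p (singular_face (Suc p) k s) = omit k (corner_points (Suc p) s)"
proof (rule nth_equalityI)
  show "length (corner_points p (singular_face (Suc p) k s)) = length (omit k (corner_points (Suc p) s))"
    using assms by (simp add: corner_points_def length_omit)
  fix j assume "j < length (corner_points p (singular_face (Suc p) k s))"
  then have j: "j < Suc p" by (simp add: corner_points_def)
  have "simplical_face k (corner j) = corner (if j < k then j else Suc j)"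
    by (auto simp: simplical_face_def fun_eq_iff)
  moreover have "corner j \<in> standard_simplex p" using j by simp
  ultimately have "singular_face (Suc p) k s (corner j) = s (corner (if j < k then j else Suc j))"
    by (simp add: singular_face_def)
  then show "corner_points p (singular_face (Suc p) k s) ! j = omit k (corner_points (Suc p) s) ! j"
    using j assms by (subst nth_omit) (auto simp: corner_points_def simp del: upt_Suc)
qed

lemma boundary_corner_chain:
  "boundary (corner_chain (Suc p) c) = corner_chain p (chain_boundary (Suc p) c)"
  using subset_UNIV
proof (induction c rule: frag_induction)
  case (one s)
  have "tuple_boundary (corner_points (Suc p) s) =
      (\<Sum>k\<le>Suc p. frag_cmul ((-1) ^ k) (frag_of (corner_points p (singular_face (Suc p) k s))))"
    unfolding tuple_boundary_def
    by (intro sum.cong) (auto simp: corner_points_def corner_points_face[symmetric, unfolded corner_points_def] less_Suc_eq_le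
        simp del: upt_Suc)
  then show ?case
    by (simp add: chain_boundary_of corner_chain_def frag_extend_sum o_def frag_extend_cmul del: sum.atMost_Suc)
qed (auto simp: corner_chain_diff chain_boundary_diff frag_extend_diff corner_chain_def)

lemma pt_points: "U \<in> L \<Longrightarrow> pt U \<in> points"
  using pt[of U] by (simp add: points_def)

lemma corner_points_near:
  assumes s: "singular_simplex p CT s" "\<And>x. x \<in> standard_simplex p \<Longrightarrow> apex (s x) \<subseteq> U"
  shows "corner_points p s \<in> point_lists (Suc p) U"
proof -
  have "pt (apex (s (corner i))) \<in> points \<and> pt (apex (s (corner i))) \<subseteq> U" if "i \<le> p" for i
  proof -
    have c: "corner i \<in> standard_simplex p" using that by simp
    then have "s (corner i) \<in> polyhedron (order_complex L)"
      using s(1) by (auto simp: singular_simplex_def continuous_map_def)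
    then have "apex (s (corner i)) \<in> L" by (rule apex)
    then show ?thesis using pt_points pt(3) s(2)[OF c] by blast
  qed
  then show ?thesis by (auto simp: point_lists_def corner_points_def less_Suc_eq_le simp del: upt_Suc)
qed

lemma keys_corner_chain:
  assumes c: "singular_chain p (subtopology CT (near L U)) c"
  shows "Poly_Mapping.keys (corner_chain p c) \<subseteq> point_lists (Suc p) U"
  unfolding corner_chain_def
proof (rule keys_frag_extend_subset[OF order_refl])
  fix s assume "s \<in> Poly_Mapping.keys c"
  then have s: "singular_simplex p CT s" "s ` standard_simplex p \<subseteq> near L U"
    using c by (auto simp: singular_chain_def singular_simplex_subtopology subset_iff)
  have "apex (s x) \<subseteq> U" if "x \<in> standard_simplex p" for x
    using s(2) that near_apex[of "s x" U] by (auto simp: near_def image_subset_iff)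
  then show "Poly_Mapping.keys (frag_of (corner_points p s)) \<subseteq> point_lists (Suc p) U"
    using corner_points_near[OF s(1)] by simp
qed

text \<open>The barycentric subdivision of a tuple, with spans as barycentres.\<close>

definition flag_chain :: "nat \<Rightarrow> ('a set list \<Rightarrow>\<^sub>0 int) \<Rightarrow> ('a set \<Rightarrow> real) chain" where
  "flag_chain p c = affine_chain p (subdivide (Suc p) c)"

lemma flag_chain_diff: "flag_chain p (a - b) = flag_chain p a - flag_chain p b"
  by (simp add: flag_chain_def affine_chain_diff subdivide_diff del: subdivide.simps)

lemma flag_chain_add: "flag_chain p (a + b) = flag_chain p a + flag_chain p b"
  by (simp add: flag_chain_def affine_chain_add subdivide_add del: subdivide.simps)

lemma tuples_top: "Poly_Mapping.keys c \<subseteq> point_lists k U \<Longrightarrow> Poly_Mapping.keys c \<subseteq> tuples k U"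
  using point_lists_tuples by blast

lemma face_flag:
  assumes "ys \<in> flag_lists (Suc p) U"
  shows "length ys = Suc p" "set ys \<in> order_complex L" "face (set ys) \<subseteq> near L U" "U \<in> L - {X} \<Longrightarrow> face (set ys) \<subseteq> T"
proof -
  show l: "length ys = Suc p" using assms by (simp add: flag_lists_def)
  have c: "is_chain (set ys)" "\<And>y. y \<in> set ys \<Longrightarrow> y \<subseteq> U" "set ys \<noteq> {}" using assms by (auto simp: flag_lists_def)
  then show oc: "set ys \<in> order_complex L" by (simp add: is_chain_def order_complex_iff)
  show "face (set ys) \<subseteq> near L U"
  proof
    fix t assume t: "t \<in> face (set ys)"
    then obtain V where "V \<in> supp t" using face_ne by blast
    then have "V \<subseteq> U" using supp_subset[OF t] c(2) by blast
    then show "t \<in> near L U" using \<open>V \<in> supp t\<close> t oc by (auto simp: near_def polyhedron_def)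
  qed
  show "face (set ys) \<subseteq> T" if "U \<in> L - {X}"
  proof -
    have "X \<notin> set ys" using c(2)[of X] that le_top[of U] by auto
    then have "set ys \<subseteq> L - {X}" using c(1) unfolding is_chain_def by blast
    then have "set ys \<in> order_complex (L - {X})" using oc by (simp add: order_complex_iff)
    then show ?thesis by (auto simp: polyhedron_def)
  qed
qed

lemma singular_chain_flag_chain:
  assumes c: "Poly_Mapping.keys c \<subseteq> tuples (Suc p) U" and U: "U \<in> L"
  shows "singular_chain p (subtopology CT (near L U)) (flag_chain p c)"
    "U \<noteq> X \<Longrightarrow> singular_chain p (subtopology CT (T \<inter> near L U)) (flag_chain p c)"
  unfolding flag_chain_def
  by (rule singular_chain_affine[OF complex keys_subdivide[OF c U]], use U face_flag in blast)+

lemma chain_boundary_flag_chain: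
  assumes c: "Poly_Mapping.keys c \<subseteq> point_lists (Suc (Suc p)) U" and U: "U \<in> L"
  shows "chain_boundary (Suc p) (flag_chain (Suc p) c) = flag_chain p (boundary c)"
proof -
  have "Poly_Mapping.keys (subdivide (Suc (Suc p)) c) \<subseteq> {ys. length ys = Suc (Suc p)}"
    using keys_subdivide[OF tuples_top[OF c] U] by (auto simp: flag_lists_def simp del: subdivide.simps)
  moreover have "Poly_Mapping.keys c \<subseteq> {ys. length ys = Suc (Suc p)}" using c by (auto simp: point_lists_def)
  ultimately show ?thesis
    unfolding flag_chain_def by (simp only: chain_boundary_affine boundary_subdivide)
qed

lemma near_top: "near L X = polyhedron (order_complex L)"
proof -
  have "\<exists>V\<in>supp t. V \<subseteq> X" if "t \<in> polyhedron (order_complex L)" for t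
    using apex[OF that] le_top by blast
  then show ?thesis by (auto simp: near_def)
qed

lemma subtopology_near_top: "subtopology CT (near L X) = CT"
  unfolding near_top using subtopology_topspace[of CT] by simp

lemma singular_chain_flag_chain_top:
  "Poly_Mapping.keys c \<subseteq> point_lists (Suc p) X \<Longrightarrow> singular_chain p CT (flag_chain p c)"
  using singular_chain_flag_chain(1)[OF tuples_top top_in] by (simp add: subtopology_near_top)

lemma lub_point_list:
  assumes "xs \<in> point_lists (Suc k) X"
  shows "lub (set xs) \<in> L" "xs \<in> point_lists (Suc k) (lub (set xs))"
proof -
  have L: "set xs \<subseteq> L" "set xs \<noteq> {}" using assms by (auto simp: point_lists_def points_def)
  show "lub (set xs) \<in> L" by (rule lub_props(1)[OF L])
  show "xs \<in> point_lists (Suc k) (lub (set xs))"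
    using assms lub_props(2)[OF L] by (simp add: point_lists_def)
qed

lemma singular_chain_flag_chain_T:
  assumes c: "Poly_Mapping.keys c \<subseteq> point_lists (Suc p) X" and "\<And>xs. xs \<in> Poly_Mapping.keys c \<Longrightarrow> lub (set xs) \<noteq> X"
  shows "singular_chain p (subtopology CT T) (flag_chain p c)"
proof -
  have eq: "flag_chain p c = frag_extend (\<lambda>xs. flag_chain p (frag_of xs)) c"
    by (rule frag_linear_eq[OF subset_UNIV]) (simp_all add: flag_chain_diff frag_extend_diff)
  show ?thesis
    unfolding eq
  proof (rule singular_chain_extend)
    fix xs assume xs: "xs \<in> Poly_Mapping.keys c"
    then have "xs \<in> point_lists (Suc p) X" using c by blast
    note l = lub_point_list[OF this]
    have "singular_chain p (subtopology CT (T \<inter> near L (lub (set xs)))) (flag_chain p (frag_of xs))"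
      using singular_chain_flag_chain(2)[of "frag_of xs" p "lub (set xs)"] l assms(2)[OF xs] point_lists_tuples by auto
    then show "singular_chain p (subtopology CT T) (flag_chain p (frag_of xs))"
      by (rule singular_chain_mono) blast
  qed
qed

lemma boundary_point_list_proper:
  assumes c: "Poly_Mapping.keys c \<subseteq> point_lists (Suc (Suc p)) X" and n: "n = Suc p"
    and xs: "xs \<in> Poly_Mapping.keys (boundary c)"
  shows "lub (set xs) \<noteq> X"
proof -
  have "xs \<in> point_lists (Suc p) X" using keys_boundary[OF c] xs by blast
  then have xs: "length xs = Suc p" "set xs \<subseteq> points" by (auto simp: point_lists_top)
  then have "xs \<noteq> []" by auto
  from rank_lub_points[OF this xs(2)] show ?thesis using xs(1) n rank_top by auto
qed

text \<open>For positive \<open>n\<close> the boundary involves tuples of \<open>n\<close> points,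
  and their spans have rank below \<open>n\<close>, so every flag built from them avoids
  \<open>X\<close>.\<close>

lemma relcycle_flag_chain:
  assumes c: "Poly_Mapping.keys c \<subseteq> point_lists (Suc n) X"
  shows "singular_relcycle n CT T (flag_chain n c)"
  unfolding singular_relcycle
proof (intro conjI)
  show "singular_chain n CT (flag_chain n c)" by (rule singular_chain_flag_chain_top[OF c])
  show "singular_chain (n - 1) (subtopology CT T) (chain_boundary n (flag_chain n c))"
  proof (cases n)
    case 0
    then show ?thesis by (simp add: chain_boundary_def)
  next
    case (Suc p)
    have c': "Poly_Mapping.keys c \<subseteq> point_lists (Suc (Suc p)) X" using c Suc by simp
    have "singular_chain p (subtopology CT T) (flag_chain p (boundary c))"
      by (rule singular_chain_flag_chain_T[OF keys_boundary[OF c'] boundary_point_list_proper[OF c' Suc]])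
    then show ?thesis using chain_boundary_flag_chain[OF c' top_in] Suc by simp
  qed
qed

lemma relboundary_flag_chain:
  assumes "c \<in> relations" shows "singular_relboundary n CT T (flag_chain n c)"
proof -
  obtain a b where ab: "c = boundary a + b" "Poly_Mapping.keys a \<subseteq> point_lists (Suc (Suc n)) X" "Poly_Mapping.keys b \<subseteq> degenerate_lists"
    using assms by (auto simp: relations_def)
  have b: "singular_chain n (subtopology CT T) (flag_chain n b)"
    by (rule singular_chain_flag_chain_T) (use ab(3) in \<open>auto simp: degenerate_lists_def\<close>)
  have "chain_boundary (Suc n) (flag_chain (Suc n) a) = flag_chain n (boundary a)"
    using chain_boundary_flag_chain[OF ab(2) top_in] .
  then have "chain_boundary (Suc n) (flag_chain (Suc n) a) = flag_chain n c + - flag_chain n b"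
    using ab(1) by (simp add: flag_chain_add)
  then show ?thesis
    unfolding singular_relboundary_alt
    using singular_chain_flag_chain_top[OF ab(2)] b singular_chain_minus by blast
qed

lemma point_lists_degenerate:
  assumes "U \<in> L" "U \<noteq> X" shows "point_lists (Suc n) U \<subseteq> degenerate_lists"
proof
  fix xs assume xs: "xs \<in> point_lists (Suc n) U"
  then have X: "xs \<in> point_lists (Suc n) X" by (simp add: point_lists_top) (simp add: point_lists_def)
  have "set xs \<subseteq> L" "set xs \<noteq> {}" using xs by (auto simp: point_lists_def points_def)
  then have "lub (set xs) \<subseteq> U" using xs assms(1) by (intro lub_props(3)) (auto simp: point_lists_def)
  then have "lub (set xs) \<noteq> X" using le_top[OF assms(1)] assms(2) by auto
  then show "xs \<in> degenerate_lists" using X by (simp add: degenerate_lists_def)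
qed

section \<open>Small chains in \<open>T\<close>, and injectivity on classes\<close>

definition small_sets :: "('a set \<Rightarrow> real) set set" where
  "small_sets = (\<lambda>U. T \<inter> near L U) ` (L - {X})"

text \<open>A point of \<open>T\<close> is near its own apex, which is a proper element. The sets in
  question are therefore an open cover of \<open>T\<close>, and iterated subdivision refines any
  chain to it.\<close>

lemma small_subdivision:
  assumes c: "singular_chain p (subtopology CT T) c"
  obtains m where "\<And>s. s \<in> Poly_Mapping.keys (iterated_subdivision m p c) \<Longrightarrow> \<exists>U\<in>L - {X}. s ` standard_simplex p \<subseteq> T \<inter> near L U"
proof -
  have op: "openin (subtopology CT T) V" if "V \<in> small_sets" for V
    using that openin_near[of "L - {X}"] unfolding small_sets_def subtopology_T near_T[symmetric] by blast
  have cover: "topspace (subtopology CT T) \<subseteq> \<Union>small_sets"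
  proof
    fix t assume "t \<in> topspace (subtopology CT T)"
    then have t: "t \<in> T" by simp
    then have "t \<in> polyhedron (order_complex L)" using T_subset by blast
    note a = apex[OF this]
    have "supp t \<subseteq> L - {X}" using polyhedronD(1)[OF t simplicial_complex_order_complex] by (simp add: order_complex_iff)
    then have "apex t \<in> L - {X}" using a(2) by (rule subsetD)
    moreover have "t \<in> T \<inter> near L (apex t)" using t near_apex \<open>t \<in> polyhedron (order_complex L)\<close> by blast
    ultimately show "t \<in> \<Union>small_sets" unfolding small_sets_def by blast
  qed
  obtain m where m: "\<And>k f. \<lbrakk>m \<le> k; f \<in> Poly_Mapping.keys (iterated_subdivision k p c)\<rbrakk> \<Longrightarrow> \<exists>V\<in>small_sets. f \<in> standard_simplex p \<rightarrow> V"
    using sufficient_iterated_singular_subdivision_exists[OF op cover c] by blast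
  show ?thesis
  proof (rule that[of m])
    fix s assume "s \<in> Poly_Mapping.keys (iterated_subdivision m p c)"
    then obtain V where "V \<in> small_sets" "s \<in> standard_simplex p \<rightarrow> V" using m[of m s] by blast
    then show "\<exists>U\<in>L - {X}. s ` standard_simplex p \<subseteq> T \<inter> near L U"
      unfolding small_sets_def by blast
  qed
qed

text \<open>A chain bounding \<open>flag_chain n c\<close> modulo \<open>T\<close> is subdivided and
  read off at its corners. The bounding chain turns into tuples whose boundary is a relation, and
  the part in \<open>T\<close>, once small, into degenerate tuples. So the image of \<open>c\<close>
  under the composite \<theta> is a relation. As \<theta> respects spans,
  \<open>carried_endomorphism_relations\<close> brings this back to \<open>c\<close>.\<close>

lemma relations_flag_chain:
  assumes c: "Poly_Mapping.keys c \<subseteq> point_lists (Suc n) X" and rel: "singular_relboundary n CT T (flag_chain n c)"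
  shows "c \<in> relations"
proof -
  obtain d e where d: "singular_chain (Suc n) CT d" and e: "singular_chain n (subtopology CT T) e"
    and de: "chain_boundary (Suc n) d = flag_chain n c + e"
    using rel unfolding singular_relboundary_alt by blast
  \<comment> \<open>Only the part \<open>e\<close> in \<open>T\<close> has to become small. The same
    number of subdivisions is then used in all degrees, which makes \<theta> a chain map.\<close>
  obtain m where m: "\<And>s. s \<in> Poly_Mapping.keys (iterated_subdivision m n e) \<Longrightarrow> \<exists>U\<in>L - {X}. s ` standard_simplex n \<subseteq> T \<inter> near L U"
    using small_subdivision[OF e] by blast
  \<comment> \<open>Length \<open>Suc p\<close> corresponds to dimension \<open>p\<close>; in length
    0 the identity extends \<theta> over the augmentation.\<close>
  define \<theta> where "\<theta> k c = (case k of 0 \<Rightarrow> c | Suc p \<Rightarrow> corner_chain p (iterated_subdivision m p (flag_chain p c)))" for k c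
  have carrier: "Poly_Mapping.keys (\<theta> k (frag_of xs)) \<subseteq> point_lists k U" if "U \<in> L" "xs \<in> point_lists k U" for k xs U
  proof (cases k)
    case (Suc p)
    have "singular_chain p (subtopology CT (near L U)) (flag_chain p (frag_of xs))"
      by (rule singular_chain_flag_chain(1)) (use that point_lists_tuples Suc in auto)
    then show ?thesis unfolding \<theta>_def Suc
      using keys_corner_chain[OF singular_chain_iterated_subdivision] by simp
  qed (use that in \<open>simp add: \<theta>_def\<close>)
  have commute: "boundary (\<theta> (Suc k) (frag_of xs)) = \<theta> k (tuple_boundary xs)" if xs: "xs \<in> point_lists (Suc k) X" for k xs
  proof (cases k)
    case 0
    then obtain x where x: "xs = [x]" using xs by (auto simp: point_lists_def length_Suc_conv)
    have s: "flag_chain 0 (frag_of xs) = frag_of (affine_simplex 0 [lub {x}])"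
      by (simp add: flag_chain_def x tuple_boundary_Cons)
    have "singular_chain 0 CT (flag_chain 0 (frag_of xs))"
      using xs 0 by (intro singular_chain_flag_chain_top) simp
    then have "iterated_subdivision m 0 (flag_chain 0 (frag_of xs)) = flag_chain 0 (frag_of xs)"
      by (rule iterated_subdivision_zero)
    then show ?thesis
      using 0 s x by (simp add: \<theta>_def tuple_boundary_Cons corner_points_def)
  next
    case (Suc p)
    have x: "Poly_Mapping.keys (frag_of xs) \<subseteq> point_lists (Suc (Suc p)) X" using xs Suc by simp
    have "boundary (\<theta> (Suc k) (frag_of xs)) = corner_chain p (chain_boundary (Suc p) (iterated_subdivision m (Suc p) (flag_chain (Suc p) (frag_of xs))))"
      by (simp add: \<theta>_def Suc boundary_corner_chain)
    also have "\<dots> = corner_chain p (iterated_subdivision m p (chain_boundary (Suc p) (flag_chain (Suc p) (frag_of xs))))"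
      using chain_boundary_iterated_subdivision[OF singular_chain_flag_chain_top[OF x]] by simp
    also have "\<dots> = \<theta> k (tuple_boundary xs)"
      using chain_boundary_flag_chain[OF x top_in] by (simp add: \<theta>_def Suc)
    finally show ?thesis .
  qed
  have "\<theta> (Suc n) c \<in> relations"
  proof -
    have fc: "singular_chain n CT (flag_chain n c)" by (rule singular_chain_flag_chain_top[OF c])
    have "flag_chain n c = chain_boundary (Suc n) d - e" using de by simp
    then have "\<theta> (Suc n) c = corner_chain n (iterated_subdivision m n (chain_boundary (Suc n) d)) - corner_chain n (iterated_subdivision m n e)"
      by (simp add: \<theta>_def singular_subdivision_power_diff corner_chain_diff)
    also have "corner_chain n (iterated_subdivision m n (chain_boundary (Suc n) d)) = boundary (corner_chain (Suc n) (iterated_subdivision m (Suc n) d))"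
      using chain_boundary_iterated_subdivision[OF d, of m] by (simp add: boundary_corner_chain)
    finally have eq: "\<theta> (Suc n) c = boundary (corner_chain (Suc n) (iterated_subdivision m (Suc n) d)) - corner_chain n (iterated_subdivision m n e)" .
    have 1: "boundary (corner_chain (Suc n) (iterated_subdivision m (Suc n) d)) \<in> relations"
      using keys_corner_chain[of "Suc n" X] singular_chain_iterated_subdivision[OF d]
      by (intro relations_boundary) (simp add: subtopology_near_top)
    have 2: "corner_chain n (iterated_subdivision m n e) \<in> relations"
    proof (rule relations_degenerate, unfold corner_chain_def, rule keys_frag_extend_subset[OF order_refl])
      fix s assume s: "s \<in> Poly_Mapping.keys (iterated_subdivision m n e)"
      obtain U where U': "U \<in> L - {X}" "s ` standard_simplex n \<subseteq> T \<inter> near L U" using m[OF s] by (rule bexE)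
      have U: "U \<in> L" "U \<noteq> X" using U'(1) by simp_all
      have U3: "s ` standard_simplex n \<subseteq> near L U" using U'(2) by (rule le_infE)
      have "singular_simplex n (subtopology CT T) s"
        using s singular_chain_iterated_subdivision[OF e] by (auto simp: singular_chain_def)
      then have "singular_simplex n CT s" by (simp add: singular_simplex_subtopology)
      then have "singular_chain n (subtopology CT (near L U)) (frag_of s)"
        using U3 by (simp add: singular_chain_of singular_simplex_subtopology)
      from keys_corner_chain[OF this] have "Poly_Mapping.keys (frag_of (corner_points n s)) \<subseteq> point_lists (Suc n) U"
        unfolding corner_chain_of .
      then show "Poly_Mapping.keys (frag_of (corner_points n s)) \<subseteq> degenerate_lists"
        using point_lists_degenerate[OF U(1,2)] by (rule subset_trans)
    qed
    show ?thesis unfolding eq by (rule relations_diff[OF 1 2])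
  qed
  then show ?thesis
  proof (rule carried_endomorphism_relations[rotated 5])
    show "\<theta> k (a - b) = \<theta> k a - \<theta> k b" for k a b
      by (cases k) (simp_all add: \<theta>_def flag_chain_diff singular_subdivision_power_diff corner_chain_diff)
  qed (use commute carrier c in \<open>auto simp: \<theta>_def simp del: subset_iff\<close>)
qed

subsection \<open>Surjectivity\<close>

text \<open>All points of the simplex contribute, not only the corners, so the whole simplex lies
  near its span.\<close>

definition span_of :: "nat \<Rightarrow> ((nat \<Rightarrow> real) \<Rightarrow> 'a set \<Rightarrow> real) \<Rightarrow> 'a set" where
  "span_of p s = lub ((\<lambda>x. apex (s x)) ` standard_simplex p)"

text \<open>The acyclic carrier of a singular simplex.\<close>

definition carrier_of :: "nat \<Rightarrow> ((nat \<Rightarrow> real) \<Rightarrow> 'a set \<Rightarrow> real) \<Rightarrow> ('a set \<Rightarrow> real) set" where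
  "carrier_of p s = (if s ` standard_simplex p \<subseteq> T \<and> span_of p s \<noteq> X then T \<inter> near L (span_of p s) else near L X)"

lemma span_of:
  assumes "singular_simplex p CT s"
  shows "span_of p s \<in> L" "\<And>x. x \<in> standard_simplex p \<Longrightarrow> apex (s x) \<subseteq> span_of p s"
    "\<And>W. W \<in> L \<Longrightarrow> (\<And>x. x \<in> standard_simplex p \<Longrightarrow> apex (s x) \<subseteq> W) \<Longrightarrow> span_of p s \<subseteq> W"
    "\<And>x. x \<in> standard_simplex p \<Longrightarrow> s x \<in> polyhedron (order_complex L)"
proof -
  show s: "\<And>x. x \<in> standard_simplex p \<Longrightarrow> s x \<in> polyhedron (order_complex L)"
    using assms by (auto simp: singular_simplex_def continuous_map_def)
  have A: "(\<lambda>x. apex (s x)) ` standard_simplex p \<subseteq> L" "(\<lambda>x. apex (s x)) ` standard_simplex p \<noteq> {}"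
    using apex(1)[OF s] nonempty_standard_simplex by auto
  show "span_of p s \<in> L" unfolding span_of_def by (rule lub_props(1)[OF A])
  show "\<And>x. x \<in> standard_simplex p \<Longrightarrow> apex (s x) \<subseteq> span_of p s"
    unfolding span_of_def by (rule lub_props(2)[OF A]) auto
  show "\<And>W. W \<in> L \<Longrightarrow> (\<And>x. x \<in> standard_simplex p \<Longrightarrow> apex (s x) \<subseteq> W) \<Longrightarrow> span_of p s \<subseteq> W"
    unfolding span_of_def by (rule lub_props(3)[OF A]) auto
qed

lemma contractible_carrier:
  assumes "singular_simplex p CT s" shows "contractible_space (subtopology CT (carrier_of p s))"
proof (cases "s ` standard_simplex p \<subseteq> T \<and> span_of p s \<noteq> X")
  case True
  have "contractible_space (subtopology (realisation (order_complex (L - {X}))) (near (L - {X}) (span_of p s)))"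
    using span_of(1)[OF assms] True by (intro contractible_near) auto
  then show ?thesis
    using True by (simp add: carrier_of_def near_T flip: subtopology_T) (simp add: subtopology_subtopology)
next
  case False
  have "contractible_space (subtopology CT (near L X))" by (rule contractible_near[OF order_refl top_in])
  then show ?thesis unfolding carrier_of_def using False by (simp only: if_False)
qed

lemma simplex_in_carrier:
  assumes "singular_simplex p CT s" shows "singular_simplex p (subtopology CT (carrier_of p s)) s"
proof -
  have "s x \<in> near L (span_of p s)" "s x \<in> near L X" if "x \<in> standard_simplex p" for x
    using span_of(2,4)[OF assms that] near_apex near_top by blast+
  then have "s ` standard_simplex p \<subseteq> carrier_of p s" by (auto simp: carrier_of_def)
  then show ?thesis using assms by (simp add: singular_simplex_subtopology)
qed

text \<open>Faces have smaller carriers, which is what lets the homotopy be built by induction on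
  the dimension. The only switch of case is from a small simplex in \<open>T\<close> to the full
  space, and it goes in the right direction.\<close>

lemma carrier_mono:
  assumes s: "singular_simplex p CT s" and s': "singular_simplex q CT s'"
    and sub: "s' ` standard_simplex q \<subseteq> s ` standard_simplex p"
  shows "carrier_of q s' \<subseteq> carrier_of p s"
proof -
  have le: "span_of q s' \<subseteq> span_of p s"
  proof (rule span_of(3)[OF s' span_of(1)[OF s]])
    fix x assume "x \<in> standard_simplex q"
    then obtain y where "y \<in> standard_simplex p" "s' x = s y" using sub by blast
    then show "apex (s' x) \<subseteq> span_of p s" using span_of(2)[OF s] by simp
  qed
  have "near L (span_of q s') \<subseteq> near L (span_of p s)" "near L (span_of q s') \<subseteq> near L X" "near L (span_of p s) \<subseteq> near L X"
    using le span_of(1)[OF s] span_of(1)[OF s'] le_top unfolding near_def by blast+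
  moreover have "s' ` standard_simplex q \<subseteq> T \<and> span_of q s' \<noteq> X" if "s ` standard_simplex p \<subseteq> T \<and> span_of p s \<noteq> X"
  proof -
    have "s' ` standard_simplex q \<subseteq> T" using sub that by (meson subset_trans)
    moreover have "span_of q s' \<noteq> X" using that le le_top[OF span_of(1)[OF s]] by auto
    ultimately show ?thesis ..
  qed
  ultimately show ?thesis unfolding carrier_of_def by auto
qed

definition approximation :: "nat \<Rightarrow> ('a set \<Rightarrow> real) chain \<Rightarrow> ('a set \<Rightarrow> real) chain" where
  "approximation p c = flag_chain p (corner_chain p c)"

lemma approximation_diff: "approximation p (a - b) = approximation p a - approximation p b"
  by (simp add: approximation_def corner_chain_diff flag_chain_diff)

text \<open>The corner points lie below the apexes, hence below the span, and subdivision does not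
  leave the span.\<close>

lemma approximation_in_carrier:
  assumes s: "singular_simplex p CT s"
  shows "singular_chain p (subtopology CT (carrier_of p s)) (approximation p (frag_of s))"
proof -
  have "corner_points p s \<in> point_lists (Suc p) (span_of p s)"
    using corner_points_near[OF s] span_of(2)[OF s] by blast
  then have k: "Poly_Mapping.keys (frag_of (corner_points p s)) \<subseteq> tuples (Suc p) (span_of p s)"
    using point_lists_tuples by auto
  note c = singular_chain_flag_chain[OF k span_of(1)[OF s]]
  show ?thesis
  proof (cases "s ` standard_simplex p \<subseteq> T \<and> span_of p s \<noteq> X")
    case True
    then show ?thesis using c(2) by (simp add: carrier_of_def approximation_def)
  next
    case False
    have "near L (span_of p s) \<subseteq> near L X" using near_top by (auto simp: near_def)
    then show ?thesis
      unfolding carrier_of_def approximation_def corner_chain_of using False singular_chain_mono[OF c(1)] by (simp only: if_False)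
  qed
qed

lemma chain_boundary_approximation:
  assumes "singular_chain (Suc p) CT c"
  shows "chain_boundary (Suc p) (approximation (Suc p) c) = approximation p (chain_boundary (Suc p) c)"
proof -
  have "Poly_Mapping.keys (corner_chain (Suc p) c) \<subseteq> point_lists (Suc (Suc p)) X"
    using keys_corner_chain[of "Suc p" X c] assms by (simp add: subtopology_near_top)
  from chain_boundary_flag_chain[OF this top_in] show ?thesis
    by (simp add: approximation_def boundary_corner_chain)
qed

text \<open>The homotopy of the acyclic carrier argument, chosen separately for each singular
  simplex. That each choice is possible is shown together with its properties, by induction on the
  dimension.\<close>

primrec carried_homotopy :: "nat \<Rightarrow> ((nat \<Rightarrow> real) \<Rightarrow> 'a set \<Rightarrow> real) \<Rightarrow> ('a set \<Rightarrow> real) chain" where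
  "carried_homotopy 0 = (\<lambda>s. SOME d. singular_chain 1 (subtopology CT (carrier_of 0 s)) d \<and>
     chain_boundary 1 d = approximation 0 (frag_of s) - frag_of s)"
| "carried_homotopy (Suc p) = (\<lambda>s. SOME d. singular_chain (Suc (Suc p)) (subtopology CT (carrier_of (Suc p) s)) d \<and>
     chain_boundary (Suc (Suc p)) d = approximation (Suc p) (frag_of s) - frag_of s -
       frag_extend (carried_homotopy p) (chain_boundary (Suc p) (frag_of s)))"

definition lower_homotopy :: "nat \<Rightarrow> ('a set \<Rightarrow> real) chain \<Rightarrow> ('a set \<Rightarrow> real) chain" where
  "lower_homotopy p c = (case p of 0 \<Rightarrow> 0 | Suc q \<Rightarrow> frag_extend (carried_homotopy q) (chain_boundary p c))"

text \<open>The chain to be bounded is a cycle by the homotopy formula one dimension lower, and it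
  lies in the carrier of \<open>s\<close> because the faces of \<open>s\<close> have smaller
  carriers. The carrier is contractible, so the cycle bounds there.\<close>

lemma carried_homotopy:
  "singular_simplex p CT s \<Longrightarrow> singular_chain (Suc p) (subtopology CT (carrier_of p s)) (carried_homotopy p s) \<and>
     chain_boundary (Suc p) (carried_homotopy p s) = approximation p (frag_of s) - frag_of s - lower_homotopy p (frag_of s)"
proof (induction p arbitrary: s)
  case 0
  let ?c = "approximation 0 (frag_of s) - frag_of s"
  have "\<exists>d. singular_chain (Suc 0) (subtopology CT (carrier_of 0 s)) d \<and> chain_boundary (Suc 0) d = ?c"
  proof (rule contractible_cycle_bounds[OF contractible_carrier[OF 0]])
    show "singular_chain 0 (subtopology CT (carrier_of 0 s)) ?c"
      using approximation_in_carrier[OF 0] simplex_in_carrier[OF 0] by (simp add: singular_chain_diff singular_chain_of)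
    show "chain_boundary 0 ?c = 0" by (simp add: chain_boundary_def)
    \<comment> \<open>Both terms are single 0-simplices, so their coefficients cancel in the
      sum.\<close>
    show "frag_extend (\<lambda>_. frag_of ()) ?c = 0"
      by (simp add: approximation_def flag_chain_def corner_points_def tuple_boundary_Cons frag_extend_diff)
  qed
  from someI_ex[OF this] show ?case by (simp add: lower_homotopy_def)
next
  case (Suc p)
  have lin: "chain_boundary (Suc p) (frag_extend (carried_homotopy p) c) = approximation p c - c - lower_homotopy p c"
    if "singular_chain p CT c" for c
    using that unfolding singular_chain_def
  proof (induction c rule: frag_induction)
    case (one s)
    then show ?case using Suc.IH by simp
  next
    case (diff a b)
    have "lower_homotopy p (a - b) = lower_homotopy p a - lower_homotopy p b"
      by (cases p) (simp_all add: lower_homotopy_def chain_boundary_diff frag_extend_diff)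
    then show ?case using diff by (simp add: frag_extend_diff chain_boundary_diff approximation_diff)
  qed (simp add: approximation_def corner_chain_def lower_homotopy_def flag_chain_def chain_boundary_0 split: nat.split)
  let ?b = "chain_boundary (Suc p) (frag_of s)"
  let ?c = "approximation (Suc p) (frag_of s) - frag_of s - frag_extend (carried_homotopy p) ?b"
  have s: "singular_chain (Suc p) CT (frag_of s)" using Suc.prems by (simp add: singular_chain_of)
  have b: "singular_chain p CT ?b" using singular_chain_boundary_alt[OF s] .
  have "\<exists>d. singular_chain (Suc (Suc p)) (subtopology CT (carrier_of (Suc p) s)) d \<and> chain_boundary (Suc (Suc p)) d = ?c"
  proof (rule contractible_cycle_bounds[OF contractible_carrier[OF Suc.prems]])
    have "singular_chain (Suc p) (subtopology CT (carrier_of (Suc p) s)) (frag_extend (carried_homotopy p) ?b)"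
    proof (rule singular_chain_extend)
      fix f assume "f \<in> Poly_Mapping.keys ?b"
      moreover have "Poly_Mapping.keys ?b \<subseteq> (\<lambda>k. singular_face (Suc p) k s) ` {..Suc p}"
        unfolding chain_boundary_of if_not_P[OF nat.distinct(2)] by (rule keys_sum_cmul_subset) simp
      ultimately obtain k where k: "k \<le> Suc p" "f = singular_face (Suc p) k s" by auto
      have f: "singular_simplex p CT f"
        using singular_simplex_singular_face[OF Suc.prems, of k] k by simp
      have "f ` standard_simplex p \<subseteq> s ` standard_simplex (Suc p)"
        using simplical_face_in_standard_simplex[of "Suc p" k] k by (auto simp: singular_face_def)
      then have "carrier_of p f \<subseteq> carrier_of (Suc p) s" by (rule carrier_mono[OF Suc.prems f])
      then show "singular_chain (Suc p) (subtopology CT (carrier_of (Suc p) s)) (carried_homotopy p f)"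
        using Suc.IH[OF f] singular_chain_mono by blast
    qed
    then show "singular_chain (Suc p) (subtopology CT (carrier_of (Suc p) s)) ?c"
      using approximation_in_carrier[OF Suc.prems] simplex_in_carrier[OF Suc.prems]
      by (simp add: singular_chain_diff singular_chain_of)
    \<comment> \<open>\<open>?b\<close> is a boundary already, so the correction term one dimension
      lower contains its vanishing boundary.\<close>
    have "lower_homotopy p ?b = 0"
    proof (cases p)
      case (Suc q)
      then show ?thesis using chain_boundary_boundary_alt[of "Suc q" CT "frag_of s"] s by (simp add: lower_homotopy_def)
    qed (simp add: lower_homotopy_def)
    then show "chain_boundary (Suc p) ?c = 0"
      using lin[OF b] chain_boundary_approximation[OF s] by (simp add: chain_boundary_diff)
  qed simp
  from someI_ex[OF this] show ?case by (simp add: lower_homotopy_def)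
qed

text \<open>The homotopy on \<open>z\<close> may run anywhere in \<open>CT\<close>, but on its
  boundary it has to stay in \<open>T\<close>. Smallness of the boundary gives its simplices proper
  spans, hence carriers inside \<open>T\<close>.\<close>

lemma homologous_approximation:
  assumes z: "singular_relcycle p CT T z"
    and small: "\<And>s. s \<in> Poly_Mapping.keys (chain_boundary p z) \<Longrightarrow> \<exists>U\<in>L - {X}. s ` standard_simplex (p - 1) \<subseteq> T \<inter> near L U"
  shows "homologous_rel p CT T (approximation p z) z"
proof -
  have zc: "singular_chain p CT z" "singular_chain (p - 1) (subtopology CT T) (chain_boundary p z)"
    using z by (auto simp: singular_relcycle)
  let ?P = "frag_extend (carried_homotopy p) z"
  have lin: "chain_boundary (Suc p) (frag_extend (carried_homotopy p) c) = approximation p c - c - lower_homotopy p c"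
    if "singular_chain p CT c" for c
    using that unfolding singular_chain_def
  proof (induction c rule: frag_induction)
    case (one s)
    then show ?case using carried_homotopy by simp
  next
    case (diff a b)
    have "lower_homotopy p (a - b) = lower_homotopy p a - lower_homotopy p b"
      by (cases p) (simp_all add: lower_homotopy_def chain_boundary_diff frag_extend_diff)
    then show ?case using diff by (simp add: frag_extend_diff chain_boundary_diff approximation_diff)
  qed (simp add: approximation_def corner_chain_def lower_homotopy_def flag_chain_def chain_boundary_0 split: nat.split)
  have P: "singular_chain (Suc p) CT ?P"
  proof (rule singular_chain_extend)
    fix s assume "s \<in> Poly_Mapping.keys z"
    then have "singular_simplex p CT s" using zc(1) by (auto simp: singular_chain_def)
    then show "singular_chain (Suc p) CT (carried_homotopy p s)"
      using carried_homotopy by (auto simp: singular_chain_subtopology)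
  qed
  have "singular_chain p (subtopology CT T) (lower_homotopy p z)"
  proof (cases p)
    case (Suc q)
    have "singular_chain (Suc q) (subtopology CT T) (frag_extend (carried_homotopy q) (chain_boundary p z))"
    proof (rule singular_chain_extend)
      fix s assume s: "s \<in> Poly_Mapping.keys (chain_boundary p z)"
      then have "singular_simplex q (subtopology CT T) s" using zc(2) Suc by (auto simp: singular_chain_def)
      then have sc: "singular_simplex q CT s" "s ` standard_simplex q \<subseteq> T" by (auto simp: singular_simplex_subtopology)
      obtain U where U: "U \<in> L" "U \<noteq> X" "s ` standard_simplex q \<subseteq> near L U" using small[OF s] Suc by auto
      have "apex (s x) \<subseteq> U" if "x \<in> standard_simplex q" for x
        using U(3) that near_apex[OF span_of(4)[OF sc(1) that]] by blast
      then have "span_of q s \<subseteq> U" using span_of(3)[OF sc(1) U(1)] by blast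
      then have "span_of q s \<noteq> X" using le_top[OF U(1)] U(2) by auto
      then have "carrier_of q s \<subseteq> T" using sc(2) by (simp add: carrier_of_def)
      then show "singular_chain (Suc q) (subtopology CT T) (carried_homotopy q s)"
        using carried_homotopy[OF sc(1)] singular_chain_mono by blast
    qed
    then show ?thesis using Suc by (simp add: lower_homotopy_def)
  qed (simp add: lower_homotopy_def)
  moreover have "chain_boundary (Suc p) ?P = (approximation p z - z) + - lower_homotopy p z"
    using lin[OF zc(1)] by simp
  ultimately show ?thesis
    unfolding homologous_rel_def singular_relboundary_alt using P singular_chain_minus by blast
qed

lemma relcycle_homologous_flag_chain:
  assumes z: "singular_relcycle n CT T z"
  obtains c where "Poly_Mapping.keys c \<subseteq> point_lists (Suc n) X" "homologous_rel n CT T (flag_chain n c) z"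
proof -
  have zc: "singular_chain n CT z" "singular_chain (n - 1) (subtopology CT T) (chain_boundary n z)"
    using z by (auto simp: singular_relcycle)
  obtain m where m: "\<And>s. s \<in> Poly_Mapping.keys (iterated_subdivision m (n - 1) (chain_boundary n z)) \<Longrightarrow>
      \<exists>U\<in>L - {X}. s ` standard_simplex (n - 1) \<subseteq> T \<inter> near L U"
    using small_subdivision[OF zc(2)] by blast
  let ?z = "iterated_subdivision m n z"
  have h: "homologous_rel n CT T ?z z" by (rule homologous_iterated_subdivision[OF z])
  then have z': "singular_relcycle n CT T ?z" using z homologous_rel_singular_relcycle by blast
  have "homologous_rel n CT T (approximation n ?z) ?z"
    by (rule homologous_approximation[OF z']) (use m chain_boundary_iterated_subdivision[OF zc(1), of m] in simp)
  then have "homologous_rel n CT T (flag_chain n (corner_chain n ?z)) z"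
    using homologous_rel_trans[OF h] by (simp add: approximation_def)
  moreover have "Poly_Mapping.keys (corner_chain n ?z) \<subseteq> point_lists (Suc n) X"
    using keys_corner_chain[of n X ?z] singular_chain_iterated_subdivision[OF zc(1)] by (simp add: subtopology_near_top)
  ultimately show ?thesis using that by blast
qed

end

section \<open>Homology of the quotient\<close>

context point_lattice
begin

abbreviation ST :: "('a set \<Rightarrow> real) option topology" where "ST \<equiv> collapse CT T"

text \<open>Decreasing the weight of the top element retracts a neighbourhood of \<open>T\<close> onto \<open>T\<close>.\<close>

definition lower :: "real \<Rightarrow> ('a set \<Rightarrow> real) \<Rightarrow> 'a set \<Rightarrow> real" where
  "lower s t = (\<lambda>v. (if v = X then max 0 (t X - s / 2) else t v) / (1 - min (t X) (s / 2)))"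

text \<open>The bound \<open>1/2\<close> is the amount that \<open>lower 1\<close> takes away from
  the coordinate at \<open>X\<close>, so the collar ends up in \<open>T\<close>.\<close>

definition collar :: "('a set \<Rightarrow> real) set" where
  "collar = {t \<in> polyhedron (order_complex L). t X < 1/2}"

lemma T_iff: "t \<in> T \<longleftrightarrow> t \<in> polyhedron (order_complex L) \<and> t X = 0"
proof -
  have "supp t \<in> order_complex (L - {X}) \<longleftrightarrow> supp t \<in> order_complex L \<and> t X = 0" for t :: "'a set \<Rightarrow> real"
    unfolding order_complex_iff by auto
  then show ?thesis
    unfolding polyhedron_iff[OF simplicial_complex_order_complex] by auto
qed

lemma coordinate_le_1: "t \<in> polyhedron (order_complex L) \<Longrightarrow> t v \<le> 1"
proof (cases "v \<in> supp t")
  case True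
  assume t: "t \<in> polyhedron (order_complex L)"
  note D = polyhedronD[OF t complex]
  show ?thesis using member_le_sum[OF True, of t] D by simp
qed simp

lemma lower_props:
  assumes t: "t \<in> polyhedron (order_complex L)" and s: "s \<in> {0..1}"
  shows "1 - min (t X) (s / 2) > 0" "lower s t \<in> polyhedron (order_complex L)" "supp (lower s t) \<subseteq> supp t"
    "lower s t X \<le> t X" "t X < 1/2 \<Longrightarrow> lower 1 t X = 0" "lower 0 t = t" "t X = 0 \<Longrightarrow> lower s t = t"
proof -
  note D = polyhedronD[OF t complex]
  show d: "1 - min (t X) (s / 2) > 0" using s by (auto simp: min_def)
  show sub: "supp (lower s t) \<subseteq> supp t" using D(4)[of X] s by (auto simp: lower_def max_def split: if_splits)
  have "sum (lower s t) (supp (lower s t)) = sum (lower s t) (supp t)"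
    using D(2) sub by (intro sum.mono_neutral_left) auto
  also have "\<dots> = (\<Sum>v\<in>supp t. if v = X then max 0 (t X - s / 2) else t v) / (1 - min (t X) (s / 2))"
    by (simp add: lower_def sum_divide_distrib)
  also have "(\<Sum>v\<in>supp t. if v = X then max 0 (t X - s / 2) else t v) = (\<Sum>v\<in>supp t. t v - (if v = X then min (t X) (s / 2) else 0))"
    by (intro sum.cong) (auto simp: max_def min_def)
  also have "\<dots> = 1 - (\<Sum>v\<in>supp t. if v = X then min (t X) (s / 2) else 0)"
    by (simp add: sum_subtractf D(5))
  also have "(\<Sum>v\<in>supp t. if v = X then min (t X) (s / 2) else 0) = min (t X) (s / 2)"
    using D(2) s by (auto simp: min_def)
  finally have sum1: "sum (lower s t) (supp (lower s t)) = 1" using d by simp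
  then have "supp (lower s t) \<noteq> {}" by (metis sum.empty zero_neq_one)
  then have "supp (lower s t) \<in> order_complex L" using simplicial_complexD(3)[OF complex D(1) sub] by blast
  moreover have "0 \<le> lower s t v" for v using D(4)[of v] d by (auto simp: lower_def)
  ultimately show "lower s t \<in> polyhedron (order_complex L)" using polyhedronI[OF complex] sum1 by blast
  show "lower s t X \<le> t X"
  proof (cases "t X \<le> s / 2")
    case False
    \<comment> \<open>Renormalising does not make up for the loss at \<open>X\<close>, since
      \<open>t X \<le> 1\<close>; hence the collar is preserved.\<close>
    have "t X - s / 2 \<le> t X * (1 - s / 2)"
      using coordinate_le_1[OF t, of X] s D(4)[of X] mult_right_mono[of "t X" 1 "s / 2"] by (simp add: algebra_simps)
    then show ?thesis using False d by (simp add: lower_def min_def pos_divide_le_eq)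
  qed (use D(4)[of X] in \<open>simp add: lower_def\<close>)
  show "t X < 1/2 \<Longrightarrow> lower 1 t X = 0" by (simp add: lower_def)
  show "lower 0 t = t" using D(4)[of X] by (auto simp: lower_def min_def)
  show "t X = 0 \<Longrightarrow> lower s t = t" using s by (auto simp: lower_def)
qed

lemma continuous_map_lower:
  "continuous_map (prod_topology unit_interval CT) CT (\<lambda>(s,t). lower s t)"
proof (rule continuous_map_prod_realisation)
  fix \<sigma> assume \<sigma>: "\<sigma> \<in> order_complex L"
  let ?Y = "prod_topology unit_interval (face_topology \<sigma>)"
  have fin: "finite \<sigma>" using simplicial_complexD[OF complex \<sigma>] by blast
  have tK: "t \<in> polyhedron (order_complex L)" if "t \<in> face \<sigma>" for t using that \<sigma> by (auto simp: polyhedron_def)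
  show "continuous_map ?Y CT (\<lambda>(s,t). lower s t)"
  proof (rule continuous_map_into_realisation[OF complex _ fin])
    fix y assume "y \<in> topspace ?Y"
    then have "snd y \<in> face \<sigma>" "fst y \<in> {0..1}" by auto
    then show "(case y of (s,t) \<Rightarrow> lower s t) \<in> polyhedron (order_complex L) \<and> supp (case y of (s,t) \<Rightarrow> lower s t) \<subseteq> \<sigma>"
      using lower_props(2,3)[OF tK, of "snd y" "fst y"] supp_subset[of "snd y" \<sigma>] by (simp add: case_prod_unfold subset_iff)
  next
    fix v
    have t: "continuous_map ?Y euclideanreal (\<lambda>y. snd y v)" for v
      using continuous_map_compose[OF continuous_map_snd continuous_map_face_coordinate] by (simp add: o_def)
    have s: "continuous_map ?Y euclideanreal fst"
      using continuous_map_fst continuous_map_into_fulltopology by blast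
    have n: "continuous_map ?Y euclideanreal (\<lambda>y. if v = X then max 0 (snd y X - fst y / 2) else snd y v)"
      by (cases "v = X") (auto intro!: continuous_intros t s)
    have "continuous_map ?Y euclideanreal (\<lambda>y. (if v = X then max 0 (snd y X - fst y / 2) else snd y v) / (1 - min (snd y X) (fst y / 2)))"
    proof (intro continuous_intros n t s)
      fix y assume "y \<in> topspace ?Y"
      then show "1 - min (snd y X) (fst y / 2) \<noteq> 0"
        using lower_props(1)[OF tK, of "snd y" "fst y"] by auto
    qed auto
    then show "continuous_map ?Y euclideanreal (\<lambda>y. (case y of (s,t) \<Rightarrow> lower s t) v)"
      by (simp add: lower_def case_prod_unfold)
  qed
qed

abbreviation quot :: "('a set \<Rightarrow> real) \<Rightarrow> ('a set \<Rightarrow> real) option" where "quot \<equiv> collapse_map T"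

definition ST_collar :: "('a set \<Rightarrow> real) option set" where
  "ST_collar = insert None (Some ` (collar - T))"

lemma T_collar: "T \<subseteq> collar" "collar \<subseteq> topspace CT"
  by (auto simp: T_iff collar_def)

lemma quot_collar: "quot \<in> collar \<rightarrow> ST_collar"
  by (auto simp: ST_collar_def collapse_map_def)

lemma lower_collar: "t \<in> collar \<Longrightarrow> s \<in> {0..1} \<Longrightarrow> lower s t \<in> collar"
  using lower_props(2,4)[of t s] by (auto simp: collar_def)

lemma lower_T: "t \<in> collar \<Longrightarrow> lower 1 t \<in> T"
  using lower_props(2,5)[of t 1] by (auto simp: collar_def T_iff)

lemma lower_on_T: "t \<in> T \<Longrightarrow> s \<in> {0..1} \<Longrightarrow> lower s t = t"
  using lower_props(7)[of t s] by (auto simp: T_iff)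

lemma iso_CT_collar:
  "hom_induced p CT T CT collar id \<in> iso (relative_homology_group p CT T) (relative_homology_group p CT collar)"
proof (rule homotopy_equivalence_relative_homology_group_isomorphism[where g = "lower 1"])
  show c: "continuous_map CT CT (lower 1)"
    using continuous_map_compose[OF _ continuous_map_lower, of CT "\<lambda>t. (1,t)"] by (simp add: o_def continuous_map_pairwise)
  have h: "homotopic_with (\<lambda>h. h \<in> S \<rightarrow> S) CT CT id (lower 1)" if S: "\<And>s t. s \<in> {0..1} \<Longrightarrow> t \<in> S \<Longrightarrow> lower s t \<in> S" and sub: "S \<subseteq> topspace CT" for S
  proof (subst homotopic_with)
    show "h \<in> S \<rightarrow> S \<longleftrightarrow> k \<in> S \<rightarrow> S" if "\<And>x. x \<in> topspace CT \<Longrightarrow> h x = k x" for h k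
      using that sub by (auto simp: Pi_iff subset_iff)
    show "\<exists>h. continuous_map (prod_topology unit_interval CT) CT h \<and> (\<forall>x\<in>topspace CT. h (0, x) = id x) \<and>
      (\<forall>x\<in>topspace CT. h (1, x) = lower 1 x) \<and> (\<forall>t\<in>{0..1}. (\<lambda>x. h (t, x)) \<in> S \<rightarrow> S)"
      by (rule exI[of _ "\<lambda>(s,t). lower s t"]) (use continuous_map_lower S lower_props(6)[of _ 0] in auto)
  qed
  have "homotopic_with (\<lambda>h. h \<in> T \<rightarrow> T) CT CT id (lower 1)"
    by (rule h) (use lower_on_T T_collar in auto)
  then show "homotopic_with (\<lambda>h. h \<in> T \<rightarrow> T) CT CT (lower 1 \<circ> id) id"
    by (simp add: homotopic_with_symD)
  have "homotopic_with (\<lambda>h. h \<in> collar \<rightarrow> collar) CT CT id (lower 1)"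
    by (rule h) (use lower_collar T_collar in auto)
  then show "homotopic_with (\<lambda>k. k \<in> collar \<rightarrow> collar) CT CT (id \<circ> lower 1) id"
    by (simp add: homotopic_with_symD)
qed (use T_collar lower_T in auto)

definition ST_lower :: "real \<times> ('a set \<Rightarrow> real) option \<Rightarrow> ('a set \<Rightarrow> real) option" where
  "ST_lower = (\<lambda>(s,x). case x of None \<Rightarrow> None | Some t \<Rightarrow> quot (lower s t))"

lemma continuous_map_ST_lower: "continuous_map (prod_topology unit_interval ST) ST ST_lower"
proof (rule continuous_map_prod_collapse)
  show "continuous_map (prod_topology unit_interval CT) ST (\<lambda>(s,x). ST_lower (s, quot x))"
    by (rule continuous_map_eq[OF continuous_map_compose[OF continuous_map_lower continuous_map_collapse]])
       (use lower_on_T in \<open>auto simp: ST_lower_def collapse_map_def\<close>)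
  show "continuous_map unit_interval ST (\<lambda>s. ST_lower (s, None))"
    by (simp add: ST_lower_def topspace_collapse)
qed (use T_collar in auto)

lemma iso_ST_collar:
  "hom_induced p ST {None} ST ST_collar id \<in> iso (relative_homology_group p ST {None}) (relative_homology_group p ST ST_collar)"
proof (rule homotopy_equivalence_relative_homology_group_isomorphism[where g = "\<lambda>x. ST_lower (1,x)"])
  show c: "continuous_map ST ST (\<lambda>x. ST_lower (1,x))"
    using continuous_map_compose[OF _ continuous_map_ST_lower, of ST "\<lambda>t. (1,t)"] by (simp add: o_def continuous_map_pairwise)
  have h: "homotopic_with (\<lambda>h. h \<in> S \<rightarrow> S) ST ST id (\<lambda>x. ST_lower (1,x))"
    if S: "\<And>s t. s \<in> {0..1} \<Longrightarrow> t \<in> S \<Longrightarrow> ST_lower (s,t) \<in> S" and sub: "S \<subseteq> topspace ST" for S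
  proof (subst homotopic_with)
    show "h \<in> S \<rightarrow> S \<longleftrightarrow> k \<in> S \<rightarrow> S" if "\<And>x. x \<in> topspace ST \<Longrightarrow> h x = k x" for h k
      using that sub by (auto simp: Pi_iff subset_iff)
    have "ST_lower (0, x) = x" if "x \<in> topspace ST" for x
      using that lower_props(6)[of _ 0] by (auto simp: ST_lower_def topspace_collapse collapse_map_def)
    then show "\<exists>h. continuous_map (prod_topology unit_interval ST) ST h \<and> (\<forall>x\<in>topspace ST. h (0, x) = id x) \<and>
      (\<forall>x\<in>topspace ST. h (1, x) = ST_lower (1, x)) \<and> (\<forall>t\<in>{0..1}. (\<lambda>x. h (t, x)) \<in> S \<rightarrow> S)"
      by (intro exI[of _ ST_lower]) (use continuous_map_ST_lower S in auto)
  qed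
  have "homotopic_with (\<lambda>h. h \<in> {None} \<rightarrow> {None}) ST ST id (\<lambda>x. ST_lower (1,x))"
    by (rule h) (auto simp: ST_lower_def topspace_collapse)
  then show "homotopic_with (\<lambda>h. h \<in> {None} \<rightarrow> {None}) ST ST ((\<lambda>x. ST_lower (1,x)) \<circ> id) id"
    by (simp add: homotopic_with_symD)
  have "homotopic_with (\<lambda>h. h \<in> ST_collar \<rightarrow> ST_collar) ST ST id (\<lambda>x. ST_lower (1,x))"
    by (rule h) (use lower_collar T_collar in \<open>auto simp: ST_lower_def topspace_collapse ST_collar_def collapse_map_def split: if_splits\<close>)
  then show "homotopic_with (\<lambda>k. k \<in> ST_collar \<rightarrow> ST_collar) ST ST (id \<circ> (\<lambda>x. ST_lower (1,x))) id"
    by (simp add: homotopic_with_symD)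
qed (use lower_T in \<open>auto simp: ST_lower_def ST_collar_def collapse_map_def\<close>)

section \<open>Excision along the collar\<close>

lemma openin_collar: "openin CT collar"
proof -
  have c: "continuous_map CT euclideanreal (\<lambda>t. t X)"
    unfolding continuous_map_realisation_iff by (simp add: continuous_map_face_coordinate)
  have "collar = {t \<in> topspace CT. t X \<in> {..<1/2}}" by (auto simp: collar_def)
  then show ?thesis using openin_continuous_map_preimage[OF c, of "{..<1/2}"] by (simp flip: open_openin)
qed

lemma closedin_T: "closedin CT T"
  by (rule closedin_polyhedron) (auto simp: simplicial_complex_order_complex order_complex_iff)

lemma openin_ST_collar: "openin ST ST_collar"
  unfolding openin_collapse
proof
  have "{x \<in> topspace CT. quot x \<in> ST_collar} = collar"
    using T_collar by (auto simp: ST_collar_def collapse_map_def)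
  then show "openin CT {x \<in> topspace CT. quot x \<in> ST_collar}" using openin_collar by simp
qed (use T_collar in \<open>auto simp: ST_collar_def\<close>)

lemma closedin_ST_base: "closedin ST {None}"
proof -
  have "topspace ST - {None} = Some ` (topspace CT - T)" by (auto simp: topspace_collapse)
  moreover have "{x \<in> topspace CT. quot x \<in> Some ` (topspace CT - T)} = topspace CT - T"
    by (auto simp: collapse_map_def)
  ultimately show ?thesis
    using closedin_T by (auto simp: closedin_def openin_collapse topspace_collapse)
qed

lemma homeomorphic_map_quot:
  "homeomorphic_map (subtopology CT (topspace CT - T)) (subtopology ST (topspace ST - {None})) quot"
proof -
  have "homeomorphic_maps (subtopology CT (topspace CT - T)) (subtopology ST (topspace ST - {None})) quot the"
    unfolding homeomorphic_maps_def
  proof (intro conjI ballI)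
    show "continuous_map (subtopology CT (topspace CT - T)) (subtopology ST (topspace ST - {None})) quot"
      by (auto simp: continuous_map_in_subtopology topspace_collapse collapse_map_def
          intro: continuous_map_from_subtopology continuous_map_collapse)
    have "continuous_map (subtopology ST (topspace ST - {None})) CT the"
      unfolding continuous_map_def
    proof (intro conjI allI impI)
      fix U assume U: "openin CT U"
      have "{x \<in> topspace CT. quot x \<in> Some ` (U - T)} = U - T"
        using openin_subset[OF U] by (auto simp: collapse_map_def)
      then have "openin ST (Some ` (U - T))"
        unfolding openin_collapse using openin_diff[OF U closedin_T] openin_subset[OF U] by auto
      moreover have "{x \<in> topspace (subtopology ST (topspace ST - {None})). the x \<in> U} = Some ` (U - T) \<inter> (topspace ST - {None})"
        using openin_subset[OF U] by (auto simp: topspace_collapse)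
      ultimately show "openin (subtopology ST (topspace ST - {None})) {x \<in> topspace (subtopology ST (topspace ST - {None})). the x \<in> U}"
        unfolding openin_subtopology by blast
    qed (auto simp: topspace_collapse)
    then show "continuous_map (subtopology ST (topspace ST - {None})) (subtopology CT (topspace CT - T)) the"
      by (auto simp: continuous_map_in_subtopology topspace_collapse)
  qed (auto simp: topspace_collapse collapse_map_def)
  then show ?thesis using homeomorphic_map_maps by blast
qed

text \<open>Both pairs are thickened to their collars. There \<open>T\<close> and the basepoint can
  be excised, since they are closed inside open collars, and the remaining pairs are homeomorphic
  under \<open>quot\<close>.\<close>

lemma iso_quot:
  "hom_induced p CT T ST {None} quot \<in> iso (relative_homology_group p CT T) (relative_homology_group p ST {None})"
proof -
  let ?U = "topspace CT - T" and ?V = "topspace ST - {None}"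
  have cq: "continuous_map CT ST quot" by (rule continuous_map_collapse)
  have T_None: "quot \<in> T \<rightarrow> {None}" by (auto simp: collapse_map_def)
  have N: "{None} \<subseteq> ST_collar" by (simp add: ST_collar_def)
  have tops: "subtopology CT (topspace CT) = CT" "subtopology ST (topspace ST) = ST"
    by (rule subtopology_topspace)+
  have b: "hom_induced p (subtopology CT ?U) (collar - T) CT collar id
      \<in> iso (relative_homology_group p (subtopology CT ?U) (collar - T)) (relative_homology_group p CT collar)"
    using homology_excision_axiom[of CT T collar "topspace CT" p] T_collar
    unfolding closure_of_closedin[OF closedin_T] interior_of_openin[OF openin_collar] tops by blast
  have d: "hom_induced p (subtopology ST ?V) (ST_collar - {None}) ST ST_collar id
      \<in> iso (relative_homology_group p (subtopology ST ?V) (ST_collar - {None})) (relative_homology_group p ST ST_collar)"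
    using homology_excision_axiom[of ST "{None}" ST_collar "topspace ST" p] N openin_subset[OF openin_ST_collar]
    unfolding closure_of_closedin[OF closedin_ST_base] interior_of_openin[OF openin_ST_collar] tops by blast
  have "quot ` (collar - T) = ST_collar - {None}" by (auto simp: ST_collar_def collapse_map_def)
  then have c: "hom_induced p (subtopology CT ?U) (collar - T) (subtopology ST ?V) (ST_collar - {None}) quot
      \<in> iso (relative_homology_group p (subtopology CT ?U) (collar - T)) (relative_homology_group p (subtopology ST ?V) (ST_collar - {None}))"
    using T_collar by (intro homeomorphic_map_relative_homology_iso[OF homeomorphic_map_quot]) auto
  have cc: "continuous_map (subtopology CT ?U) (subtopology ST ?V) quot"
    using homeomorphic_imp_continuous_map[OF homeomorphic_map_quot] .
  have ids: "continuous_map (subtopology CT ?U) CT id" "continuous_map (subtopology ST ?V) ST id"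
    by (simp_all add: continuous_map_from_subtopology)
  have "hom_induced p CT collar ST ST_collar quot \<circ> hom_induced p (subtopology CT ?U) (collar - T) CT collar id =
      hom_induced p (subtopology CT ?U) (collar - T) ST ST_collar (quot \<circ> id)"
    by (rule hom_induced_compose[symmetric]) (use ids cq quot_collar in auto)
  also have "\<dots> = hom_induced p (subtopology CT ?U) (collar - T) ST ST_collar (id \<circ> quot)" by simp
  also have "\<dots> = hom_induced p (subtopology ST ?V) (ST_collar - {None}) ST ST_collar id \<circ>
      hom_induced p (subtopology CT ?U) (collar - T) (subtopology ST ?V) (ST_collar - {None}) quot"
    by (rule hom_induced_compose) (use ids cc in \<open>auto simp: ST_collar_def collapse_map_def\<close>)
  finally have sq1: "hom_induced p CT collar ST ST_collar quot \<circ> hom_induced p (subtopology CT ?U) (collar - T) CT collar id = \<dots>" .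
  have "hom_induced p CT collar ST ST_collar quot \<circ> hom_induced p CT T CT collar id = hom_induced p CT T ST ST_collar (quot \<circ> id)"
    by (rule hom_induced_compose[symmetric]) (use cq quot_collar T_collar in auto)
  also have "\<dots> = hom_induced p CT T ST ST_collar (id \<circ> quot)" by simp
  also have "\<dots> = hom_induced p ST {None} ST ST_collar id \<circ> hom_induced p CT T ST {None} quot"
    by (rule hom_induced_compose) (use cq T_None N in auto)
  finally have sq2: "hom_induced p CT collar ST ST_collar quot \<circ> hom_induced p CT T CT collar id =
      hom_induced p ST {None} ST ST_collar id \<circ> hom_induced p CT T ST {None} quot" .
  have bij: "f \<in> iso G H \<Longrightarrow> bij_betw f (carrier G) (carrier H)" for f G H by (simp add: iso_def)
  have im: "hom_induced p CT T ST {None} quot ` carrier (relative_homology_group p CT T) \<subseteq> carrier (relative_homology_group p ST {None})"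
    by (intro image_subsetI hom_induced_carrier)
  \<comment> \<open>The first square makes the map between the thickened pairs bijective. The second
    square carries this over to the original pairs, as both thickenings induce isomorphisms.\<close>
  have "bij_betw (hom_induced p CT collar ST ST_collar quot \<circ> hom_induced p (subtopology CT ?U) (collar - T) CT collar id)
      (carrier (relative_homology_group p (subtopology CT ?U) (collar - T))) (carrier (relative_homology_group p ST ST_collar))"
    unfolding sq1 by (rule bij_betw_trans[OF bij[OF c] bij[OF d]])
  then have "bij_betw (hom_induced p CT collar ST ST_collar quot) (carrier (relative_homology_group p CT collar)) (carrier (relative_homology_group p ST ST_collar))"
    using bij_betw_comp_iff[OF bij[OF b]] by blast
  then have "bij_betw (hom_induced p ST {None} ST ST_collar id \<circ> hom_induced p CT T ST {None} quot)
      (carrier (relative_homology_group p CT T)) (carrier (relative_homology_group p ST ST_collar))"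
    unfolding sq2[symmetric] by (rule bij_betw_trans[OF bij[OF iso_CT_collar]])
  then have "bij_betw (hom_induced p CT T ST {None} quot) (carrier (relative_homology_group p CT T)) (carrier (relative_homology_group p ST {None}))"
    by (rule iffD2[OF bij_betw_comp_iff2[OF bij[OF iso_ST_collar] im]])
  then show ?thesis by (simp add: iso_def hom_induced_hom)
qed

lemma iso_reduced:
  "hom_induced p ST {} ST {None} id \<in> iso (reduced_homology_group p ST) (relative_homology_group p ST {None})"
proof (rule iso_reduced_homology_by_contractible)
  show "contractible_space (subtopology ST {None})"
    by (rule contractible_space_subtopology_singleton)
  show "topspace ST \<inter> {None} \<noteq> {}" by (simp add: topspace_collapse)
qed

subsection \<open>The comparison homomorphism\<close>

definition relative_class :: "('a set list \<Rightarrow>\<^sub>0 int) \<Rightarrow> ('a set \<Rightarrow> real) option chain set" where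
  "relative_class c = hom_induced (int n) CT T ST {None} quot (homologous_rel_set n CT T (flag_chain n c))"

definition comparison :: "('a set list \<Rightarrow>\<^sub>0 int) \<Rightarrow> ('a set \<Rightarrow> real) option chain set" where
  "comparison c = inv_into (carrier (reduced_homology_group (int n) ST)) (hom_induced (int n) ST {} ST {None} id) (relative_class c)"

abbreviation tuple_group :: "('a set list \<Rightarrow>\<^sub>0 int) monoid" where
  "tuple_group \<equiv> free_Abelian_group (point_lists (Suc n) X)"

lemma class_hom: "(\<lambda>c. homologous_rel_set n CT T (flag_chain n c)) \<in> hom tuple_group (relative_homology_group (int n) CT T)"
proof (rule homI)
  fix c assume "c \<in> carrier tuple_group"
  then show "homologous_rel_set n CT T (flag_chain n c) \<in> carrier (relative_homology_group (int n) CT T)"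
    using relcycle_flag_chain by (auto simp: carrier_relative_homology_group)
next
  fix c c' assume "c \<in> carrier tuple_group" "c' \<in> carrier tuple_group"
  then have r: "singular_relcycle n CT T (flag_chain n c)" "singular_relcycle n CT T (flag_chain n c')"
    using relcycle_flag_chain by auto
  \<comment> \<open>The product of two homology classes is their setwise sum, which is compared here
    with the class of the sum.\<close>
  have "(\<Union>r\<in>homologous_rel_set n CT T a. \<Union>s\<in>homologous_rel_set n CT T b. {r + s}) = homologous_rel_set n CT T (a + b)" for a b
  proof (intro equalityI subsetI)
    fix x assume "x \<in> (\<Union>r\<in>homologous_rel_set n CT T a. \<Union>s\<in>homologous_rel_set n CT T b. {r + s})"
    then show "x \<in> homologous_rel_set n CT T (a + b)" using homologous_rel_add by auto
  next
    fix x assume "x \<in> homologous_rel_set n CT T (a + b)"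
    then have "homologous_rel n CT T b (x - a)" by (simp add: homologous_rel_def algebra_simps)
    then show "x \<in> (\<Union>r\<in>homologous_rel_set n CT T a. \<Union>s\<in>homologous_rel_set n CT T b. {r + s})"
      by (intro UN_I[of a] UN_I[of "x - a"]) simp_all
  qed
  then show "homologous_rel_set n CT T (flag_chain n (c \<otimes>\<^bsub>tuple_group\<^esub> c')) =
      homologous_rel_set n CT T (flag_chain n c) \<otimes>\<^bsub>relative_homology_group (int n) CT T\<^esub> homologous_rel_set n CT T (flag_chain n c')"
    by (simp add: mult_relative_homology_group flag_chain_add)
qed

lemma relative_class_hom: "relative_class \<in> hom tuple_group (relative_homology_group (int n) ST {None})"
  unfolding relative_class_def using hom_compose[OF class_hom hom_induced_hom] by (simp add: o_def)

lemma comparison_relative_class: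
  assumes "c \<in> carrier tuple_group"
  shows "comparison c \<in> carrier (reduced_homology_group (int n) ST)"
    "hom_induced (int n) ST {} ST {None} id (comparison c) = relative_class c"
proof -
  have j: "hom_induced (int n) ST {} ST {None} id ` carrier (reduced_homology_group (int n) ST) = carrier (relative_homology_group (int n) ST {None})"
    using iso_reduced[of "int n"] by (simp add: iso_def bij_betw_def)
  have r: "relative_class c \<in> hom_induced (int n) ST {} ST {None} id ` carrier (reduced_homology_group (int n) ST)"
    unfolding j using hom_in_carrier[OF relative_class_hom assms] .
  show "comparison c \<in> carrier (reduced_homology_group (int n) ST)"
    unfolding comparison_def by (rule inv_into_into[OF r])
  show "hom_induced (int n) ST {} ST {None} id (comparison c) = relative_class c"
    unfolding comparison_def by (rule f_inv_into_f[OF r])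
qed

text \<open>Identities for \<open>comparison\<close> are verified in the homology relative to the
  basepoint, where no inverse map occurs.\<close>

lemma comparison_unique:
  assumes "x \<in> carrier (reduced_homology_group (int n) ST)" "hom_induced (int n) ST {} ST {None} id x = relative_class c"
  shows "comparison c = x"
proof -
  have "inj_on (hom_induced (int n) ST {} ST {None} id) (carrier (reduced_homology_group (int n) ST))"
    using iso_reduced[of "int n"] by (simp add: iso_def bij_betw_def)
  then show ?thesis unfolding comparison_def assms(2)[symmetric] using assms(1) by (rule inv_into_f_f)
qed

lemma comparison_hom: "comparison \<in> hom tuple_group (reduced_homology_group (int n) ST)"
proof (rule homI)
  fix c c' assume c: "c \<in> carrier tuple_group" "c' \<in> carrier tuple_group"
  let ?G = "reduced_homology_group (int n) ST"
  let ?j = "hom_induced (int n) ST {} ST {None} id"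
  have m: "comparison c \<otimes>\<^bsub>?G\<^esub> comparison c' \<in> carrier ?G"
    using comparison_relative_class(1) c by (intro monoid.m_closed group.is_monoid) auto
  have "?j (comparison c \<otimes>\<^bsub>?G\<^esub> comparison c') = ?j (comparison c) \<otimes>\<^bsub>relative_homology_group (int n) ST {None}\<^esub> ?j (comparison c')"
    using iso_reduced[of "int n"] comparison_relative_class(1) c by (auto simp: iso_def hom_def)
  also have "\<dots> = relative_class (c \<otimes>\<^bsub>tuple_group\<^esub> c')"
    using comparison_relative_class(2) c relative_class_hom by (auto simp: hom_def)
  finally show "comparison (c \<otimes>\<^bsub>tuple_group\<^esub> c') = comparison c \<otimes>\<^bsub>?G\<^esub> comparison c'"
    by (rule comparison_unique[OF m])
qed (rule comparison_relative_class(1))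

lemma comparison_surj: "comparison ` carrier tuple_group = carrier (reduced_homology_group (int n) ST)"
proof (intro equalityI subsetI)
  fix x assume x: "x \<in> carrier (reduced_homology_group (int n) ST)"
  let ?j = "hom_induced (int n) ST {} ST {None} id"
  have "?j x \<in> carrier (relative_homology_group (int n) ST {None})" by (rule hom_induced_carrier)
  also have "\<dots> = hom_induced (int n) CT T ST {None} quot ` carrier (relative_homology_group (int n) CT T)"
    using iso_quot[of "int n"] by (simp add: iso_def bij_betw_def)
  finally obtain w where w: "?j x = hom_induced (int n) CT T ST {None} quot w" "w \<in> carrier (relative_homology_group (int n) CT T)"
    by (rule imageE)
  obtain z where z: "singular_relcycle n CT T z" "?j x = hom_induced (int n) CT T ST {None} quot (homologous_rel_set n CT T z)"
    using w unfolding carrier_relative_homology_group by blast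
  obtain c where c: "Poly_Mapping.keys c \<subseteq> point_lists (Suc n) X" "homologous_rel n CT T (flag_chain n c) z"
    using relcycle_homologous_flag_chain[OF z(1)] by blast
  have "homologous_rel_set n CT T (flag_chain n c) = homologous_rel_set n CT T z"
    using c(2) homologous_rel_set_eq by blast
  then have "?j x = relative_class c" using z(2) by (simp add: relative_class_def)
  then show "x \<in> comparison ` carrier tuple_group"
    using comparison_unique[OF x] c(1) by (intro image_eqI[of _ _ c]) auto
qed (use comparison_relative_class(1) in auto)

text \<open>Since \<open>iso_reduced\<close> and \<open>iso_quot\<close> are injective, triviality
  can be read off on chains: \<open>flag_chain n c\<close> bounds modulo \<open>T\<close> exactly
  when \<open>c\<close> is a relation.\<close>

lemma comparison_kernel: "kernel tuple_group (reduced_homology_group (int n) ST) comparison = relations \<inter> carrier tuple_group"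
proof -
  let ?G = "reduced_homology_group (int n) ST"
  have "comparison c = \<one>\<^bsub>?G\<^esub> \<longleftrightarrow> c \<in> relations" if c: "c \<in> carrier tuple_group" for c
  proof -
    let ?R = "relative_homology_group (int n) CT T" and ?S = "relative_homology_group (int n) ST {None}"
    have iso_one: "f a = \<one>\<^bsub>K\<^esub> \<longleftrightarrow> a = \<one>\<^bsub>H\<^esub>" if "f \<in> iso H K" "group H" "group K" "a \<in> carrier H"
      for f a and H :: "'c monoid" and K :: "'d monoid"
    proof -
      have "inj_on f (carrier H)" "f \<one>\<^bsub>H\<^esub> = \<one>\<^bsub>K\<^esub>" using that by (auto simp: iso_def bij_betw_def hom_one)
      then show ?thesis using inj_on_eq_iff[of f "carrier H" a "\<one>\<^bsub>H\<^esub>"] that(2,4) by (simp add: group.is_monoid)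
    qed
    have "comparison c = \<one>\<^bsub>?G\<^esub> \<longleftrightarrow> relative_class c = \<one>\<^bsub>?S\<^esub>"
      unfolding comparison_relative_class(2)[OF c, symmetric]
      by (rule iso_one[OF iso_reduced _ _ comparison_relative_class(1)[OF c], symmetric]) simp_all
    also have "\<dots> \<longleftrightarrow> homologous_rel_set n CT T (flag_chain n c) = \<one>\<^bsub>?R\<^esub>"
      unfolding relative_class_def
      by (rule iso_one[OF iso_quot _ _ hom_in_carrier[OF class_hom c]]) simp_all
    also have "\<dots> \<longleftrightarrow> singular_relboundary n CT T (flag_chain n c)"
      by (simp add: homologous_rel_set_eq_relboundary)
    also have "\<dots> \<longleftrightarrow> c \<in> relations"
      using relations_flag_chain relboundary_flag_chain c by auto
    finally show ?thesis .
  qed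
  then show ?thesis unfolding kernel_def by blast
qed

subsection \<open>Equivariance\<close>

definition poset_automorphism :: "('a set \<Rightarrow> 'a set) \<Rightarrow> bool" where
  "poset_automorphism f \<longleftrightarrow> bij_betw f L L \<and> (\<forall>U\<in>L. \<forall>V\<in>L. f U \<subseteq> f V \<longleftrightarrow> U \<subseteq> V)"

context
  fixes f :: "'a set \<Rightarrow> 'a set"
  assumes f: "poset_automorphism f"
begin

lemma auto_in: "U \<in> L \<Longrightarrow> f U \<in> L"
  using f by (auto simp: poset_automorphism_def bij_betw_def)

lemma auto_onto: "V \<in> L \<Longrightarrow> \<exists>U\<in>L. f U = V"
proof -
  assume "V \<in> L"
  then have "V \<in> f ` L" using f by (simp add: poset_automorphism_def bij_betw_def)
  then show ?thesis by blast
qed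

lemma auto_le: "U \<in> L \<Longrightarrow> V \<in> L \<Longrightarrow> f U \<subseteq> f V \<longleftrightarrow> U \<subseteq> V"
  using f by (simp add: poset_automorphism_def)

lemma auto_inj: "inj_on f L"
  using f by (simp add: poset_automorphism_def bij_betw_def)

lemma auto_top: "f X = X"
proof -
  obtain U where U: "U \<in> L" "f U = X" using auto_onto[OF top_in] by blast
  then have "X \<subseteq> f X" using auto_le[OF U(1) top_in] le_top by simp
  then show ?thesis using le_top[OF auto_in[OF top_in]] by blast
qed

text \<open>An automorphism is only known to respect the order, not the rank. Points are recognised
  as the minimal elements of \<open>L\<close>.\<close>

lemma auto_points: assumes "p \<in> points" shows "f p \<in> points"
proof -
  have p: "p \<in> L" "rk p = 0" using assms by (auto simp: points_def)
  obtain q where q: "q \<in> L" "rk q = 0" "q \<subseteq> f p" using point_exists[OF auto_in[OF p(1)]] by blast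
  obtain q' where q': "q' \<in> L" "f q' = q" using auto_onto[OF q(1)] by blast
  have "q' \<subseteq> p" using q(3) q' auto_le[OF q'(1) p(1)] by simp
  then have "q' = p" using rank_strict[OF q'(1) p(1)] p(2) by (metis not_less_zero psubsetI)
  then show ?thesis using q q' by (simp add: points_def)
qed

lemma auto_lub:
  assumes "\<A> \<subseteq> L" "\<A> \<noteq> {}" shows "lub (f ` \<A>) = f (lub \<A>)"
proof -
  have fA: "f ` \<A> \<subseteq> L" "f ` \<A> \<noteq> {}" using assms auto_in by auto
  note A = lub_props[OF assms] and F = lub_props[OF fA]
  obtain V where V: "V \<in> L" "f V = lub (f ` \<A>)" using auto_onto[OF F(1)] by blast
  show ?thesis
  proof
    show "lub (f ` \<A>) \<subseteq> f (lub \<A>)"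
    proof (rule F(3)[OF auto_in[OF A(1)]])
      fix U assume "U \<in> f ` \<A>"
      then obtain W where "W \<in> \<A>" "U = f W" by blast
      then show "U \<subseteq> f (lub \<A>)" using A(2)[of W] auto_le[of W "lub \<A>"] A(1) assms(1) by blast
    qed
    have "lub \<A> \<subseteq> V"
    proof (rule A(3)[OF V(1)])
      fix U assume U: "U \<in> \<A>"
      then have "f U \<subseteq> f V" using F(2)[of "f U"] V(2) by simp
      then show "U \<subseteq> V" using auto_le[OF _ V(1)] U assms(1) by blast
    qed
    then show "f (lub \<A>) \<subseteq> lub (f ` \<A>)" using V auto_le[OF A(1) V(1)] by simp
  qed
qed

text \<open>Least upper bounds are determined by the order and \<open>subdivide\<close> uses nothing
  else; in particular the choice \<open>pt\<close> does not occur.\<close>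

lemma map_tuples_subdivide:
  "Poly_Mapping.keys c \<subseteq> tuples k X \<Longrightarrow> map_tuples f (subdivide k c) = subdivide k (map_tuples f c)"
proof (induction k arbitrary: c)
  case (Suc k)
  show ?case
  proof (rule frag_linear_eq[OF Suc.prems])
    fix xs assume xs: "xs \<in> tuples (Suc k) X"
    then have L: "set xs \<subseteq> L" "set xs \<noteq> {}" by (auto simp: tuples_def)
    have "Poly_Mapping.keys (tuple_boundary xs) \<subseteq> tuples k X"
    proof
      fix ys assume "ys \<in> Poly_Mapping.keys (tuple_boundary xs)"
      then have "Suc (length ys) = length xs" "set ys \<subseteq> set xs" using keys_tuple_boundary by blast+
      then show "ys \<in> tuples k X" using xs unfolding tuples_def by auto
    qed
    from Suc.IH[OF this] show "map_tuples f (subdivide (Suc k) (frag_of xs)) = subdivide (Suc k) (map_tuples f (frag_of xs))"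
      using auto_lub[OF L] by (simp add: map_tuples_cone map_tuples_boundary)
  qed (simp_all add: map_tuples_diff subdivide_diff frag_extend_diff)
qed simp

lemma realisation_map_vertex_map: "realisation_map f (vertex_map ys b) = vertex_map (map f ys) b"
proof
  fix w
  let ?I = "{i. i < length ys \<and> f (ys ! i) = w}" and ?V = "{v \<in> set ys. f v = w}"
  have "vertex_map (map f ys) b w = sum b ?I" unfolding vertex_map_def by (intro sum.cong) auto
  also have "\<dots> = (\<Sum>v\<in>?V. sum b {i \<in> ?I. ys ! i = v})" by (rule sum.group[symmetric]) auto
  also have "\<dots> = (\<Sum>v\<in>?V. vertex_map ys b v)" unfolding vertex_map_def by (intro sum.cong refl) (auto intro: arg_cong[of _ _ "sum b"])
  also have "\<dots> = (\<Sum>v | vertex_map ys b v \<noteq> 0 \<and> f v = w. vertex_map ys b v)"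
    using vertex_map_outside[of _ ys b] by (intro sum.mono_neutral_right) auto
  finally show "realisation_map f (vertex_map ys b) w = vertex_map (map f ys) b w" by (simp add: realisation_map_def)
qed

lemma chain_map_affine:
  assumes "Poly_Mapping.keys c \<subseteq> {ys. length ys = Suc p}"
  shows "chain_map p (realisation_map f) (affine_chain p c) = affine_chain p (map_tuples f c)"
proof (rule frag_linear_eq[OF assms])
  fix ys :: "'a set list" assume "ys \<in> {ys. length ys = Suc p}"
  show "chain_map p (realisation_map f) (affine_chain p (frag_of ys)) = affine_chain p (map_tuples f (frag_of ys))"
    by (auto simp: simplex_map_def affine_simplex_def realisation_map_vertex_map fun_eq_iff intro!: arg_cong[of _ _ frag_of])
qed (simp_all add: affine_chain_diff chain_map_diff map_tuples_diff)

lemma chain_map_flag_chain: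
  assumes "Poly_Mapping.keys c \<subseteq> point_lists (Suc p) X"
  shows "chain_map p (realisation_map f) (flag_chain p c) = flag_chain p (map_tuples f c)"
proof -
  have "Poly_Mapping.keys (subdivide (Suc p) c) \<subseteq> {ys. length ys = Suc p}"
    using keys_subdivide[OF tuples_top[OF assms] top_in] by (auto simp: flag_lists_def simp del: subdivide.simps)
  from chain_map_affine[OF this] show ?thesis
    by (simp add: flag_chain_def map_tuples_subdivide[OF tuples_top[OF assms]] del: subdivide.simps)
qed

lemma realisation_map_props:
  assumes t: "t \<in> polyhedron (order_complex L)"
  shows "realisation_map f t \<in> polyhedron (order_complex L)" "supp (realisation_map f t) = f ` supp t"
    "realisation_map f t X = t X" "\<And>v. v \<in> L \<Longrightarrow> realisation_map f t (f v) = t v"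
proof -
  note D = polyhedronD[OF t complex]
  have sL: "supp t \<subseteq> L" "\<And>U V. U \<in> supp t \<Longrightarrow> V \<in> supp t \<Longrightarrow> U \<subseteq> V \<or> V \<subseteq> U" using D(1) by (simp_all add: order_complex_iff)
  show val: "realisation_map f t (f v) = t v" if v: "v \<in> L" for v
  proof -
    have "{u. t u \<noteq> 0 \<and> f u = f v} = (if t v = 0 then {} else {v})"
      using sL(1) v auto_inj by (auto simp: inj_on_def)
    then show ?thesis by (simp add: realisation_map_def)
  qed
  from val[OF top_in] show "realisation_map f t X = t X" by (simp add: auto_top)
  have zero: "realisation_map f t w = 0" if "w \<notin> f ` supp t" for w
  proof -
    have "{u. t u \<noteq> 0 \<and> f u = w} = {}" using that by auto
    then show ?thesis unfolding realisation_map_def by (simp only: sum.empty)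
  qed
  show s: "supp (realisation_map f t) = f ` supp t"
    using zero val sL(1) by auto
  show "realisation_map f t \<in> polyhedron (order_complex L)"
  proof (rule polyhedronI[OF complex])
    show "0 \<le> realisation_map f t v" for v unfolding realisation_map_def by (intro sum_nonneg) (rule D)
    have "sum (realisation_map f t) (f ` supp t) = (\<Sum>v\<in>supp t. realisation_map f t (f v))"
      using sum.reindex[of f "supp t" "realisation_map f t"] inj_on_subset[OF auto_inj sL(1)] by (simp add: o_def)
    also have "\<dots> = sum t (supp t)" using val sL(1) by (intro sum.cong) auto
    finally show "sum (realisation_map f t) (supp (realisation_map f t)) = 1" unfolding s D(5) .
    show "supp (realisation_map f t) \<in> order_complex L"
      unfolding s order_complex_iff
    proof (intro conjI ballI)
      fix U V assume "U \<in> f ` supp t" "V \<in> f ` supp t"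
      then obtain U' V' where "U' \<in> supp t" "V' \<in> supp t" "U = f U'" "V = f V'" by blast
      then show "U \<subseteq> V \<or> V \<subseteq> U" using sL(2)[of U' V'] auto_le[of U' V'] auto_le[of V' U'] sL(1) by blast
    qed (use D auto_in sL(1) in auto)
  qed
qed

lemma continuous_map_realisation_map: "continuous_map CT CT (realisation_map f)"
  unfolding continuous_map_realisation_iff
proof
  fix \<sigma> assume \<sigma>: "\<sigma> \<in> order_complex L"
  have fin: "finite \<sigma>" "finite (f ` \<sigma>)" using simplicial_complexD(1)[OF complex \<sigma>] by auto
  have tK: "t \<in> polyhedron (order_complex L)" if "t \<in> face \<sigma>" for t using that \<sigma> by (auto simp: polyhedron_def)
  show "continuous_map (face_topology \<sigma>) CT (realisation_map f)"
  proof (rule continuous_map_into_realisation[OF complex _ fin(2)])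
    fix w
    have "continuous_map (face_topology \<sigma>) euclideanreal (\<lambda>t. \<Sum>v | v \<in> \<sigma> \<and> f v = w. t v)"
      using fin(1) by (intro continuous_map_sum continuous_map_face_coordinate) auto
    then show "continuous_map (face_topology \<sigma>) euclideanreal (\<lambda>t. realisation_map f t w)"
    proof (rule continuous_map_eq)
      fix t assume "t \<in> topspace (face_topology \<sigma>)"
      then have "supp t \<subseteq> \<sigma>" using supp_subset by auto
      then show "(\<Sum>v | v \<in> \<sigma> \<and> f v = w. t v) = realisation_map f t w"
        unfolding realisation_map_def using fin(1) by (intro sum.mono_neutral_right) auto
    qed
  next
    fix t assume "t \<in> topspace (face_topology \<sigma>)"
    then have "t \<in> face \<sigma>" by simp
    then show "realisation_map f t \<in> polyhedron (order_complex L) \<and> supp (realisation_map f t) \<subseteq> f ` \<sigma>"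
      using realisation_map_props(1,2)[OF tK] supp_subset[of t \<sigma>] by blast
  qed
qed

lemma realisation_map_T: "t \<in> polyhedron (order_complex L) \<Longrightarrow> realisation_map f t \<in> T \<longleftrightarrow> t \<in> T"
  using realisation_map_props(1,3)[of t] by (simp add: T_iff)

lemma quot_realisation_map:
  "t \<in> polyhedron (order_complex L) \<Longrightarrow> map_option (realisation_map f) (quot t) = quot (realisation_map f t)"
  using realisation_map_T by (simp add: collapse_map_def)

lemma continuous_map_ST_map: "continuous_map ST ST (map_option (realisation_map f))"
proof (rule continuous_map_from_collapse)
  show "continuous_map CT ST (map_option (realisation_map f) \<circ> quot)"
    by (rule continuous_map_eq[OF continuous_map_compose[OF continuous_map_realisation_map continuous_map_collapse]])
       (simp add: quot_realisation_map)
qed (simp add: topspace_collapse)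

lemma map_tuples_in_group: "c \<in> carrier tuple_group \<Longrightarrow> map_tuples f c \<in> carrier tuple_group"
proof -
  assume "c \<in> carrier tuple_group"
  then have "Poly_Mapping.keys (map_tuples f c) \<subseteq> map f ` point_lists (Suc n) X" by (intro keys_map_tuples) simp
  also have "\<dots> \<subseteq> point_lists (Suc n) X" using auto_points by (auto simp: point_lists_top subset_iff)
  finally show ?thesis by simp
qed

text \<open>After passing to the homology relative to the basepoint this is naturality of the
  quotient map \<open>quot\<close> together with naturality of the subdivision.\<close>

lemma comparison_equivariant:
  assumes c: "c \<in> carrier tuple_group"
  shows "comparison (map_tuples f c) = hom_induced (int n) ST {} ST {} (map_option (realisation_map f)) (comparison c)"
proof (rule comparison_unique)
  let ?f = "map_option (realisation_map f)" and ?r = "realisation_map f"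
  show "hom_induced (int n) ST {} ST {} ?f (comparison c) \<in> carrier (reduced_homology_group (int n) ST)"
    by (rule hom_induced_reduced[OF comparison_relative_class(1)[OF c]])
  have z: "singular_relcycle n CT T (flag_chain n c)" using relcycle_flag_chain c by simp
  have rT: "?r \<in> T \<rightarrow> T" using realisation_map_T T_subset by blast
  have qT: "quot \<in> T \<rightarrow> {None}" by (auto simp: collapse_map_def)
  note cr = continuous_map_realisation_map and cf = continuous_map_ST_map and cq = continuous_map_collapse[of CT T]
  have "hom_induced (int n) ST {} ST {None} id (hom_induced (int n) ST {} ST {} ?f (comparison c))
      = hom_induced (int n) ST {} ST {None} (id \<circ> ?f) (comparison c)"
    by (rule hom_induced_compose') (use cf in auto)
  also have "\<dots> = hom_induced (int n) ST {} ST {None} (?f \<circ> id) (comparison c)" by simp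
  also have "\<dots> = hom_induced (int n) ST {None} ST {None} ?f (hom_induced (int n) ST {} ST {None} id (comparison c))"
    by (rule hom_induced_compose'[symmetric]) (use cf in auto)
  also have "\<dots> = hom_induced (int n) ST {None} ST {None} ?f (hom_induced (int n) CT T ST {None} quot (homologous_rel_set n CT T (flag_chain n c)))"
    using comparison_relative_class(2)[OF c] by (simp add: relative_class_def)
  also have "\<dots> = hom_induced (int n) CT T ST {None} (?f \<circ> quot) (homologous_rel_set n CT T (flag_chain n c))"
    by (rule hom_induced_compose') (use cf cq qT in auto)
  also have "\<dots> = hom_induced (int n) CT T ST {None} (quot \<circ> ?r) (homologous_rel_set n CT T (flag_chain n c))"
    by (rule fun_cong[OF hom_induced_eq]) (simp add: quot_realisation_map)
  also have "\<dots> = hom_induced (int n) CT T ST {None} quot (hom_induced (int n) CT T CT T ?r (homologous_rel_set n CT T (flag_chain n c)))"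
    by (rule hom_induced_compose'[symmetric]) (use cr cq qT rT in auto)
  also have "hom_induced (int n) CT T CT T ?r (homologous_rel_set n CT T (flag_chain n c)) = homologous_rel_set n CT T (flag_chain n (map_tuples f c))"
    using hom_induced_chain_map[OF cr rT z] chain_map_flag_chain[of c n] c by simp
  finally show "hom_induced (int n) ST {} ST {None} id (hom_induced (int n) ST {} ST {} ?f (comparison c)) = relative_class (map_tuples f c)"
    unfolding relative_class_def .
qed

end

end

section \<open>Modules over integral group rings\<close>

text \<open>Compared with \<open>frag_induction\<close>, the step for differences also knows where
  the keys of both terms lie, as the rules for scalar multiplication demand.\<close>

lemma frag_keys_induct [consumes 1, case_names zero one diff]:
  assumes "Poly_Mapping.keys c \<subseteq> S" "P 0" "\<And>x. x \<in> S \<Longrightarrow> P (frag_of x)"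
    and diff: "\<And>a b. Poly_Mapping.keys a \<subseteq> S \<Longrightarrow> Poly_Mapping.keys b \<subseteq> S \<Longrightarrow> P a \<Longrightarrow> P b \<Longrightarrow> P (a - b)"
  shows "P c"
proof -
  have "Poly_Mapping.keys c \<subseteq> S \<and> P c"
    using assms(1)
  proof (induction c rule: frag_induction)
    case (diff a b)
    then show ?case using assms(4) keys_diff_subset[of a S b] by blast
  qed (use assms in auto)
  then show ?thesis ..
qed

lemma carrier_group_ring: "x \<in> carrier (group_ring H) \<longleftrightarrow> Poly_Mapping.keys x \<subseteq> carrier H"
  by (simp add: group_ring_def)

context
  fixes H :: "('g, 'b) monoid_scheme" and M :: "('c, 'd) monoid_scheme" and act :: "'g \<Rightarrow> 'c \<Rightarrow> 'c"
  assumes H: "group H" and M: "comm_group M"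
    and act_hom: "\<And>g. g \<in> carrier H \<Longrightarrow> act g \<in> hom M M"
begin

interpretation M: comm_group M by (rule M)

lemma act_closed: "g \<in> carrier H \<Longrightarrow> x \<in> carrier M \<Longrightarrow> act g x \<in> carrier M"
  using act_hom hom_in_carrier by metis

lemma smult_superset:
  assumes "Poly_Mapping.keys a \<subseteq> S" "finite S" "S \<subseteq> carrier H" "x \<in> carrier M"
  shows "group_ring_smult M act a x = finprod M (\<lambda>g. act g x [^]\<^bsub>M\<^esub> Poly_Mapping.lookup a g) S"
  unfolding group_ring_smult_def
  by (rule M.finprod_mono_neutral_cong_left)
     (use assms act_closed in \<open>auto simp: in_keys_iff Pi_iff subset_iff intro!: M.int_pow_closed\<close>)

lemma smult_closed:
  assumes "Poly_Mapping.keys a \<subseteq> carrier H" "x \<in> carrier M"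
  shows "group_ring_smult M act a x \<in> carrier M"
  unfolding group_ring_smult_def using assms act_closed by (intro M.finprod_closed) auto

lemma smult_add:
  assumes "Poly_Mapping.keys a \<subseteq> carrier H" "Poly_Mapping.keys b \<subseteq> carrier H" "x \<in> carrier M"
  shows "group_ring_smult M act (a + b) x = group_ring_smult M act a x \<otimes>\<^bsub>M\<^esub> group_ring_smult M act b x"
proof -
  let ?S = "Poly_Mapping.keys a \<union> Poly_Mapping.keys b"
  have S: "finite ?S" "?S \<subseteq> carrier H" using assms by auto
  have cl: "act g x \<in> carrier M" if "g \<in> ?S" for g using that assms act_closed by auto
  have "group_ring_smult M act (a + b) x = finprod M (\<lambda>g. act g x [^]\<^bsub>M\<^esub> Poly_Mapping.lookup (a + b) g) ?S"
    by (rule smult_superset[OF keys_add S assms(3)])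
  also have "\<dots> = finprod M (\<lambda>g. act g x [^]\<^bsub>M\<^esub> Poly_Mapping.lookup a g \<otimes>\<^bsub>M\<^esub> act g x [^]\<^bsub>M\<^esub> Poly_Mapping.lookup b g) ?S"
    using cl by (intro M.finprod_cong') (auto simp: lookup_add M.int_pow_mult)
  also have "\<dots> = finprod M (\<lambda>g. act g x [^]\<^bsub>M\<^esub> Poly_Mapping.lookup a g) ?S \<otimes>\<^bsub>M\<^esub> finprod M (\<lambda>g. act g x [^]\<^bsub>M\<^esub> Poly_Mapping.lookup b g) ?S"
    using cl by (intro M.finprod_multf) auto
  finally show ?thesis using smult_superset[of a ?S x] smult_superset[of b ?S x] S assms by auto
qed

lemma smult_0: "group_ring_smult M act 0 x = \<one>\<^bsub>M\<^esub>"
  by (simp add: group_ring_smult_def)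

lemma smult_diff:
  assumes "Poly_Mapping.keys a \<subseteq> carrier H" "Poly_Mapping.keys b \<subseteq> carrier H" "x \<in> carrier M"
  shows "group_ring_smult M act (a - b) x = group_ring_smult M act a x \<otimes>\<^bsub>M\<^esub> inv\<^bsub>M\<^esub> group_ring_smult M act b x"
proof -
  have ab: "Poly_Mapping.keys (a - b) \<subseteq> carrier H" using keys_diff_subset[OF assms(1,2)] .
  have "group_ring_smult M act a x = group_ring_smult M act (a - b) x \<otimes>\<^bsub>M\<^esub> group_ring_smult M act b x"
    using smult_add[OF ab assms(2,3)] by simp
  then show ?thesis
    using smult_closed[OF ab assms(3)] smult_closed[OF assms(2,3)] by (simp add: M.inv_solve_right)
qed

lemma smult_of: "g \<in> carrier H \<Longrightarrow> x \<in> carrier M \<Longrightarrow> group_ring_smult M act (frag_of g) x = act g x"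
  using act_closed[of g x] by (simp add: group_ring_smult_def)

lemma smult_hom:
  assumes "Poly_Mapping.keys a \<subseteq> carrier H" "x \<in> carrier M" "y \<in> carrier M"
  shows "group_ring_smult M act a (x \<otimes>\<^bsub>M\<^esub> y) = group_ring_smult M act a x \<otimes>\<^bsub>M\<^esub> group_ring_smult M act a y"
proof -
  have cl: "act g x \<in> carrier M" "act g y \<in> carrier M" "act g (x \<otimes>\<^bsub>M\<^esub> y) = act g x \<otimes>\<^bsub>M\<^esub> act g y" if "g \<in> Poly_Mapping.keys a" for g
    using that assms act_closed hom_mult[OF act_hom] by auto
  have "group_ring_smult M act a (x \<otimes>\<^bsub>M\<^esub> y) =
      finprod M (\<lambda>g. act g x [^]\<^bsub>M\<^esub> Poly_Mapping.lookup a g \<otimes>\<^bsub>M\<^esub> act g y [^]\<^bsub>M\<^esub> Poly_Mapping.lookup a g) (Poly_Mapping.keys a)"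
    unfolding group_ring_smult_def using cl by (intro M.finprod_cong') (auto simp: M.int_pow_distrib)
  then show ?thesis unfolding group_ring_smult_def using cl by (subst (asm) M.finprod_multf) auto
qed

text \<open>Associativity is reached by two inductions along differences: first with a single group
  element on the left (\<open>m1\<close>), then with an arbitrary left factor
  (\<open>m2\<close>).\<close>

lemma left_module_group_ring:
  assumes mult: "\<And>g h x. g \<in> carrier H \<Longrightarrow> h \<in> carrier H \<Longrightarrow> x \<in> carrier M \<Longrightarrow> act (g \<otimes>\<^bsub>H\<^esub> h) x = act g (act h x)"
    and one: "\<And>x. x \<in> carrier M \<Longrightarrow> act \<one>\<^bsub>H\<^esub> x = x"
  shows "left_module (group_ring H) M (group_ring_smult M act)"
proof -
  interpret H: group H by (rule H)
  let ?s = "group_ring_smult M act"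
  have keys_mult: "Poly_Mapping.keys (frag_extend (\<lambda>h. frag_of (g \<otimes>\<^bsub>H\<^esub> h)) b) \<subseteq> carrier H"
    if "g \<in> carrier H" "Poly_Mapping.keys b \<subseteq> carrier H" for g b
    by (rule keys_frag_extend_subset[OF that(2)]) (use that in auto)
  have m1: "?s (frag_extend (\<lambda>h. frag_of (g \<otimes>\<^bsub>H\<^esub> h)) b) x = act g (?s b x)"
    if g: "g \<in> carrier H" and b: "Poly_Mapping.keys b \<subseteq> carrier H" and x: "x \<in> carrier M" for g b x
  proof -
    interpret hg: group_hom M M "act g"
      using act_hom[OF g] by (simp add: group_hom_def group_hom_axioms_def M.is_group)
    show ?thesis using b
    proof (induction b rule: frag_keys_induct)
      case zero
      then show ?case by (simp add: smult_0)
    next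
      case (one h)
      then show ?case using g x mult by (simp add: smult_of act_closed)
    next
      case (diff a b)
      then show ?case
        using x g keys_mult[OF g] act_closed smult_closed
        by (simp add: frag_extend_diff smult_diff)
    qed
  qed
  have m2: "?s (frag_extend (\<lambda>g. frag_extend (\<lambda>h. frag_of (g \<otimes>\<^bsub>H\<^esub> h)) b) a) x = ?s a (?s b x)"
    if a: "Poly_Mapping.keys a \<subseteq> carrier H" and b: "Poly_Mapping.keys b \<subseteq> carrier H" and x: "x \<in> carrier M" for a b x
    using a
  proof (induction a rule: frag_keys_induct)
    case zero
    then show ?case by (simp add: smult_0)
  next
    case (one g)
    then show ?case using m1[OF _ b x] smult_closed[OF b x] by (simp add: smult_of)
  next
    case (diff c d)
    have k: "Poly_Mapping.keys (frag_extend (\<lambda>g. frag_extend (\<lambda>h. frag_of (g \<otimes>\<^bsub>H\<^esub> h)) b) c) \<subseteq> carrier H"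
      if "Poly_Mapping.keys c \<subseteq> carrier H" for c
      by (rule keys_frag_extend_subset[OF that keys_mult[OF _ b]])
    show ?case using diff k x smult_closed[OF b x] by (simp add: frag_extend_diff smult_diff)
  qed
  show ?thesis
    unfolding left_module_def
  proof (intro conjI ballI)
    show "ring (group_ring H)" by (rule ring_group_ring[OF H])
    fix a b x assume "a \<in> carrier (group_ring H)" "b \<in> carrier (group_ring H)" "x \<in> carrier M"
    then show "?s (a \<oplus>\<^bsub>group_ring H\<^esub> b) x = ?s a x \<otimes>\<^bsub>M\<^esub> ?s b x" "?s (a \<otimes>\<^bsub>group_ring H\<^esub> b) x = ?s a (?s b x)"
      using smult_add m2 by (simp_all add: carrier_group_ring) (simp_all add: group_ring_def)
  next
    fix x assume "x \<in> carrier M"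
    then show "?s \<one>\<^bsub>group_ring H\<^esub> x = x" using one by (simp add: group_ring_def smult_of)
  qed (use M smult_closed smult_hom in \<open>auto simp: carrier_group_ring\<close>)
qed

end

text \<open>The module axioms on the target of an equivariant isomorphism follow from those on the source.\<close>

lemma left_module_iso_group_ring:
  assumes H: "group H" and M: "comm_group M" and N: "comm_group N"
    and act_M: "\<And>g. g \<in> carrier H \<Longrightarrow> act g \<in> hom M M" and act_N: "\<And>g. g \<in> carrier H \<Longrightarrow> act' g \<in> hom N N"
    and mult: "\<And>g h x. g \<in> carrier H \<Longrightarrow> h \<in> carrier H \<Longrightarrow> x \<in> carrier M \<Longrightarrow> act (g \<otimes>\<^bsub>H\<^esub> h) x = act g (act h x)"
    and one: "\<And>x. x \<in> carrier M \<Longrightarrow> act \<one>\<^bsub>H\<^esub> x = x"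
    and \<phi>: "\<phi> \<in> iso M N" and equivariant: "\<And>g x. g \<in> carrier H \<Longrightarrow> x \<in> carrier M \<Longrightarrow> \<phi> (act g x) = act' g (\<phi> x)"
  shows "left_module_iso (group_ring H) M (group_ring_smult M act) N (group_ring_smult N act') \<phi>"
proof -
  interpret H: group H by (rule H)
  interpret M: comm_group M by (rule M)
  interpret N: comm_group N by (rule N)
  interpret \<phi>: group_hom M N \<phi>
    using \<phi> by (simp add: group_hom_def group_hom_axioms_def iso_def M.is_group N.is_group)
  note cM = act_closed[of H M act, OF H M act_M]
  note sM = smult_of[of H M act, OF H M act_M] smult_diff[of H M act, OF H M act_M] smult_closed[of H M act, OF H M act_M]
  note sN = smult_of[of H N act', OF H N act_N] smult_diff[of H N act', OF H N act_N] smult_closed[of H N act', OF H N act_N]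
  have surj: "\<phi> ` carrier M = carrier N" using \<phi> by (simp add: iso_def bij_betw_def)
  have eq: "\<phi> (group_ring_smult M act a x) = group_ring_smult N act' a (\<phi> x)"
    if a: "Poly_Mapping.keys a \<subseteq> carrier H" and x: "x \<in> carrier M" for a x
    using a
  proof (induction a rule: frag_keys_induct)
    case zero
    then show ?case by (simp add: group_ring_smult_def)
  next
    case (one g)
    then show ?case using sM(1) sN(1) equivariant x by simp
  next
    case (diff a b)
    then show ?case
      using sM(2,3) sN(2) x by simp
  qed
  show ?thesis
    unfolding left_module_iso_def
  proof (intro conjI ballI)
    show "left_module (group_ring H) M (group_ring_smult M act)"
      by (rule left_module_group_ring[of H M act, OF H M act_M mult one])
    show "left_module (group_ring H) N (group_ring_smult N act')"
    proof (rule left_module_group_ring[of H N act', OF H N act_N])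
      fix g h y assume gh: "g \<in> carrier H" "h \<in> carrier H" and "y \<in> carrier N"
      then obtain x where x: "x \<in> carrier M" "y = \<phi> x" using surj by blast
      have "act' (g \<otimes>\<^bsub>H\<^esub> h) y = \<phi> (act (g \<otimes>\<^bsub>H\<^esub> h) x)" using equivariant[of "g \<otimes>\<^bsub>H\<^esub> h" x] gh x by simp
      also have "\<dots> = act' g (act' h y)" using mult[OF gh x(1)] equivariant gh x cM by simp
      finally show "act' (g \<otimes>\<^bsub>H\<^esub> h) y = act' g (act' h y)" .
    next
      fix y assume "y \<in> carrier N"
      then obtain x where x: "x \<in> carrier M" "y = \<phi> x" using surj by blast
      then show "act' \<one>\<^bsub>H\<^esub> y = y" using equivariant[of "\<one>\<^bsub>H\<^esub>" x] one by simp
    qed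
  qed (use \<phi> eq in \<open>auto simp: carrier_group_ring\<close>)
qed

section \<open>The module isomorphism\<close>

context point_lattice
begin

abbreviation Ls :: "('a set list \<Rightarrow>\<^sub>0 int) set monoid" where
  "Ls \<equiv> tuple_group Mod (relations \<inter> carrier tuple_group)"

lemma comparison_group_hom: "group_hom tuple_group (reduced_homology_group (int n) ST) comparison"
  using comparison_hom by (simp add: group_hom_def group_hom_axioms_def)

definition tuple_iso :: "('a set list \<Rightarrow>\<^sub>0 int) set \<Rightarrow> ('a set \<Rightarrow> real) option chain set" where
  "tuple_iso C = the_elem (comparison ` C)"

lemma tuple_iso: "tuple_iso \<in> iso Ls (reduced_homology_group (int n) ST)"
  using group_hom.FactGroup_iso_set[OF comparison_group_hom comparison_surj]
  unfolding comparison_kernel tuple_iso_def[abs_def] .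

lemma comm_group_Ls: "comm_group Ls"
proof -
  interpret comm_group tuple_group by (rule abelian_free_Abelian_group)
  have "subgroup (relations \<inter> carrier tuple_group) tuple_group"
    using group_hom.subgroup_kernel[OF comparison_group_hom] unfolding comparison_kernel .
  then show ?thesis by (rule abelian_FactGroup)
qed

lemma coset_eq: "(relations \<inter> carrier tuple_group) #>\<^bsub>tuple_group\<^esub> c = {r + c |r. r \<in> relations \<inter> carrier tuple_group}"
  by (auto simp: r_coset_def)

lemma Ls_carrier: "C \<in> carrier Ls \<longleftrightarrow> (\<exists>c\<in>carrier tuple_group. C = {r + c |r. r \<in> relations \<inter> carrier tuple_group})"
  by (simp add: FactGroup_def RCOSETS_def coset_eq)

lemma relations_carrier_0: "0 \<in> relations \<inter> carrier tuple_group"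
  using relations_degenerate[of 0] by simp

lemma comparison_coset:
  assumes c: "c \<in> carrier tuple_group"
  shows "comparison ` {r + c |r. r \<in> relations \<inter> carrier tuple_group} = {comparison c}"
proof -
  interpret group_hom tuple_group "reduced_homology_group (int n) ST" comparison by (rule comparison_group_hom)
  have "comparison (r + c) = comparison c" if "r \<in> relations \<inter> carrier tuple_group" for r
  proof -
    have "r \<in> kernel tuple_group (reduced_homology_group (int n) ST) comparison" using that comparison_kernel by simp
    then have "r \<in> carrier tuple_group" "comparison r = \<one>\<^bsub>reduced_homology_group (int n) ST\<^esub>" by (auto simp: kernel_def)
    then show ?thesis using hom_mult[of r c] hom_closed[OF c] c by simp
  qed
  then show ?thesis using relations_carrier_0 by force
qed

text \<open>The relations are the kernel of \<open>comparison\<close>, so their invariance is read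
  off from equivariance.\<close>

lemma map_tuples_relations:
  assumes f: "poset_automorphism f" and r: "r \<in> relations \<inter> carrier tuple_group"
  shows "map_tuples f r \<in> relations \<inter> carrier tuple_group"
proof -
  interpret group_hom tuple_group "reduced_homology_group (int n) ST" comparison by (rule comparison_group_hom)
  have r': "r \<in> carrier tuple_group" "comparison r = \<one>\<^bsub>reduced_homology_group (int n) ST\<^esub>"
    using r comparison_kernel by (auto simp: kernel_def set_eq_iff)
  have "comparison (map_tuples f r) = \<one>\<^bsub>reduced_homology_group (int n) ST\<^esub>"
    unfolding comparison_equivariant[OF f r'(1)] r'(2)
    by (rule Group.hom_one[OF hom_induced_reduced_hom]) simp_all
  then have "map_tuples f r \<in> kernel tuple_group (reduced_homology_group (int n) ST) comparison"
    using map_tuples_in_group[OF f r'(1)] by (simp add: kernel_def)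
  then show ?thesis unfolding comparison_kernel .
qed

lemma map_tuples_cancel:
  assumes c: "c \<in> carrier tuple_group" and fg: "\<And>U. U \<in> L \<Longrightarrow> f (g U) = U"
  shows "map_tuples f (map_tuples g c) = c"
proof (rule frag_linear_eq[of c "point_lists (Suc n) X"])
  fix xs assume "xs \<in> point_lists (Suc n) X"
  then have "map (f \<circ> g) xs = xs" using fg by (intro map_idI) (auto simp: point_lists_def points_def)
  then show "map_tuples f (map_tuples g (frag_of xs)) = frag_of xs" by simp
qed (use c in \<open>simp_all add: map_tuples_diff\<close>)

text \<open>The image is a whole coset and not merely part of one, because the inverse automorphism
  preserves the relations too. This matters since the action on the quotient is the image of a
  set.\<close>

lemma map_tuples_image_coset:
  assumes f: "poset_automorphism f" and g: "poset_automorphism g" and fg: "\<And>U. U \<in> L \<Longrightarrow> f (g U) = U"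
    and c: "c \<in> carrier tuple_group"
  shows "map_tuples f ` {r + c |r. r \<in> relations \<inter> carrier tuple_group} =
    {r + map_tuples f c |r. r \<in> relations \<inter> carrier tuple_group}"
proof (intro equalityI subsetI)
  fix x assume "x \<in> map_tuples f ` {r + c |r. r \<in> relations \<inter> carrier tuple_group}"
  then obtain r where "r \<in> relations \<inter> carrier tuple_group" "x = map_tuples f (r + c)" by blast
  then show "x \<in> {r + map_tuples f c |r. r \<in> relations \<inter> carrier tuple_group}"
    using map_tuples_relations[OF f] by (auto simp: map_tuples_add)
next
  fix x assume "x \<in> {r + map_tuples f c |r. r \<in> relations \<inter> carrier tuple_group}"
  then obtain r where r: "r \<in> relations \<inter> carrier tuple_group" "x = r + map_tuples f c" by blast
  have "map_tuples f (map_tuples g r + c) = x"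
    using map_tuples_cancel[of r f g, OF _ fg] r by (simp add: map_tuples_add)
  then show "x \<in> map_tuples f ` {r + c |r. r \<in> relations \<inter> carrier tuple_group}"
    using map_tuples_relations[OF g r(1)] by blast
qed

theorem tuple_module_iso:
  fixes H :: "('g, 'b) monoid_scheme" and f :: "'g \<Rightarrow> 'a set \<Rightarrow> 'a set"
  assumes H: "group H" and f: "\<And>g. g \<in> carrier H \<Longrightarrow> poset_automorphism (f g)"
    and f_mult: "\<And>g h U. g \<in> carrier H \<Longrightarrow> h \<in> carrier H \<Longrightarrow> f (g \<otimes>\<^bsub>H\<^esub> h) U = f g (f h U)"
    and f_one: "\<And>U. f \<one>\<^bsub>H\<^esub> U = U"
  shows "left_module_iso (group_ring H) Ls (group_ring_smult Ls (\<lambda>g C. map_tuples (f g) ` C))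
    (reduced_homology_group (int n) ST)
    (group_ring_smult (reduced_homology_group (int n) ST) (\<lambda>g. hom_induced (int n) ST {} ST {} (map_option (realisation_map (f g)))))
    tuple_iso"
proof -
  interpret H: group H by (rule H)
  let ?N = "reduced_homology_group (int n) ST"
  have comp: "map_tuples (f g) (map_tuples (f h) x) = map_tuples (f (g \<otimes>\<^bsub>H\<^esub> h)) x"
    if "g \<in> carrier H" "h \<in> carrier H" for g h x
    by (rule frag_linear_eq[OF subset_UNIV, where f = "\<lambda>x. map_tuples (f g) (map_tuples (f h) x)" and g = "map_tuples (f (g \<otimes>\<^bsub>H\<^esub> h))"])
       (simp_all add: map_tuples_diff o_def ext[of "f (g \<otimes>\<^bsub>H\<^esub> h)" "f g \<circ> f h", unfolded o_apply, OF f_mult[OF that]])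
  have one: "map_tuples (f \<one>\<^bsub>H\<^esub>) x = x" for x
    by (rule frag_linear_eq[OF subset_UNIV, where f = "map_tuples (f \<one>\<^bsub>H\<^esub>)" and g = "\<lambda>x. x"])
       (simp_all add: map_tuples_diff f_one map_idI)
  have inv: "f g (f (inv\<^bsub>H\<^esub> g) U) = U" if "g \<in> carrier H" for g U
    using f_mult[OF that H.inv_closed[OF that], of U] that f_one by simp
  have coset: "map_tuples (f g) ` {r + c |r. r \<in> relations \<inter> carrier tuple_group} =
      {r + map_tuples (f g) c |r. r \<in> relations \<inter> carrier tuple_group}"
    if "g \<in> carrier H" "c \<in> carrier tuple_group" for g c
    by (rule map_tuples_image_coset[OF f[OF that(1)] f[OF H.inv_closed[OF that(1)]] inv[OF that(1)] that(2)])
  show ?thesis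
  proof (rule left_module_iso_group_ring[OF H comm_group_Ls])
    show "comm_group ?N"
      unfolding reduced_homology_group_def
      by (rule group.abelian_subgroup_generated[OF _ abelian_homology_group]) simp
    show "(\<lambda>C. map_tuples (f g) ` C) \<in> hom Ls Ls" if g: "g \<in> carrier H" for g
    proof (rule homI)
      fix C assume "C \<in> carrier Ls"
      then obtain c where c: "c \<in> carrier tuple_group" "C = {r + c |r. r \<in> relations \<inter> carrier tuple_group}"
        using Ls_carrier by blast
      show "map_tuples (f g) ` C \<in> carrier Ls"
        unfolding Ls_carrier c(2) coset[OF g c(1)] using map_tuples_in_group[OF f[OF g] c(1)] by blast
    next
      fix C D
      show "map_tuples (f g) ` (C \<otimes>\<^bsub>Ls\<^esub> D) = (map_tuples (f g) ` C) \<otimes>\<^bsub>Ls\<^esub> (map_tuples (f g) ` D)"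
        by (force simp: FactGroup_def set_mult_def map_tuples_add)
    qed
    show "hom_induced (int n) ST {} ST {} (map_option (realisation_map (f g))) \<in> hom ?N ?N" for g
      by (rule hom_induced_reduced_hom)
    show "map_tuples (f (g \<otimes>\<^bsub>H\<^esub> h)) ` C = map_tuples (f g) ` map_tuples (f h) ` C"
      if "g \<in> carrier H" "h \<in> carrier H" for g h C
      using comp[OF that] by (simp add: image_image)
    show "map_tuples (f \<one>\<^bsub>H\<^esub>) ` C = C" for C by (simp add: one)
    show "tuple_iso \<in> iso Ls ?N" by (rule tuple_iso)
    show "tuple_iso (map_tuples (f g) ` C) = hom_induced (int n) ST {} ST {} (map_option (realisation_map (f g))) (tuple_iso C)"
      if g: "g \<in> carrier H" and "C \<in> carrier Ls" for g C
    proof -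
      obtain c where c: "c \<in> carrier tuple_group" "C = {r + c |r. r \<in> relations \<inter> carrier tuple_group}"
        using Ls_carrier \<open>C \<in> carrier Ls\<close> by blast
      show ?thesis
        unfolding tuple_iso_def c(2) coset[OF g c(1)] comparison_coset[OF c(1)]
          comparison_coset[OF map_tuples_in_group[OF f[OF g] c(1)]]
        by (simp add: comparison_equivariant[OF f[OF g] c(1)])
    qed
  qed
qed

end

section \<open>Geometric subspaces\<close>

lemma zero_not_in_model: "0 \<notin> model_space X"
  by (cases X) auto

lemma geo_span_eq:
  assumes "A \<subseteq> model_space X" shows "geo_span X A = model_space X \<inter> span A"
proof
  show "geo_span X A \<subseteq> model_space X \<inter> span A"
    unfolding geo_span_def geometric_subspaces_def using assms subspace_span span_superset by blast
  show "model_space X \<inter> span A \<subseteq> geo_span X A"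
  proof
    fix x assume x: "x \<in> model_space X \<inter> span A"
    show "x \<in> geo_span X A"
      unfolding geo_span_def
    proof
      fix U assume "U \<in> {U \<in> geometric_subspaces X. A \<subseteq> U}"
      then obtain V where "U = model_space X \<inter> V" "subspace V" "A \<subseteq> V" unfolding geometric_subspaces_def by blast
      then show "x \<in> U" using x span_minimal[of A V] by blast
    qed
  qed
qed

lemma geometric_subspace_span: "U \<in> geometric_subspaces X \<Longrightarrow> U = model_space X \<inter> span U"
proof -
  assume "U \<in> geometric_subspaces X"
  then obtain V where V: "U = model_space X \<inter> V" "subspace V" unfolding geometric_subspaces_def by blast
  then have "span U \<subseteq> V" by (intro span_minimal) auto
  then show ?thesis using V span_superset[of U] by blast
qed

text \<open>Each standard basis vector is a combination of points of the model. The dimension of the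
  model, and with it the rank \<open>n\<close> of the top element, follows.\<close>

lemma span_model_space: "span (model_space X :: 'm::{finite,zero} vect set) = UNIV"
proof -
  let ?e = "\<lambda>i::'m. axis i (1::real)"
  have base: "?e i \<in> span (model_space X)" for i
  proof (cases X)
    case Euclidean
    have 0: "?e 0 \<in> span (model_space X)" using Euclidean by (intro span_base) (simp add: axis_def)
    have "?e 0 + ?e i \<in> span (model_space X)" if "i \<noteq> 0"
      using that Euclidean by (intro span_base) (simp add: axis_def)
    then have "(?e 0 + ?e i) - ?e 0 \<in> span (model_space X)" if "i \<noteq> 0" using that 0 span_diff by blast
    then show ?thesis using 0 by (cases "i = 0") auto
  next
    case Hyperbolic
    have 0: "?e 0 \<in> span (model_space X)"
      using Hyperbolic by (intro span_base) (simp add: axis_def)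
    \<comment> \<open>The factor \<open>sqrt 2\<close> puts the vector on the hyperboloid:
      \<open>- 2 + 1 = - 1\<close>.\<close>
    have "sqrt 2 *\<^sub>R ?e 0 + ?e i \<in> span (model_space X)" if "i \<noteq> 0"
    proof (intro span_base)
      have "(\<Sum>j\<in>UNIV - {0::'m}. ((sqrt 2 *\<^sub>R ?e 0 + ?e i) $ j)\<^sup>2) = (\<Sum>j\<in>UNIV - {0::'m}. if j = i then 1 else 0)"
        by (intro sum.cong) (auto simp: axis_def)
      also have "\<dots> = 1" using that by simp
      finally show "sqrt 2 *\<^sub>R ?e 0 + ?e i \<in> model_space X" using Hyperbolic that by (simp add: axis_def)
    qed
    then have "(sqrt 2 *\<^sub>R ?e 0 + ?e i) - sqrt 2 *\<^sub>R ?e 0 \<in> span (model_space X)" if "i \<noteq> 0"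
      using that 0 by (intro span_diff span_scale) auto
    then show ?thesis using 0 by (cases "i = 0") auto
  next
    case Spherical
    have "(\<Sum>j\<in>UNIV. (?e i $ j)\<^sup>2) = (\<Sum>j\<in>UNIV. if j = i then 1 else (0::real))"
      by (intro sum.cong) (auto simp: axis_def)
    then show ?thesis using Spherical by (intro span_base) simp
  qed
  have "(Basis :: 'm vect set) \<subseteq> span (model_space X)" using base by (auto simp: Basis_vec_def)
  then have "span (Basis :: 'm vect set) \<subseteq> span (model_space X)" by (intro span_minimal) auto
  then show ?thesis by auto
qed

locale generated_collection =
  fixes X :: geometry and n :: nat and L :: "'m::{finite,zero} vect set set"
  assumes card: "CARD('m) = n + 1" and L_geometric: "L \<subseteq> geometric_subspaces X" and nonempty: "{} \<notin> L"
    and model_in: "model_space X \<in> L" and generated: "generated_by_points X L"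
begin

abbreviation M :: "'m vect set" where "M \<equiv> model_space X"

text \<open>The subtraction never truncates on \<open>L\<close>: its members are nonempty and avoid
  0, so their linear spans have positive dimension (\<open>dim_pos\<close>).\<close>

definition rank :: "'m vect set \<Rightarrow> nat" where "rank U = dim U - 1"

lemma L_span: "U \<in> L \<Longrightarrow> U = M \<inter> span U"
  using geometric_subspace_span L_geometric by blast

lemma L_subset: "U \<in> L \<Longrightarrow> U \<subseteq> M"
  using L_span by blast

lemma dim_pos: assumes "U \<in> L" shows "dim U \<ge> 1"
proof -
  have "U \<noteq> {}" "0 \<notin> U" using assms nonempty L_subset zero_not_in_model by auto
  then have "\<not> U \<subseteq> {0}" by blast
  then show ?thesis using dim_eq_0[of U] by linarith
qed

lemma geo_dim_rank: "U \<in> L \<Longrightarrow> geo_dim U = int (rank U)"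
  using dim_pos[of U] by (simp add: geo_dim_def rank_def)

lemma points_of_iff: "p \<in> points_of L \<longleftrightarrow> p \<in> L \<and> rank p = 0"
  using geo_dim_rank[of p] by (auto simp: points_of_def)

lemma points_of_subset: "F \<subseteq> points_of L \<Longrightarrow> \<Union>F \<subseteq> M"
  using L_subset by (auto simp: points_of_def)

lemma L_iff: "U \<in> L \<longleftrightarrow> U \<noteq> {} \<and> (\<exists>F. finite F \<and> F \<subseteq> points_of L \<and> U = M \<inter> span (\<Union>F))"
proof -
  have "U \<in> L \<longleftrightarrow> U \<in> {geo_span X (\<Union>F) |F. finite F \<and> F \<subseteq> points_of L} - {{}}"
    by (rule arg_cong[OF generated[unfolded generated_by_points_def]])
  also have "\<dots> \<longleftrightarrow> U \<noteq> {} \<and> (\<exists>F. finite F \<and> F \<subseteq> points_of L \<and> U = geo_span X (\<Union>F))"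
    unfolding Diff_iff mem_Collect_eq singleton_iff by metis
  also have "\<dots> \<longleftrightarrow> U \<noteq> {} \<and> (\<exists>F. finite F \<and> F \<subseteq> points_of L \<and> U = M \<inter> span (\<Union>F))"
    using geo_span_eq[OF points_of_subset] by metis
  finally show ?thesis .
qed

text \<open>Generation by points speaks of finite collections only, but the ambient space has finite
  dimension, so finitely many points already produce the span of any family.\<close>

lemma L_supremum:
  assumes "\<A> \<subseteq> L" "\<A> \<noteq> {}"
  shows "M \<inter> span (\<Union>\<A>) \<in> L"
proof -
  let ?P = "{p \<in> points_of L. \<exists>U\<in>\<A>. p \<subseteq> U}"
  have "span (\<Union>\<A>) \<subseteq> span (\<Union>?P)"
  proof (intro span_minimal subspace_span Union_least)
    fix U assume U: "U \<in> \<A>"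
    then obtain F where F: "F \<subseteq> points_of L" "U = M \<inter> span (\<Union>F)" using L_iff[of U] assms(1) by blast
    have "p \<subseteq> U" if "p \<in> F" for p
      unfolding F(2) using that F(1) points_of_subset[OF F(1)] span_superset[of "\<Union>F"] by blast
    then have "F \<subseteq> ?P" using F(1) U by auto
    then have "\<Union>F \<subseteq> \<Union>?P" by (rule Union_mono)
    from span_mono[OF this] show "U \<subseteq> span (\<Union>?P)" unfolding F(2) by (rule le_infI2)
  qed
  moreover obtain B where B: "B \<subseteq> \<Union>?P" "independent B" "\<Union>?P \<subseteq> span B"
    by (rule basis_exists[of "\<Union>?P"]) (rule that)
  \<comment> \<open>For every vector of a basis taken from the available points, one point
    containing it is selected; these finitely many points span the same subspace.\<close>
  have "\<forall>b\<in>B. \<exists>p. p \<in> ?P \<and> b \<in> p" using subsetD[OF B(1)] unfolding Union_iff Bex_def by (rule ballI)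
  from bchoice[OF this] obtain c where c': "\<forall>b\<in>B. c b \<in> ?P \<and> b \<in> c b" ..
  have c: "c b \<in> ?P" "b \<in> c b" if "b \<in> B" for b using bspec[OF c' that] by simp_all
  let ?F = "c ` B"
  have "finite B" using B(2) independent_bound by blast
  then have F: "finite ?F" "?F \<subseteq> points_of L" using c(1) by auto
  have "span (\<Union>?P) \<subseteq> span (\<Union>?F)"
  proof (intro span_minimal subspace_span)
    have "B \<subseteq> \<Union>?F" using c(2) by blast
    from subset_trans[OF B(3) span_mono[OF this]] show "\<Union>?P \<subseteq> span (\<Union>?F)" .
  qed
  moreover have "span (\<Union>?F) \<subseteq> span (\<Union>\<A>)" by (rule span_mono) (use c(1) in blast)
  ultimately have "M \<inter> span (\<Union>\<A>) = M \<inter> span (\<Union>?F)" by blast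
  moreover obtain U where "U \<in> \<A>" using assms(2) by blast
  then have "U \<subseteq> M \<inter> span (\<Union>\<A>)" "U \<noteq> {}" using L_subset[of U] assms(1) nonempty span_superset[of "\<Union>\<A>"] by blast+
  ultimately show ?thesis using L_iff F by blast
qed

lemma supremum_upper: "\<A> \<subseteq> L \<Longrightarrow> U \<in> \<A> \<Longrightarrow> U \<subseteq> M \<inter> span (\<Union>\<A>)"
  using L_subset[of U] span_superset[of "\<Union>\<A>"] by blast

lemma supremum_least: "W \<in> geometric_subspaces X \<Longrightarrow> (\<And>U. U \<in> \<A> \<Longrightarrow> U \<subseteq> W) \<Longrightarrow> M \<inter> span (\<Union>\<A>) \<subseteq> W"
  using geometric_subspace_span[of W] span_mono[of "\<Union>\<A>" W] by blast

lemma dim_strict: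
  assumes "U \<in> geometric_subspaces X" "V \<in> geometric_subspaces X" "U \<subset> V" shows "dim U < dim V"
proof (rule ccontr)
  assume "\<not> dim U < dim V"
  then have "span U = span V" using assms(3) by (intro dim_eq_span) auto
  then show False using assms geometric_subspace_span by blast
qed

sublocale point_lattice L "model_space X" rank n
proof
  show "M \<in> L" by (rule model_in)
  show "U \<subseteq> M" if "U \<in> L" for U using L_subset[OF that] .
  show "\<exists>J\<in>L. (\<forall>U\<in>\<A>. U \<subseteq> J) \<and> (\<forall>W\<in>L. (\<forall>U\<in>\<A>. U \<subseteq> W) \<longrightarrow> J \<subseteq> W)" if "\<A> \<subseteq> L" "\<A> \<noteq> {}" for \<A>
  proof (rule bexI[OF _ L_supremum[OF that]], intro conjI ballI impI)
    show "U \<subseteq> M \<inter> span (\<Union>\<A>)" if "U \<in> \<A>" for U by (rule supremum_upper[OF \<open>\<A> \<subseteq> L\<close> that])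
    show "M \<inter> span (\<Union>\<A>) \<subseteq> W" if "W \<in> L" "\<forall>U\<in>\<A>. U \<subseteq> W" for W
      by (rule supremum_least) (use that subsetD[OF L_geometric] in simp_all)
  qed
  show "rank U < rank V" if "U \<in> L" "V \<in> L" "U \<subset> V" for U V
  proof -
    have "dim U < dim V" by (rule dim_strict) (use that L_geometric in auto)
    then show ?thesis using dim_pos[OF that(1)] by (simp add: rank_def)
  qed
  have "dim M = CARD('m)" using dim_span[of M] unfolding span_model_space by simp
  then show "rank M = n" using card by (simp add: rank_def)
  show "\<exists>p\<in>L. rank p = 0 \<and> p \<subseteq> U" if U: "U \<in> L" for U
  proof -
    obtain F where F: "F \<subseteq> points_of L" "U = M \<inter> span (\<Union>F)" "U \<noteq> {}" using U L_iff[of U] by blast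
    \<comment> \<open>The span of the empty set is zero, which is not in the model.\<close>
    have "F \<noteq> {}" using F(2,3) zero_not_in_model[of X] by auto
    then obtain p where p: "p \<in> F" by blast
    then have "p \<subseteq> U" unfolding F(2) using points_of_subset[OF F(1)] span_superset[of "\<Union>F"] by blast
    then show ?thesis using p F(1) points_of_iff by blast
  qed
  fix U p J assume U: "U \<in> L" and p: "p \<in> L" "rank p = 0" and J: "J \<in> L" "U \<subseteq> J" "p \<subseteq> J"
    and least: "\<And>W. W \<in> L \<Longrightarrow> U \<subseteq> W \<Longrightarrow> p \<subseteq> W \<Longrightarrow> J \<subseteq> W"
  have Up: "{U,p} \<subseteq> L" "{U,p} \<noteq> {}" using U p by auto
  have "J \<subseteq> M \<inter> span (\<Union>{U,p})"
    by (rule least[OF L_supremum[OF Up]]) (use supremum_upper[OF Up(1)] in auto)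
  then have "J \<subseteq> span (U \<union> p)" by auto
  moreover obtain B where B: "B \<subseteq> p" "p \<subseteq> span B" "card B = dim p"
    by (rule basis_exists[of p]) (rule that)
  \<comment> \<open>A point spans a line, even a spherical one with its two antipodes, so joining it
    enlarges the linear span by at most one vector.\<close>
  have "dim p = 1" using p dim_pos[OF p(1)] by (simp add: rank_def)
  then obtain v where v: "B = {v}" using B(3) by (metis card_1_singletonE)
  have "U \<union> p \<subseteq> span (insert v U)"
  proof (rule Un_least)
    show "U \<subseteq> span (insert v U)" by (rule subset_trans[OF subset_insertI span_superset])
    have "span {v} \<subseteq> span (insert v U)" by (rule span_mono) simp
    with B(2) show "p \<subseteq> span (insert v U)" unfolding v by (rule subset_trans)
  qed
  then have "span (U \<union> p) \<subseteq> span (insert v U)" by (rule span_minimal) simp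
  ultimately have "J \<subseteq> span (insert v U)" by blast
  then have "dim J \<le> dim (insert v U)" using dim_subset[of J "span (insert v U)"] by simp
  also have "\<dots> \<le> dim U + 1" by (simp add: dim_insert)
  finally show "rank J \<le> Suc (rank U)" using dim_pos[OF U] by (simp add: rank_def)
qed

section \<open>Translation between the geometric and the order-theoretic definitions\<close>

lemma ST_space_eq: "ST_space X L = ST"
  by (simp add: ST_space_def CT_space_def T_space_def)

lemma points_eq: "points = points_of L"
  by (auto simp: points_def points_of_iff)

lemma point_tuples_eq: "point_tuples k L = point_lists k M"
  by (auto simp: point_tuples_def point_lists_top points_eq)

text \<open>Degeneracy is defined by arbitrary geometric subspaces, possibly outside
  \<open>L\<close>. Any such subspace contains the span of the tuple, which belongs to
  \<open>L\<close>, so the span alone decides.\<close>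

lemma lub_proper_iff:
  assumes "xs \<in> point_lists (Suc k) M"
  shows "lub (set xs) \<noteq> M \<longleftrightarrow> (\<exists>U\<in>geometric_subspaces X. U \<subset> M \<and> geo_dim U \<le> int n - 1 \<and> (\<forall>x\<in>set xs. x \<subseteq> U))"
proof
  have A: "set xs \<subseteq> L" "set xs \<noteq> {}" using assms by (auto simp: point_lists_def points_def)
  note l = lub_props[OF A]
  {
    assume "lub (set xs) \<noteq> M"
    then have "lub (set xs) \<subset> M" using L_subset[OF l(1)] by blast
    moreover have "geo_dim (lub (set xs)) \<le> int n - 1"
      using rank_strict[OF l(1) model_in calculation] rank_top geo_dim_rank[OF l(1)] by simp
    ultimately show "\<exists>U\<in>geometric_subspaces X. U \<subset> M \<and> geo_dim U \<le> int n - 1 \<and> (\<forall>x\<in>set xs. x \<subseteq> U)"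
      using l(1,2) L_geometric by (intro bexI[of _ "lub (set xs)"]) auto
  next
    assume "\<exists>U\<in>geometric_subspaces X. U \<subset> M \<and> geo_dim U \<le> int n - 1 \<and> (\<forall>x\<in>set xs. x \<subseteq> U)"
    then obtain U where U: "U \<in> geometric_subspaces X" "U \<subset> M" "\<And>x. x \<in> set xs \<Longrightarrow> x \<subseteq> U" by blast
    have "lub (set xs) \<subseteq> M \<inter> span (\<Union>(set xs))"
      by (rule l(3)[OF L_supremum[OF A] supremum_upper[OF A(1)]])
    also have "\<dots> \<subseteq> U" by (rule supremum_least[OF U(1,3)])
    finally show "lub (set xs) \<noteq> M" using U(2) by blast
  }
qed

lemma Ls_degenerate_eq: "Ls_degenerate X n L = frag_of ` degenerate_lists"
proof -
  let ?Q = "\<lambda>xs. \<exists>U\<in>geometric_subspaces X. U \<subset> M \<and> geo_dim U \<le> int n - 1 \<and> (\<forall>x\<in>set xs. x \<subseteq> U)"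
  have "Ls_degenerate X n L = frag_of ` {xs \<in> point_lists (Suc n) M. ?Q xs}"
    unfolding Ls_degenerate_def point_tuples_eq Suc_eq_plus1 image_Collect by (rule Collect_cong) metis
  also have "{xs \<in> point_lists (Suc n) M. ?Q xs} = degenerate_lists"
    unfolding degenerate_lists_def
  proof (rule Collect_cong, rule conj_cong[OF refl])
    fix xs assume "xs \<in> point_lists (Suc n) M"
    from lub_proper_iff[OF this] show "?Q xs \<longleftrightarrow> lub (set xs) \<noteq> M" by (rule sym)
  qed
  finally show ?thesis .
qed

lemma Ls_boundaries_eq: "Ls_boundaries n L = tuple_boundary ` point_lists (Suc (Suc n)) M"
proof -
  have "(\<Sum>i\<le>n + 1. frag_cmul ((- 1) ^ i) (frag_of (omit i ys))) = tuple_boundary ys"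
    if "ys \<in> point_lists (Suc (Suc n)) M" for ys
    using that by (simp add: tuple_boundary_def point_lists_def lessThan_Suc_atMost del: sum.atMost_Suc)
  then have "(\<lambda>ys. \<Sum>i\<le>n + 1. frag_cmul ((- 1) ^ i) (frag_of (omit i ys))) ` point_lists (Suc (Suc n)) M
      = tuple_boundary ` point_lists (Suc (Suc n)) M"
    by (rule image_cong[OF refl])
  then show ?thesis
    by (simp only: Ls_boundaries_def point_tuples_eq Setcompr_eq_image add_2_eq_Suc')
qed

text \<open>The closed form is a subgroup, being the kernel of \<open>comparison\<close>, and it
  contains the generators. Conversely its elements are built from the generators by differences and
  sums.\<close>

lemma generate_relations:
  "generate tuple_group (Ls_degenerate X n L \<union> Ls_boundaries n L) = relations \<inter> carrier tuple_group"
proof -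
  interpret G: comm_group tuple_group by (rule abelian_free_Abelian_group)
  let ?S = "Ls_degenerate X n L \<union> Ls_boundaries n L"
  have sub: "subgroup (relations \<inter> carrier tuple_group) tuple_group"
    using group_hom.subgroup_kernel[OF comparison_group_hom] unfolding comparison_kernel .
  have deg: "degenerate_lists \<subseteq> point_lists (Suc n) M" by (auto simp: degenerate_lists_def)
  have bd: "Poly_Mapping.keys (tuple_boundary ys) \<subseteq> point_lists (Suc n) M" "tuple_boundary ys \<in> relations"
    if "ys \<in> point_lists (Suc (Suc n)) M" for ys
    using keys_boundary[of "frag_of ys" "Suc n" M] relations_boundary[of "frag_of ys"] that by auto
  have S: "?S \<subseteq> relations \<inter> carrier tuple_group"
    unfolding Ls_degenerate_eq Ls_boundaries_eq
    using deg bd relations_degenerate by auto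
  then have "?S \<subseteq> carrier tuple_group" by blast
  then have gen: "subgroup (generate tuple_group ?S) tuple_group" by (rule G.generate_is_subgroup)
  have diff: "a - b \<in> generate tuple_group ?S" if "a \<in> generate tuple_group ?S" "b \<in> generate tuple_group ?S" for a b
  proof -
    have "Poly_Mapping.keys b \<subseteq> point_lists (Suc n) M" using subsetD[OF subgroup.subset[OF gen] that(2)] by simp
    then have "a \<otimes>\<^bsub>tuple_group\<^esub> inv\<^bsub>tuple_group\<^esub> b = a - b" by simp
    then show ?thesis using subgroup.m_closed[OF gen that(1) subgroup.m_inv_closed[OF gen that(2)]] by simp
  qed
  have zero: "0 \<in> generate tuple_group ?S" using subgroup.one_closed[OF gen] by simp
  have b1: "boundary a \<in> generate tuple_group ?S" if "Poly_Mapping.keys a \<subseteq> point_lists (Suc (Suc n)) M" for a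
    using that
  proof (induction a rule: frag_induction)
    case (one ys)
    then show ?case by (auto simp: Ls_boundaries_eq intro!: generate.incl)
  qed (auto simp: zero diff frag_extend_diff)
  have b2: "b \<in> generate tuple_group ?S" if "Poly_Mapping.keys b \<subseteq> degenerate_lists" for b
    using that
  proof (induction b rule: frag_induction)
    case (one ys)
    then show ?case by (auto simp: Ls_degenerate_eq intro!: generate.incl)
  qed (auto simp: zero diff)
  have "relations \<subseteq> generate tuple_group ?S"
  proof
    fix x assume "x \<in> relations"
    then obtain a b where "x = boundary a + b" "Poly_Mapping.keys a \<subseteq> point_lists (Suc (Suc n)) M" "Poly_Mapping.keys b \<subseteq> degenerate_lists"
      unfolding relations_def by blast
    then show "x \<in> generate tuple_group ?S" using subgroup.m_closed[OF gen b1 b2] by simp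
  qed
  then show ?thesis using G.generate_subgroup_incl[OF S sub] by blast
qed

lemma Ls_group_eq: "Ls_group X n L = Ls"
  using generate_relations by (simp add: Ls_group_def Let_def point_tuples_eq)

lemma Ls_action_eq: "Ls_action g = (\<lambda>C. map_tuples ((`) ((*v) g)) ` C)"
  by (simp add: Ls_action_def map_tuples_def fun_eq_iff)

lemma ST_homology_action_eq:
  "ST_homology_action X n L g = hom_induced (int n) ST {} ST {} (map_option (realisation_map ((`) ((*v) g))))"
  by (simp add: ST_homology_action_def ST_space_eq ST_action_def)

lemma automorphism:
  assumes "invertible g" "(\<lambda>U. (*v) g ` U) ` L = L"
  shows "poset_automorphism ((`) ((*v) g))"
proof -
  obtain h where h: "h ** g = mat 1" using assms(1) by (auto simp: invertible_def)
  have "inj ((*v) g)"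
    by (rule inj_on_inverseI[of _ "(*v) h"]) (simp add: matrix_vector_mul_assoc h)
  then show ?thesis
    using assms(2) by (auto simp: poset_automorphism_def bij_betw_def inj_image_subset_iff inj_image_eq_iff intro!: inj_onI)
qed

end

section \<open>Inverses in the isometry groups\<close>

lemma affine_inverse:
  fixes A B :: "'m::{finite,zero} matrix"
  assumes "A $ 0 = axis 0 1" "A ** B = mat 1" shows "B $ 0 = axis 0 1"
proof -
  have "(A ** B) $ 0 $ j = B $ 0 $ j" for j
  proof -
    have "(A ** B) $ 0 $ j = (\<Sum>k\<in>UNIV. A $ 0 $ k * B $ k $ j)" by (simp add: matrix_matrix_mult_def)
    also have "\<dots> = (\<Sum>k\<in>UNIV. if k = 0 then B $ k $ j else 0)"
      by (rule sum.cong) (auto simp: assms(1) axis_def)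
    finally have "(A ** B) $ 0 $ j = (\<Sum>k\<in>UNIV. if k = 0 then B $ k $ j else 0)" .
    then show ?thesis by simp
  qed
  then show ?thesis unfolding assms(2) by (simp add: mat_def axis_def vec_eq_iff eq_commute)
qed

text \<open>Let \<open>A'\<close> and \<open>B'\<close> be the linear blocks without index 0. Row 0
  of \<open>B\<close> vanishes off the diagonal, so \<open>A' B' = 1\<close>. Inserting
  \<open>A'\<^sup>T A' = 1\<close> gives \<open>B'\<^sup>T B' = (A' B')\<^sup>T (A' B') = 1\<close>;
  the chain of sums below is this computation.\<close>

lemma euclidean_inverse:
  fixes A B :: "'m::{finite,zero} matrix"
  assumes "A $ 0 = axis 0 1" and AB: "A ** B = mat 1"
    and orth: "\<forall>j\<in>UNIV - {0}. \<forall>k\<in>UNIV - {0}. (\<Sum>i\<in>UNIV - {0}. A $ i $ j * A $ i $ k) = (if j = k then 1 else 0)"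
  shows "\<forall>j\<in>UNIV - {0}. \<forall>k\<in>UNIV - {0}. (\<Sum>i\<in>UNIV - {0}. B $ i $ j * B $ i $ k) = (if j = k then 1 else 0)"
proof (intro ballI)
  fix j k :: 'm assume jk: "j \<in> UNIV - {0}" "k \<in> UNIV - {0}"
  let ?I = "UNIV - {0::'m}"
  have B0: "B $ 0 $ j = 0" if "j \<in> ?I" for j using affine_inverse[OF assms(1,2)] that by (simp add: axis_def)
  have e: "(\<Sum>l\<in>?I. A $ i $ l * B $ l $ j) = (if i = j then 1 else 0)" if "j \<in> ?I" for i j
  proof -
    have "(\<Sum>l\<in>?I. A $ i $ l * B $ l $ j) = (\<Sum>l\<in>UNIV. A $ i $ l * B $ l $ j)"
      by (rule sum.mono_neutral_left) (use B0[OF that] in auto)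
    also have "\<dots> = (A ** B) $ i $ j" by (simp add: matrix_matrix_mult_def)
    finally show ?thesis unfolding AB by (simp add: mat_def)
  qed
  have "(\<Sum>l\<in>?I. B $ l $ j * B $ l $ k) = (\<Sum>l\<in>?I. \<Sum>l'\<in>?I. B $ l $ j * B $ l' $ k * (if l = l' then 1 else 0))"
    by (intro sum.cong) (auto simp: if_distrib sum.delta' cong: if_cong)
  also have "\<dots> = (\<Sum>l\<in>?I. \<Sum>l'\<in>?I. B $ l $ j * B $ l' $ k * (\<Sum>i\<in>?I. A $ i $ l * A $ i $ l'))"
    using orth by (intro sum.cong) auto
  also have "\<dots> = (\<Sum>l\<in>?I. \<Sum>l'\<in>?I. \<Sum>i\<in>?I. (A $ i $ l * B $ l $ j) * (A $ i $ l' * B $ l' $ k))"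
    by (simp add: sum_distrib_left algebra_simps)
  also have "\<dots> = (\<Sum>l\<in>?I. \<Sum>i\<in>?I. \<Sum>l'\<in>?I. (A $ i $ l * B $ l $ j) * (A $ i $ l' * B $ l' $ k))"
    by (intro sum.cong refl sum.swap)
  also have "\<dots> = (\<Sum>i\<in>?I. \<Sum>l\<in>?I. \<Sum>l'\<in>?I. (A $ i $ l * B $ l $ j) * (A $ i $ l' * B $ l' $ k))"
    by (rule sum.swap)
  also have "\<dots> = (\<Sum>i\<in>?I. (\<Sum>l\<in>?I. A $ i $ l * B $ l $ j) * (\<Sum>l'\<in>?I. A $ i $ l' * B $ l' $ k))"
    by (simp add: sum_product)
  also have "\<dots> = (\<Sum>i\<in>?I. (if i = j then 1 else 0) * (if i = k then 1 else 0))"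
    using e[OF jk(1)] e[OF jk(2)] by simp
  also have "\<dots> = (\<Sum>i\<in>?I. if i = j then (if j = k then 1 else 0) else 0)" by (rule sum.cong) auto
  also have "\<dots> = (if j = k then 1 else 0)" using jk by simp
  finally show "(\<Sum>l\<in>?I. B $ l $ j * B $ l $ k) = (if j = k then 1 else 0)" .
qed

lemma isometries_inverse:
  fixes A :: "'m::{finite,zero} matrix"
  assumes "A \<in> isometries X"
  shows "\<exists>B\<in>isometries X. A ** B = mat 1 \<and> B ** A = mat 1"
proof -
  have "invertible A"
    using assms by (cases X) (auto simp: orthogonal_matrix_def invertible_def)
  then obtain B where B: "A ** B = mat 1" "B ** A = mat 1" by (auto simp: invertible_def)
  then have inv: "invertible B" by (auto simp: invertible_def)
  have "B \<in> isometries X"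
  proof (cases X)
    case Euclidean
    then show ?thesis
      using assms inv affine_inverse[OF _ B(1)] euclidean_inverse[OF _ B(1)] by simp
  next
    case Hyperbolic
    have AB: "A *v (B *v x) = x" and BA: "B *v (A *v x) = x" for x by (simp_all add: matrix_vector_mul_assoc B)
    have A: "lorentz_form (A *v x) (A *v y) = lorentz_form x y" "(*v) A ` model_space Hyperbolic = model_space Hyperbolic" for x y
      using assms Hyperbolic by auto
    have "lorentz_form (B *v x) (B *v y) = lorentz_form x y" for x y
      using A(1)[of "B *v x" "B *v y"] by (simp add: AB)
    moreover have "(*v) B ` model_space Hyperbolic = (*v) B ` (*v) A ` model_space Hyperbolic"
      by (simp only: A(2))
    then have "(*v) B ` model_space Hyperbolic = model_space Hyperbolic" by (simp add: image_image BA)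
    ultimately show ?thesis using Hyperbolic inv by simp
  next
    case Spherical
    then have "transpose A ** A = mat 1" "orthogonal_matrix A" using assms by (auto simp: orthogonal_matrix_def)
    then have "B = transpose A"
      by (metis B(1) matrix_mul_assoc matrix_mul_lid matrix_mul_rid)
    then show ?thesis using Spherical \<open>orthogonal_matrix A\<close> by simp
  qed
  then show ?thesis using B by blast
qed

lemma affine_group_inverse:
  fixes A :: "'m::{finite,zero} matrix"
  assumes "A \<in> carrier affine_group"
  shows "\<exists>B\<in>carrier affine_group. A ** B = mat 1 \<and> B ** A = mat 1"
proof -
  have A: "invertible A" "A $ 0 = axis 0 1" using assms by (auto simp: affine_group_def)
  then obtain B where B: "A ** B = mat 1" "B ** A = mat 1" by (auto simp: invertible_def)
  then have "invertible B" by (auto simp: invertible_def)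
  then show ?thesis using B affine_inverse[OF A(2) B(1)] by (auto simp: affine_group_def)
qed

text \<open>The inverses in the hypothesis \<open>subgroup\<close> are formed in the structure with
  carrier \<open>S\<close>. They have to be identified with matrix inverses before \<open>G\<close>
  with matrix multiplication is recognised as a group.\<close>

lemma group_of_matrices:
  fixes G S :: "'m::finite matrix set"
  assumes G: "subgroup G (general_linear\<lparr>carrier := S\<rparr>)"
    and inv: "\<And>A. A \<in> S \<Longrightarrow> \<exists>B\<in>S. A ** B = mat 1 \<and> B ** A = mat 1"
  shows "group (general_linear\<lparr>carrier := G\<rparr>)" "\<And>A. A \<in> G \<Longrightarrow> invertible A"
proof -
  let ?S = "general_linear\<lparr>carrier := S\<rparr>"
  have S: "G \<subseteq> S" using subgroup.subset[OF G] by simp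
  then show "invertible A" if "A \<in> G" for A using inv[of A] that by (auto simp: invertible_def)
  show "group (general_linear\<lparr>carrier := G\<rparr>)"
  proof (rule groupI)
    fix A assume "A \<in> carrier (general_linear\<lparr>carrier := G\<rparr>)"
    then have A: "A \<in> G" by simp
    obtain B where B: "B \<in> S" "A ** B = mat 1" "B ** A = mat 1" using inv A S by blast
    have "inv\<^bsub>?S\<^esub> A = B"
      unfolding m_inv_def
    proof (rule the_equality)
      fix C assume "C \<in> carrier ?S \<and> A \<otimes>\<^bsub>?S\<^esub> C = \<one>\<^bsub>?S\<^esub> \<and> C \<otimes>\<^bsub>?S\<^esub> A = \<one>\<^bsub>?S\<^esub>"
      then have "C ** A = mat 1" by (simp add: general_linear_def)
      then show "C = B" by (metis B(2) matrix_mul_assoc matrix_mul_lid matrix_mul_rid)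
    qed (use B in \<open>simp add: general_linear_def\<close>)
    then have "B \<in> G" using subgroup.m_inv_closed[OF G A] by simp
    then show "\<exists>B\<in>carrier (general_linear\<lparr>carrier := G\<rparr>). B \<otimes>\<^bsub>general_linear\<lparr>carrier := G\<rparr>\<^esub> A = \<one>\<^bsub>general_linear\<lparr>carrier := G\<rparr>\<^esub>"
      using B by (auto simp: general_linear_def)
  next
    fix A B assume "A \<in> carrier (general_linear\<lparr>carrier := G\<rparr>)" "B \<in> carrier (general_linear\<lparr>carrier := G\<rparr>)"
    then show "A \<otimes>\<^bsub>general_linear\<lparr>carrier := G\<rparr>\<^esub> B \<in> carrier (general_linear\<lparr>carrier := G\<rparr>)"
      using subgroup.m_closed[OF G, of A B] by simp
  qed (use subgroup.one_closed[OF G] in \<open>simp_all add: general_linear_def matrix_mul_assoc\<close>)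
qed

theorem theoremA:
  fixes X :: geometry and n :: nat
    and L :: "'m::{finite,zero} vect set set"
    and G :: "'m matrix set"
  assumes "CARD('m) = n + 1"
    and "L \<subseteq> geometric_subspaces X"
    and "{} \<notin> L"
    and "model_space X \<in> L"
    and "subgroup G (isometry_group X) \<or> X = Euclidean \<and> subgroup G affine_group"
    and "\<forall>g\<in>G. (\<lambda>U. (*v) g ` U) ` L = L"
    and "generated_by_points X L"
  shows "(\<exists>I :: 'm vect set list set.
            ST_space X L homotopy_equivalent_space wedge_of_spheres n I) \<and>
         (\<exists>\<phi>. left_module_iso (group_ring (general_linear\<lparr>carrier := G\<rparr>))
            (Ls_group X n L) (group_ring_smult (Ls_group X n L) Ls_action)
            (reduced_homology_group (int n) (ST_space X L))
            (group_ring_smult (reduced_homology_group (int n) (ST_space X L))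
               (ST_homology_action X n L)) \<phi>)"
proof -
  interpret generated_collection X n L
    using assms by unfold_locales auto
  let ?H = "general_linear\<lparr>carrier := G\<rparr>"
  have G: "group ?H" "\<And>g. g \<in> G \<Longrightarrow> invertible g"
  proof -
    consider "subgroup G (isometry_group X)" | "subgroup G affine_group" using assms(5) by blast
    then have "group ?H \<and> (\<forall>g\<in>G. invertible g)"
    proof cases
      case 1
      then have "subgroup G (general_linear\<lparr>carrier := isometries X\<rparr>)" by (simp only: isometry_group_def)
      from group_of_matrices[OF this isometries_inverse] show ?thesis by simp
    next
      case 2
      have "affine_group = general_linear\<lparr>carrier := carrier affine_group\<rparr>" by (simp add: affine_group_def)
      with 2 have "subgroup G (general_linear\<lparr>carrier := carrier affine_group\<rparr>)" by (rule subst[rotated])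
      from group_of_matrices[OF this affine_group_inverse] show ?thesis by simp
    qed
    then show "group ?H" "\<And>g. g \<in> G \<Longrightarrow> invertible g" by simp_all
  qed
  have "left_module_iso (group_ring ?H) Ls (group_ring_smult Ls (\<lambda>g C. map_tuples ((`) ((*v) g)) ` C))
    (reduced_homology_group (int n) ST)
    (group_ring_smult (reduced_homology_group (int n) ST) (\<lambda>g. hom_induced (int n) ST {} ST {} (map_option (realisation_map ((`) ((*v) g))))))
    tuple_iso"
  proof (rule tuple_module_iso[OF G(1)])
    show "poset_automorphism ((`) ((*v) g))" if "g \<in> carrier ?H" for g
      using automorphism[of g] G(2) assms(6) that by simp
    show "(*v) (g \<otimes>\<^bsub>?H\<^esub> h) ` U = (*v) g ` (*v) h ` U" for g h U
      by (simp add: image_image general_linear_def matrix_vector_mul_assoc)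
    show "(*v) \<one>\<^bsub>?H\<^esub> ` U = U" for U
      by (simp add: general_linear_def)
  qed
  then have "left_module_iso (group_ring ?H) (Ls_group X n L) (group_ring_smult (Ls_group X n L) Ls_action)
            (reduced_homology_group (int n) (ST_space X L))
            (group_ring_smult (reduced_homology_group (int n) (ST_space X L))
               (ST_homology_action X n L)) tuple_iso"
    unfolding Ls_group_eq Ls_action_eq[abs_def] ST_homology_action_eq[abs_def] ST_space_eq .
  moreover have "ST_space X L homotopy_equivalent_space wedge_of_spheres n full_lists"
    unfolding ST_space_eq by (rule wedge_of_spheres_equivalence)
  ultimately show ?thesis by blast
qed

end
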